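(* Let $\eta$ be a Poisson process on $\mathbb X$ with locally finite intensity measure $\lambda$; for a $\sigma$-finite measure $\nu$ that is a multiple of $\lambda$ let $\eta_\nu$ denote a Poisson process with intensity measure $\nu$. Let $f_n:\mathbf N\to\{0,1\}$, $n\ge1$, be a sequence of measurable, increasing, jump regular and non-degenerate mappings. Assume that there exist randomized stopping sets $Z_n$, $n\ge1$, such that for every $n$: (1) $Z_n$ determines $f_n$; (2) there is an increasing sequence of randomized stopping sets $Z_{n,j}$, $j\ge1$ (with the same randomization as $Z_n$), with $\mathbb P(\eta(Z_{n,j}(\eta))<\infty)=1$ for all $j$ and $Z_n=\bigcup_jZ_{n,j}$; and assume moreover that $$\delta_n:=\sup_{x\in\mathbb X}\mathbb P(x\in Z_n(\eta))\to0\quad\text{as }n\to\infty.$$ Then, for any sequence $c_n\in(0,1)$ such that $\delta_n=o(c_n^2)$, $$\mathbb E[f_n(\eta_{(1+c_n)\lambda})]\to1\quad\text{and}\quad\mathbb E[f_n(\eta_{(1-c_n)\lambda})]\to0\qquad\text{as }n\to\infty.$$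
   Context: $(\mathbb X,\mathcal X)$ is a Borel space (measurably isomorphic to a Borel subset of $[0,1]$). Fix an increasing sequence $B_n\in\mathcal X$ with $B_n\uparrow\mathbb X$, and let $\mathcal X_0:=\{B\cap B_n:B\in\mathcal X,n\in\mathbb N\}$. A measure on $\mathbb X$ is locally finite if it is finite on $\mathcal X_0$. $\mathbf N$ is the set of all measures on $\mathbb X$ that are $\mathbb N_0$-valued on $\mathcal X_0$, with the $\sigma$-field generated by $\mu\mapsto\mu(B)$, $B\in\mathcal X$. For a measure $\nu$ and $B\in\mathcal X$, $\nu_B:=\nu(\cdot\cap B)$. A Poisson process with intensity $\lambda$ is a random element $\eta$ of $\mathbf N$ with $\eta(B)$ Poisson of mean $\lambda(B)$ and independent values on disjoint sets. $f:\mathbf N\to\mathbb R$ is increasing if $f(\mu)\le f(\nu)$ whenever $\mu\le\nu$. Stopping set: a map $Z:\mathbf N\to\mathcal X$ such that $(x,\mu)\mapsto\mathbf 1\{x\in Z(\mu)\}$ is measurable and $Z(\mu)=Z(\mu_{Z(\mu)}+\psi_{Z(\mu)^c})$ for all $\mu,\psi\in\mathbf N$. Randomized stopping set: $Z^Y$, where $Y$ is a random element of a measurable space $\mathbb Y$ independent of $\eta$, $Z^y$ is a stopping set for $\mathbb P(Y\in\cdot)$-a.e. $y$, and $(\mu,x,y)\mapsto\mathbf 1\{x\in Z^y(\mu)\}$ is jointly measurable; $Z(\eta)$ means $Z^Y(\eta)$. $f$ is determined by a stopping set $Z$ if $f(\mu)=f(\mu_{Z(\mu)})$ for all $\mu\in\mathbf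 N$, and by $Z^Y$ if it is determined by $Z^y$ for $\mathbb P(Y\in\cdot)$-a.e. $y$. $\{f_n\}$ is non-degenerate if there is $\gamma_0\in(0,1)$ with $\gamma_0\le\mathbb E[f_n(\eta)]\le1-\gamma_0$ for all $n$. $f:\mathbf N\to\mathbb R$ is jump regular if almost surely $t\mapsto f(\eta^t)$ is piecewise constant, i.e. on any compact interval it equals a finite linear combination of indicators of bounded intervals $[a,b)$. Here $\{\eta^t:t\ge0\}$ is the Markov birth-and-death process started from $\eta^0=\eta$ in which each point of $\eta$ (with multiplicity) has an independent unit-rate exponential lifetime and is removed at its end; independently, new points are born according to a Poisson process on $\mathbb X\times(0,\infty)$ (location, birth time) with intensity $\lambda(dx)\,dt$, each new point also having an independent unit-rate exponential lifetime. *)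

theory Defs
  imports "HOL-Probability.Probability" "HOL-Library.Landau_Symbols"
begin

text \<open>
  A measurable space is given, as usual, by an \<^typ>\<open>'a measure\<close> \<open>X\<close> of which only \<open>space X\<close> and
  \<open>sets X\<close> matter.
\<close>

definition borel_space :: "'a measure \<Rightarrow> bool" where
  "borel_space X \<longleftrightarrow>
    (\<exists>S \<in> sets (borel :: real measure). S \<subseteq> {0..1} \<and>
      (\<exists>h \<in> X \<rightarrow>\<^sub>M restrict_space borel S. \<exists>g \<in> restrict_space borel S \<rightarrow>\<^sub>M X.
         (\<forall>x\<in>space X. g (h x) = x) \<and> (\<forall>s\<in>S. h (g s) = s)))"

definition localizing_sequence :: "'a measure \<Rightarrow> (nat \<Rightarrow> 'a set) \<Rightarrow> bool" where
  "localizing_sequence X B \<longleftrightarrow> range B \<subseteq> sets X \<and> incseq B \<and> (\<Union>n. B n) = space X"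

definition bounded_sets :: "'a measure \<Rightarrow> (nat \<Rightarrow> 'a set) \<Rightarrow> 'a set set" where
  "bounded_sets X B = {A \<inter> B n | A n. A \<in> sets X}"

definition locally_finite :: "'a measure \<Rightarrow> (nat \<Rightarrow> 'a set) \<Rightarrow> 'a measure \<Rightarrow> bool" where
  "locally_finite X B \<mu> \<longleftrightarrow> sets \<mu> = sets X \<and> (\<forall>A \<in> bounded_sets X B. emeasure \<mu> A < \<infinity>)"

text \<open>
  The measurable space \<open>\<bold>N\<close>.  The \<open>\<sigma>\<close>-field is the one generated by the evaluations
  \<open>\<mu> \<mapsto> \<mu>(A)\<close>, written in the same way as in the library's \<^const>\<open>subprob_algebra\<close>.
\<close>

definition point_measures :: "'a measure \<Rightarrow> (nat \<Rightarrow> 'a set) \<Rightarrow> 'a measure measure" where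
  "point_measures X B =
    (SUP A \<in> sets X. vimage_algebra
       {\<mu>. sets \<mu> = sets X \<and> (\<forall>C \<in> bounded_sets X B. emeasure \<mu> C \<in> range of_nat)}
       (\<lambda>\<mu>. emeasure \<mu> A) borel)"

lemma space_point_measures:
  "space (point_measures X B) =
     {\<mu>. sets \<mu> = sets X \<and> (\<forall>C \<in> bounded_sets X B. emeasure \<mu> C \<in> range of_nat)}"
  by (auto simp: point_measures_def space_Sup_eq_UN)

lemma measurable_emeasure_point_measures:
  "A \<in> sets X \<Longrightarrow> (\<lambda>\<mu>. emeasure \<mu> A) \<in> borel_measurable (point_measures X B)"
  by (auto intro!: measurable_Sup1 measurable_vimage_algebra1 simp: point_measures_def)

definition restr :: "'a measure \<Rightarrow> 'a set \<Rightarrow> 'a measure" where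
  "restr \<mu> A = density \<mu> (indicator A)"

lemma emeasure_restr:
  "A \<in> sets \<mu> \<Longrightarrow> C \<in> sets \<mu> \<Longrightarrow> emeasure (restr \<mu> A) C = emeasure \<mu> (C \<inter> A)"
  by (simp add: restr_def emeasure_restricted Int_commute)

definition superpose :: "'a measure \<Rightarrow> 'a measure \<Rightarrow> 'a measure" where
  "superpose \<mu> \<psi> = measure_of (space \<mu>) (sets \<mu>) (\<lambda>A. emeasure \<mu> A + emeasure \<psi> A)"

lemma emeasure_superpose:
  assumes "sets \<psi> = sets \<mu>" and A: "A \<in> sets \<mu>"
  shows "emeasure (superpose \<mu> \<psi>) A = emeasure \<mu> A + emeasure \<psi> A"
proof (rule emeasure_measure_of[OF superpose_def])
  show "countably_additive (sets (superpose \<mu> \<psi>)) (\<lambda>A. emeasure \<mu> A + emeasure \<psi> A)"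
    using assms by (auto simp: superpose_def countably_additive_def suminf_add[symmetric]
      suminf_emeasure image_subset_iff)
qed (use A sets.sets_into_space in \<open>auto simp: superpose_def positive_def sets.space_closed\<close>)

text \<open>
  Independence of two random elements.  The library's \<^const>\<open>prob_space.indep_var\<close> forces both
  to take values in the same type, so its defining condition on the generated \<open>\<sigma>\<close>-fields is
  stated directly.
\<close>

definition indep_elements ::
  "'o measure \<Rightarrow> 'b measure \<Rightarrow> ('o \<Rightarrow> 'b) \<Rightarrow> 'c measure \<Rightarrow> ('o \<Rightarrow> 'c) \<Rightarrow> bool" where
  "indep_elements M S U T V \<longleftrightarrow> U \<in> M \<rightarrow>\<^sub>M S \<and> V \<in> M \<rightarrow>\<^sub>M T \<and>
     prob_space.indep_set M (sets (vimage_algebra (space M) U S)) (sets (vimage_algebra (space M) V T))"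

text \<open>
  The Poisson distribution with mean \<open>m \<in> [0,\<infinity>]\<close>: for \<open>m = 0\<close> it is concentrated at \<open>0\<close> (as
  \<open>0 ^ 0 = 1\<close>), for \<open>m = \<infinity>\<close> at \<open>\<infinity>\<close>.  (\<^const>\<open>poisson_pmf\<close> covers only \<open>0 < m < \<infinity>\<close>.)
\<close>

definition poisson_distributed :: "'o measure \<Rightarrow> ennreal \<Rightarrow> ('o \<Rightarrow> ennreal) \<Rightarrow> bool" where
  "poisson_distributed M m K \<longleftrightarrow>
    (if m = \<infinity> then (AE \<omega> in M. K \<omega> = \<infinity>)
     else \<forall>k::nat. measure M {\<omega> \<in> space M. K \<omega> = of_nat k}
            = enn2real m ^ k / fact k * exp (- enn2real m))"

definition poisson_process ::
  "'o measure \<Rightarrow> 'a measure \<Rightarrow> (nat \<Rightarrow> 'a set) \<Rightarrow> 'a measure \<Rightarrow> ('o \<Rightarrow> 'a measure) \<Rightarrow> bool" where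
  "poisson_process M X B L \<eta> \<longleftrightarrow>
     prob_space M \<and> \<eta> \<in> M \<rightarrow>\<^sub>M point_measures X B \<and>
     (\<forall>A \<in> sets X. poisson_distributed M (emeasure L A) (\<lambda>\<omega>. emeasure (\<eta> \<omega>) A)) \<and>
     (\<forall>(m::nat) A. (\<forall>i<m. A i \<in> sets X) \<and> disjoint_family_on A {..<m} \<longrightarrow>
        prob_space.indep_vars M (\<lambda>_. borel) (\<lambda>i \<omega>. emeasure (\<eta> \<omega>) (A i)) {..<m})"

text \<open>
  The order on measures with the same measurable sets is the setwise one
  (\<open>le_measure_iff\<close>), so \<^const>\<open>mono_on\<close> expresses that \<open>f\<close> is increasing.
\<close>

definition increasing_functional ::
  "'a measure \<Rightarrow> (nat \<Rightarrow> 'a set) \<Rightarrow> ('a measure \<Rightarrow> real) \<Rightarrow> bool" where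
  "increasing_functional X B f \<longleftrightarrow> mono_on (space (point_measures X B)) f"

definition stopping_set ::
  "'a measure \<Rightarrow> (nat \<Rightarrow> 'a set) \<Rightarrow> ('a measure \<Rightarrow> 'a set) \<Rightarrow> bool" where
  "stopping_set X B Z \<longleftrightarrow>
     Z \<in> space (point_measures X B) \<rightarrow> sets X \<and>
     Measurable.pred (X \<Otimes>\<^sub>M point_measures X B) (\<lambda>(x, \<mu>). x \<in> Z \<mu>) \<and>
     (\<forall>\<mu> \<in> space (point_measures X B). \<forall>\<psi> \<in> space (point_measures X B).
        Z \<mu> = Z (superpose (restr \<mu> (Z \<mu>)) (restr \<psi> (space X - Z \<mu>))))"

definition determined_by ::
  "'a measure \<Rightarrow> (nat \<Rightarrow> 'a set) \<Rightarrow> ('a measure \<Rightarrow> real) \<Rightarrow> ('a measure \<Rightarrow> 'a set) \<Rightarrow> bool" where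
  "determined_by X B f Z \<longleftrightarrow> (\<forall>\<mu> \<in> space (point_measures X B). f \<mu> = f (restr \<mu> (Z \<mu>)))"

text \<open>
  \<open>Z y\<close> is the map \<open>Z\<^sup>y\<close>; the randomization \<open>Y\<close> takes values in the measurable space \<open>\<Y>\<close>.
\<close>

definition randomized_stopping_set ::
  "'o measure \<Rightarrow> 'a measure \<Rightarrow> (nat \<Rightarrow> 'a set) \<Rightarrow> ('o \<Rightarrow> 'a measure) \<Rightarrow>
   'y measure \<Rightarrow> ('o \<Rightarrow> 'y) \<Rightarrow> ('y \<Rightarrow> 'a measure \<Rightarrow> 'a set) \<Rightarrow> bool" where
  "randomized_stopping_set M X B \<eta> \<Y> Y Z \<longleftrightarrow>
     indep_elements M \<Y> Y (point_measures X B) \<eta> \<and>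
     (AE y in distr M \<Y> Y. stopping_set X B (Z y)) \<and>
     Measurable.pred (point_measures X B \<Otimes>\<^sub>M X \<Otimes>\<^sub>M \<Y>) (\<lambda>(\<mu>, x, y). x \<in> Z y \<mu>)"

definition determined_by_randomized ::
  "'o measure \<Rightarrow> 'a measure \<Rightarrow> (nat \<Rightarrow> 'a set) \<Rightarrow> 'y measure \<Rightarrow> ('o \<Rightarrow> 'y) \<Rightarrow>
   ('a measure \<Rightarrow> real) \<Rightarrow> ('y \<Rightarrow> 'a measure \<Rightarrow> 'a set) \<Rightarrow> bool" where
  "determined_by_randomized M X B \<Y> Y f Z \<longleftrightarrow>
     (AE y in distr M \<Y> Y. determined_by X B f (Z y))"

definition non_degenerate ::
  "'o measure \<Rightarrow> ('o \<Rightarrow> 'a measure) \<Rightarrow> (nat \<Rightarrow> 'a measure \<Rightarrow> real) \<Rightarrow> bool" where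
  "non_degenerate M \<eta> f \<longleftrightarrow>
     (\<exists>\<gamma>::real. 0 < \<gamma> \<and> \<gamma> < 1 \<and>
        (\<forall>n. \<gamma> \<le> (\<integral>\<omega>. f n (\<eta> \<omega>) \<partial>M) \<and> (\<integral>\<omega>. f n (\<eta> \<omega>) \<partial>M) \<le> 1 - \<gamma>))"

text \<open>
  \<open>dirac_sum X I x\<close> is the measure \<open>\<Sum>i\<in>I. \<delta>(x i)\<close> on \<open>X\<close>, as an image of a counting measure.
  A random measure \<open>\<Phi>\<close> has the (measurably enumerated) points \<open>x 0, x 1, \<dots>\<close>, \<open>k\<close> in number,
  counted with multiplicity, if it is almost surely their Dirac sum.
\<close>

definition dirac_sum :: "'a measure \<Rightarrow> nat set \<Rightarrow> (nat \<Rightarrow> 'a) \<Rightarrow> 'a measure" where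
  "dirac_sum X I x = distr (count_space I) X x"

definition has_points ::
  "'o measure \<Rightarrow> 'a measure \<Rightarrow> ('o \<Rightarrow> 'a measure) \<Rightarrow> ('o \<Rightarrow> enat) \<Rightarrow> ('o \<Rightarrow> nat \<Rightarrow> 'a) \<Rightarrow> bool" where
  "has_points M X \<Phi> k x \<longleftrightarrow>
     k \<in> M \<rightarrow>\<^sub>M count_space UNIV \<and> x \<in> M \<rightarrow>\<^sub>M (\<Pi>\<^sub>M i\<in>UNIV. X) \<and>
     (AE \<omega> in M. \<Phi> \<omega> = dirac_sum X {i. enat i < k \<omega>} (x \<omega>))"

text \<open>
  The birth-and-death process \<open>\<eta>t\<close> started from \<open>\<eta>\<close>.  Here \<open>x\<close> enumerates the points of
  \<open>\<eta>\<close>; \<open>b\<close> enumerates the points (location, birth time) of the Poisson process \<open>\<Phi>\<close> of births on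
  \<open>X \<times> (0,\<infinity>)\<close>, for which the bounded sets are those contained in some \<open>B n \<times> (0,n]\<close>.  The
  lifetimes are \<open>T (Inl i)\<close> for the \<open>i\<close>-th initial point and \<open>T (Inr i)\<close> for the \<open>i\<close>-th new one.
  A point born at time \<open>s\<close> with lifetime \<open>r\<close> is present during \<open>[s, s + r)\<close>.
\<close>

definition birth_death_process ::
  "'o measure \<Rightarrow> 'a measure \<Rightarrow> (nat \<Rightarrow> 'a set) \<Rightarrow> 'a measure \<Rightarrow> ('o \<Rightarrow> 'a measure) \<Rightarrow>
   (real \<Rightarrow> 'o \<Rightarrow> 'a measure) \<Rightarrow> bool" where
  "birth_death_process M X B L \<eta> \<eta>t \<longleftrightarrow>
    (\<exists>k x \<Phi> l b (T :: nat + nat \<Rightarrow> 'o \<Rightarrow> real).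
       let R = restrict_space borel {0<..};
           initial = (\<lambda>\<omega>. (k \<omega>, x \<omega>)); births = (\<lambda>\<omega>. (l \<omega>, b \<omega>));
           \<I> = count_space UNIV \<Otimes>\<^sub>M (\<Pi>\<^sub>M i\<in>UNIV. X);
           \<B> = count_space UNIV \<Otimes>\<^sub>M (\<Pi>\<^sub>M i\<in>UNIV. X \<Otimes>\<^sub>M R)
       in
         has_points M X \<eta> k x \<and>
         poisson_process M (X \<Otimes>\<^sub>M R) (\<lambda>n. B n \<times> {0<..real n})
           (L \<Otimes>\<^sub>M restrict_space lborel {0<..}) \<Phi> \<and>
         has_points M (X \<Otimes>\<^sub>M R) \<Phi> l b \<and>
         (\<forall>i. distributed M lborel (T i) (exponential_density 1)) \<and>
         prob_space.indep_vars M (\<lambda>_. borel) T UNIV \<and>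
         indep_elements M \<I> initial \<B> births \<and>
         indep_elements M (\<I> \<Otimes>\<^sub>M \<B>) (\<lambda>\<omega>. (initial \<omega>, births \<omega>))
           (\<Pi>\<^sub>M i\<in>UNIV. borel) (\<lambda>\<omega> i. T i \<omega>) \<and>
         (\<forall>t\<ge>0. \<forall>\<omega>\<in>space M. \<eta>t t \<omega> =
            superpose
              (dirac_sum X {i. enat i < k \<omega> \<and> t < T (Inl i) \<omega>} (x \<omega>))
              (dirac_sum X {i. enat i < l \<omega> \<and> snd (b \<omega> i) \<le> t \<and> t < snd (b \<omega> i) + T (Inr i) \<omega>}
                 (\<lambda>i. fst (b \<omega> i)))))"

definition piecewise_constant :: "(real \<Rightarrow> real) \<Rightarrow> bool" where
  "piecewise_constant g \<longleftrightarrow>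
     (\<forall>s u. 0 \<le> s \<longrightarrow> (\<exists>(m::nat) a b c. \<forall>t\<in>{s..u}.
        g t = (\<Sum>i<m. c i * indicator {a i..<b i} t)))"

definition jump_regular ::
  "'o measure \<Rightarrow> (real \<Rightarrow> 'o \<Rightarrow> 'a measure) \<Rightarrow> ('a measure \<Rightarrow> real) \<Rightarrow> bool" where
  "jump_regular M \<eta>t f \<longleftrightarrow> (AE \<omega> in M. piecewise_constant (\<lambda>t. f (\<eta>t t \<omega>)))"

end

theory Submission
  imports Defs
begin

text \<open>
  Let \<open>\<eta>\<close> have intensity \<open>\<lambda>\<close> and let \<open>\<xi>\<close> be the superposition of \<open>\<eta>\<close> with an independent Poisson
  process of intensity \<open>c \<lambda>\<close>.  As \<open>f\<close> is increasing with values in \<open>{0, 1}\<close>, the covariance of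
  \<open>f(\<eta>)\<close> and \<open>f(\<xi>)\<close> is \<open>E f(\<eta>) * (1 - E f(\<xi>))\<close>, so by non-degeneracy it is enough to make this
  covariance small; for a thinning \<open>\<xi>\<close> of \<open>\<eta>\<close> with retention probability \<open>1 - c\<close> it is
  \<open>E f(\<xi>) * (1 - E f(\<eta>))\<close>.  In the chaos expansion the passage between \<open>\<xi>\<close> and \<open>\<eta>\<close>
  damps the \<open>k\<close>-th level by a factor of order \<open>(1 + c) powr (- k / 2)\<close>, while the Schramm-Steif inequality
  bounds the squared norm of the \<open>k\<close>-th level of \<open>f(\<eta>)\<close> by \<open>k * \<delta>\<close>.  Summing over \<open>k \<ge> 1\<close>, the
  covariance is of order \<open>sqrt \<delta> / c\<close>.

  No multiple stochastic integrals are needed: the functionals \<open>exp (\<integral> \<phi> d\<mu>)\<close> with \<open>\<phi>\<close> simple are dense in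
  \<open>L\<^sup>2\<close>, and for finitely many of them the chaos levels are multivariate Charlier polynomials in the
  counts of finitely many disjoint bounded sets.
\<close>

section \<open>Point measures and test functions\<close>

text \<open>Conditioning on what a stopping set reveals is the delicate point. It is replaced by an
  exact invariance: redrawing the points outside \<open>Z \<mu>\<close> from an independent copy
  preserves the law. In a bounded window two independent copies are one finite configuration with
  fair coin labels, and redrawing permutes the labellings; exponential functionals of test functions
  see only a window, so the whole space needs no further limit. With the revealed part frozen, a
  chaos level is a convolution of revealed and hidden levels: the purely revealed term is its
  conditional mean, and the purely hidden one keeps the variance (for one cell
  \<open>lamC ^ k\<close> in place of \<open>lam ^ k\<close>). The tangent to \<open>x ^ k\<close>
  bounds the loss by \<open>k\<close> times the revealed share, hence the factor \<open>k\<close>.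
  In the coupling step the second moment of a functional of \<open>\<xi>\<close> is a power series
  in the intensity factor \<open>\<kappa>\<close>, so a weight \<open>t ^ k\<close> with
  \<open>t * \<tau>\<^sup>2 \<le> \<kappa>\<close> is affordable; Cauchy-Schwarz then costs the sum
  of \<open>k / t ^ k\<close>, which is \<open>t / (t - 1)\<^sup>2\<close>.\<close>

locale localized_space =
  fixes X :: "'a measure" and B :: "nat \<Rightarrow> 'a set"
  assumes localizing: "localizing_sequence X B"
begin

abbreviation N :: "'a measure measure" where
  "N \<equiv> point_measures X B"

lemma sets_B [measurable, simp]: "B n \<in> sets X"
  using localizing by (auto simp: localizing_sequence_def)

lemma incseq_B: "incseq B"
  using localizing by (auto simp: localizing_sequence_def)

lemma UN_B: "(\<Union>n. B n) = space X"
  using localizing by (auto simp: localizing_sequence_def)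

lemma bounded_setsI: "A \<in> sets X \<Longrightarrow> A \<subseteq> B n \<Longrightarrow> A \<in> bounded_sets X B"
  by (auto simp: bounded_sets_def)

lemma bounded_setsE:
  assumes "A \<in> bounded_sets X B"
  obtains n where "A \<in> sets X" "A \<subseteq> B n"
proof -
  from assms obtain A' n where "A = A' \<inter> B n" "A' \<in> sets X" by (auto simp: bounded_sets_def)
  then have "A \<in> sets X" "A \<subseteq> B n" by auto
  then show ?thesis by (rule that)
qed

lemma locally_finite_sets: "locally_finite X B \<mu> \<Longrightarrow> sets \<mu> = sets X"
  by (simp add: locally_finite_def)

lemma locally_finite_space: "locally_finite X B \<mu> \<Longrightarrow> space \<mu> = space X"
  using locally_finite_sets sets_eq_imp_space_eq by blast

lemma emeasure_bounded_finite:
  "locally_finite X B \<mu> \<Longrightarrow> A \<in> sets X \<Longrightarrow> A \<subseteq> B n \<Longrightarrow> emeasure \<mu> A < \<infinity>"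
  using bounded_setsI by (auto simp: locally_finite_def)

lemma N_locally_finite: "\<mu> \<in> space N \<Longrightarrow> locally_finite X B \<mu>"
  unfolding space_point_measures locally_finite_def
  by (auto simp: image_iff) (metis of_nat_less_top)

lemma N_sets: "\<mu> \<in> space N \<Longrightarrow> sets \<mu> = sets X"
  by (simp add: space_point_measures)

lemma N_space: "\<mu> \<in> space N \<Longrightarrow> space \<mu> = space X"
  using N_sets sets_eq_imp_space_eq by blast

lemma N_natE:
  assumes "\<mu> \<in> space N" "A \<in> sets X" "A \<subseteq> B n"
  obtains k :: nat where "emeasure \<mu> A = of_nat k"
  using assms bounded_setsI[of A n] by (auto simp: space_point_measures)

lemma N_I:
  assumes "sets \<mu> = sets X"
    and "\<And>A n. A \<in> sets X \<Longrightarrow> A \<subseteq> B n \<Longrightarrow> emeasure \<mu> A \<in> range (of_nat :: nat \<Rightarrow> ennreal)"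
  shows "\<mu> \<in> space N"
  using assms by (auto simp: space_point_measures elim!: bounded_setsE)

lemma emeasure_SUP_B:
  assumes "sets \<mu> = sets X" "A \<in> sets X"
  shows "emeasure \<mu> A = (SUP n. emeasure \<mu> (A \<inter> B n))"
proof -
  have "(SUP n. emeasure \<mu> (A \<inter> B n)) = emeasure \<mu> (\<Union>n. A \<inter> B n)"
    using assms incseq_B by (intro SUP_emeasure_incseq) (auto simp: incseq_def)
  also have "(\<Union>n. A \<inter> B n) = A"
    using UN_B sets.sets_into_space[OF assms(2)] by auto
  finally show ?thesis by simp
qed

section \<open>Measurability of maps into and integrals against point measures\<close>

lemma measurable_emeasure_N [measurable (raw)]:
  assumes "F \<in> \<Omega> \<rightarrow>\<^sub>M N" "A \<in> sets X"
  shows "(\<lambda>\<omega>. emeasure (F \<omega>) A) \<in> borel_measurable \<Omega>"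
  using measurable_compose[OF assms(1) measurable_emeasure_point_measures[OF assms(2)]] .

lemma measurable_measure_N [measurable (raw)]:
  assumes "F \<in> \<Omega> \<rightarrow>\<^sub>M N" "A \<in> sets X"
  shows "(\<lambda>\<omega>. measure (F \<omega>) A) \<in> borel_measurable \<Omega>"
  unfolding measure_def using assms by measurable

text \<open>Bounded sets suffice, because the mass of any set is the supremum of the masses of its
  traces on the windows \<open>B n\<close>.\<close>

lemma measurable_N:
  assumes F: "\<And>\<omega>. \<omega> \<in> space \<Omega> \<Longrightarrow> F \<omega> \<in> space N"
    and *: "\<And>A n. A \<in> sets X \<Longrightarrow> A \<subseteq> B n \<Longrightarrow> (\<lambda>\<omega>. emeasure (F \<omega>) A) \<in> borel_measurable \<Omega>"
  shows "F \<in> \<Omega> \<rightarrow>\<^sub>M N"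
  unfolding point_measures_def
proof (intro measurable_SUP2 measurable_vimage_algebra2)
  fix A assume A: "A \<in> sets X"
  have "(\<lambda>\<omega>. SUP n. emeasure (F \<omega>) (A \<inter> B n)) \<in> borel_measurable \<Omega>"
    using A by (intro borel_measurable_SUP *) auto
  then show "(\<lambda>\<omega>. emeasure (F \<omega>) A) \<in> borel_measurable \<Omega>"
    using F emeasure_SUP_B[OF N_sets A] by (simp cong: measurable_cong)
qed (use F in \<open>auto simp: space_point_measures\<close>)

lemma nn_integral_SUP_B:
  assumes "sets \<mu> = sets X" "h \<in> borel_measurable X"
  shows "(\<integral>\<^sup>+x. h x \<partial>\<mu>) = (SUP n. \<integral>\<^sup>+x. h x * indicator (B n) x \<partial>\<mu>)"
proof -
  have sp: "space \<mu> = space X" using assms(1) sets_eq_imp_space_eq by blast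
  have [measurable]: "h \<in> borel_measurable \<mu>" "\<And>n. B n \<in> sets \<mu>"
    using assms by (auto cong: measurable_cong_sets)
  have sup: "(SUP n. h x * indicator (B n) x) = h x" if x: "x \<in> space \<mu>" for x
  proof (rule antisym)
    show "(SUP n. h x * indicator (B n) x) \<le> h x"
      by (rule SUP_least) (auto simp: indicator_def)
    obtain n where "x \<in> B n" using UN_B x sp by auto
    then show "h x \<le> (SUP n. h x * indicator (B n) x)"
      by (intro SUP_upper2[of n]) auto
  qed
  have "(\<integral>\<^sup>+x. h x \<partial>\<mu>) = (\<integral>\<^sup>+x. (SUP n. h x * indicator (B n) x) \<partial>\<mu>)"
    by (rule nn_integral_cong) (simp add: sup)
  also have "\<dots> = (SUP n. \<integral>\<^sup>+x. h x * indicator (B n) x \<partial>\<mu>)"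
    using incseq_B
    by (intro nn_integral_monotone_convergence_SUP)
       (auto simp: incseq_def le_fun_def intro!: mult_left_mono split: split_indicator)
  finally show ?thesis .
qed

text \<open>A point measure may have infinite mass and is then no subprobability kernel. On each
  window it becomes one after division by its mass there, and the integral is recovered as a
  supremum over the windows.\<close>

lemma measurable_nn_integral_N:
  assumes F[measurable]: "F \<in> \<Omega> \<rightarrow>\<^sub>M N" and h[measurable]: "(\<lambda>(\<omega>, x). h \<omega> x) \<in> borel_measurable (\<Omega> \<Otimes>\<^sub>M X)"
  shows "(\<lambda>\<omega>. \<integral>\<^sup>+x. h \<omega> x \<partial>F \<omega>) \<in> borel_measurable \<Omega>"
\<comment> \<open>A subprobability space is nonempty by definition, so the empty space is treated
  apart.\<close>
proof (cases "space X = {}")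
  case True
  then have "(\<integral>\<^sup>+x. h \<omega> x \<partial>F \<omega>) = 0" if "\<omega> \<in> space \<Omega>" for \<omega>
    using N_space[OF measurable_space[OF F that]] by (simp add: nn_integral_empty)
  then show ?thesis by (simp cong: measurable_cong)
next
  case ne: False
  have NF: "F \<omega> \<in> space N" if "\<omega> \<in> space \<Omega>" for \<omega>
    using measurable_space[OF F that] .
  \<comment> \<open>The maximum with \<open>1\<close> avoids a division by zero when the window
    carries no point.\<close>
  define M where "M n \<omega> = max 1 (emeasure (F \<omega>) (B n))" for n \<omega>
  have M1: "1 \<le> M n \<omega>" for n \<omega> by (simp add: M_def)
  have Mfin: "M n \<omega> < \<infinity>" if "\<omega> \<in> space \<Omega>" for n \<omega>
    using emeasure_bounded_finite[OF N_locally_finite[OF NF[OF that]], of "B n" n]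
    by (simp add: M_def)
  have [measurable]: "M n \<in> borel_measurable \<Omega>" for n
    unfolding M_def by measurable
  define \<kappa> where "\<kappa> n \<omega> = density (F \<omega>) (\<lambda>x. indicator (B n) x / M n \<omega>)" for n \<omega>
  have em\<kappa>: "emeasure (\<kappa> n \<omega>) A = emeasure (F \<omega>) (A \<inter> B n) / M n \<omega>"
    if "\<omega> \<in> space \<Omega>" "A \<in> sets X" for n \<omega> A
  proof -
    have s: "sets (F \<omega>) = sets X" using N_sets[OF NF[OF that(1)]] .
    have [measurable]: "A \<in> sets (F \<omega>)" "B n \<in> sets (F \<omega>)" using that s by auto
    have "emeasure (\<kappa> n \<omega>) A = (\<integral>\<^sup>+x. indicator (A \<inter> B n) x / M n \<omega> \<partial>F \<omega>)"
      unfolding \<kappa>_def by (subst emeasure_density) (auto intro!: nn_integral_cong split: split_indicator)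
    also have "\<dots> = emeasure (F \<omega>) (A \<inter> B n) / M n \<omega>"
      by (subst nn_integral_divide) auto
    finally show ?thesis .
  qed
  have \<kappa>[measurable]: "\<kappa> n \<in> \<Omega> \<rightarrow>\<^sub>M subprob_algebra X" for n
  proof (rule measurable_subprob_algebra)
    fix \<omega> assume w: "\<omega> \<in> space \<Omega>"
    show sk: "sets (\<kappa> n \<omega>) = sets X" by (simp add: \<kappa>_def N_sets[OF NF[OF w]])
    show "subprob_space (\<kappa> n \<omega>)"
    proof (rule subprob_spaceI)
      have "space (\<kappa> n \<omega>) = space X" using sk sets_eq_imp_space_eq by blast
      then have "emeasure (\<kappa> n \<omega>) (space (\<kappa> n \<omega>)) = emeasure (F \<omega>) (B n) / M n \<omega>"
        using em\<kappa>[OF w sets.top, of n] sets.sets_into_space[OF sets_B[of n]] by (simp add: Int_absorb1)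
      also have "\<dots> \<le> 1"
        using M1[of n \<omega>] Mfin[OF w, of n] by (intro divide_le_posI_ennreal) (auto simp: M_def less_le_trans[OF zero_less_one])
      finally show "emeasure (\<kappa> n \<omega>) (space (\<kappa> n \<omega>)) \<le> 1" .
      show "space (\<kappa> n \<omega>) \<noteq> {}" using \<open>space (\<kappa> n \<omega>) = space X\<close> ne by simp
    qed
  next
    fix A assume A[measurable]: "A \<in> sets X"
    have "(\<lambda>\<omega>. emeasure (F \<omega>) (A \<inter> B n) / M n \<omega>) \<in> borel_measurable \<Omega>" by measurable
    then show "(\<lambda>\<omega>. emeasure (\<kappa> n \<omega>) A) \<in> borel_measurable \<Omega>"
      by (rule measurable_cong[THEN iffD1, rotated]) (simp add: em\<kappa>)
  qed
  have "(\<lambda>\<omega>. \<integral>\<^sup>+x. h \<omega> x \<partial>\<kappa> n \<omega>) \<in> borel_measurable \<Omega>" for n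
    by (rule nn_integral_measurable_subprob_algebra2[OF h \<kappa>])
  then have "(\<lambda>\<omega>. SUP n. M n \<omega> * (\<integral>\<^sup>+x. h \<omega> x \<partial>\<kappa> n \<omega>)) \<in> borel_measurable \<Omega>"
    by (intro borel_measurable_SUP) auto
  moreover have "(\<integral>\<^sup>+x. h \<omega> x \<partial>F \<omega>) = (SUP n. M n \<omega> * (\<integral>\<^sup>+x. h \<omega> x \<partial>\<kappa> n \<omega>))"
    if w: "\<omega> \<in> space \<Omega>" for \<omega>
  proof -
    have s: "sets (F \<omega>) = sets X" using N_sets[OF NF[OF w]] .
    have hx: "h \<omega> \<in> borel_measurable X"
      using measurable_compose[OF measurable_Pair1'[OF w, of X] h] by simp
    then have [measurable]: "h \<omega> \<in> borel_measurable (F \<omega>)" "\<And>n. B n \<in> sets (F \<omega>)"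
      using s by (auto cong: measurable_cong_sets)
    have "M n \<omega> * (\<integral>\<^sup>+x. h \<omega> x \<partial>\<kappa> n \<omega>) = (\<integral>\<^sup>+x. h \<omega> x * indicator (B n) x \<partial>F \<omega>)" for n
    proof -
      have "M n \<omega> * (\<integral>\<^sup>+x. h \<omega> x \<partial>\<kappa> n \<omega>) = (\<integral>\<^sup>+x. M n \<omega> * (indicator (B n) x / M n \<omega> * h \<omega> x) \<partial>F \<omega>)"
        unfolding \<kappa>_def by (subst nn_integral_density) (auto simp: nn_integral_cmult)
      also have "\<dots> = (\<integral>\<^sup>+x. h \<omega> x * indicator (B n) x \<partial>F \<omega>)"
        using M1[of n \<omega>] Mfin[OF w, of n]
        apply (intro nn_integral_cong)
        by (auto split: split_indicator simp: ennreal_times_divide mult.assoc[symmetric])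
           (metis ennreal_mult_divide_eq ennreal_times_divide infinity_ennreal_def less_numeral_extra(1) mult.commute mult.left_neutral not_less order_less_irrefl zero_less_one less_le_trans)
      finally show ?thesis .
    qed
    then show ?thesis using nn_integral_SUP_B[OF s hx] by simp
  qed
  ultimately show ?thesis by (simp cong: measurable_cong)
qed

section \<open>Restriction and superposition as operations on point measures\<close>

lemma sets_restr [simp, measurable_cong]: "sets (restr \<mu> A) = sets \<mu>"
  by (simp add: restr_def)

lemma space_restr [simp]: "space (restr \<mu> A) = space \<mu>"
  by (simp add: restr_def)

lemma sets_superpose [simp]: "sets (superpose \<mu> \<psi>) = sets \<mu>"
  by (simp add: superpose_def sets.sigma_sets_eq)

lemma space_superpose [simp]: "space (superpose \<mu> \<psi>) = space \<mu>"
  by (simp add: superpose_def)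

lemma restr_in_N:
  assumes "\<mu> \<in> space N" "A \<in> sets X"
  shows "restr \<mu> A \<in> space N"
proof (rule N_I)
  fix C n assume C: "C \<in> sets X" "C \<subseteq> B n"
  then have "C \<inter> A \<in> sets X" "C \<inter> A \<subseteq> B n" using assms by auto
  then show "emeasure (restr \<mu> A) C \<in> range (of_nat :: nat \<Rightarrow> ennreal)"
    using N_natE[OF assms(1)] C assms emeasure_restr[of A \<mu> C] by (metis N_sets rangeI)
qed (use assms N_sets in simp)

lemma superpose_in_N:
  assumes "\<mu> \<in> space N" "\<psi> \<in> space N"
  shows "superpose \<mu> \<psi> \<in> space N"
proof (rule N_I)
  fix C n assume C: "C \<in> sets X" "C \<subseteq> B n"
  obtain k l :: nat where "emeasure \<mu> C = of_nat k" "emeasure \<psi> C = of_nat l"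
    using N_natE[OF assms(1) C] N_natE[OF assms(2) C] by metis
  then have "emeasure (superpose \<mu> \<psi>) C = of_nat (k + l)"
    using assms C by (subst emeasure_superpose) (auto simp: N_sets)
  then show "emeasure (superpose \<mu> \<psi>) C \<in> range (of_nat :: nat \<Rightarrow> ennreal)" by blast
qed (use assms N_sets in simp)

lemma le_superpose:
  assumes "\<mu> \<in> space N" "\<psi> \<in> space N"
  shows "\<mu> \<le> superpose \<mu> \<psi>"
  using assms by (subst le_measure) (auto simp: emeasure_superpose N_sets)

lemma measurable_superpose_N [measurable (raw)]:
  assumes [measurable]: "F \<in> \<Omega> \<rightarrow>\<^sub>M N" "G \<in> \<Omega> \<rightarrow>\<^sub>M N"
  shows "(\<lambda>\<omega>. superpose (F \<omega>) (G \<omega>)) \<in> \<Omega> \<rightarrow>\<^sub>M N"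
proof (rule measurable_N)
  fix \<omega> assume "\<omega> \<in> space \<Omega>"
  then show "superpose (F \<omega>) (G \<omega>) \<in> space N"
    using assms[THEN measurable_space] by (intro superpose_in_N) auto
next
  fix A assume A[measurable]: "A \<in> sets X"
  have "(\<lambda>\<omega>. emeasure (F \<omega>) A + emeasure (G \<omega>) A) \<in> borel_measurable \<Omega>" by measurable
  then show "(\<lambda>\<omega>. emeasure (superpose (F \<omega>) (G \<omega>)) A) \<in> borel_measurable \<Omega>"
    using assms[THEN measurable_space] A N_sets
    by (subst measurable_cong[where g="\<lambda>\<omega>. emeasure (F \<omega>) A + emeasure (G \<omega>) A"])
       (auto simp: emeasure_superpose)
qed

text \<open>For a moving set \<open>S \<omega>\<close> the restricted mass of \<open>A\<close> is
  the integral of a jointly measurable indicator in \<open>(\<omega>, x)\<close>, to which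
  \<open>measurable_nn_integral_N\<close> applies.\<close>

lemma measurable_restr_N:
  assumes F[measurable]: "F \<in> \<Omega> \<rightarrow>\<^sub>M N" and S: "\<And>\<omega>. \<omega> \<in> space \<Omega> \<Longrightarrow> S \<omega> \<in> sets X"
    and p[measurable]: "Measurable.pred (\<Omega> \<Otimes>\<^sub>M X) (\<lambda>(\<omega>, x). x \<in> S \<omega>)"
  shows "(\<lambda>\<omega>. restr (F \<omega>) (S \<omega>)) \<in> \<Omega> \<rightarrow>\<^sub>M N"
proof (rule measurable_N)
  fix \<omega> assume "\<omega> \<in> space \<Omega>"
  then show "restr (F \<omega>) (S \<omega>) \<in> space N"
    using measurable_space[OF F] S by (intro restr_in_N) auto
next
  fix A assume A[measurable]: "A \<in> sets X"
  have "(\<lambda>(\<omega>, x). indicator {(\<omega>, x). x \<in> S \<omega> \<and> x \<in> A} (\<omega>, x) :: ennreal) \<in> borel_measurable (\<Omega> \<Otimes>\<^sub>M X)"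
    by measurable
  then have "(\<lambda>\<omega>. \<integral>\<^sup>+x. indicator {(\<omega>, x). x \<in> S \<omega> \<and> x \<in> A} (\<omega>, x) \<partial>F \<omega>) \<in> borel_measurable \<Omega>"
    by (intro measurable_nn_integral_N) simp_all
  moreover have "(\<integral>\<^sup>+x. indicator {(\<omega>, x). x \<in> S \<omega> \<and> x \<in> A} (\<omega>, x) \<partial>F \<omega>) = emeasure (restr (F \<omega>) (S \<omega>)) A"
    if w: "\<omega> \<in> space \<Omega>" for \<omega>
  proof -
    have s: "sets (F \<omega>) = sets X" using N_sets measurable_space[OF F w] by blast
    have "emeasure (restr (F \<omega>) (S \<omega>)) A = emeasure (F \<omega>) (A \<inter> S \<omega>)"
      using s S[OF w] A by (intro emeasure_restr) auto
    also have "\<dots> = (\<integral>\<^sup>+x. indicator (A \<inter> S \<omega>) x \<partial>F \<omega>)"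
      using s S[OF w] A by (subst nn_integral_indicator) auto
    finally show ?thesis by (auto intro!: nn_integral_cong split: split_indicator)
  qed
  ultimately show "(\<lambda>\<omega>. emeasure (restr (F \<omega>) (S \<omega>)) A) \<in> borel_measurable \<Omega>"
    by (simp cong: measurable_cong)
qed

lemma measurable_restr_const_N:
  assumes [measurable]: "F \<in> \<Omega> \<rightarrow>\<^sub>M N" "A \<in> sets X"
  shows "(\<lambda>\<omega>. restr (F \<omega>) A) \<in> \<Omega> \<rightarrow>\<^sub>M N"
  by (rule measurable_restr_N) (use assms in simp_all)

text \<open>Finitely many values and a support inside a window make
  \<open>\<integral>x. \<phi> x \<partial>\<mu>\<close> a finite linear combination of masses of
  bounded sets, hence finite for every locally finite measure and measurable in
  \<open>\<mu>\<close>.\<close>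

definition test :: "('a \<Rightarrow> real) \<Rightarrow> bool" where
  "test \<phi> \<longleftrightarrow> simple_function X \<phi> \<and> (\<exists>n. \<forall>x\<in>space X - B n. \<phi> x = 0)"

lemma test_compose:
  assumes "test \<phi>" "g 0 = 0"
  shows "test (\<lambda>x. g (\<phi> x))"
proof -
  obtain n where "\<forall>x\<in>space X - B n. \<phi> x = 0" using assms by (auto simp: test_def)
  then have "\<forall>x\<in>space X - B n. g (\<phi> x) = 0" using assms(2) by simp
  then show ?thesis using assms by (auto simp: test_def intro: simple_function_compose1)
qed

lemma test_compose2:
  assumes "test \<phi>" "test \<psi>" "g 0 0 = 0"
  shows "test (\<lambda>x. g (\<phi> x) (\<psi> x))"
proof -
  obtain n m where "\<forall>x\<in>space X - B n. \<phi> x = 0" "\<forall>x\<in>space X - B m. \<psi> x = 0"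
    using assms by (auto simp: test_def)
  moreover have "B n \<subseteq> B (max n m)" "B m \<subseteq> B (max n m)"
    using incseq_B by (auto simp: incseq_def)
  ultimately have "\<forall>x\<in>space X - B (max n m). g (\<phi> x) (\<psi> x) = 0"
    using assms(3) by (metis DiffE DiffI subsetD)
  then show ?thesis using assms by (auto simp: test_def intro: simple_function_compose2)
qed

lemma test_add: "test \<phi> \<Longrightarrow> test \<psi> \<Longrightarrow> test (\<lambda>x. \<phi> x + \<psi> x)"
  by (rule test_compose2) auto

lemma test_mult_indicator:
  assumes "test \<phi>" "A \<in> sets X"
  shows "test (\<lambda>x. \<phi> x * indicator A x)"
  using assms by (auto simp: test_def intro!: simple_function_mult)

lemma test_indicator:
  assumes "A \<in> sets X" "A \<subseteq> B n"
  shows "test (\<lambda>x. c * indicator A x)"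
  using assms by (auto simp: test_def split: split_indicator intro!: simple_function_mult exI[of _ n])

lemma test_zero: "test (\<lambda>x. 0)"
  by (simp add: test_def)

lemma test_sum:
  assumes "\<And>i. i \<in> I \<Longrightarrow> test (\<phi> i)"
  shows "test (\<lambda>x. \<Sum>i\<in>I. \<phi> i x)"
  using assms by (induction I rule: infinite_finite_induct) (auto intro: test_zero test_add)

lemma test_vimage:
  assumes "test \<phi>" "v \<noteq> 0"
  shows "{x \<in> space X. \<phi> x = v} \<in> sets X" "\<exists>n. {x \<in> space X. \<phi> x = v} \<subseteq> B n"
proof -
  have "\<phi> -` {v} \<inter> space X \<in> sets X" using assms by (auto simp: test_def dest: simple_functionD)
  moreover have "{x \<in> space X. \<phi> x = v} = \<phi> -` {v} \<inter> space X" by auto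
  ultimately show "{x \<in> space X. \<phi> x = v} \<in> sets X" by metis
  show "\<exists>n. {x \<in> space X. \<phi> x = v} \<subseteq> B n" using assms by (auto simp: test_def)
qed

lemma test_measurable: "test \<phi> \<Longrightarrow> \<phi> \<in> borel_measurable X"
  by (auto simp: test_def borel_measurable_simple_function)

text \<open>The condition \<open>g 0 = 0\<close> removes the level set of the value
  \<open>0\<close>, the only one that may be unbounded; the remaining ones have finite mass.\<close>

lemma integral_test_compose:
  fixes g :: "real \<Rightarrow> real"
  assumes lf: "locally_finite X B \<mu>" and \<phi>: "test \<phi>" and g: "g 0 = 0"
  shows "integrable \<mu> (\<lambda>x. g (\<phi> x))"
    and "(\<integral>x. g (\<phi> x) \<partial>\<mu>) = (\<Sum>v\<in>\<phi> ` space X - {0}. g v * measure \<mu> {x \<in> space X. \<phi> x = v})"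
proof -
  note sp = locally_finite_space[OF lf] and s = locally_finite_sets[OF lf]
  have f: "finite (\<phi> ` space X)" using \<phi> by (auto simp: test_def dest: simple_functionD)
  have eq: "g (\<phi> x) = (\<Sum>v\<in>\<phi> ` space X - {0}. g v * indicator {x \<in> space X. \<phi> x = v} x)" (is "_ = ?S x")
    if "x \<in> space \<mu>" for x
  proof -
    have x: "x \<in> space X" using that sp by simp
    have "?S x = (\<Sum>v\<in>\<phi> ` space X - {0}. if \<phi> x = v then g v else 0)"
      by (rule sum.cong) (use x in \<open>simp_all add: indicator_def\<close>)
    also have "\<dots> = g (\<phi> x)" using f x g by (subst sum.delta') auto
    finally show ?thesis by simp
  qed
  have "has_bochner_integral \<mu> ?S (\<Sum>v\<in>\<phi> ` space X - {0}. g v * measure \<mu> {x \<in> space X. \<phi> x = v})"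
  proof (rule has_bochner_integral_sum, rule has_bochner_integral_mult_right)
    fix v assume "v \<in> \<phi> ` space X - {0}"
    then have "v \<noteq> 0" by auto
    then obtain n where "{x \<in> space X. \<phi> x = v} \<in> sets X" "{x \<in> space X. \<phi> x = v} \<subseteq> B n"
      using test_vimage[OF \<phi>] by blast
    then show "has_bochner_integral \<mu> (indicator {x \<in> space X. \<phi> x = v}) (measure \<mu> {x \<in> space X. \<phi> x = v})"
      using emeasure_bounded_finite[OF lf] s by (intro has_bochner_integral_real_indicator) simp_all
  qed
  then have "has_bochner_integral \<mu> (\<lambda>x. g (\<phi> x)) (\<Sum>v\<in>\<phi> ` space X - {0}. g v * measure \<mu> {x \<in> space X. \<phi> x = v})"
    using has_bochner_integral_cong[OF refl eq refl] by (rule iffD2[rotated])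
  then show "integrable \<mu> (\<lambda>x. g (\<phi> x))"
    and "(\<integral>x. g (\<phi> x) \<partial>\<mu>) = (\<Sum>v\<in>\<phi> ` space X - {0}. g v * measure \<mu> {x \<in> space X. \<phi> x = v})"
    by (auto simp: has_bochner_integral_iff)
qed

lemma integral_test:
  assumes "locally_finite X B \<mu>" "test \<phi>"
  shows "integrable \<mu> \<phi>"
    and "(\<integral>x. \<phi> x \<partial>\<mu>) = (\<Sum>v\<in>\<phi> ` space X - {0}. v * measure \<mu> {x \<in> space X. \<phi> x = v})"
  using integral_test_compose[OF assms, of "\<lambda>v. v"] by simp_all

lemma measurable_integral_test:
  assumes [measurable]: "F \<in> \<Omega> \<rightarrow>\<^sub>M N" and \<phi>: "test \<phi>"
  shows "(\<lambda>\<omega>. \<integral>x. \<phi> x \<partial>F \<omega>) \<in> borel_measurable \<Omega>"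
proof -
  have [measurable]: "{x \<in> space X. \<phi> x = v} \<in> sets X" if "v \<in> \<phi> ` space X - {0}" for v
    using that test_vimage[OF \<phi>] by auto
  have "(\<lambda>\<omega>. \<Sum>v\<in>\<phi> ` space X - {0}. v * measure (F \<omega>) {x \<in> space X. \<phi> x = v}) \<in> borel_measurable \<Omega>"
    by measurable
  then show ?thesis
    using measurable_space[OF assms(1)]
    by (subst measurable_cong[OF integral_test(2)[OF N_locally_finite \<phi>]]) auto
qed

lemma integral_superpose:
  assumes "\<mu> \<in> space N" "\<psi> \<in> space N" and \<phi>: "test \<phi>"
  shows "(\<integral>x. \<phi> x \<partial>superpose \<mu> \<psi>) = (\<integral>x. \<phi> x \<partial>\<mu>) + (\<integral>x. \<phi> x \<partial>\<psi>)"
proof -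
  have "measure (superpose \<mu> \<psi>) {x \<in> space X. \<phi> x = v} =
      measure \<mu> {x \<in> space X. \<phi> x = v} + measure \<psi> {x \<in> space X. \<phi> x = v}"
    if v: "v \<noteq> 0" for v
  proof -
    let ?A = "{x \<in> space X. \<phi> x = v}"
    obtain n where A: "?A \<in> sets X" "?A \<subseteq> B n" using test_vimage[OF \<phi> v] by auto
    have "emeasure \<mu> ?A < \<infinity>" "emeasure \<psi> ?A < \<infinity>"
      using A assms N_locally_finite emeasure_bounded_finite by blast+
    then show ?thesis
      using A assms by (simp add: measure_def emeasure_superpose N_sets enn2real_plus)
  qed
  then show ?thesis
    using integral_test(2)[OF N_locally_finite \<phi>] assms superpose_in_N
    by (simp add: sum.distrib[symmetric] algebra_simps)
qed

lemma integral_restr: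
  assumes "locally_finite X B \<mu>" "A \<in> sets X" and \<phi>: "test \<phi>"
  shows "(\<integral>x. \<phi> x \<partial>restr \<mu> A) = (\<integral>x. \<phi> x * indicator A x \<partial>\<mu>)"
proof -
  have [measurable]: "\<phi> \<in> borel_measurable \<mu>" "A \<in> sets \<mu>"
    using test_measurable[OF \<phi>] assms locally_finite_sets[OF assms(1)] by (auto cong: measurable_cong_sets)
  have "(\<integral>x. \<phi> x \<partial>density \<mu> (\<lambda>x. ennreal (indicator A x))) = (\<integral>x. indicator A x *\<^sub>R \<phi> x \<partial>\<mu>)"
    by (rule integral_density) auto
  then show ?thesis by (simp add: restr_def ennreal_indicator mult.commute)
qed

section \<open>Exponential functionals\<close>

text \<open>The integrand of the Laplace functional. It turns sums of test functions and
  superpositions of configurations into products.\<close>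

definition expf :: "('a \<Rightarrow> real) \<Rightarrow> 'a measure \<Rightarrow> real" where
  "expf \<phi> \<mu> = exp (\<integral>x. \<phi> x \<partial>\<mu>)"

lemma expf_nonneg: "0 \<le> expf \<phi> \<mu>"
  by (simp add: expf_def)

lemma measurable_expf:
  assumes "F \<in> \<Omega> \<rightarrow>\<^sub>M N" "test \<phi>"
  shows "(\<lambda>\<omega>. expf \<phi> (F \<omega>)) \<in> borel_measurable \<Omega>"
  unfolding expf_def using measurable_integral_test[OF assms] by measurable

lemma expf_add:
  assumes "\<mu> \<in> space N" "test \<phi>" "test \<psi>"
  shows "expf (\<lambda>x. \<phi> x + \<psi> x) \<mu> = expf \<phi> \<mu> * expf \<psi> \<mu>"
  using assms integral_test(1)[OF N_locally_finite[OF assms(1)]]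
  by (simp add: expf_def exp_add[symmetric])

lemma expf_superpose:
  assumes "\<mu> \<in> space N" "\<psi> \<in> space N" "test \<phi>"
  shows "expf \<phi> (superpose \<mu> \<psi>) = expf \<phi> \<mu> * expf \<phi> \<psi>"
  using integral_superpose[OF assms] by (simp add: expf_def exp_add)

lemma expf_restr:
  assumes "\<mu> \<in> space N" "A \<in> sets X" "test \<phi>"
  shows "expf \<phi> (restr \<mu> A) = expf (\<lambda>x. \<phi> x * indicator A x) \<mu>"
  using integral_restr[OF N_locally_finite] assms by (simp add: expf_def)

lemma expf_le_1: "(\<And>x. \<phi> x \<le> 0) \<Longrightarrow> expf \<phi> \<mu> \<le> 1"
  using Bochner_Integration.integral_nonneg[of \<mu> "\<lambda>x. - \<phi> x"] by (simp add: expf_def)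

text \<open>The linear span of the \<open>expf \<phi>\<close> with nonpositive
  \<open>\<phi>\<close>, taken up to equality on \<open>space N\<close>. Nonpositivity makes its
  members bounded, and since exponents add it is an algebra, which polynomial approximation
  requires.\<close>

inductive expoly :: "('a measure \<Rightarrow> real) \<Rightarrow> bool" where
  zero: "(\<And>\<mu>. \<mu> \<in> space N \<Longrightarrow> F \<mu> = 0) \<Longrightarrow> expoly F"
| step: "expoly F \<Longrightarrow> test \<phi> \<Longrightarrow> (\<And>x. \<phi> x \<le> 0) \<Longrightarrow>
    (\<And>\<mu>. \<mu> \<in> space N \<Longrightarrow> G \<mu> = a * expf \<phi> \<mu> + F \<mu>) \<Longrightarrow> expoly G"

lemma expoly_cong: "expoly F \<Longrightarrow> (\<And>\<mu>. \<mu> \<in> space N \<Longrightarrow> G \<mu> = F \<mu>) \<Longrightarrow> expoly G"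
proof (induction F rule: expoly.induct)
  case (zero F)
  then show ?case by (intro expoly.zero) simp
next
  case (step F \<phi> H a)
  show ?case by (rule expoly.step[OF step(1-3), of _ a]) (use step in simp)
qed

lemma expoly_expf: "test \<phi> \<Longrightarrow> (\<And>x. \<phi> x \<le> 0) \<Longrightarrow> expoly (\<lambda>\<mu>. a * expf \<phi> \<mu>)"
  by (rule expoly.step[where F="\<lambda>_. 0" and a=a and \<phi>=\<phi>]) (simp_all add: expoly.zero)

lemma expoly_const: "expoly (\<lambda>\<mu>. a)"
  using expoly_expf[OF test_zero, of a] by (simp add: expf_def)

lemma expoly_add:
  assumes "expoly F" "expoly H"
  shows "expoly (\<lambda>\<mu>. F \<mu> + H \<mu>)"
  using assms(1)
proof (induction F)
  case (zero F)
  then show ?case by (intro expoly_cong[OF assms(2)]) simp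
next
  case (step F \<phi> G a)
  show ?case by (rule expoly.step[OF step(5,2,3), of _ a]) (use step in simp)
qed

lemma expoly_mult_expf:
  assumes "expoly F" "test \<psi>" "\<And>x. \<psi> x \<le> 0"
  shows "expoly (\<lambda>\<mu>. b * expf \<psi> \<mu> * F \<mu>)"
  using assms(1)
proof induction
  case (zero F)
  then show ?case by (auto intro!: expoly.zero)
next
  case (step F \<phi> G a)
  show ?case
  proof (rule expoly.step[where F="\<lambda>\<mu>. b * expf \<psi> \<mu> * F \<mu>" and \<phi>="\<lambda>x. \<psi> x + \<phi> x" and a="a * b"])
    show "\<psi> x + \<phi> x \<le> 0" for x using step assms(3)[of x] by (simp add: add_nonpos_nonpos)
  qed (use step assms in \<open>auto simp: expf_add algebra_simps intro: test_add\<close>)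
qed

lemma expoly_mult:
  assumes "expoly F" "expoly H"
  shows "expoly (\<lambda>\<mu>. F \<mu> * H \<mu>)"
  using assms(1)
proof induction
  case (zero F)
  then show ?case by (auto intro!: expoly.zero)
next
  case (step F \<phi> G a)
  have "expoly (\<lambda>\<mu>. a * expf \<phi> \<mu> * H \<mu> + F \<mu> * H \<mu>)"
    using expoly_add[OF expoly_mult_expf[OF assms(2) step(2,3)] step(5)] .
  then show ?case by (rule expoly_cong) (use step in \<open>simp add: algebra_simps\<close>)
qed

lemma expoly_power: "expoly F \<Longrightarrow> expoly (\<lambda>\<mu>. F \<mu> ^ k)"
  by (induction k) (auto intro: expoly_const expoly_mult)

lemma expoly_diff: "expoly F \<Longrightarrow> expoly H \<Longrightarrow> expoly (\<lambda>\<mu>. F \<mu> - H \<mu>)"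
  using expoly_add[of F "\<lambda>\<mu>. (-1) * H \<mu>"] expoly_mult[OF expoly_const[of "-1"], of H] by simp

lemma expoly_sum: "(\<And>i. i \<in> I \<Longrightarrow> expoly (F i)) \<Longrightarrow> expoly (\<lambda>\<mu>. \<Sum>i\<in>I. F i \<mu>)"
  by (induction I rule: infinite_finite_induct) (auto intro: expoly_const expoly_add)

text \<open>The indexed form is what quadratic forms in the coefficients and a common family of
  cells refer to later.\<close>

lemma expoly_repr:
  assumes "expoly F"
  shows "\<exists>(r::nat) a \<phi>. (\<forall>i<r. test (\<phi> i) \<and> (\<forall>x. \<phi> i x \<le> 0)) \<and>
    (\<forall>\<mu>\<in>space N. F \<mu> = (\<Sum>i<r. a i * expf (\<phi> i) \<mu>))"
  using assms
proof induction
  case (zero F)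
  then show ?case by (intro exI[of _ 0]) auto
next
  case (step F \<psi> G b)
  from step(5) obtain r :: nat and a \<phi> where *: "\<forall>i<r. test (\<phi> i) \<and> (\<forall>x. \<phi> i x \<le> 0)"
    "\<forall>\<mu>\<in>space N. F \<mu> = (\<Sum>i<r. a i * expf (\<phi> i) \<mu>)" by blast
  show ?case
  proof (intro exI conjI allI impI ballI)
    fix i assume "i < Suc r"
    then show "test ((\<phi>(r := \<psi>)) i)" "(\<phi>(r := \<psi>)) i x \<le> 0" for x
      using * step(2,3) by (auto simp: less_Suc_eq)
  next
    fix \<mu> assume "\<mu> \<in> space N"
    then show "G \<mu> = (\<Sum>i<Suc r. (a(r := b)) i * expf ((\<phi>(r := \<psi>)) i) \<mu>)"
      using * step(4) by simp
  qed
qed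

lemma expoly_measurable: "expoly F \<Longrightarrow> F \<in> borel_measurable N"
proof (induction F rule: expoly.induct)
  case (zero F)
  then show ?case by (simp cong: measurable_cong)
next
  case (step F \<phi> G a)
  have [measurable]: "expf \<phi> \<in> borel_measurable N"
    using measurable_expf[of "\<lambda>x. x" N \<phi>] step by simp
  have "(\<lambda>\<mu>. a * expf \<phi> \<mu> + F \<mu>) \<in> borel_measurable N" using step by measurable
  then show ?case using step by (simp cong: measurable_cong)
qed

lemma expoly_bounded: "expoly F \<Longrightarrow> \<exists>C. \<forall>\<mu>\<in>space N. \<bar>F \<mu>\<bar> \<le> C"
proof (induction F rule: expoly.induct)
  case (zero F)
  then show ?case by (intro exI[of _ 0]) auto
next
  case (step F \<phi> G a)
  then obtain C where C: "\<forall>\<mu>\<in>space N. \<bar>F \<mu>\<bar> \<le> C" by auto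
  have "\<bar>G \<mu>\<bar> \<le> \<bar>a\<bar> + C" if "\<mu> \<in> space N" for \<mu>
  proof -
    have "\<bar>G \<mu>\<bar> \<le> \<bar>a\<bar> * expf \<phi> \<mu> + \<bar>F \<mu>\<bar>"
      using step(4)[OF that] expf_nonneg[of \<phi> \<mu>] abs_triangle_ineq[of "a * expf \<phi> \<mu>" "F \<mu>"] by (simp add: abs_mult)
    also have "\<dots> \<le> \<bar>a\<bar> * 1 + C"
      using C that expf_le_1[OF step(3)] by (intro add_mono mult_left_mono) auto
    finally show ?thesis by simp
  qed
  then show ?case by auto
qed

section \<open>Uniform approximation by exponential polynomials\<close>

definition unif_expoly :: "('a measure \<Rightarrow> real) \<Rightarrow> bool" where
  "unif_expoly H \<longleftrightarrow> (\<forall>\<epsilon>>0. \<exists>F. expoly F \<and> (\<forall>\<mu>\<in>space N. \<bar>H \<mu> - F \<mu>\<bar> < \<epsilon>))"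

lemma unif_expoly_mult:
  assumes "unif_expoly H" "unif_expoly K"
    and b: "\<And>\<mu>. \<mu> \<in> space N \<Longrightarrow> \<bar>H \<mu>\<bar> \<le> 1" "\<And>\<mu>. \<mu> \<in> space N \<Longrightarrow> \<bar>K \<mu>\<bar> \<le> 1"
  shows "unif_expoly (\<lambda>\<mu>. H \<mu> * K \<mu>)"
  unfolding unif_expoly_def
proof safe
  fix \<epsilon> :: real assume "0 < \<epsilon>"
  \<comment> \<open>The cap \<open>1\<close> gives \<open>\<bar>G \<mu>\<bar> \<le> 2\<close>, so
    that the total error stays below \<open>3 * e\<close>.\<close>
  define e where "e = min 1 (\<epsilon> / 4)"
  have e: "0 < e" "e \<le> 1" "4 * e \<le> \<epsilon>" using \<open>0 < \<epsilon>\<close> by (auto simp: e_def)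
  obtain F G where F: "expoly F" "\<forall>\<mu>\<in>space N. \<bar>H \<mu> - F \<mu>\<bar> < e" and G: "expoly G" "\<forall>\<mu>\<in>space N. \<bar>K \<mu> - G \<mu>\<bar> < e"
    using assms(1,2) e(1) unfolding unif_expoly_def by blast
  have "\<bar>H \<mu> * K \<mu> - F \<mu> * G \<mu>\<bar> < \<epsilon>" if m: "\<mu> \<in> space N" for \<mu>
  proof -
    have g: "\<bar>G \<mu>\<bar> \<le> 2" using b(2)[OF m] G(2) m e by (smt (verit))
    have "H \<mu> * K \<mu> - F \<mu> * G \<mu> = H \<mu> * (K \<mu> - G \<mu>) + (H \<mu> - F \<mu>) * G \<mu>" by (simp add: algebra_simps)
    also have "\<bar>\<dots>\<bar> \<le> \<bar>H \<mu>\<bar> * \<bar>K \<mu> - G \<mu>\<bar> + \<bar>H \<mu> - F \<mu>\<bar> * \<bar>G \<mu>\<bar>"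
      using abs_triangle_ineq[of "H \<mu> * (K \<mu> - G \<mu>)" "(H \<mu> - F \<mu>) * G \<mu>"] by (simp add: abs_mult)
    also have "\<dots> \<le> 1 * \<bar>K \<mu> - G \<mu>\<bar> + \<bar>H \<mu> - F \<mu>\<bar> * 2"
      using b(1)[OF m] g by (intro add_mono mult_right_mono mult_left_mono) auto
    also have "\<dots> < e + e * 2" using F(2) G(2) m by (intro add_strict_mono) auto
    also have "\<dots> \<le> \<epsilon>" using e by simp
    finally show ?thesis .
  qed
  then show "\<exists>J. expoly J \<and> (\<forall>\<mu>\<in>space N. \<bar>H \<mu> * K \<mu> - J \<mu>\<bar> < \<epsilon>)"
    using expoly_mult[OF F(1) G(1)] by (intro exI[of _ "\<lambda>\<mu>. F \<mu> * G \<mu>"]) auto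
qed

text \<open>The count of a bounded set is read off \<open>2 powr - \<mu>(A)\<close> by a bump function, which Bernstein
  polynomials approximate uniformly on the unit interval.\<close>

lemma unif_expoly_count:
  assumes A: "A \<in> sets X" "A \<subseteq> B n"
  shows "unif_expoly (\<lambda>\<mu>. of_bool (measure \<mu> A = real k))"
  unfolding unif_expoly_def
proof safe
  fix \<epsilon> :: real assume e: "0 < \<epsilon>"
  \<comment> \<open>A tent of height \<open>1\<close> at \<open>(1/2) ^ k\<close> and half-width
    \<open>(1/2) ^ (k + 1)\<close>. This is exactly the distance to the nearest other power of
    \<open>1/2\<close>, so the tent vanishes at every other value that \<open>s\<close> can
    take.\<close>
  define h :: "real \<Rightarrow> real" where "h t = max 0 (1 - 2 ^ (k + 1) * \<bar>t - (1/2) ^ k\<bar>)" for t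
  have "continuous_on {0..1} h" unfolding h_def by (intro continuous_intros)
  then obtain M where M: "\<And>t. t \<in> {0..1} \<Longrightarrow> \<bar>h t - (\<Sum>j\<le>M. h (j/M) * Bernstein M j t)\<bar> < \<epsilon>"
    using Bernstein_Weierstrass[of h \<epsilon>] e by blast
  define s where "s = expf (\<lambda>x. - ln 2 * indicator A x)"
  have t: "test (\<lambda>x. - ln 2 * indicator A x)" using test_indicator[OF A, of "- ln 2"] .
  have es: "expoly s"
    using expoly_expf[OF t, of 1] by (auto simp: s_def split: split_indicator)
  have "expoly (\<lambda>\<mu>. \<Sum>j\<le>M. h (j/M) * Bernstein M j (s \<mu>))"
    unfolding Bernstein_def
    by (intro expoly_sum expoly_mult expoly_const expoly_power expoly_diff es)
  moreover have "\<bar>of_bool (measure \<mu> A = real k) - (\<Sum>j\<le>M. h (j/M) * Bernstein M j (s \<mu>))\<bar> < \<epsilon>"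
    if \<mu>: "\<mu> \<in> space N" for \<mu>
  proof -
    obtain m :: nat where m: "emeasure \<mu> A = of_nat m" using N_natE[OF \<mu> A] .
    then have mm: "measure \<mu> A = real m"
      by (metis enn2real_ennreal ennreal_of_nat_eq_real_of_nat measure_def of_nat_0_le_iff)
    have fin: "emeasure \<mu> A < \<infinity>" using m by (simp add: of_nat_less_top)
    have "s \<mu> = exp (- ln 2 * measure \<mu> A)"
      using A N_sets[OF \<mu>] fin by (simp add: s_def expf_def)
    also have "\<dots> = (1/2) ^ m"
      by (simp add: mm exp_minus exp_of_nat2_mult power_one_over inverse_eq_divide)
    finally have s: "s \<mu> = (1/2) ^ m" .
    have "h (s \<mu>) = of_bool (m = k)"
    proof (cases "m = k")
      case False
      have "1 \<le> 2 ^ (k + 1) * \<bar>(1/2) ^ m - (1/2) ^ k :: real\<bar>"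
      proof (cases "m < k")
        case True
        then obtain d where d: "k = m + Suc d" using less_iff_Suc_add by auto
        have p: "(1/2::real) ^ k \<le> (1/2) ^ (Suc m)" using d by (intro power_decreasing) auto
        then have "(1/2::real) ^ m - (1/2) ^ k \<ge> (1/2) ^ (Suc m)" by simp
        moreover have "(1/2::real) ^ (Suc m) \<ge> (1/2) ^ k" using p .
        ultimately have "\<bar>(1/2::real) ^ m - (1/2) ^ k\<bar> \<ge> (1/2) ^ k" by linarith
        then have "2 ^ (k+1) * \<bar>(1/2) ^ m - (1/2) ^ k :: real\<bar> \<ge> 2 ^ (k+1) * (1/2) ^ k"
          by (intro mult_left_mono) auto
        moreover have "(2::real) ^ (k+1) * (1/2) ^ k = 2" by (simp add: power_one_over)
        ultimately show ?thesis by linarith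
      next
        case f: False
        with False obtain d where d: "m = k + Suc d" using less_iff_Suc_add[of k m] by auto
        have "(1/2::real) ^ m \<le> (1/2) ^ (Suc k)" using d by (intro power_decreasing) auto
        moreover have "(1/2::real) ^ k = 2 * (1/2) ^ (Suc k)" by simp
        ultimately have "\<bar>(1/2::real) ^ m - (1/2) ^ k\<bar> \<ge> (1/2) ^ (Suc k)" by linarith
        then have "2 ^ (k+1) * \<bar>(1/2) ^ m - (1/2) ^ k :: real\<bar> \<ge> 2 ^ (k+1) * (1/2) ^ (Suc k)"
          by (intro mult_left_mono) auto
        moreover have "(2::real) ^ (k+1) * (1/2) ^ (Suc k) = 1" by (simp add: power_one_over)
        ultimately show ?thesis by linarith
      qed
      then show ?thesis using False by (simp add: h_def s)
    qed (simp add: h_def s)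
    moreover have "s \<mu> \<in> {0..1}" by (simp add: s power_le_one)
    ultimately show ?thesis using M[of "s \<mu>"] by (simp add: mm)
  qed
  ultimately show "\<exists>F. expoly F \<and> (\<forall>\<mu>\<in>space N. \<bar>of_bool (measure \<mu> A = real k) - F \<mu>\<bar> < \<epsilon>)" by blast
qed

section \<open>Count events as an intersection-stable generator\<close>

definition cylinder :: "('a set \<times> nat) set \<Rightarrow> 'a measure set" where
  "cylinder S = {\<mu> \<in> space N. \<forall>(A, k)\<in>S. measure \<mu> A = real k}"

definition cylinders :: "'a measure set set" where
  "cylinders = {cylinder S | S. finite S \<and> (\<forall>(A, k)\<in>S. A \<in> bounded_sets X B)}"

lemma Int_stable_cylinders: "Int_stable cylinders"
proof (rule Int_stableI)
  fix C D assume "C \<in> cylinders" "D \<in> cylinders"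
  then obtain S T where "C = cylinder S" "D = cylinder T" "finite S" "finite T"
    "\<forall>(A, k)\<in>S. A \<in> bounded_sets X B" "\<forall>(A, k)\<in>T. A \<in> bounded_sets X B"
    unfolding cylinders_def by blast
  then have "C \<inter> D = cylinder (S \<union> T)" "finite (S \<union> T)" "\<forall>(A, k)\<in>S \<union> T. A \<in> bounded_sets X B"
    by (auto simp: cylinder_def)
  then show "C \<inter> D \<in> cylinders" unfolding cylinders_def by blast
qed

lemma cylinders_Pow: "cylinders \<subseteq> Pow (space N)"
  by (auto simp: cylinders_def cylinder_def)

lemma cylinder_sets:
  assumes "finite S" "\<forall>(A, k)\<in>S. A \<in> bounded_sets X B"
  shows "cylinder S \<in> sets N"
proof -
  have "cylinder S = {\<mu> \<in> space N. \<forall>p\<in>S. measure \<mu> (fst p) = real (snd p)}"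
    by (auto simp: cylinder_def)
  also have "\<dots> \<in> sets N"
  proof (rule sets.sets_Collect_finite_All[OF _ assms(1)])
    fix p assume "p \<in> S"
    then have "fst p \<in> sets X" using assms(2) by (cases p) (auto elim!: bounded_setsE)
    then have [measurable]: "(\<lambda>\<mu>. measure \<mu> (fst p)) \<in> borel_measurable N"
      using measurable_measure_N[of "\<lambda>x. x" N "fst p"] by simp
    show "{\<mu> \<in> space N. measure \<mu> (fst p) = real (snd p)} \<in> sets N" by measurable
  qed
  finally show ?thesis .
qed

text \<open>On bounded sets the evaluations take integer values, so the events that fix finitely
  many of them already make every evaluation measurable. The inclusion of \<open>sets N\<close> is
  then measurability of the identity into \<open>N\<close>.\<close>

lemma sets_N_eq: "sets N = sigma_sets (space N) cylinders"
proof
  show "sigma_sets (space N) cylinders \<subseteq> sets N"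
    using cylinder_sets by (intro sets.sigma_sets_subset) (auto simp: cylinders_def)
  let ?S = "sigma (space N) cylinders"
  have "(\<lambda>\<mu>. \<mu>) \<in> ?S \<rightarrow>\<^sub>M N"
  proof (rule measurable_N)
    fix \<mu> assume "\<mu> \<in> space ?S"
    then show "\<mu> \<in> space N" using cylinders_Pow by (simp add: space_measure_of)
  next
    fix A n assume A: "A \<in> sets X" "A \<subseteq> B n"
    have m: "emeasure \<mu> A = of_nat (nat \<lfloor>measure \<mu> A\<rfloor>)" if \<mu>: "\<mu> \<in> space N" for \<mu>
    proof -
      obtain m :: nat where "emeasure \<mu> A = of_nat m" using N_natE[OF \<mu> A] .
      then show ?thesis
        by (simp add: measure_def flip: ennreal_of_nat_eq_real_of_nat)
    qed
    have k: "{\<mu> \<in> space N. measure \<mu> A = real k} \<in> sets ?S" for k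
    proof -
      have "cylinder {(A, k)} \<in> cylinders"
        using bounded_setsI[OF A] unfolding cylinders_def by blast
      then show ?thesis using cylinders_Pow by (auto simp: cylinder_def)
    qed
    have "(nat \<lfloor>measure \<mu> A\<rfloor> = k) = (measure \<mu> A = real k)" if \<mu>: "\<mu> \<in> space N" for \<mu> k
    proof -
      obtain m :: nat where "emeasure \<mu> A = of_nat m" using N_natE[OF \<mu> A] .
      then have "measure \<mu> A = real m" by (simp add: measure_def flip: ennreal_of_nat_eq_real_of_nat)
      then show ?thesis by simp
    qed
    then have "{\<mu> \<in> space N. nat \<lfloor>measure \<mu> A\<rfloor> = k} = {\<mu> \<in> space N. measure \<mu> A = real k}" for k
      by (intro Collect_cong conj_cong) simp_all
    then have "(\<lambda>\<mu>. nat \<lfloor>measure \<mu> A\<rfloor>) \<in> ?S \<rightarrow>\<^sub>M count_space UNIV"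
      using k cylinders_Pow
      by (intro measurable_count_space_eq2_countable[THEN iffD2])
         (auto simp: vimage_def Int_def space_measure_of conj_commute)
    then have "(\<lambda>\<mu>. of_nat (nat \<lfloor>measure \<mu> A\<rfloor>) :: ennreal) \<in> borel_measurable ?S"
      by (rule measurable_compose) simp
    then show "(\<lambda>\<mu>. emeasure \<mu> A) \<in> borel_measurable ?S"
      using m cylinders_Pow by (subst measurable_cong[where g="\<lambda>\<mu>. of_nat (nat \<lfloor>measure \<mu> A\<rfloor>)"]) (auto simp: space_measure_of)
  qed
  note id = this
  have sp: "space ?S = space N" using cylinders_Pow by (simp add: space_measure_of)
  have "A \<in> sets ?S" if "A \<in> sets N" for A
  proof -
    have "(\<lambda>\<mu>. \<mu>) -` A \<inter> space ?S = A" using sets.sets_into_space[OF that] unfolding sp by blast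
    then show ?thesis using measurable_sets[OF id that] by simp
  qed
  then show "sets N \<subseteq> sigma_sets (space N) cylinders" using cylinders_Pow by (simp add: subset_iff sets_measure_of)
qed

lemma unif_expoly_cylinder:
  assumes "finite S" "\<forall>(A, k)\<in>S. A \<in> bounded_sets X B"
  shows "unif_expoly (indicator (cylinder S))"
  using assms
proof (induction S)
  case empty
  have "expoly (\<lambda>_. 1)" by (rule expoly_const)
  then show ?case by (auto simp: unif_expoly_def cylinder_def indicator_def intro!: exI[of _ "\<lambda>_. 1"])
next
  case (insert p S)
  obtain A k where p: "p = (A, k)" by (cases p)
  then obtain n where A: "A \<in> sets X" "A \<subseteq> B n" using insert by (auto elim!: bounded_setsE)
  have "unif_expoly (\<lambda>\<mu>. of_bool (measure \<mu> A = real k) * indicator (cylinder S) \<mu>)"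
    using insert by (intro unif_expoly_mult unif_expoly_count[OF A]) (auto split: split_indicator)
  moreover have "indicator (cylinder (insert p S)) \<mu> = of_bool (measure \<mu> A = real k) * (indicator (cylinder S) \<mu> :: real)" for \<mu>
    by (auto simp: cylinder_def p indicator_def)
  ultimately show ?case by (simp add: unif_expoly_def)
qed

end

text \<open>Finite rather than probability measures: density is applied to the sum of two laws, and
  uniqueness to exponentially weighted laws, neither of which is normalized.\<close>

locale finite_point_law = localized_space X B + finite_measure Q
  for X :: "'a measure" and B and Q :: "'a measure measure" +
  assumes sets_Q [measurable_cong, simp]: "sets Q = sets (point_measures X B)"
begin

lemma space_Q [simp]: "space Q = space N"
  using sets_Q sets_eq_imp_space_eq by blast

definition approx :: "('a measure \<Rightarrow> real) \<Rightarrow> bool" where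
  "approx H \<longleftrightarrow> H \<in> borel_measurable Q \<and> (\<exists>C. \<forall>\<mu>\<in>space N. \<bar>H \<mu>\<bar> \<le> C) \<and>
     (\<forall>\<epsilon>>0. \<exists>F. expoly F \<and> (\<integral>\<mu>. (H \<mu> - F \<mu>)\<^sup>2 \<partial>Q) < \<epsilon>)"

lemma integrable_bounded:
  "F \<in> borel_measurable Q \<Longrightarrow> (\<And>\<mu>. \<mu> \<in> space N \<Longrightarrow> \<bar>F \<mu>\<bar> \<le> C) \<Longrightarrow> integrable Q (F :: _ \<Rightarrow> real)"
  by (rule integrable_const_bound[where B=C]) (auto intro!: AE_I2)

lemma integrable_diff_square:
  fixes H F :: "'a measure \<Rightarrow> real"
  assumes [measurable]: "H \<in> borel_measurable Q" "F \<in> borel_measurable Q"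
    and "\<And>\<mu>. \<mu> \<in> space N \<Longrightarrow> \<bar>H \<mu>\<bar> \<le> C" "\<And>\<mu>. \<mu> \<in> space N \<Longrightarrow> \<bar>F \<mu>\<bar> \<le> D"
  shows "integrable Q (\<lambda>\<mu>. (H \<mu> - F \<mu>)\<^sup>2)"
proof (rule integrable_bounded)
  fix \<mu> assume "\<mu> \<in> space N"
  then have "\<bar>H \<mu> - F \<mu>\<bar> \<le> C + D" using assms(3,4)[of \<mu>] by linarith
  then show "\<bar>(H \<mu> - F \<mu>)\<^sup>2\<bar> \<le> (C + D)\<^sup>2" by (simp add: abs_le_square_iff[symmetric])
qed measurable

lemma expoly_measurable_Q: "expoly F \<Longrightarrow> F \<in> borel_measurable Q"
  using expoly_measurable by (simp cong: measurable_cong_sets)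

lemma square_sum_le: "((a::real) + b)\<^sup>2 \<le> 2 * a\<^sup>2 + 2 * b\<^sup>2"
  using zero_le_power2[of "a - b"] by (simp add: power2_eq_square algebra_simps)

lemma square_diff_le: "((a::real) - c)\<^sup>2 \<le> 2 * (a - b)\<^sup>2 + 2 * (b - c)\<^sup>2"
  using square_sum_le[of "a - b" "b - c"] by simp

lemma square_sum_diff_le: "((a::real) + b - (c + d))\<^sup>2 \<le> 2 * (a - c)\<^sup>2 + 2 * (b - d)\<^sup>2"
  using square_sum_le[of "a - c" "b - d"] by (simp add: algebra_simps)

lemma approx_limit:
  assumes H[measurable]: "H \<in> borel_measurable Q" and C: "\<And>\<mu>. \<mu> \<in> space N \<Longrightarrow> \<bar>H \<mu>\<bar> \<le> C"
    and *: "\<And>\<epsilon>. 0 < \<epsilon> \<Longrightarrow> \<exists>K. approx K \<and> (\<integral>\<mu>. (H \<mu> - K \<mu>)\<^sup>2 \<partial>Q) < \<epsilon>"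
  shows "approx H"
  unfolding approx_def
proof safe
  show "\<exists>C. \<forall>\<mu>\<in>space N. \<bar>H \<mu>\<bar> \<le> C" using C by blast
  fix \<epsilon> :: real assume e: "0 < \<epsilon>"
  \<comment> \<open>The quarters compensate for the factor \<open>2\<close> in front of both errors
    in \<open>square_diff_le\<close>.\<close>
  then obtain K where K: "approx K" "(\<integral>\<mu>. (H \<mu> - K \<mu>)\<^sup>2 \<partial>Q) < \<epsilon> / 4" using *[of "\<epsilon>/4"] by auto
  have "0 < \<epsilon> / 4" using e by simp
  with K(1) obtain F where F: "expoly F" "(\<integral>\<mu>. (K \<mu> - F \<mu>)\<^sup>2 \<partial>Q) < \<epsilon> / 4"
    unfolding approx_def by blast
  obtain D where [measurable]: "K \<in> borel_measurable Q" and D: "\<forall>\<mu>\<in>space N. \<bar>K \<mu>\<bar> \<le> D"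
    using K(1) unfolding approx_def by blast
  obtain E where E: "\<forall>\<mu>\<in>space N. \<bar>F \<mu>\<bar> \<le> E" using expoly_bounded[OF F(1)] by blast
  note [measurable] = expoly_measurable_Q[OF F(1)]
  have i: "integrable Q (\<lambda>\<mu>. (H \<mu> - K \<mu>)\<^sup>2)" "integrable Q (\<lambda>\<mu>. (K \<mu> - F \<mu>)\<^sup>2)" "integrable Q (\<lambda>\<mu>. (H \<mu> - F \<mu>)\<^sup>2)"
    using C D E by (auto intro!: integrable_diff_square)
  have "(\<integral>\<mu>. (H \<mu> - F \<mu>)\<^sup>2 \<partial>Q) \<le> (\<integral>\<mu>. 2 * (H \<mu> - K \<mu>)\<^sup>2 + 2 * (K \<mu> - F \<mu>)\<^sup>2 \<partial>Q)"
    using i by (intro integral_mono square_diff_le) auto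
  also have "\<dots> = 2 * (\<integral>\<mu>. (H \<mu> - K \<mu>)\<^sup>2 \<partial>Q) + 2 * (\<integral>\<mu>. (K \<mu> - F \<mu>)\<^sup>2 \<partial>Q)" using i by simp
  finally show "\<exists>F. expoly F \<and> (\<integral>\<mu>. (H \<mu> - F \<mu>)\<^sup>2 \<partial>Q) < \<epsilon>" using K(2) F by (intro exI[of _ F]) auto
qed (rule H)

lemma approx_expoly: "expoly F \<Longrightarrow> approx F"
  unfolding approx_def using expoly_bounded expoly_measurable_Q by (auto intro!: exI[of _ F])

lemma approx_add:
  assumes H: "approx H" and K: "approx K"
  shows "approx (\<lambda>\<mu>. H \<mu> + K \<mu>)"
  unfolding approx_def
proof safe
  show "(\<lambda>\<mu>. H \<mu> + K \<mu>) \<in> borel_measurable Q" using H K unfolding approx_def by auto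
  obtain C D where CD: "\<forall>\<mu>\<in>space N. \<bar>H \<mu>\<bar> \<le> C" "\<forall>\<mu>\<in>space N. \<bar>K \<mu>\<bar> \<le> D" using H K unfolding approx_def by auto
  then have "\<forall>\<mu>\<in>space N. \<bar>H \<mu> + K \<mu>\<bar> \<le> C + D" by (smt (verit))
  then show "\<exists>C. \<forall>\<mu>\<in>space N. \<bar>H \<mu> + K \<mu>\<bar> \<le> C" by blast
  fix \<epsilon> :: real assume "0 < \<epsilon>"
  then have e': "0 < \<epsilon> / 4" by simp
  obtain F G where F: "expoly F" "(\<integral>\<mu>. (H \<mu> - F \<mu>)\<^sup>2 \<partial>Q) < \<epsilon> / 4"
    and G: "expoly G" "(\<integral>\<mu>. (K \<mu> - G \<mu>)\<^sup>2 \<partial>Q) < \<epsilon> / 4"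
    using H K e' unfolding approx_def by blast
  have [measurable]: "H \<in> borel_measurable Q" "K \<in> borel_measurable Q" using H K unfolding approx_def by auto
  note [measurable] = expoly_measurable_Q[OF F(1)] expoly_measurable_Q[OF G(1)]
  obtain E E' where E: "\<forall>\<mu>\<in>space N. \<bar>F \<mu>\<bar> \<le> E" "\<forall>\<mu>\<in>space N. \<bar>G \<mu>\<bar> \<le> E'"
    using expoly_bounded[OF F(1)] expoly_bounded[OF G(1)] by blast
  obtain E'' where E'': "\<forall>\<mu>\<in>space N. \<bar>F \<mu> + G \<mu>\<bar> \<le> E''" using expoly_bounded[OF expoly_add[OF F(1) G(1)]] by blast
  have i: "integrable Q (\<lambda>\<mu>. (H \<mu> - F \<mu>)\<^sup>2)" "integrable Q (\<lambda>\<mu>. (K \<mu> - G \<mu>)\<^sup>2)"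
    using CD E by (auto intro!: integrable_diff_square)
  have i': "integrable Q (\<lambda>\<mu>. (H \<mu> + K \<mu> - (F \<mu> + G \<mu>))\<^sup>2)"
    using \<open>\<forall>\<mu>\<in>space N. \<bar>H \<mu> + K \<mu>\<bar> \<le> C + D\<close> E'' by (intro integrable_diff_square) auto
  have "(\<integral>\<mu>. (H \<mu> + K \<mu> - (F \<mu> + G \<mu>))\<^sup>2 \<partial>Q) \<le> (\<integral>\<mu>. 2 * (H \<mu> - F \<mu>)\<^sup>2 + 2 * (K \<mu> - G \<mu>)\<^sup>2 \<partial>Q)"
    using i i' by (intro integral_mono square_sum_diff_le) auto
  also have "\<dots> = 2 * (\<integral>\<mu>. (H \<mu> - F \<mu>)\<^sup>2 \<partial>Q) + 2 * (\<integral>\<mu>. (K \<mu> - G \<mu>)\<^sup>2 \<partial>Q)" using i by simp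
  finally show "\<exists>F. expoly F \<and> (\<integral>\<mu>. (H \<mu> + K \<mu> - F \<mu>)\<^sup>2 \<partial>Q) < \<epsilon>"
    using F G expoly_add[OF F(1) G(1)] by (intro exI[of _ "\<lambda>\<mu>. F \<mu> + G \<mu>"]) auto
qed

lemma approx_uminus:
  assumes "approx H" shows "approx (\<lambda>\<mu>. - H \<mu>)"
proof -
  have "\<exists>F. expoly F \<and> (\<integral>\<mu>. (- H \<mu> - F \<mu>)\<^sup>2 \<partial>Q) < \<epsilon>" if e: "0 < \<epsilon>" for \<epsilon>
  proof -
    obtain F where F: "expoly F" "(\<integral>\<mu>. (H \<mu> - F \<mu>)\<^sup>2 \<partial>Q) < \<epsilon>"
      using assms e unfolding approx_def by blast
    have "(\<lambda>\<mu>. (- H \<mu> - - F \<mu>)\<^sup>2) = (\<lambda>\<mu>. (H \<mu> - F \<mu>)\<^sup>2)"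
      by (auto simp: power2_eq_square algebra_simps)
    moreover have "expoly (\<lambda>\<mu>. - F \<mu>)" using expoly_diff[OF expoly_const[of 0] F(1)] by simp
    ultimately show ?thesis using F(2) by (intro exI[of _ "\<lambda>\<mu>. - F \<mu>"]) metis
  qed
  then show ?thesis using assms by (auto simp: approx_def)
qed

lemma approx_sum: "(\<And>i. i \<in> I \<Longrightarrow> approx (H i)) \<Longrightarrow> approx (\<lambda>\<mu>. \<Sum>i\<in>I. H i \<mu>)"
  by (induction I rule: infinite_finite_induct) (auto intro: approx_expoly expoly_const approx_add)

lemma approx_unif:
  assumes H[measurable]: "H \<in> borel_measurable Q" and C: "\<And>\<mu>. \<mu> \<in> space N \<Longrightarrow> \<bar>H \<mu>\<bar> \<le> C" and u: "unif_expoly H"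
  shows "approx H"
proof (rule approx_limit[OF H C])
  fix \<epsilon> :: real assume e: "0 < \<epsilon>"
  \<comment> \<open>The added \<open>1\<close> keeps the divisor positive for the zero measure and
    makes the last estimate strict.\<close>
  define q where "q = measure Q (space N) + 1"
  have q: "q > 0" unfolding q_def by (smt (verit) measure_nonneg)
  obtain F where F: "expoly F" "\<And>\<mu>. \<mu> \<in> space N \<Longrightarrow> \<bar>H \<mu> - F \<mu>\<bar> < sqrt (\<epsilon> / q)"
    using u e q unfolding unif_expoly_def by (metis divide_pos_pos real_sqrt_gt_zero)
  have le: "(H \<mu> - F \<mu>)\<^sup>2 \<le> \<epsilon> / q" if "\<mu> \<in> space N" for \<mu>
    using F(2)[OF that] e q by (metis less_imp_le real_sqrt_abs real_sqrt_le_iff)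
  note [measurable] = expoly_measurable_Q[OF F(1)]
  have "(\<integral>\<mu>. (H \<mu> - F \<mu>)\<^sup>2 \<partial>Q) \<le> (\<integral>\<mu>. \<epsilon> / q \<partial>Q)"
    using le e q by (intro integral_mono integrable_bounded[where C="\<epsilon>/q"]) auto
  also have "\<dots> = \<epsilon> * (measure Q (space N) / q)" by simp
  also have "\<dots> < \<epsilon> * 1" using e q by (intro mult_strict_left_mono) (auto simp: q_def)
  finally show "\<exists>K. approx K \<and> (\<integral>\<mu>. (H \<mu> - K \<mu>)\<^sup>2 \<partial>Q) < \<epsilon>" using approx_expoly[OF F(1)] by auto
qed

text \<open>A Dynkin argument. Cylinder indicators are uniform limits, and uniform closeness gives
  \<open>L2\<close> closeness because \<open>Q\<close> is finite; complements and countable disjoint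
  unions inherit approximability.\<close>

lemma approx_indicator:
  assumes "A \<in> sets N"
  shows "approx (indicator A)"
proof -
  have "A \<in> sigma_sets (space N) cylinders" using assms sets_N_eq by simp
  with Int_stable_cylinders cylinders_Pow show ?thesis
  proof (induction rule: sigma_sets_induct_disjoint)
    case (basic A)
    then obtain S where S: "A = cylinder S" "finite S" "\<forall>(A, k)\<in>S. A \<in> bounded_sets X B" unfolding cylinders_def by blast
    then show ?case
      using cylinder_sets[OF S(2,3)] unif_expoly_cylinder[OF S(2,3)]
      by (intro approx_unif[where C=1]) (auto split: split_indicator)
  next
    case empty
    then show ?case using approx_expoly[OF expoly_const[of 0]] by (simp add: indicator_def)
  next
    case (compl A)
    have "approx (\<lambda>\<mu>. 1 + - indicator A \<mu>)" by (intro approx_add approx_uminus compl approx_expoly expoly_const)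
    then have *: "approx (\<lambda>\<mu>. 1 - indicator A \<mu>)" by simp
    have A: "space N - A \<in> sets Q" using compl(1) sets_N_eq by auto
    show ?case
    proof (rule approx_limit[where C=1])
      show "\<exists>K. approx K \<and> (\<integral>\<mu>. (indicator (space N - A) \<mu> - K \<mu>)\<^sup>2 \<partial>Q) < \<epsilon>" if "0 < \<epsilon>" for \<epsilon>
      proof (intro exI conjI, rule *)
        have "(\<integral>\<mu>. (indicator (space N - A) \<mu> - (1 - indicator A \<mu> :: real))\<^sup>2 \<partial>Q) = (\<integral>\<mu>. 0 \<partial>Q)"
          by (intro Bochner_Integration.integral_cong) (auto split: split_indicator)
        then show "(\<integral>\<mu>. (indicator (space N - A) \<mu> - (1 - indicator A \<mu> :: real))\<^sup>2 \<partial>Q) < \<epsilon>" using that by simp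
      qed
    qed (use A in \<open>auto split: split_indicator\<close>)
  next
    \<comment> \<open>Continuity of the finite measure from below: the squared \<open>L2\<close>
      distance between the indicators of nested sets is the measure of their difference.\<close>
    case (union A)
    have A: "A i \<in> sets Q" for i using union(2) sets_N_eq by auto
    have [measurable]: "(\<Union>i. A i) \<in> sets Q" using A by auto
    have fin: "indicator (\<Union>i<n. A i) = (\<lambda>\<mu>. \<Sum>i<n. indicator (A i) \<mu> :: real)" for n
      using union(1) by (intro ext) (auto simp: disjoint_family_on_def intro!: indicator_UN_disjoint)
    show ?case
    proof (rule approx_limit[where C=1])
      fix \<epsilon> :: real assume e: "0 < \<epsilon>"
      have "(\<lambda>n. measure Q (\<Union>i<n. A i)) \<longlonglongrightarrow> measure Q (\<Union>n. \<Union>i<n. A i)"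
        using A by (intro finite_Lim_measure_incseq incseq_SucI) (auto simp: lessThan_Suc)
      moreover have "(\<Union>n. \<Union>i<n. A i) = (\<Union>i. A i)" by auto
      ultimately have "eventually (\<lambda>n. dist (measure Q (\<Union>i<n. A i)) (measure Q (\<Union>i. A i)) < \<epsilon>) sequentially"
        using e by (simp add: tendsto_iff)
      then obtain n where n: "\<bar>measure Q (\<Union>i<n. A i) - measure Q (\<Union>i. A i)\<bar> < \<epsilon>"
        by (auto simp: eventually_sequentially dist_real_def)
      have "(\<integral>\<mu>. (indicator (\<Union>i. A i) \<mu> - indicator (\<Union>i<n. A i) \<mu> :: real)\<^sup>2 \<partial>Q) = (\<integral>\<mu>. indicator ((\<Union>i. A i) - (\<Union>i<n. A i)) \<mu> \<partial>Q)"
        by (intro Bochner_Integration.integral_cong) (auto split: split_indicator)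
      also have "\<dots> = measure Q ((\<Union>i. A i) - (\<Union>i<n. A i))"
        using A by (subst Bochner_Integration.integral_indicator) (auto intro!: arg_cong[where f="measure Q"] dest: sets.sets_into_space)
      also have "\<dots> = measure Q (\<Union>i. A i) - measure Q (\<Union>i<n. A i)"
        using A by (intro finite_measure_Diff) auto
      also have "\<dots> < \<epsilon>" using n by simp
      finally have "(\<integral>\<mu>. (indicator (\<Union>i. A i) \<mu> - indicator (\<Union>i<n. A i) \<mu> :: real)\<^sup>2 \<partial>Q) < \<epsilon>" .
      moreover have "approx (indicator (\<Union>i<n. A i))" unfolding fin using union(3) by (intro approx_sum)
      ultimately show "\<exists>K. approx K \<and> (\<integral>\<mu>. (indicator (\<Union>i. A i) \<mu> - K \<mu>)\<^sup>2 \<partial>Q) < \<epsilon>" by blast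
    qed (auto split: split_indicator)
  qed
qed

end

section \<open>Laplace functionals determine finite laws\<close>

context localized_space begin

text \<open>An indicator is approximated in \<open>L2\<close> of the sum of the two laws, which
  controls both errors with a single approximant; on exponential polynomials the two integrals agree
  by linearity.\<close>

lemma point_law_unique:
  assumes "finite_measure Q1" "finite_measure Q2" and s: "sets Q1 = sets N" "sets Q2 = sets N"
    and eq: "\<And>\<phi>. test \<phi> \<Longrightarrow> (\<And>x. \<phi> x \<le> 0) \<Longrightarrow> (\<integral>\<^sup>+\<mu>. expf \<phi> \<mu> \<partial>Q1) = (\<integral>\<^sup>+\<mu>. expf \<phi> \<mu> \<partial>Q2)"
  shows "Q1 = Q2"
proof -
  interpret Q1: finite_point_law X B Q1
    using assms by (simp add: finite_point_law_def finite_point_law_axioms_def localized_space_axioms)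
  interpret Q2: finite_point_law X B Q2
    using assms by (simp add: finite_point_law_def finite_point_law_axioms_def localized_space_axioms)
  define Q where "Q = superpose Q1 Q2"
  have em: "emeasure Q A = emeasure Q1 A + emeasure Q2 A" if "A \<in> sets N" for A
    unfolding Q_def using that s by (intro emeasure_superpose) auto
  have sQ: "sets Q = sets N" using s by (simp add: Q_def)
  have spQ: "space Q = space N" using sQ sets_eq_imp_space_eq by blast
  have "emeasure Q (space Q) \<noteq> \<infinity>"
    using em[OF sets.top] Q1.emeasure_real[of "space N"] Q2.emeasure_real[of "space N"] unfolding spQ by auto
  then interpret Q: finite_point_law X B Q
    using sQ by (simp add: finite_point_law_def finite_point_law_axioms_def localized_space_axioms finite_measureI)
  have le: "Q1 \<le> Q" "Q2 \<le> Q"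
    using em s sQ by (simp_all add: le_measure)
  have int: "(\<integral>\<mu>. F \<mu> \<partial>Q1) = (\<integral>\<mu>. F \<mu> \<partial>Q2)" if "expoly F" for F
    using that
  proof induction
    case (zero F)
    have "(\<integral>\<mu>. F \<mu> \<partial>Q1) = (\<integral>\<mu>. 0 \<partial>Q1)" by (rule Bochner_Integration.integral_cong) (use zero in simp_all)
    moreover have "(\<integral>\<mu>. F \<mu> \<partial>Q2) = (\<integral>\<mu>. 0 \<partial>Q2)" by (rule Bochner_Integration.integral_cong) (use zero in simp_all)
    ultimately show ?case by simp
  next
    case (step F \<phi> G a)
    note [measurable] = Q1.expoly_measurable_Q[OF step(1)] Q2.expoly_measurable_Q[OF step(1)]
    have [measurable]: "expf \<phi> \<in> borel_measurable Q1" "expf \<phi> \<in> borel_measurable Q2"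
      using measurable_expf[OF _ step(2), of "\<lambda>x. x" N] by (simp_all cong: measurable_cong_sets)
    obtain C where C: "\<forall>\<mu>\<in>space N. \<bar>F \<mu>\<bar> \<le> C" using expoly_bounded[OF step(1)] by blast
    have b: "\<bar>expf \<phi> \<mu>\<bar> \<le> 1" for \<mu> using expf_le_1[OF step(3)] expf_nonneg by simp
    have i: "integrable Q1 F" "integrable Q2 F" "integrable Q1 (expf \<phi>)" "integrable Q2 (expf \<phi>)"
      using C b by (auto intro: Q1.integrable_bounded[where C=C] Q2.integrable_bounded[where C=C]
          Q1.integrable_bounded[where C=1] Q2.integrable_bounded[where C=1])
    have "(\<integral>\<mu>. expf \<phi> \<mu> \<partial>Q1) = (\<integral>\<mu>. expf \<phi> \<mu> \<partial>Q2)"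
      using eq[OF step(2,3)] expf_nonneg by (simp add: integral_eq_nn_integral)
    then have "(\<integral>\<mu>. a * expf \<phi> \<mu> + F \<mu> \<partial>Q1) = (\<integral>\<mu>. a * expf \<phi> \<mu> + F \<mu> \<partial>Q2)"
      using i step.IH by simp
    moreover have "(\<integral>\<mu>. G \<mu> \<partial>Q1) = (\<integral>\<mu>. a * expf \<phi> \<mu> + F \<mu> \<partial>Q1)" "(\<integral>\<mu>. G \<mu> \<partial>Q2) = (\<integral>\<mu>. a * expf \<phi> \<mu> + F \<mu> \<partial>Q2)"
      using step(4) by (auto intro!: Bochner_Integration.integral_cong)
    ultimately show ?case by simp
  qed
  \<comment> \<open>The elementary \<open>\<bar>y\<bar> \<le> t + y\<^sup>2 / t\<close> passes from
    \<open>L2\<close> to \<open>L1\<close> under any finite total mass, and \<open>R \<le> Q\<close>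
    moves the square error to the common measure.\<close>
  have close: "\<bar>measure R A - (\<integral>\<mu>. F \<mu> \<partial>R)\<bar> \<le> t * measure R (space N) + (\<integral>\<mu>. (indicator A \<mu> - F \<mu>)\<^sup>2 \<partial>Q) / t"
    if R: "finite_point_law X B R" "R \<le> Q" and A: "A \<in> sets N" and F: "expoly F" and t: "0 < t" for R A F t
  proof -
    interpret R: finite_point_law X B R by fact
    note [measurable] = R.expoly_measurable_Q[OF F] Q.expoly_measurable_Q[OF F]
    have [measurable]: "A \<in> sets R" "A \<in> sets Q" using A by simp_all
    obtain C where C: "\<forall>\<mu>\<in>space N. \<bar>F \<mu>\<bar> \<le> C" using expoly_bounded[OF F] by blast
    have i: "integrable R F" "integrable R (\<lambda>\<mu>. (indicator A \<mu> - F \<mu>)\<^sup>2)" "integrable Q (\<lambda>\<mu>. (indicator A \<mu> - F \<mu>)\<^sup>2)"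
      using C by (auto intro: R.integrable_bounded[where C=C] R.integrable_diff_square[where C=1 and D=C]
          Q.integrable_diff_square[where C=1 and D=C] split: split_indicator)
    have iA: "integrable R (indicator A :: _ \<Rightarrow> real)" by (intro R.integrable_bounded[where C=1]) (auto split: split_indicator)
    have p: "\<bar>y\<bar> \<le> t + y\<^sup>2 / t" for y :: real
    proof (cases "\<bar>y\<bar> \<le> t")
      case True
      moreover have "0 \<le> y\<^sup>2 / t" using t by simp
      ultimately show ?thesis by linarith
    next
      case False
      then have "\<bar>y\<bar> * t \<le> \<bar>y\<bar> * \<bar>y\<bar>" by (intro mult_left_mono) auto
      then have "\<bar>y\<bar> \<le> y\<^sup>2 / t" using t by (simp add: field_simps power2_eq_square)
      then show ?thesis using t by simp
    qed
    have "measure R A - (\<integral>\<mu>. F \<mu> \<partial>R) = (\<integral>\<mu>. indicator A \<mu> - F \<mu> \<partial>R)" using i iA A sets.sets_into_space[OF A] by (simp add: Int_absorb2)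
    also have "\<bar>\<dots>\<bar> \<le> (\<integral>\<mu>. \<bar>indicator A \<mu> - F \<mu>\<bar> \<partial>R)" by (rule integral_abs_bound)
    also have "\<dots> \<le> (\<integral>\<mu>. t + (indicator A \<mu> - F \<mu>)\<^sup>2 / t \<partial>R)"
      using i iA p by (intro integral_mono) auto
    also have "\<dots> = t * measure R (space N) + (\<integral>\<mu>. (indicator A \<mu> - F \<mu>)\<^sup>2 \<partial>R) / t"
      using i by simp
    also have "(\<integral>\<mu>. (indicator A \<mu> - F \<mu>)\<^sup>2 \<partial>R) \<le> (\<integral>\<mu>. (indicator A \<mu> - F \<mu>)\<^sup>2 \<partial>Q)"
    proof -
      have "(\<integral>\<^sup>+\<mu>. (indicator A \<mu> - F \<mu>)\<^sup>2 \<partial>R) \<le> (\<integral>\<^sup>+\<mu>. (indicator A \<mu> - F \<mu>)\<^sup>2 \<partial>Q)"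
        using R(2) le_measureD3[OF R(2)] by (intro nn_integral_mono_measure) auto
      then show ?thesis using i by (simp add: nn_integral_eq_integral)
    qed
    finally show ?thesis using t by (simp add: divide_right_mono)
  qed
  show ?thesis
  proof (rule measure_eqI)
    fix A assume "A \<in> sets Q1"
    then have A: "A \<in> sets N" using s by simp
    \<comment> \<open>The summand \<open>2\<close> accounts for the two square errors, each at most
      \<open>t\<close> after division by \<open>t\<close>.\<close>
    define q where "q = measure Q1 (space N) + measure Q2 (space N) + 2"
    have q: "0 < q" unfolding q_def by (smt (verit) measure_nonneg)
    have "\<bar>measure Q1 A - measure Q2 A\<bar> \<le> e" if e: "0 < e" for e
    proof -
      define t where "t = e / q"
      have t: "0 < t" using e q by (simp add: t_def)
      obtain F where F: "expoly F" "(\<integral>\<mu>. (indicator A \<mu> - F \<mu>)\<^sup>2 \<partial>Q) < t\<^sup>2"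
        using Q.approx_indicator[OF A] t unfolding Q.approx_def by (metis zero_less_power)
      then have "(\<integral>\<mu>. (indicator A \<mu> - F \<mu>)\<^sup>2 \<partial>Q) / t \<le> t"
        using t by (simp add: field_simps power2_eq_square)
      then have "\<bar>measure Q1 A - measure Q2 A\<bar> \<le> t * q"
        using close[OF Q1.finite_point_law_axioms le(1) A F(1) t] close[OF Q2.finite_point_law_axioms le(2) A F(1) t] int[OF F(1)]
        by (simp add: q_def algebra_simps)
      then show ?thesis using q by (simp add: t_def)
    qed
    then have "measure Q1 A = measure Q2 A" by (metis abs_le_zero_iff diff_eq_diff_eq diff_self dense_ge)
    then show "emeasure Q1 A = emeasure Q2 A" by (simp add: Q1.emeasure_eq_measure Q2.emeasure_eq_measure)
  qed (use s in simp)
qed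

text \<open>Two passes of \<open>point_law_unique\<close>, one coordinate at a time: weight the pair
  law by an exponential of the second coordinate and project to the first, which yields indicators
  there; then weight by such an indicator and project to the second.\<close>

lemma pair_law_unique:
  assumes "finite_measure R1" "finite_measure R2"
    and s: "sets R1 = sets (N \<Otimes>\<^sub>M N)" "sets R2 = sets (N \<Otimes>\<^sub>M N)"
    and eq: "\<And>\<phi> \<psi>. test \<phi> \<Longrightarrow> (\<And>x. \<phi> x \<le> 0) \<Longrightarrow> test \<psi> \<Longrightarrow> (\<And>x. \<psi> x \<le> 0) \<Longrightarrow>
      (\<integral>\<^sup>+p. ennreal (expf \<phi> (fst p)) * ennreal (expf \<psi> (snd p)) \<partial>R1) =
      (\<integral>\<^sup>+p. ennreal (expf \<phi> (fst p)) * ennreal (expf \<psi> (snd p)) \<partial>R2)"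
  shows "R1 = R2"
proof -
  define D where "D R h g = distr (density R h) N g" for R :: "('a measure \<times> 'a measure) measure" and h g
  have D: "finite_measure (D R h g)" "sets (D R h g) = sets N"
    "(\<integral>\<^sup>+\<mu>. k \<mu> \<partial>D R h g) = (\<integral>\<^sup>+p. h p * k (g p) \<partial>R)"
    if R: "finite_measure R" "sets R = sets (N \<Otimes>\<^sub>M N)" and h: "h \<in> borel_measurable (N \<Otimes>\<^sub>M N)" "\<And>p. h p \<le> 1"
      and g: "g \<in> N \<Otimes>\<^sub>M N \<rightarrow>\<^sub>M N" and k: "k \<in> borel_measurable N" for R h g k
  proof -
    interpret finite_measure R by fact
    note [measurable_cong] = R(2) and [measurable] = h(1) g k
    have [measurable]: "g \<in> density R h \<rightarrow>\<^sub>M N" by simp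
    have "(\<integral>\<^sup>+p. h p \<partial>R) \<le> (\<integral>\<^sup>+p. 1 \<partial>R)" using h by (intro nn_integral_mono) auto
    also have "\<dots> < \<infinity>" by (simp add: emeasure_real less_top[symmetric])
    finally have "emeasure (density R h) (space R) \<noteq> \<infinity>"
      by (subst emeasure_density) (auto cong: nn_integral_cong)
    then have "finite_measure (density R h)" by (intro finite_measureI) simp
    then show "finite_measure (D R h g)" unfolding D_def by (rule finite_measure.finite_measure_distr) simp
    show "sets (D R h g) = sets N" by (simp add: D_def)
    show "(\<integral>\<^sup>+\<mu>. k \<mu> \<partial>D R h g) = (\<integral>\<^sup>+p. h p * k (g p) \<partial>R)"
      unfolding D_def by (simp add: nn_integral_distr nn_integral_density)
  qed
  have ms: "(\<lambda>p. ennreal (expf \<psi> (snd p))) \<in> borel_measurable (N \<Otimes>\<^sub>M N)" "(\<lambda>\<mu>. ennreal (expf \<psi> \<mu>)) \<in> borel_measurable N" if "test \<psi>" for \<psi>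
    using that measurable_expf[of snd "N \<Otimes>\<^sub>M N" \<psi>] measurable_expf[of "\<lambda>x. x" N \<psi>] by auto
  have le1: "ennreal (expf \<psi> \<mu>) \<le> 1" if "\<And>x. \<psi> x \<le> 0" for \<psi> \<mu>
    using expf_le_1[OF that] by (simp add: ennreal_le_1)
  have 1: "(\<integral>\<^sup>+p. ennreal (expf \<psi> (snd p)) * indicator A (fst p) \<partial>R1) = (\<integral>\<^sup>+p. ennreal (expf \<psi> (snd p)) * indicator A (fst p) \<partial>R2)"
    if \<psi>: "test \<psi>" "\<And>x. \<psi> x \<le> 0" and A: "A \<in> sets N" for A \<psi>
  proof -
    let ?h = "\<lambda>p. ennreal (expf \<psi> (snd p))"
    have "D R1 ?h fst = D R2 ?h fst"
    proof (rule point_law_unique)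
      fix \<phi> assume \<phi>: "test \<phi>" "\<And>x. \<phi> x \<le> 0"
      show "(\<integral>\<^sup>+\<mu>. expf \<phi> \<mu> \<partial>D R1 ?h fst) = (\<integral>\<^sup>+\<mu>. expf \<phi> \<mu> \<partial>D R2 ?h fst)"
        using eq[OF \<phi> \<psi>]
        by (simp add: D(3)[OF assms(1) s(1) ms(1)[OF \<psi>(1)] le1[OF \<psi>(2)] measurable_fst ms(2)[OF \<phi>(1)]]
            D(3)[OF assms(2) s(2) ms(1)[OF \<psi>(1)] le1[OF \<psi>(2)] measurable_fst ms(2)[OF \<phi>(1)]] mult.commute)
    qed (rule D[OF assms(1) s(1) ms(1)[OF \<psi>(1)] le1[OF \<psi>(2)] measurable_fst borel_measurable_const]
              D[OF assms(2) s(2) ms(1)[OF \<psi>(1)] le1[OF \<psi>(2)] measurable_fst borel_measurable_const])+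
    then have "(\<integral>\<^sup>+\<mu>. indicator A \<mu> \<partial>D R1 ?h fst) = (\<integral>\<^sup>+\<mu>. indicator A \<mu> \<partial>D R2 ?h fst)" by simp
    then show ?thesis
      using A by (simp add: D(3)[OF assms(1) s(1) ms(1)[OF \<psi>(1)] le1[OF \<psi>(2)] measurable_fst]
            D(3)[OF assms(2) s(2) ms(1)[OF \<psi>(1)] le1[OF \<psi>(2)] measurable_fst])
  qed
  have 2: "emeasure R1 (A \<times> C) = emeasure R2 (A \<times> C)" if A: "A \<in> sets N" and C: "C \<in> sets N" for A C
  proof -
    let ?h = "\<lambda>p. indicator A (fst p) :: ennreal"
    have h: "?h \<in> borel_measurable (N \<Otimes>\<^sub>M N)" "?h p \<le> 1" for p using A by (auto split: split_indicator)
    have "D R1 ?h snd = D R2 ?h snd"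
    proof (rule point_law_unique)
      fix \<phi> assume \<phi>: "test \<phi>" "\<And>x. \<phi> x \<le> 0"
      show "(\<integral>\<^sup>+\<mu>. expf \<phi> \<mu> \<partial>D R1 ?h snd) = (\<integral>\<^sup>+\<mu>. expf \<phi> \<mu> \<partial>D R2 ?h snd)"
        using 1[OF \<phi> A] by (simp add: D(3)[OF assms(1) s(1) h measurable_snd ms(2)[OF \<phi>(1)]]
            D(3)[OF assms(2) s(2) h measurable_snd ms(2)[OF \<phi>(1)]] mult.commute)
    qed (rule D[OF assms(1) s(1) h measurable_snd borel_measurable_const]
              D[OF assms(2) s(2) h measurable_snd borel_measurable_const])+
    then have "(\<integral>\<^sup>+\<mu>. indicator C \<mu> \<partial>D R1 ?h snd) = (\<integral>\<^sup>+\<mu>. indicator C \<mu> \<partial>D R2 ?h snd)" by simp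
    then have "(\<integral>\<^sup>+p. indicator A (fst p) * indicator C (snd p) \<partial>R1) = (\<integral>\<^sup>+p. indicator A (fst p) * indicator C (snd p) \<partial>R2)"
      using C by (simp add: D(3)[OF assms(1) s(1) h measurable_snd] D(3)[OF assms(2) s(2) h measurable_snd])
    moreover have "(\<lambda>p. indicator A (fst p) * indicator C (snd p)) = (indicator (A \<times> C) :: _ \<Rightarrow> ennreal)"
      by (auto split: split_indicator)
    moreover have "A \<times> C \<in> sets R1" "A \<times> C \<in> sets R2" using A C s by auto
    ultimately show ?thesis by simp
  qed
  show ?thesis
  proof (rule measure_eqI_generator_eq[OF Int_stable_pair_measure_generator pair_measure_closed, where A="\<lambda>_. space N \<times> space N"])
    show "emeasure R1 X = emeasure R2 X" if "X \<in> {a \<times> b |a b. a \<in> sets N \<and> b \<in> sets N}" for X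
      using that 2 by auto
    show "sets R1 = sigma_sets (space N \<times> space N) {a \<times> b |a b. a \<in> sets N \<and> b \<in> sets N}"
      "sets R2 = sigma_sets (space N \<times> space N) {a \<times> b |a b. a \<in> sets N \<and> b \<in> sets N}"
      using s by (simp_all add: sets_pair_measure)
    show "emeasure R1 (space N \<times> space N) \<noteq> \<infinity>"
      using finite_measure.emeasure_finite[OF assms(1)] by simp
  qed auto
qed

end

section \<open>Poisson laws\<close>

locale intensity_space = localized_space X B for X :: "'a measure" and B +
  fixes L :: "'a measure"
  assumes locally_finite_L: "locally_finite X B L"
begin

lemma sets_L [simp, measurable_cong]: "sets L = sets X"
  using locally_finite_sets[OF locally_finite_L] .

lemma space_L [simp]: "space L = space X"
  using locally_finite_space[OF locally_finite_L] .

lemma emeasure_L_eq: "A \<in> sets X \<Longrightarrow> A \<subseteq> B n \<Longrightarrow> emeasure L A = ennreal (measure L A)"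
  using emeasure_bounded_finite[OF locally_finite_L, of A n] by (intro emeasure_eq_ennreal_measure) auto

sublocale L: sigma_finite_measure L
proof
  show "\<exists>A. countable A \<and> A \<subseteq> sets L \<and> \<Union> A = space L \<and> (\<forall>a\<in>A. emeasure L a \<noteq> \<infinity>)"
    using UN_B emeasure_bounded_finite[OF locally_finite_L sets_B order_refl]
    by (intro exI[of _ "range B"]) (auto simp: less_top)
qed

lemma integrable_exp_test:
  assumes "test \<phi>" shows "integrable L (\<lambda>x. exp (\<phi> x) - 1)"
  using integral_test_compose(1)[OF locally_finite_L assms, of "\<lambda>v. exp v - 1"] by simp

definition plaw :: "real \<Rightarrow> 'a measure measure \<Rightarrow> bool" where
  "plaw \<kappa> Q \<longleftrightarrow> prob_space Q \<and> sets Q = sets N \<and>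
     (\<forall>\<phi>. test \<phi> \<longrightarrow> (\<integral>\<^sup>+\<mu>. expf \<phi> \<mu> \<partial>Q) = ennreal (exp (\<kappa> * (\<integral>x. exp (\<phi> x) - 1 \<partial>L))))"

lemma plaw_unique:
  assumes "plaw \<kappa> P" "plaw \<kappa> Q"
  shows "P = Q"
  using assms prob_space.finite_measure
  by (intro point_law_unique) (auto simp: plaw_def)

lemma nn_integral_exp_poisson:
  assumes "prob_space M" and [measurable]: "K \<in> borel_measurable M" and m: "0 \<le> m"
    and K: "\<And>\<omega>. \<omega> \<in> space M \<Longrightarrow> K \<omega> \<in> range (of_nat :: nat \<Rightarrow> ennreal)"
    and pd: "poisson_distributed M (ennreal m) K"
  shows "(\<integral>\<^sup>+\<omega>. exp (v * enn2real (K \<omega>)) \<partial>M) = ennreal (exp (m * (exp v - 1)))"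
proof -
  interpret prob_space M by fact
  define k where "k \<omega> = nat \<lfloor>enn2real (K \<omega>)\<rfloor>" for \<omega>
  have [measurable]: "k \<in> M \<rightarrow>\<^sub>M count_space UNIV" unfolding k_def by measurable
  have kK: "K \<omega> = of_nat (k \<omega>)" if "\<omega> \<in> space M" for \<omega>
    using K[OF that] by (auto simp: k_def ennreal_of_nat_eq_real_of_nat)
  have prob: "emeasure M {\<omega> \<in> space M. k \<omega> = n} = ennreal (m ^ n / fact n * exp (- m))" for n
  proof -
    have "{\<omega> \<in> space M. k \<omega> = n} = {\<omega> \<in> space M. K \<omega> = of_nat n}"
      using kK by auto
    then show ?thesis using pd m by (simp add: poisson_distributed_def emeasure_eq_measure)
  qed
  have sums: "(\<lambda>n. exp (v * real n) * (m ^ n / fact n * exp (- m))) sums exp (m * (exp v - 1))"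
  proof -
    have "(\<lambda>n. exp (- m) * ((m * exp v) ^ n /\<^sub>R fact n)) sums (exp (- m) * exp (m * exp v))"
      by (intro sums_mult exp_converges)
    then show ?thesis
      by (simp add: power_mult_distrib exp_of_nat2_mult[symmetric] field_simps exp_add[symmetric] exp_minus exp_diff mult_ac)
  qed
  have "(\<integral>\<^sup>+\<omega>. exp (v * enn2real (K \<omega>)) \<partial>M) =
      (\<integral>\<^sup>+\<omega>. (\<Sum>n. ennreal (exp (v * real n)) * indicator {\<omega> \<in> space M. k \<omega> = n} \<omega>) \<partial>M)"
  proof (rule nn_integral_cong)
    fix \<omega> assume w: "\<omega> \<in> space M"
    have "(\<Sum>n. ennreal (exp (v * real n)) * indicator {\<omega> \<in> space M. k \<omega> = n} \<omega>) =
        (\<Sum>n\<in>{k \<omega>}. ennreal (exp (v * real n)) * indicator {\<omega> \<in> space M. k \<omega> = n} \<omega>)"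
      by (rule suminf_finite) auto
    then show "ennreal (exp (v * enn2real (K \<omega>))) = (\<Sum>n. ennreal (exp (v * real n)) * indicator {\<omega> \<in> space M. k \<omega> = n} \<omega>)"
      using w by (simp add: kK ennreal_of_nat_eq_real_of_nat)
  qed
  also have "\<dots> = (\<Sum>n. ennreal (exp (v * real n)) * emeasure M {\<omega> \<in> space M. k \<omega> = n})"
    by (subst nn_integral_suminf) (auto simp: nn_integral_cmult_indicator)
  also have "\<dots> = (\<Sum>n. ennreal (exp (v * real n) * (m ^ n / fact n * exp (- m))))"
    unfolding prob by (intro suminf_cong ennreal_mult[symmetric]) (auto simp: m)
  also have "\<dots> = ennreal (exp (m * (exp v - 1)))"
    using sums m by (intro suminf_ennreal_eq) auto
  finally show ?thesis .
qed

text \<open>The level sets of \<open>\<phi>\<close> for nonzero values are disjoint and bounded, so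
  their counts are independent Poisson variables of finite mean and the exponential factorizes over
  them.\<close>

lemma poisson_process_plaw:
  assumes pp: "poisson_process M X B \<nu> \<eta>" and \<nu>: "\<nu> = scale_measure (ennreal \<kappa>) L" and \<kappa>: "0 \<le> \<kappa>"
  shows "plaw \<kappa> (distr M N \<eta>)"
proof -
  interpret M: prob_space M using pp by (simp add: poisson_process_def)
  have \<eta>[measurable]: "\<eta> \<in> M \<rightarrow>\<^sub>M N" using pp by (simp add: poisson_process_def)
  have "(\<integral>\<^sup>+\<mu>. expf \<phi> \<mu> \<partial>distr M N \<eta>) = ennreal (exp (\<kappa> * (\<integral>x. exp (\<phi> x) - 1 \<partial>L)))" if \<phi>: "test \<phi>" for \<phi>
  proof -
    define V where "V = \<phi> ` space X - {0}"
    have "finite V" using \<phi> by (auto simp: V_def test_def dest: simple_functionD)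
    then obtain h :: "nat \<Rightarrow> real" where h: "bij_betw h {..<card V} V"
      by (metis lessThan_atLeast0 ex_bij_betw_nat_finite)
    define A where "A i = {x \<in> space X. \<phi> x = h i}" for i
    have hV: "h i \<noteq> 0" if "i < card V" for i
      using h that by (auto simp: bij_betw_def V_def)
    have A: "A i \<in> sets X" "\<exists>n. A i \<subseteq> B n" if "i < card V" for i
      unfolding A_def using test_vimage[OF \<phi> hV[OF that]] by auto
    have "disjoint_family_on A {..<card V}"
      using h by (auto simp: disjoint_family_on_def A_def bij_betw_def inj_on_def)
    then have ind: "M.indep_vars (\<lambda>_. borel) (\<lambda>i \<omega>. emeasure (\<eta> \<omega>) (A i)) {..<card V}"
      using pp A(1) unfolding poisson_process_def by blast
    have \<eta>N: "\<eta> \<omega> \<in> space N" if "\<omega> \<in> space M" for \<omega> using measurable_space[OF \<eta> that] .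
    define g where "g i y = ennreal (exp (h i * enn2real y))" for i y
    have [measurable]: "g i \<in> borel_measurable borel" for i unfolding g_def by measurable
    have one: "(\<integral>\<^sup>+\<omega>. g i (emeasure (\<eta> \<omega>) (A i)) \<partial>M) = ennreal (exp (\<kappa> * ((exp (h i) - 1) * measure L (A i))))"
      if i: "i < card V" for i
    proof -
      obtain n where n: "A i \<subseteq> B n" using A(2)[OF i] by auto
      have em: "emeasure \<nu> (A i) = ennreal (\<kappa> * measure L (A i))"
        using emeasure_L_eq[OF A(1)[OF i] n] \<kappa> by (simp add: \<nu> ennreal_mult)
      have "(\<integral>\<^sup>+\<omega>. exp (h i * enn2real (emeasure (\<eta> \<omega>) (A i))) \<partial>M) = ennreal (exp (\<kappa> * measure L (A i) * (exp (h i) - 1)))"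
      proof (rule nn_integral_exp_poisson)
        show "poisson_distributed M (ennreal (\<kappa> * measure L (A i))) (\<lambda>\<omega>. emeasure (\<eta> \<omega>) (A i))"
          using pp A(1)[OF i] unfolding poisson_process_def em[symmetric] by blast
        show "emeasure (\<eta> \<omega>) (A i) \<in> range (of_nat :: nat \<Rightarrow> ennreal)" if "\<omega> \<in> space M" for \<omega>
          using N_natE[OF \<eta>N[OF that] A(1)[OF i] n] by auto
      qed (use A(1)[OF i] \<kappa> M.prob_space_axioms in auto)
      then show ?thesis by (simp add: g_def mult_ac)
    qed
    have "(\<integral>\<^sup>+\<mu>. expf \<phi> \<mu> \<partial>distr M N \<eta>) = (\<integral>\<^sup>+\<omega>. expf \<phi> (\<eta> \<omega>) \<partial>M)"
      using measurable_expf[of "\<lambda>x. x" N \<phi>] \<phi> by (subst nn_integral_distr) auto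
    also have "\<dots> = (\<integral>\<^sup>+\<omega>. (\<Prod>i<card V. g i (emeasure (\<eta> \<omega>) (A i))) \<partial>M)"
    proof (rule nn_integral_cong)
      fix \<omega> assume w: "\<omega> \<in> space M"
      have "(\<integral>x. \<phi> x \<partial>\<eta> \<omega>) = (\<Sum>v\<in>V. v * measure (\<eta> \<omega>) {x \<in> space X. \<phi> x = v})"
        unfolding V_def by (rule integral_test[OF N_locally_finite[OF \<eta>N[OF w]] \<phi>])
      also have "\<dots> = (\<Sum>i<card V. h i * measure (\<eta> \<omega>) (A i))"
        unfolding A_def by (rule sum.reindex_bij_betw[OF h, symmetric])
      finally show "ennreal (expf \<phi> (\<eta> \<omega>)) = (\<Prod>i<card V. g i (emeasure (\<eta> \<omega>) (A i)))"
        by (simp add: expf_def exp_sum g_def prod_ennreal measure_def)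
    qed
    also have "\<dots> = (\<Prod>i<card V. \<integral>\<^sup>+\<omega>. g i (emeasure (\<eta> \<omega>) (A i)) \<partial>M)"
      using M.indep_vars_compose2[OF ind, of g "\<lambda>_. borel"] by (intro M.indep_vars_nn_integral) auto
    also have "\<dots> = (\<Prod>i<card V. ennreal (exp (\<kappa> * ((exp (h i) - 1) * measure L (A i)))))"
      by (rule prod.cong) (simp_all add: one)
    also have "\<dots> = ennreal (exp (\<kappa> * (\<Sum>i<card V. (exp (h i) - 1) * measure L (A i))))"
      by (simp add: prod_ennreal exp_sum sum_distrib_left)
    also have "(\<Sum>i<card V. (exp (h i) - 1) * measure L (A i)) = (\<Sum>v\<in>V. (exp v - 1) * measure L {x \<in> space X. \<phi> x = v})"
      unfolding A_def by (rule sum.reindex_bij_betw[OF h])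
    also have "\<dots> = (\<integral>x. exp (\<phi> x) - 1 \<partial>L)"
      using integral_test_compose(2)[OF locally_finite_L \<phi>, of "\<lambda>v. exp v - 1"] by (simp add: V_def)
    finally show ?thesis .
  qed
  then show ?thesis by (simp add: plaw_def M.prob_space_distr)
qed

end

context localized_space begin

section \<open>The strong Markov property of stopping sets\<close>

lemma emeasure_dirac_sum:
  assumes "finite I" "\<And>i. i \<in> I \<Longrightarrow> x i \<in> space X" "A \<in> sets X"
  shows "emeasure (dirac_sum X I x) A = of_nat (card {i \<in> I. x i \<in> A})"
proof -
  have "x -` A \<inter> I = {i \<in> I. x i \<in> A}" by auto
  then show ?thesis
    using assms unfolding dirac_sum_def
    by (subst emeasure_distr) (auto simp: emeasure_count_space)
qed

lemma sets_dirac_sum [simp]: "sets (dirac_sum X I x) = sets X"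
  by (simp add: dirac_sum_def)

lemma dirac_sum_in_N:
  assumes "finite I" "\<And>i. i \<in> I \<Longrightarrow> x i \<in> space X"
  shows "dirac_sum X I x \<in> space N"
  using emeasure_dirac_sum[OF assms] by (intro N_I) auto

lemma expf_dirac_sum:
  assumes "finite I" "\<And>i. i \<in> I \<Longrightarrow> x i \<in> space X" "test \<phi>"
  shows "expf \<phi> (dirac_sum X I x) = (\<Prod>i\<in>I. exp (\<phi> (x i)))"
  using assms test_measurable[OF assms(3)]
  by (simp add: expf_def dirac_sum_def integral_distr lebesgue_integral_count_space_finite exp_sum)

lemma measurable_dirac_sum:
  assumes "finite I" "\<And>i. i \<in> I \<Longrightarrow> x i \<in> \<Omega> \<rightarrow>\<^sub>M X"
  shows "(\<lambda>\<omega>. dirac_sum X I (\<lambda>i. x i \<omega>)) \<in> \<Omega> \<rightarrow>\<^sub>M N"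
proof (rule measurable_N)
  have sp: "x i \<omega> \<in> space X" if "i \<in> I" "\<omega> \<in> space \<Omega>" for i \<omega>
    using measurable_space[OF assms(2)] that by auto
  show "dirac_sum X I (\<lambda>i. x i \<omega>) \<in> space N" if "\<omega> \<in> space \<Omega>" for \<omega>
    using sp that by (intro dirac_sum_in_N assms(1)) auto
  fix A assume A: "A \<in> sets X"
  have "(\<lambda>\<omega>. \<Sum>i\<in>I. indicator A (x i \<omega>) :: ennreal) \<in> borel_measurable \<Omega>"
    using assms(2) A by (intro borel_measurable_sum) (auto intro: measurable_compose)
  moreover have "emeasure (dirac_sum X I (\<lambda>i. x i \<omega>)) A = (\<Sum>i\<in>I. indicator A (x i \<omega>))" if "\<omega> \<in> space \<Omega>" for \<omega>
  proof -
    have "emeasure (dirac_sum X I (\<lambda>i. x i \<omega>)) A = of_nat (card {i \<in> I. x i \<omega> \<in> A})"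
      using sp that A assms(1) by (intro emeasure_dirac_sum) auto
    also have "\<dots> = (\<Sum>i\<in>I. indicator A (x i \<omega>))"
      using assms(1) by (simp add: indicator_def sum.If_cases Int_def flip: of_bool_def)
    finally show ?thesis .
  qed
  ultimately show "(\<lambda>\<omega>. emeasure (dirac_sum X I (\<lambda>i. x i \<omega>)) A) \<in> borel_measurable \<Omega>"
    by (simp cong: measurable_cong)
qed

text \<open>Redraws the unseen part of \<open>\<mu>\<close> from \<open>\<psi>\<close>. The full
  choice \<open>W = space X\<close> is the one of interest; a bounded \<open>W\<close> leaves only
  finitely many points to be redrawn, which makes a counting argument possible.\<close>

definition glue :: "'a set \<Rightarrow> ('a measure \<Rightarrow> 'a set) \<Rightarrow> 'a measure \<Rightarrow> 'a measure \<Rightarrow> 'a measure" where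
  "glue W Z \<mu> \<psi> = superpose (restr \<mu> (Z \<mu> \<union> (space X - W))) (restr \<psi> (W - Z \<mu>))"

lemma stopping_set_sets: "stopping_set X B Z \<Longrightarrow> \<mu> \<in> space N \<Longrightarrow> Z \<mu> \<in> sets X"
  by (auto simp: stopping_set_def)

lemma stopping_set_pred:
  assumes "stopping_set X B Z"
  shows "Measurable.pred (N \<Otimes>\<^sub>M X) (\<lambda>(\<mu>, x). x \<in> Z \<mu>)"
proof -
  have "(\<lambda>(x, \<mu>). x \<in> Z \<mu>) \<in> X \<Otimes>\<^sub>M N \<rightarrow>\<^sub>M count_space UNIV"
    using assms by (simp add: stopping_set_def)
  from measurable_compose[OF measurable_pair_swap' this] show ?thesis
    by (simp add: case_prod_beta')
qed

lemma glue_in_N: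
  assumes "stopping_set X B Z" "W \<in> sets X" "\<mu> \<in> space N" "\<psi> \<in> space N"
  shows "glue W Z \<mu> \<psi> \<in> space N"
  unfolding glue_def using assms stopping_set_sets by (intro superpose_in_N restr_in_N) auto

lemma emeasure_glue:
  assumes "stopping_set X B Z" "W \<in> sets X" "\<mu> \<in> space N" "\<psi> \<in> space N" "A \<in> sets X"
  shows "emeasure (glue W Z \<mu> \<psi>) A =
    emeasure \<mu> (A \<inter> (Z \<mu> \<union> (space X - W))) + emeasure \<psi> (A \<inter> (W - Z \<mu>))"
  unfolding glue_def using assms stopping_set_sets[OF assms(1)] N_sets
  by (subst emeasure_superpose) (auto simp: emeasure_restr)

lemma measurable_glue:
  assumes Z: "stopping_set X B Z" and W [measurable]: "W \<in> sets X"
  shows "(\<lambda>(\<mu>, \<psi>). glue W Z \<mu> \<psi>) \<in> N \<Otimes>\<^sub>M N \<rightarrow>\<^sub>M N"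
proof -
  note p = stopping_set_pred[OF Z]
  have [measurable]: "Measurable.pred ((N \<Otimes>\<^sub>M N) \<Otimes>\<^sub>M X) (\<lambda>(p, x). x \<in> Z (fst p))"
    using measurable_compose[OF _ p, of "\<lambda>(p, x). (fst p, x)" "(N \<Otimes>\<^sub>M N) \<Otimes>\<^sub>M X"]
    by (simp add: case_prod_beta')
  have "(\<lambda>p. restr (fst p) (Z (fst p) \<union> (space X - W))) \<in> N \<Otimes>\<^sub>M N \<rightarrow>\<^sub>M N"
    by (rule measurable_restr_N) (use stopping_set_sets[OF Z] in \<open>auto simp: space_pair_measure\<close>)
  moreover have "(\<lambda>p. restr (snd p) (W - Z (fst p))) \<in> N \<Otimes>\<^sub>M N \<rightarrow>\<^sub>M N"
    by (rule measurable_restr_N) (use stopping_set_sets[OF Z] in \<open>auto simp: space_pair_measure\<close>)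
  ultimately show ?thesis
    unfolding glue_def case_prod_beta by (rule measurable_superpose_N)
qed

text \<open>The glued configuration agrees with \<open>\<mu>\<close> on \<open>Z \<mu>\<close>, so
  completing the revealed part of \<open>\<mu>\<close> by the glued configuration itself gives the
  glued configuration back; the defining identity of a stopping set then applies.\<close>

lemma stopping_set_glue:
  assumes Z: "stopping_set X B Z" and W: "W \<in> sets X" and m: "\<mu> \<in> space N" "\<psi> \<in> space N"
  shows "Z (glue W Z \<mu> \<psi>) = Z \<mu>"
proof -
  have Zs: "Z \<mu> \<in> sets X" using stopping_set_sets[OF Z m(1)] .
  have "superpose (restr \<mu> (Z \<mu>)) (restr (glue W Z \<mu> \<psi>) (space X - Z \<mu>)) = glue W Z \<mu> \<psi>"
  proof (rule measure_eqI)
    fix A assume "A \<in> sets (superpose (restr \<mu> (Z \<mu>)) (restr (glue W Z \<mu> \<psi>) (space X - Z \<mu>)))"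
    then have A: "A \<in> sets X" using N_sets[OF m(1)] by simp
    have g: "sets (glue W Z \<mu> \<psi>) = sets X" using N_sets[OF glue_in_N[OF Z W m]] .
    have "emeasure (superpose (restr \<mu> (Z \<mu>)) (restr (glue W Z \<mu> \<psi>) (space X - Z \<mu>))) A =
        emeasure \<mu> (A \<inter> Z \<mu>) + emeasure (glue W Z \<mu> \<psi>) (A \<inter> (space X - Z \<mu>))"
      using A Zs g N_sets[OF m(1)] by (subst emeasure_superpose) (auto simp: emeasure_restr)
    also have "emeasure (glue W Z \<mu> \<psi>) (A \<inter> (space X - Z \<mu>)) =
        emeasure \<mu> (A \<inter> (space X - Z \<mu>) \<inter> (Z \<mu> \<union> (space X - W))) + emeasure \<psi> (A \<inter> (space X - Z \<mu>) \<inter> (W - Z \<mu>))"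
      using A Zs by (intro emeasure_glue Z W m) auto
    also have "A \<inter> (space X - Z \<mu>) \<inter> (W - Z \<mu>) = A \<inter> (W - Z \<mu>)"
      using sets.sets_into_space[OF A] by auto
    also have "emeasure \<mu> (A \<inter> Z \<mu>) + (emeasure \<mu> (A \<inter> (space X - Z \<mu>) \<inter> (Z \<mu> \<union> (space X - W))) + emeasure \<psi> (A \<inter> (W - Z \<mu>))) =
       (emeasure \<mu> (A \<inter> Z \<mu>) + emeasure \<mu> (A \<inter> (space X - Z \<mu>) \<inter> (Z \<mu> \<union> (space X - W)))) + emeasure \<psi> (A \<inter> (W - Z \<mu>))"
      by (simp add: add.assoc)
    also have "emeasure \<mu> (A \<inter> Z \<mu>) + emeasure \<mu> (A \<inter> (space X - Z \<mu>) \<inter> (Z \<mu> \<union> (space X - W))) = emeasure \<mu> (A \<inter> (Z \<mu> \<union> (space X - W)))"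
      using A Zs W N_sets[OF m(1)] sets.sets_into_space[OF A]
      by (subst plus_emeasure) (auto intro!: arg_cong[where f="emeasure \<mu>"])
    finally show "emeasure (superpose (restr \<mu> (Z \<mu>)) (restr (glue W Z \<mu> \<psi>) (space X - Z \<mu>))) A = emeasure (glue W Z \<mu> \<psi>) A"
      using emeasure_glue[OF Z W m A] by simp
  qed (use N_sets[OF m(1)] N_sets[OF glue_in_N[OF Z W m]] in simp)
  then show ?thesis
    using Z m(1) glue_in_N[OF Z W m] unfolding stopping_set_def by metis
qed

text \<open>Inside the window \<open>W\<close>, a point configuration with labels \<open>I\<close> is split into two; gluing along a
  stopping set only flips the labels of the points outside of it, and this flip is an involution.\<close>

definition labelled :: "'a set \<Rightarrow> nat set \<Rightarrow> (nat \<Rightarrow> 'a) \<Rightarrow> 'a measure \<Rightarrow> 'a measure" where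
  "labelled W I x a = superpose (restr a (space X - W)) (dirac_sum X I x)"

lemma labelled_in_N:
  assumes "W \<in> sets X" "finite I" "\<And>i. i \<in> I \<Longrightarrow> x i \<in> space X" "a \<in> space N"
  shows "labelled W I x a \<in> space N"
  unfolding labelled_def using assms by (intro superpose_in_N restr_in_N dirac_sum_in_N) auto

lemma emeasure_labelled:
  assumes "W \<in> sets X" "finite I" "\<And>i. i \<in> I \<Longrightarrow> x i \<in> space X" "a \<in> space N" "A \<in> sets X"
  shows "emeasure (labelled W I x a) A = emeasure a (A - W) + of_nat (card {i \<in> I. x i \<in> A})"
proof -
  have "A \<inter> (space X - W) = A - W" using sets.sets_into_space[OF assms(5)] by auto
  then show ?thesis unfolding labelled_def using assms N_sets[OF assms(4)]
    by (subst emeasure_superpose) (auto simp: emeasure_restr emeasure_dirac_sum)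
qed

lemma sum_glue_labelled:
  fixes H :: "'a measure \<Rightarrow> ennreal"
  assumes Z: "stopping_set X B Z" and W: "W \<in> sets X" and x: "\<And>i. i < k \<Longrightarrow> x i \<in> W"
    and ab: "a \<in> space N" "b \<in> space N"
  shows "(\<Sum>I\<in>Pow {..<k}. H (glue W Z (labelled W I x a) (labelled W ({..<k} - I) x b))) =
    (\<Sum>I\<in>Pow {..<k}. H (labelled W I x a))"
proof -
  have xs: "x i \<in> space X" if "i < k" for i using x[OF that] sets.sets_into_space[OF W] by auto
  \<comment> \<open>Points seen by \<open>Z\<close> keep their label and hidden points switch it.
    Outside \<open>W\<close> nothing is redrawn, which is why \<open>a\<close> survives and
    \<open>b\<close> disappears.\<close>
  define flip where "flip I = {i. i < k \<and> (i \<in> I \<longleftrightarrow> x i \<in> Z (labelled W I x a))}" for I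
  have lN: "labelled W I x a \<in> space N" "labelled W ({..<k} - I) x b \<in> space N" if "I \<subseteq> {..<k}" for I
    using that xs W ab finite_subset[OF that] by (auto intro!: labelled_in_N)
  have eq: "glue W Z (labelled W I x a) (labelled W ({..<k} - I) x b) = labelled W (flip I) x a"
    if I: "I \<subseteq> {..<k}" for I
  proof (rule measure_eqI)
    let ?m = "labelled W I x a" and ?p = "labelled W ({..<k} - I) x b"
    have fin: "finite I" "finite (flip I)" using I by (auto intro: finite_subset simp: flip_def)
    have Zs: "Z ?m \<in> sets X" using stopping_set_sets[OF Z lN(1)[OF I]] .
    fix A assume "A \<in> sets (glue W Z ?m ?p)"
    then have A: "A \<in> sets X" using N_sets[OF glue_in_N[OF Z W lN[OF I]]] by simp
    have A1: "A \<inter> (Z ?m \<union> (space X - W)) - W = A - W" "A \<inter> (W - Z ?m) - W = {}"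
      using sets.sets_into_space[OF A] by auto
    have "emeasure (glue W Z ?m ?p) A = emeasure ?m (A \<inter> (Z ?m \<union> (space X - W))) + emeasure ?p (A \<inter> (W - Z ?m))"
      by (rule emeasure_glue[OF Z W lN[OF I] A])
    also have "emeasure ?m (A \<inter> (Z ?m \<union> (space X - W))) = emeasure a (A - W) + of_nat (card {i \<in> I. x i \<in> A \<inter> (Z ?m \<union> (space X - W))})"
      using A Zs W I xs fin ab by (subst emeasure_labelled) (auto simp: A1)
    also have "emeasure ?p (A \<inter> (W - Z ?m)) = of_nat (card {i \<in> {..<k} - I. x i \<in> A \<inter> (W - Z ?m)})"
      using A Zs W I xs fin ab by (subst emeasure_labelled) (auto simp: A1)
    also have "emeasure a (A - W) + of_nat (card {i \<in> I. x i \<in> A \<inter> (Z ?m \<union> (space X - W))}) + of_nat (card {i \<in> {..<k} - I. x i \<in> A \<inter> (W - Z ?m)}) =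
        emeasure a (A - W) + of_nat (card {i \<in> I. x i \<in> A \<inter> (Z ?m \<union> (space X - W))} + card {i \<in> {..<k} - I. x i \<in> A \<inter> (W - Z ?m)})"
      by (simp add: add.assoc)
    also have "card {i \<in> I. x i \<in> A \<inter> (Z ?m \<union> (space X - W))} + card {i \<in> {..<k} - I. x i \<in> A \<inter> (W - Z ?m)} =
        card ({i \<in> I. x i \<in> A \<inter> (Z ?m \<union> (space X - W))} \<union> {i \<in> {..<k} - I. x i \<in> A \<inter> (W - Z ?m)})"
      using fin by (subst card_Un_disjoint) auto
    also have "{i \<in> I. x i \<in> A \<inter> (Z ?m \<union> (space X - W))} \<union> {i \<in> {..<k} - I. x i \<in> A \<inter> (W - Z ?m)} = {i \<in> flip I. x i \<in> A}"
      using I x by (auto simp: flip_def)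
    also have "emeasure a (A - W) + of_nat (card {i \<in> flip I. x i \<in> A}) = emeasure (labelled W (flip I) x a) A"
      using A W xs fin ab by (subst emeasure_labelled) (auto simp: flip_def)
    finally show "emeasure (glue W Z ?m ?p) A = emeasure (labelled W (flip I) x a) A" .
  qed (use N_sets[OF glue_in_N[OF Z W lN[OF I]]] N_sets[OF ab(1)] in \<open>simp add: labelled_def\<close>)
  have flip_sub: "flip I \<subseteq> {..<k}" for I by (auto simp: flip_def)
  \<comment> \<open>Gluing does not change what \<open>Z\<close> sees, so the second flip acts on
    the same hidden points as the first.\<close>
  have flip_flip: "flip (flip I) = I" if I: "I \<subseteq> {..<k}" for I
  proof -
    have "Z (labelled W (flip I) x a) = Z (labelled W I x a)"
      using stopping_set_glue[OF Z W lN[OF I]] eq[OF I] by simp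
    then show ?thesis using I unfolding flip_def by auto
  qed
  have "bij_betw flip (Pow {..<k}) (Pow {..<k})"
    by (rule bij_betw_byWitness[where f'=flip]) (use flip_sub flip_flip in auto)
  then have "(\<Sum>I\<in>Pow {..<k}. H (labelled W (flip I) x a)) = (\<Sum>I\<in>Pow {..<k}. H (labelled W I x a))"
    by (rule sum.reindex_bij_betw)
  then show ?thesis by (simp add: eq)
qed

end

section \<open>Invariance of Poisson laws under gluing\<close>

context intensity_space begin

lemma plaw_prob: "plaw \<kappa> P \<Longrightarrow> prob_space P" and plaw_sets: "plaw \<kappa> P \<Longrightarrow> sets P = sets N"
  and plaw_expf: "plaw \<kappa> P \<Longrightarrow> test \<phi> \<Longrightarrow> (\<integral>\<^sup>+\<mu>. expf \<phi> \<mu> \<partial>P) = ennreal (exp (\<kappa> * (\<integral>x. exp (\<phi> x) - 1 \<partial>L)))"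
  by (auto simp: plaw_def)

lemma nn_integral_poisson_pmf_power:
  assumes "0 < r" "0 \<le> t"
  shows "(\<integral>\<^sup>+k. ennreal (t ^ k) \<partial>poisson_pmf r) = ennreal (exp (r * (t - 1)))"
proof -
  have "(\<lambda>k. exp (- r) * ((r * t) ^ k /\<^sub>R fact k)) sums (exp (- r) * exp (r * t))"
    by (intro sums_mult exp_converges)
  moreover have "exp (- r) * ((r * t) ^ k /\<^sub>R fact k) = pmf (poisson_pmf r) k * t ^ k" for k
    using assms by (simp add: power_mult_distrib field_simps)
  moreover have "exp (- r) * exp (r * t) = exp (r * (t - 1))"
    by (simp add: exp_add[symmetric] algebra_simps)
  ultimately have s: "(\<lambda>k. pmf (poisson_pmf r) k * t ^ k) sums exp (r * (t - 1))" by simp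
  have "(\<integral>\<^sup>+k. ennreal (t ^ k) \<partial>poisson_pmf r) = (\<Sum>k. ennreal (pmf (poisson_pmf r) k) * ennreal (t ^ k))"
    by (simp only: nn_integral_measure_pmf nn_integral_count_space_nat)
  also have "\<dots> = (\<Sum>k. ennreal (pmf (poisson_pmf r) k * t ^ k))"
    using assms by (intro suminf_cong ennreal_mult[symmetric]) auto
  also have "\<dots> = ennreal (exp (r * (t - 1)))"
    using assms by (intro suminf_ennreal_eq s) auto
  finally show ?thesis .
qed

text \<open>Inside the window a pair of independent copies is a Poisson number of independent
  uniform points with fair coin labels. For fixed positions, gluing only permutes the label sets, so
  averaging over the labels cannot tell the glued configuration from the first copy.\<close>

lemma window_swap_pos:
  assumes Z: "stopping_set X B Z" and P: "plaw \<kappa> P" and \<kappa>: "0 < \<kappa>" and pos: "0 < measure L (B n)"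
  shows "distr (P \<Otimes>\<^sub>M P) N (\<lambda>(\<mu>, \<psi>). glue (B n) Z \<mu> \<psi>) = P"
proof -
  interpret P: prob_space P using plaw_prob[OF P] .
  have sP[measurable_cong, simp]: "sets P = sets N" using plaw_sets[OF P] .
  have spP[simp]: "space P = space N" using sP sets_eq_imp_space_eq by blast
  interpret PP: pair_prob_space P P ..
  define W where "W = B n"
  have W[measurable]: "W \<in> sets X" by (simp add: W_def)
  define mL where "mL = measure L W"
  have mL: "0 < mL" using pos by (simp add: mL_def W_def)
  have emL: "emeasure L W = ennreal mL" using emeasure_L_eq[of W n] by (simp add: W_def mL_def)
  \<comment> \<open>The law of a single point: the intensity on the window, normalized. This is
    where positive mass is required.\<close>
  define q where "q = density L (\<lambda>x. ennreal (indicator W x / mL))"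
  have sq[measurable_cong, simp]: "sets q = sets X" by (simp add: q_def)
  have spq[simp]: "space q = space X" by (simp add: q_def)
  have "prob_space q"
  proof
    have "emeasure q (space q) = (\<integral>\<^sup>+x. ennreal (1 / mL) * indicator W x \<partial>L)"
      unfolding q_def by (subst emeasure_density) (auto intro!: nn_integral_cong split: split_indicator)
    also have "\<dots> = ennreal (1 / mL) * ennreal mL" using W emL by (simp add: nn_integral_cmult_indicator)
    also have "\<dots> = 1" using mL by (simp add: ennreal_mult[symmetric])
    finally show "emeasure q (space q) = 1" .
  qed
  then interpret q: prob_space q .
  have AEq: "AE x in q. x \<in> W"
    unfolding q_def by (subst AE_density) (auto split: split_indicator)
  interpret pq: product_prob_space "\<lambda>_::nat. q" UNIV ..
  define D where "D \<phi> = (\<integral>x. exp (\<phi> x * indicator W x) - 1 \<partial>L)" for \<phi> :: "'a \<Rightarrow> real"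
  have tW: "test (\<lambda>x. \<phi> x * indicator W x)" if "test \<phi>" for \<phi> using test_mult_indicator[OF that W] .
  have q_int: "(\<integral>\<^sup>+x. exp (\<phi> x) \<partial>q) = ennreal (1 + D \<phi> / mL)" "0 \<le> 1 + D \<phi> / mL" if \<phi>: "test \<phi>" for \<phi>
  proof -
    have [measurable]: "\<phi> \<in> borel_measurable X" using test_measurable[OF \<phi>] .
    let ?g = "\<lambda>x. indicator W x / mL + (exp (\<phi> x * indicator W x) - 1) / mL"
    have g: "indicator W x / mL * exp (\<phi> x) = ?g x" for x using mL by (simp add: field_simps split: split_indicator)
    have g0: "0 \<le> ?g x" for x unfolding g[symmetric] using mL by simp
    have i: "integrable L (indicator W :: _ \<Rightarrow> real)" using emL W by (intro integrable_real_indicator) auto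
    have i2: "integrable L (\<lambda>x. exp (\<phi> x * indicator W x) - 1)" using integrable_exp_test[OF tW[OF \<phi>]] .
    have "(\<integral>\<^sup>+x. exp (\<phi> x) \<partial>q) = (\<integral>\<^sup>+x. ennreal (?g x) \<partial>L)"
    proof -
      have "ennreal (indicator W x / mL) * ennreal (exp (\<phi> x)) = ennreal (?g x)" for x
        unfolding g[symmetric] using mL by (intro ennreal_mult[symmetric]) auto
      then show ?thesis unfolding q_def by (subst nn_integral_density) auto
    qed
    also have "\<dots> = ennreal (\<integral>x. ?g x \<partial>L)"
      using i i2 g0 by (intro nn_integral_eq_integral) auto
    also have "(\<integral>x. ?g x \<partial>L) = 1 + D \<phi> / mL"
      using i i2 mL sets.sets_into_space[OF W] by (simp add: D_def mL_def Int_absorb2)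
    finally show "(\<integral>\<^sup>+x. exp (\<phi> x) \<partial>q) = ennreal (1 + D \<phi> / mL)" .
    have "0 \<le> (\<integral>x. ?g x \<partial>L)" using g0 by (intro Bochner_Integration.integral_nonneg) auto
    then show "0 \<le> 1 + D \<phi> / mL" using \<open>(\<integral>x. ?g x \<partial>L) = 1 + D \<phi> / mL\<close> by simp
  qed
  define Pq where "Pq k = PiM {..<k} (\<lambda>_::nat. q)" for k
  interpret Pqk: prob_space "Pq k" for k unfolding Pq_def by (rule prob_space_PiM) (rule q.prob_space_axioms)
  \<comment> \<open>Intersecting with \<open>{..<k}\<close> keeps the first configuration finite and
    measurable for every pair \<open>(k, I)\<close>, also for those that \<open>K\<close> never
    produces.\<close>
  define cfg where "cfg k I = (\<lambda>(x, a, b). (labelled W (I \<inter> {..<k}) x a, labelled W ({..<k} - I) x b))" for k :: nat and I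
  have cfg[measurable]: "cfg k I \<in> Pq k \<Otimes>\<^sub>M (P \<Otimes>\<^sub>M P) \<rightarrow>\<^sub>M N \<Otimes>\<^sub>M N" for k I
  proof -
    have c: "(\<lambda>\<omega>. fst \<omega> i) \<in> Pq k \<Otimes>\<^sub>M (P \<Otimes>\<^sub>M P) \<rightarrow>\<^sub>M X" if "i < k" for i
    proof -
      have "(\<lambda>x. x i) \<in> Pq k \<rightarrow>\<^sub>M q" unfolding Pq_def using that by (intro measurable_component_singleton) auto
      then have "(\<lambda>x. x i) \<in> Pq k \<rightarrow>\<^sub>M X" by (simp cong: measurable_cong_sets)
      from measurable_compose[OF measurable_fst this] show ?thesis .
    qed
    have d: "(\<lambda>\<omega>. dirac_sum X J (\<lambda>i. fst \<omega> i)) \<in> Pq k \<Otimes>\<^sub>M (P \<Otimes>\<^sub>M P) \<rightarrow>\<^sub>M N" if "J \<subseteq> {..<k}" for J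
      using that c by (intro measurable_dirac_sum) (auto intro: finite_subset)
    have p: "(\<lambda>\<omega>. fst (snd \<omega>)) \<in> Pq k \<Otimes>\<^sub>M (P \<Otimes>\<^sub>M P) \<rightarrow>\<^sub>M N" "(\<lambda>\<omega>. snd (snd \<omega>)) \<in> Pq k \<Otimes>\<^sub>M (P \<Otimes>\<^sub>M P) \<rightarrow>\<^sub>M N"
      by (simp_all cong: measurable_cong_sets)
    have "(\<lambda>\<omega>. (labelled W (I \<inter> {..<k}) (fst \<omega>) (fst (snd \<omega>)), labelled W ({..<k} - I) (fst \<omega>) (snd (snd \<omega>))))
        \<in> Pq k \<Otimes>\<^sub>M (P \<Otimes>\<^sub>M P) \<rightarrow>\<^sub>M N \<Otimes>\<^sub>M N"
      unfolding labelled_def using d p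
      by (intro measurable_Pair measurable_superpose_N measurable_restr_const_N) auto
    then show ?thesis by (simp add: cfg_def case_prod_beta')
  qed
  \<comment> \<open>Two copies place \<open>2 * (\<kappa> * mL)\<close> points into the window on
    average, and each point belongs to either copy with probability one half, independently of the
    others.\<close>
  define K where "K = bind_pmf (poisson_pmf (2 * (\<kappa> * mL))) (\<lambda>k. map_pmf (Pair k) (pmf_of_set (Pow {..<k})))"
  define kern where "kern = (\<lambda>(k, I). distr (Pq k \<Otimes>\<^sub>M (P \<Otimes>\<^sub>M P)) (N \<Otimes>\<^sub>M N) (cfg k I))"
  have pps: "prob_space (Pq k \<Otimes>\<^sub>M (P \<Otimes>\<^sub>M P))" for k
  proof -
    interpret Q: pair_prob_space "Pq k" "P \<Otimes>\<^sub>M P" ..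
    show ?thesis by (rule Q.prob_space_axioms)
  qed
  have kern[measurable]: "kern \<in> measure_pmf K \<rightarrow>\<^sub>M subprob_algebra (N \<Otimes>\<^sub>M N)"
    using prob_space.prob_space_distr[OF pps cfg]
    by (auto simp: kern_def space_subprob_algebra prob_space_imp_subprob_space)
  \<comment> \<open>An explicit model for the pair law: labelled points inside the window, and the
    parts outside taken from two independent copies.\<close>
  define R where "R = measure_pmf K \<bind> kern"
  have sR: "sets R = sets (N \<Otimes>\<^sub>M N)" unfolding R_def by (rule sets_bind_measurable[OF kern]) simp
  have R_int: "(\<integral>\<^sup>+p. \<Phi> p \<partial>R) = (\<integral>\<^sup>+k. (\<Sum>I\<in>Pow {..<k}. \<integral>\<^sup>+x. \<integral>\<^sup>+ab. \<Phi> (cfg k I (x, ab)) \<partial>(P \<Otimes>\<^sub>M P) \<partial>Pq k) / 2 ^ k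
      \<partial>poisson_pmf (2 * (\<kappa> * mL)))" if [measurable]: "\<Phi> \<in> borel_measurable (N \<Otimes>\<^sub>M N)" for \<Phi>
  proof -
    have "(\<integral>\<^sup>+p. \<Phi> p \<partial>R) = (\<integral>\<^sup>+y. \<integral>\<^sup>+p. \<Phi> p \<partial>kern y \<partial>K)"
      unfolding R_def by (rule nn_integral_bind[OF that kern])
    also have "\<dots> = (\<integral>\<^sup>+k. (\<Sum>I\<in>Pow {..<k}. \<integral>\<^sup>+p. \<Phi> p \<partial>kern (k, I)) / 2 ^ k \<partial>poisson_pmf (2 * (\<kappa> * mL)))"
      unfolding K_def by (simp add: nn_integral_pmf_of_set card_Pow Pow_not_empty)
    finally have eq: "(\<integral>\<^sup>+p. \<Phi> p \<partial>R) = (\<integral>\<^sup>+k. (\<Sum>I\<in>Pow {..<k}. \<integral>\<^sup>+p. \<Phi> p \<partial>kern (k, I)) / 2 ^ k \<partial>poisson_pmf (2 * (\<kappa> * mL)))" .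
    have "(\<integral>\<^sup>+p. \<Phi> p \<partial>kern (k, I)) = (\<integral>\<^sup>+x. \<integral>\<^sup>+ab. \<Phi> (cfg k I (x, ab)) \<partial>(P \<Otimes>\<^sub>M P) \<partial>Pq k)" for k I
      unfolding kern_def by (simp add: nn_integral_distr PP.nn_integral_fst[symmetric])
    then show ?thesis unfolding eq by simp
  qed
  have "emeasure R (space R) = 1"
  proof -
    have "(\<Sum>I\<in>Pow {..<k}. \<integral>\<^sup>+x. \<integral>\<^sup>+ab. 1 \<partial>(P \<Otimes>\<^sub>M P) \<partial>Pq k) / 2 ^ k = (1::ennreal)" for k
    proof -
      have "(2::ennreal) ^ k / 2 ^ k = 1" by (rule ennreal_divide_self) (simp_all add: less_top power_less_top_ennreal)
      then show ?thesis by (simp add: PP.emeasure_space_1 Pqk.emeasure_space_1 card_Pow)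
    qed
    then show ?thesis using R_int[of "\<lambda>_. 1"] by simp
  qed
  then have Rfin: "finite_measure R" by (intro finite_measureI) simp
  \<comment> \<open>Outside the window both pair laws contribute the same factor \<open>C\<close>.
    Inside, averaging over labels and over the Poisson number of points reproduces the two Laplace
    factors.\<close>
  have R: "R = P \<Otimes>\<^sub>M P"
  proof (rule pair_law_unique[OF Rfin PP.finite_measure_axioms sR])
    show "sets (P \<Otimes>\<^sub>M P) = sets (N \<Otimes>\<^sub>M N)" by (intro sets_pair_measure_cong) simp_all
    fix \<phi> \<psi> assume \<phi>: "test \<phi>" and \<psi>: "test \<psi>"
    note [measurable] = measurable_expf[OF measurable_fst \<phi>] measurable_expf[OF measurable_snd \<psi>]
      measurable_expf[OF measurable_ident \<phi>, unfolded id_def] measurable_expf[OF measurable_ident \<psi>, unfolded id_def]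
    define a b where "a = 1 + D \<phi> / mL" and "b = 1 + D \<psi> / mL"
    have ab0: "0 \<le> a" "0 \<le> b" using q_int(2)[OF \<phi>] q_int(2)[OF \<psi>] by (auto simp: a_def b_def)
    define W' where "W' = space X - W"
    have W'[measurable]: "W' \<in> sets X" by (simp add: W'_def)
    define C where "C = exp (\<kappa> * (\<integral>x. exp (\<phi> x * indicator W' x) - 1 \<partial>L)) * exp (\<kappa> * (\<integral>x. exp (\<psi> x * indicator W' x) - 1 \<partial>L))"
    note t' = test_mult_indicator[OF \<phi> W'] test_mult_indicator[OF \<psi> W']
    have pp: "(\<integral>\<^sup>+p. ennreal (expf \<phi>' (fst p)) * ennreal (expf \<psi>' (snd p)) \<partial>(P \<Otimes>\<^sub>M P)) =
       ennreal (exp (\<kappa> * (\<integral>x. exp (\<phi>' x) - 1 \<partial>L)) * exp (\<kappa> * (\<integral>x. exp (\<psi>' x) - 1 \<partial>L)))"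
      if t: "test \<phi>'" "test \<psi>'" for \<phi>' \<psi>'
    proof -
      note [measurable] = measurable_expf[OF measurable_fst t(1)] measurable_expf[OF measurable_snd t(2)]
         measurable_expf[OF measurable_ident t(1), unfolded id_def] measurable_expf[OF measurable_ident t(2), unfolded id_def]
      have "(\<integral>\<^sup>+p. ennreal (expf \<phi>' (fst p)) * ennreal (expf \<psi>' (snd p)) \<partial>(P \<Otimes>\<^sub>M P)) =
         (\<integral>\<^sup>+\<mu>. \<integral>\<^sup>+\<nu>. ennreal (expf \<phi>' \<mu>) * ennreal (expf \<psi>' \<nu>) \<partial>P \<partial>P)"
        by (subst P.nn_integral_fst[symmetric]) auto
      also have "\<dots> = (\<integral>\<^sup>+\<mu>. expf \<phi>' \<mu> \<partial>P) * (\<integral>\<^sup>+\<nu>. expf \<psi>' \<nu> \<partial>P)"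
        by (simp add: nn_integral_cmult nn_integral_multc)
      finally show ?thesis by (simp add: plaw_expf[OF P] t ennreal_mult)
    qed
    have step: "(\<integral>\<^sup>+x. \<integral>\<^sup>+ab. ennreal (expf \<phi> (fst (cfg k I (x, ab)))) * ennreal (expf \<psi> (snd (cfg k I (x, ab)))) \<partial>(P \<Otimes>\<^sub>M P) \<partial>Pq k) =
        ennreal C * ((\<Prod>i\<in>I. ennreal a) * (\<Prod>i\<in>{..<k} - I. ennreal b))" if I: "I \<subseteq> {..<k}" for k I
    proof -
      have fI: "finite I" using I by (rule finite_subset) simp
      have "(\<integral>\<^sup>+ab. ennreal (expf \<phi> (fst (cfg k I (x, ab)))) * ennreal (expf \<psi> (snd (cfg k I (x, ab)))) \<partial>(P \<Otimes>\<^sub>M P)) =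
          ennreal C * (\<Prod>i<k. ennreal (exp (if i \<in> I then \<phi> (x i) else \<psi> (x i))))" if x: "x \<in> space (Pq k)" for x
      proof -
        have xs: "x i \<in> space X" if "i < k" for i using x that by (auto simp: Pq_def space_PiM PiE_iff)
        have e1: "expf \<phi> (labelled W I x \<mu>) = expf (\<lambda>y. \<phi> y * indicator W' y) \<mu> * (\<Prod>i\<in>I. exp (\<phi> (x i)))" if "\<mu> \<in> space N" for \<mu>
        proof -
          have d: "dirac_sum X I x \<in> space N" "expf \<phi> (dirac_sum X I x) = (\<Prod>i\<in>I. exp (\<phi> (x i)))"
            using I xs fI by (auto intro!: dirac_sum_in_N expf_dirac_sum \<phi>)
          show ?thesis
            unfolding labelled_def W'_def[symmetric] using that \<phi> W'
            by (simp add: expf_superpose restr_in_N d expf_restr)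
        qed
        have e2: "expf \<psi> (labelled W ({..<k} - I) x \<mu>) = expf (\<lambda>y. \<psi> y * indicator W' y) \<mu> * (\<Prod>i\<in>{..<k} - I. exp (\<psi> (x i)))" if "\<mu> \<in> space N" for \<mu>
        proof -
          have d: "dirac_sum X ({..<k} - I) x \<in> space N" "expf \<psi> (dirac_sum X ({..<k} - I) x) = (\<Prod>i\<in>({..<k} - I). exp (\<psi> (x i)))"
            using I xs fI by (auto intro!: dirac_sum_in_N expf_dirac_sum \<psi>)
          show ?thesis
            unfolding labelled_def W'_def[symmetric] using that \<psi> W'
            by (simp add: expf_superpose restr_in_N d expf_restr)
        qed
        have pr: "(\<Prod>i<k. exp (if i \<in> I then \<phi> (x i) else \<psi> (x i))) = (\<Prod>i\<in>I. exp (\<phi> (x i))) * (\<Prod>i\<in>{..<k} - I. exp (\<psi> (x i)))"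
        proof -
          have "(\<Prod>i<k. exp (if i \<in> I then \<phi> (x i) else \<psi> (x i))) = (\<Prod>i\<in>{..<k} - I. exp (if i \<in> I then \<phi> (x i) else \<psi> (x i))) * (\<Prod>i\<in>I. exp (if i \<in> I then \<phi> (x i) else \<psi> (x i)))"
            by (rule prod.subset_diff[OF I]) simp
          then show ?thesis by (simp add: mult.commute)
        qed
        have "(\<integral>\<^sup>+ab. ennreal (expf \<phi> (fst (cfg k I (x, ab)))) * ennreal (expf \<psi> (snd (cfg k I (x, ab)))) \<partial>(P \<Otimes>\<^sub>M P)) =
          (\<integral>\<^sup>+ab. ennreal (\<Prod>i<k. exp (if i \<in> I then \<phi> (x i) else \<psi> (x i))) * (ennreal (expf (\<lambda>y. \<phi> y * indicator W' y) (fst ab)) * ennreal (expf (\<lambda>y. \<psi> y * indicator W' y) (snd ab))) \<partial>(P \<Otimes>\<^sub>M P))"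
        proof (rule nn_integral_cong)
          fix ab assume "ab \<in> space (P \<Otimes>\<^sub>M P)"
          then have "fst ab \<in> space N" "snd ab \<in> space N" by (auto simp: space_pair_measure)
          then show "ennreal (expf \<phi> (fst (cfg k I (x, ab)))) * ennreal (expf \<psi> (snd (cfg k I (x, ab)))) =
             ennreal (\<Prod>i<k. exp (if i \<in> I then \<phi> (x i) else \<psi> (x i))) * (ennreal (expf (\<lambda>y. \<phi> y * indicator W' y) (fst ab)) * ennreal (expf (\<lambda>y. \<psi> y * indicator W' y) (snd ab)))"
            unfolding pr using I
            by (simp add: cfg_def case_prod_beta Int_absorb2 e1 e2 ennreal_mult prod_nonneg expf_nonneg mult_ac)
        qed
        also have "\<dots> = ennreal (\<Prod>i<k. exp (if i \<in> I then \<phi> (x i) else \<psi> (x i))) * ennreal C"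
          using measurable_expf[OF measurable_fst t'(1), of N] measurable_expf[OF measurable_snd t'(2), of N]
          by (subst nn_integral_cmult) (auto simp: pp[OF t'] C_def)
        finally show ?thesis by (simp add: prod_ennreal mult.commute)
      qed
      then have "(\<integral>\<^sup>+x. \<integral>\<^sup>+ab. ennreal (expf \<phi> (fst (cfg k I (x, ab)))) * ennreal (expf \<psi> (snd (cfg k I (x, ab)))) \<partial>(P \<Otimes>\<^sub>M P) \<partial>Pq k) =
         (\<integral>\<^sup>+x. ennreal C * (\<Prod>i<k. ennreal (exp (if i \<in> I then \<phi> (x i) else \<psi> (x i)))) \<partial>Pq k)"
        by (rule nn_integral_cong)
      also have "\<dots> = ennreal C * (\<integral>\<^sup>+x. (\<Prod>i<k. (\<lambda>i y. ennreal (exp (if i \<in> I then \<phi> y else \<psi> y))) i (x i)) \<partial>Pq k)"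
      proof (rule nn_integral_cmult)
        have "(\<lambda>x. ennreal (exp (if i \<in> I then \<phi> (x i) else \<psi> (x i)))) \<in> borel_measurable (Pq k)" if "i < k" for i
        proof -
          have "(\<lambda>x. x i) \<in> Pq k \<rightarrow>\<^sub>M q" unfolding Pq_def using that by (intro measurable_component_singleton) auto
          then have [measurable]: "(\<lambda>x. x i) \<in> Pq k \<rightarrow>\<^sub>M X" by (simp cong: measurable_cong_sets)
          note [measurable] = test_measurable[OF \<phi>] test_measurable[OF \<psi>]
          show ?thesis by (cases "i \<in> I") simp_all
        qed
        then show "(\<lambda>x. \<Prod>i<k. ennreal (exp (if i \<in> I then \<phi> (x i) else \<psi> (x i)))) \<in> borel_measurable (Pq k)"
          by (intro borel_measurable_prod_ennreal) auto
      qed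
      also have "(\<integral>\<^sup>+x. (\<Prod>i<k. (\<lambda>i y. ennreal (exp (if i \<in> I then \<phi> y else \<psi> y))) i (x i)) \<partial>Pq k) = (\<Prod>i<k. \<integral>\<^sup>+y. ennreal (exp (if i \<in> I then \<phi> y else \<psi> y)) \<partial>q)"
        unfolding Pq_def
      proof (rule pq.product_nn_integral_prod)
        note [measurable] = test_measurable[OF \<phi>] test_measurable[OF \<psi>]
        show "(\<lambda>y. ennreal (exp (if i \<in> I then \<phi> y else \<psi> y))) \<in> borel_measurable q" for i
          by (cases "i \<in> I") simp_all
      qed simp
      also have "\<dots> = (\<Prod>i<k. if i \<in> I then ennreal a else ennreal b)"
        using q_int(1)[OF \<phi>] q_int(1)[OF \<psi>] by (intro prod.cong) (auto simp: a_def b_def)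
      also have "\<dots> = (\<Prod>i\<in>{..<k} - I. if i \<in> I then ennreal a else ennreal b) * (\<Prod>i\<in>I. if i \<in> I then ennreal a else ennreal b)"
        by (rule prod.subset_diff[OF I]) simp
      finally show ?thesis by (simp add: mult.commute)
    qed
    \<comment> \<open>Expanding \<open>(a + b) ^ k\<close> over the set of indices that choose
      \<open>a\<close> is the sum over label sets; the fair labels divide it by
      \<open>2 ^ k\<close>.\<close>
    have pw: "(\<Sum>I\<in>Pow {..<k}. ennreal C * ((\<Prod>i\<in>I. ennreal a) * (\<Prod>i\<in>{..<k} - I. ennreal b))) / 2 ^ k = ennreal C * ennreal (((a + b) / 2) ^ k)" for k
    proof -
      have "(\<Sum>I\<in>Pow {..<k}. ennreal C * ((\<Prod>i\<in>I. ennreal a) * (\<Prod>i\<in>{..<k} - I. ennreal b))) = ennreal C * (\<Prod>i<k. ennreal a + ennreal b)"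
        by (subst prod_add) (simp_all add: sum_distrib_left)
      also have "(\<Prod>i<k. ennreal a + ennreal b) = ennreal ((a + b) ^ k)"
        using ab0 by (simp add: ennreal_power flip: ennreal_plus)
      also have "ennreal C * ennreal ((a + b) ^ k) / 2 ^ k = ennreal C * (ennreal ((a + b) ^ k) / ennreal (2 ^ k))"
        by (simp add: ennreal_times_divide ennreal_power[symmetric])
      also have "ennreal ((a + b) ^ k) / ennreal (2 ^ k) = ennreal (((a + b) / 2) ^ k)"
        using ab0 by (subst divide_ennreal) (auto simp: power_divide)
      finally show ?thesis .
    qed
    have "(\<integral>\<^sup>+p. ennreal (expf \<phi> (fst p)) * ennreal (expf \<psi> (snd p)) \<partial>R) =
       (\<integral>\<^sup>+k. (\<Sum>I\<in>Pow {..<k}. ennreal C * ((\<Prod>i\<in>I. ennreal a) * (\<Prod>i\<in>{..<k} - I. ennreal b))) / 2 ^ k \<partial>poisson_pmf (2 * (\<kappa> * mL)))"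
      by (subst R_int) (auto intro!: nn_integral_cong arg_cong[where f="\<lambda>y. y / _"] sum.cong simp: step)
    also have "\<dots> = (\<integral>\<^sup>+k. ennreal C * ennreal (((a + b) / 2) ^ k) \<partial>poisson_pmf (2 * (\<kappa> * mL)))"
      by (simp only: pw)
    also have "\<dots> = ennreal C * ennreal (exp (2 * (\<kappa> * mL) * ((a + b) / 2 - 1)))"
      using \<kappa> mL ab0 by (simp add: nn_integral_cmult nn_integral_poisson_pmf_power)
    also have "2 * (\<kappa> * mL) * ((a + b) / 2 - 1) = \<kappa> * D \<phi> + \<kappa> * D \<psi>"
      using mL by (simp add: a_def b_def field_simps)
    also have "ennreal C * ennreal (exp (\<kappa> * D \<phi> + \<kappa> * D \<psi>)) = ennreal (exp (\<kappa> * (\<integral>x. exp (\<phi> x) - 1 \<partial>L)) * exp (\<kappa> * (\<integral>x. exp (\<psi> x) - 1 \<partial>L)))"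
    proof -
      have split: "(\<integral>x. exp (\<phi>' x) - 1 \<partial>L) = (\<integral>x. exp (\<phi>' x * indicator W' x) - 1 \<partial>L) + D \<phi>'" if t: "test \<phi>'" for \<phi>'
      proof -
        have "(\<integral>x. exp (\<phi>' x) - 1 \<partial>L) = (\<integral>x. (exp (\<phi>' x * indicator W' x) - 1) + (exp (\<phi>' x * indicator W x) - 1) \<partial>L)"
          by (rule Bochner_Integration.integral_cong) (auto simp: W'_def split: split_indicator)
        also have "\<dots> = (\<integral>x. exp (\<phi>' x * indicator W' x) - 1 \<partial>L) + D \<phi>'"
          unfolding D_def by (intro Bochner_Integration.integral_add integrable_exp_test test_mult_indicator t W' W)
        finally show ?thesis .
      qed
      show ?thesis by (simp add: split[OF \<phi>] split[OF \<psi>] C_def ennreal_mult[symmetric] exp_add algebra_simps)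
    qed
    finally show "(\<integral>\<^sup>+p. ennreal (expf \<phi> (fst p)) * ennreal (expf \<psi> (snd p)) \<partial>R) = (\<integral>\<^sup>+p. ennreal (expf \<phi> (fst p)) * ennreal (expf \<psi> (snd p)) \<partial>(P \<Otimes>\<^sub>M P))"
      by (simp add: pp[OF \<phi> \<psi>])
  qed
  have glue_m: "(\<lambda>p. glue W Z (fst p) (snd p)) \<in> N \<Otimes>\<^sub>M N \<rightarrow>\<^sub>M N"
    using measurable_glue[OF Z W] by (simp add: case_prod_beta')
  show ?thesis
  proof (rule measure_eqI)
    fix A assume "A \<in> sets (distr (P \<Otimes>\<^sub>M P) N (\<lambda>(\<mu>, \<psi>). glue (B n) Z \<mu> \<psi>))"
    then have A[measurable]: "A \<in> sets N" by simp
    note [measurable] = glue_m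
    have m1: "(\<lambda>p. indicator A (glue W Z (fst p) (snd p)) :: ennreal) \<in> borel_measurable (N \<Otimes>\<^sub>M N)" by measurable
    have m2: "(\<lambda>p. indicator A (fst p) :: ennreal) \<in> borel_measurable (N \<Otimes>\<^sub>M N)" by measurable
    \<comment> \<open>The label sum is moved inside both integrals, because
      \<open>sum_glue_labelled\<close> needs the positions and the outer configurations to be
      fixed.\<close>
    have inner: "(\<Sum>I\<in>Pow {..<k}. \<integral>\<^sup>+x. \<integral>\<^sup>+ab. indicator A (glue W Z (fst (cfg k I (x, ab))) (snd (cfg k I (x, ab)))) \<partial>(P \<Otimes>\<^sub>M P) \<partial>Pq k) =
       (\<Sum>I\<in>Pow {..<k}. \<integral>\<^sup>+x. \<integral>\<^sup>+ab. indicator A (fst (cfg k I (x, ab))) \<partial>(P \<Otimes>\<^sub>M P) \<partial>Pq k)" (is "?l = ?r") for k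
    proof -
      have AEx: "AE x in Pq k. \<forall>i\<in>{..<k}. x i \<in> W"
        unfolding Pq_def by (intro AE_finite_allI AE_PiM_component q.prob_space_axioms AEq) auto
      note mm1 = measurable_compose[OF cfg m1] and mm2 = measurable_compose[OF cfg m2]
      have pm1: "(\<lambda>ab. indicator A (glue W Z (fst (cfg k I (x, ab))) (snd (cfg k I (x, ab)))) :: ennreal) \<in> borel_measurable (P \<Otimes>\<^sub>M P)"
        and pm2: "(\<lambda>ab. indicator A (fst (cfg k I (x, ab))) :: ennreal) \<in> borel_measurable (P \<Otimes>\<^sub>M P)" if "x \<in> space (Pq k)" for x I
        using measurable_compose[OF measurable_Pair1'[OF that] mm1] measurable_compose[OF measurable_Pair1'[OF that] mm2] by simp_all
      have "?l = (\<integral>\<^sup>+x. (\<Sum>I\<in>Pow {..<k}. \<integral>\<^sup>+ab. indicator A (glue W Z (fst (cfg k I (x, ab))) (snd (cfg k I (x, ab)))) \<partial>(P \<Otimes>\<^sub>M P)) \<partial>Pq k)"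
        by (rule nn_integral_sum[symmetric]) (rule PP.borel_measurable_nn_integral_fst[OF mm1])
      also have "\<dots> = (\<integral>\<^sup>+x. (\<Sum>I\<in>Pow {..<k}. \<integral>\<^sup>+ab. indicator A (fst (cfg k I (x, ab))) \<partial>(P \<Otimes>\<^sub>M P)) \<partial>Pq k)"
      proof (rule nn_integral_cong_AE)
        show "AE x in Pq k. (\<Sum>I\<in>Pow {..<k}. \<integral>\<^sup>+ab. indicator A (glue W Z (fst (cfg k I (x, ab))) (snd (cfg k I (x, ab)))) \<partial>(P \<Otimes>\<^sub>M P)) =
           (\<Sum>I\<in>Pow {..<k}. \<integral>\<^sup>+ab. indicator A (fst (cfg k I (x, ab))) \<partial>(P \<Otimes>\<^sub>M P))"
          using AEx AE_space
        proof eventually_elim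
          case (elim x)
          have "(\<Sum>I\<in>Pow {..<k}. \<integral>\<^sup>+ab. indicator A (glue W Z (fst (cfg k I (x, ab))) (snd (cfg k I (x, ab)))) \<partial>(P \<Otimes>\<^sub>M P)) =
            (\<integral>\<^sup>+ab. (\<Sum>I\<in>Pow {..<k}. indicator A (glue W Z (fst (cfg k I (x, ab))) (snd (cfg k I (x, ab))))) \<partial>(P \<Otimes>\<^sub>M P))"
            using pm1[OF elim(2)] by (intro nn_integral_sum[symmetric])
          also have "\<dots> = (\<integral>\<^sup>+ab. (\<Sum>I\<in>Pow {..<k}. indicator A (fst (cfg k I (x, ab)))) \<partial>(P \<Otimes>\<^sub>M P))"
          proof (rule nn_integral_cong)
            fix ab assume "ab \<in> space (P \<Otimes>\<^sub>M P)"
            then have ab: "fst ab \<in> space N" "snd ab \<in> space N" by (auto simp: space_pair_measure)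
            have c: "cfg k I (x, ab) = (labelled W I x (fst ab), labelled W ({..<k} - I) x (snd ab))" if "I \<in> Pow {..<k}" for I
              using that by (auto simp: cfg_def case_prod_beta Int_absorb2)
            show "(\<Sum>I\<in>Pow {..<k}. indicator A (glue W Z (fst (cfg k I (x, ab))) (snd (cfg k I (x, ab))))) = (\<Sum>I\<in>Pow {..<k}. indicator A (fst (cfg k I (x, ab))) :: ennreal)"
            proof -
              have "(\<Sum>I\<in>Pow {..<k}. indicator A (glue W Z (fst (cfg k I (x, ab))) (snd (cfg k I (x, ab)))) :: ennreal) =
                 (\<Sum>I\<in>Pow {..<k}. indicator A (glue W Z (labelled W I x (fst ab)) (labelled W ({..<k} - I) x (snd ab))))"
                by (intro sum.cong refl) (simp only: c fst_conv snd_conv)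
              also have "\<dots> = (\<Sum>I\<in>Pow {..<k}. indicator A (labelled W I x (fst ab)))"
                using elim(1) by (intro sum_glue_labelled[OF Z W _ ab]) auto
              also have "\<dots> = (\<Sum>I\<in>Pow {..<k}. indicator A (fst (cfg k I (x, ab))))"
                by (intro sum.cong refl) (simp only: c fst_conv)
              finally show ?thesis .
            qed
          qed
          also have "\<dots> = (\<Sum>I\<in>Pow {..<k}. \<integral>\<^sup>+ab. indicator A (fst (cfg k I (x, ab))) \<partial>(P \<Otimes>\<^sub>M P))"
            using pm2[OF elim(2)] by (intro nn_integral_sum)
          finally show ?case .
        qed
      qed
      also have "\<dots> = ?r" by (rule nn_integral_sum) (rule PP.borel_measurable_nn_integral_fst[OF mm2])
      finally show ?thesis .
    qed
    have "emeasure (distr (P \<Otimes>\<^sub>M P) N (\<lambda>(\<mu>, \<psi>). glue (B n) Z \<mu> \<psi>)) A = (\<integral>\<^sup>+p. indicator A (glue W Z (fst p) (snd p)) \<partial>(P \<Otimes>\<^sub>M P))"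
      using glue_m by (subst nn_integral_indicator[symmetric], simp) (subst nn_integral_distr, auto simp: W_def case_prod_beta' cong: measurable_cong_sets)
    also have "\<dots> = (\<integral>\<^sup>+p. indicator A (fst p) \<partial>(P \<Otimes>\<^sub>M P))"
      unfolding R[symmetric] by (simp only: R_int[OF m1] R_int[OF m2] inner)
    also have "\<dots> = (\<integral>\<^sup>+\<mu>. \<integral>\<^sup>+\<psi>. indicator A \<mu> \<partial>P \<partial>P)"
      by (subst P.nn_integral_fst[symmetric]) (auto cong: measurable_cong_sets)
    also have "\<dots> = emeasure P A" using P.emeasure_space_1 by simp
    finally show "emeasure (distr (P \<Otimes>\<^sub>M P) N (\<lambda>(\<mu>, \<psi>). glue (B n) Z \<mu> \<psi>)) A = emeasure P A" .
  qed simp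
qed

text \<open>The variable \<open>exp (- \<mu>(W))\<close> is at most \<open>1\<close> and has
  expectation \<open>1\<close>, which forces it to be almost surely \<open>1\<close>.\<close>

lemma AE_plaw_null:
  assumes P: "plaw \<kappa> P" and W: "W \<in> sets X" "W \<subseteq> B n" and null: "measure L W = 0"
  shows "AE \<mu> in P. emeasure \<mu> W = 0"
proof -
  interpret P: prob_space P using plaw_prob[OF P] .
  have sP[measurable_cong, simp]: "sets P = sets N" using plaw_sets[OF P] .
  have spP[simp]: "space P = space N" using sP sets_eq_imp_space_eq by blast
  define \<phi> :: "'a \<Rightarrow> real" where "\<phi> x = - 1 * indicator W x" for x
  have \<phi>: "test \<phi>" unfolding \<phi>_def using test_indicator[OF W, of "- 1"] .
  have [measurable]: "expf \<phi> \<in> borel_measurable P" using measurable_expf[OF measurable_ident \<phi>] by (simp add: id_def)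
  have le: "expf \<phi> \<mu> \<le> 1" for \<mu> by (rule expf_le_1) (simp add: \<phi>_def)
  have "(\<integral>x. exp (\<phi> x) - 1 \<partial>L) = (\<integral>x. (exp (- 1) - 1) * indicator W x \<partial>L)"
    by (rule Bochner_Integration.integral_cong) (auto simp: \<phi>_def split: split_indicator)
  also have "\<dots> = 0" using null sets.sets_into_space[OF W(1)] by (simp add: Int_absorb2)
  finally have "(\<integral>\<^sup>+\<mu>. expf \<phi> \<mu> \<partial>P) = 1" using plaw_expf[OF P \<phi>] by simp
  then have "(\<integral>\<mu>. expf \<phi> \<mu> \<partial>P) = 1" by (simp add: integral_eq_nn_integral expf_nonneg)
  moreover have i: "integrable P (expf \<phi>)"
    by (rule P.integrable_const_bound[where B=1]) (simp_all add: expf_nonneg le)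
  ultimately have "(\<integral>\<mu>. 1 - expf \<phi> \<mu> \<partial>P) = 0" by (simp add: P.prob_space[unfolded spP])
  then have "AE \<mu> in P. 1 - expf \<phi> \<mu> = 0"
    using i le by (subst (asm) integral_nonneg_eq_0_iff_AE) auto
  then show ?thesis
    using AE_space
  proof eventually_elim
    case (elim \<mu>)
    then have \<mu>: "\<mu> \<in> space N" by simp
    have fin: "emeasure \<mu> W < \<infinity>" using emeasure_bounded_finite[OF N_locally_finite[OF \<mu>] W] .
    moreover have "(\<integral>x. \<phi> x \<partial>\<mu>) = 0" using elim by (simp add: expf_def)
    ultimately have "measure \<mu> W = 0"
      using W N_sets[OF \<mu>] N_space[OF \<mu>] sets.sets_into_space[OF W(1)] by (simp add: \<phi>_def Int_absorb2)
    then show ?case using fin emeasure_eq_ennreal_measure[of \<mu> W] by simp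
  qed
qed

lemma glue_null:
  assumes Z: "stopping_set X B Z" and W: "W \<in> sets X" and m: "\<mu> \<in> space N" "\<psi> \<in> space N"
    and null: "emeasure \<mu> W = 0" "emeasure \<psi> W = 0"
  shows "glue W Z \<mu> \<psi> = \<mu>"
proof (rule measure_eqI)
  note Zs = stopping_set_sets[OF Z m(1)] and s = N_sets[OF m(1)] N_sets[OF m(2)]
  fix A assume "A \<in> sets (glue W Z \<mu> \<psi>)"
  then have A: "A \<in> sets X" using N_sets[OF glue_in_N[OF Z W m]] by simp
  have "emeasure \<psi> (A \<inter> (W - Z \<mu>)) \<le> emeasure \<psi> W" using A W Zs s by (intro emeasure_mono) auto
  then have 0: "emeasure \<psi> (A \<inter> (W - Z \<mu>)) = 0" using null by simp
  have "emeasure \<mu> A \<le> emeasure \<mu> ((A \<inter> (Z \<mu> \<union> (space X - W))) \<union> W)"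
    using A W Zs s sets.sets_into_space[OF A] by (intro emeasure_mono) auto
  also have "\<dots> \<le> emeasure \<mu> (A \<inter> (Z \<mu> \<union> (space X - W))) + emeasure \<mu> W"
    using A W Zs s by (intro emeasure_subadditive) auto
  finally have "emeasure \<mu> A \<le> emeasure \<mu> (A \<inter> (Z \<mu> \<union> (space X - W)))" using null by simp
  moreover have "emeasure \<mu> (A \<inter> (Z \<mu> \<union> (space X - W))) \<le> emeasure \<mu> A"
    using A W Zs s by (intro emeasure_mono) auto
  ultimately show "emeasure (glue W Z \<mu> \<psi>) A = emeasure \<mu> A"
    using emeasure_glue[OF Z W m A] 0 by simp
qed (simp add: N_sets[OF glue_in_N[OF Z W m]] N_sets[OF m(1)])

lemma window_swap:
  assumes Z: "stopping_set X B Z" and P: "plaw \<kappa> P" and \<kappa>: "0 < \<kappa>"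
  shows "distr (P \<Otimes>\<^sub>M P) N (\<lambda>(\<mu>, \<psi>). glue (B n) Z \<mu> \<psi>) = P"
proof (cases "measure L (B n) = 0")
  case False
  then have "0 < measure L (B n)" using measure_nonneg[of L "B n"] by linarith
  then show ?thesis by (rule window_swap_pos[OF Z P \<kappa>])
next
  \<comment> \<open>The one-point law cannot be normalized here, but almost surely both
    configurations are empty in the window and gluing does nothing.\<close>
  case True
  interpret P: prob_space P using plaw_prob[OF P] .
  have sP[measurable_cong, simp]: "sets P = sets N" using plaw_sets[OF P] .
  have spP[simp]: "space P = space N" using sP sets_eq_imp_space_eq by blast
  interpret PP: pair_prob_space P P ..
  have ae: "AE \<mu> in P. emeasure \<mu> (B n) = 0" using AE_plaw_null[OF P sets_B order_refl True] .
  have "AE p in P \<Otimes>\<^sub>M P. emeasure (fst p) (B n) = 0 \<and> emeasure (snd p) (B n) = 0"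
  proof (rule PP.AE_pair_measure)
    have "Measurable.pred (N \<Otimes>\<^sub>M N) (\<lambda>p. emeasure (fst p) (B n) = 0 \<and> emeasure (snd p) (B n) = 0)"
      by measurable
    then show "{p \<in> space (P \<Otimes>\<^sub>M P). emeasure (fst p) (B n) = 0 \<and> emeasure (snd p) (B n) = 0} \<in> sets (P \<Otimes>\<^sub>M P)"
      by (simp add: pred_def space_pair_measure cong: measurable_cong_sets)
    show "AE x in P. AE y in P. emeasure (fst (x, y)) (B n) = 0 \<and> emeasure (snd (x, y)) (B n) = 0"
      using ae by eventually_elim (use ae in simp)
  qed
  then have "AE p in P \<Otimes>\<^sub>M P. (case p of (\<mu>, \<psi>) \<Rightarrow> glue (B n) Z \<mu> \<psi>) = fst p"
    using AE_space
    by eventually_elim (auto simp: space_pair_measure glue_null[OF Z])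
  then have "distr (P \<Otimes>\<^sub>M P) N (\<lambda>(\<mu>, \<psi>). glue (B n) Z \<mu> \<psi>) = distr (P \<Otimes>\<^sub>M P) P fst"
    using measurable_glue[OF Z, of "B n"]
    by (intro distr_cong_AE) (simp_all cong: measurable_cong_sets)
  then show ?thesis by (simp add: P.distr_pair_fst)
qed

lemma expf_cong: "\<mu> \<in> space N \<Longrightarrow> (\<And>x. x \<in> space X \<Longrightarrow> \<phi> x = \<psi> x) \<Longrightarrow> expf \<phi> \<mu> = expf \<psi> \<mu>"
  unfolding expf_def using N_space by (auto intro!: arg_cong[where f=exp] Bochner_Integration.integral_cong)

text \<open>For \<open>\<phi>\<close> supported in the window the right-hand side no longer mentions
  \<open>W\<close>, so gluing over a window and over the whole space cannot be distinguished by
  \<open>expf \<phi>\<close>.\<close>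

lemma expf_glue:
  assumes Z: "stopping_set X B Z" and W: "W \<in> sets X" and m: "\<mu> \<in> space N" "\<psi> \<in> space N"
    and \<phi>: "test \<phi>" and off: "\<And>x. x \<in> space X - W \<Longrightarrow> \<phi> x = 0"
  shows "expf \<phi> (glue W Z \<mu> \<psi>) = expf (\<lambda>x. \<phi> x * indicator (Z \<mu>) x) \<mu> * expf (\<lambda>x. \<phi> x * indicator (space X - Z \<mu>) x) \<psi>"
proof -
  note Zs = stopping_set_sets[OF Z m(1)]
  have s: "Z \<mu> \<union> (space X - W) \<in> sets X" "W - Z \<mu> \<in> sets X" using Zs W by auto
  have "expf \<phi> (glue W Z \<mu> \<psi>) = expf (\<lambda>x. \<phi> x * indicator (Z \<mu> \<union> (space X - W)) x) \<mu> * expf (\<lambda>x. \<phi> x * indicator (W - Z \<mu>) x) \<psi>"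
    unfolding glue_def using s m \<phi> by (simp add: expf_superpose restr_in_N expf_restr)
  also have "expf (\<lambda>x. \<phi> x * indicator (Z \<mu> \<union> (space X - W)) x) \<mu> = expf (\<lambda>x. \<phi> x * indicator (Z \<mu>) x) \<mu>"
    using off by (intro expf_cong m) (auto split: split_indicator)
  also have "expf (\<lambda>x. \<phi> x * indicator (W - Z \<mu>) x) \<psi> = expf (\<lambda>x. \<phi> x * indicator (space X - Z \<mu>) x) \<psi>"
    using off by (intro expf_cong m) (auto split: split_indicator)
  finally show ?thesis .
qed

text \<open>Laplace functionals reduce the claim to one test function at a time. Each of them lives
  in some window, where \<open>expf_glue\<close> replaces the whole space by that window.\<close>

theorem strong_markov:
  assumes Z: "stopping_set X B Z" and P: "plaw \<kappa> P" and \<kappa>: "0 < \<kappa>"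
  shows "distr (P \<Otimes>\<^sub>M P) N (\<lambda>(\<mu>, \<psi>). glue (space X) Z \<mu> \<psi>) = P"
proof -
  interpret P: prob_space P using plaw_prob[OF P] .
  have sP[measurable_cong, simp]: "sets P = sets N" using plaw_sets[OF P] .
  have spP[simp]: "space P = space N" using sP sets_eq_imp_space_eq by blast
  interpret PP: pair_prob_space P P ..
  have g: "(\<lambda>(\<mu>, \<psi>). glue W Z \<mu> \<psi>) \<in> P \<Otimes>\<^sub>M P \<rightarrow>\<^sub>M N" if "W \<in> sets X" for W
    using measurable_glue[OF Z that] by (simp cong: measurable_cong_sets)
  show ?thesis
  proof (rule point_law_unique)
    fix \<phi> assume \<phi>: "test \<phi>"
    then obtain n where n: "\<And>x. x \<in> space X - B n \<Longrightarrow> \<phi> x = 0" by (auto simp: test_def)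
    have [measurable]: "(\<lambda>\<mu>. ennreal (expf \<phi> \<mu>)) \<in> borel_measurable N"
      using measurable_expf[OF measurable_ident \<phi>] by (simp add: id_def)
    have "(\<integral>\<^sup>+\<mu>. expf \<phi> \<mu> \<partial>distr (P \<Otimes>\<^sub>M P) N (\<lambda>(\<mu>, \<psi>). glue (space X) Z \<mu> \<psi>)) =
        (\<integral>\<^sup>+p. expf \<phi> (case p of (\<mu>, \<psi>) \<Rightarrow> glue (space X) Z \<mu> \<psi>) \<partial>(P \<Otimes>\<^sub>M P))"
      using g[OF sets.top] by (subst nn_integral_distr) auto
    also have "\<dots> = (\<integral>\<^sup>+p. expf \<phi> (case p of (\<mu>, \<psi>) \<Rightarrow> glue (B n) Z \<mu> \<psi>) \<partial>(P \<Otimes>\<^sub>M P))"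
      using expf_glue[OF Z sets.top _ _ \<phi>] expf_glue[OF Z sets_B _ _ \<phi> n]
      by (intro nn_integral_cong) (auto simp: space_pair_measure)
    also have "\<dots> = (\<integral>\<^sup>+\<mu>. expf \<phi> \<mu> \<partial>distr (P \<Otimes>\<^sub>M P) N (\<lambda>(\<mu>, \<psi>). glue (B n) Z \<mu> \<psi>))"
      using g[OF sets_B] by (subst nn_integral_distr) auto
    also have "\<dots> = (\<integral>\<^sup>+\<mu>. expf \<phi> \<mu> \<partial>P)" unfolding window_swap[OF Z P \<kappa>] ..
    finally show "(\<integral>\<^sup>+\<mu>. expf \<phi> \<mu> \<partial>distr (P \<Otimes>\<^sub>M P) N (\<lambda>(\<mu>, \<psi>). glue (space X) Z \<mu> \<psi>)) = (\<integral>\<^sup>+\<mu>. expf \<phi> \<mu> \<partial>P)" .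
  qed (use g[OF sets.top] P.finite_measure_axioms PP.finite_measure_distr in \<open>simp_all\<close>)
qed

end

section \<open>Charlier polynomials\<close>

text \<open>Dividing the difference by the lowest power at which the coefficients disagree and
  letting \<open>r\<close> tend to \<open>0\<close> makes that coefficient vanish.\<close>

lemma powser_unique:
  fixes a b :: "nat \<Rightarrow> real"
  assumes a: "\<And>r. \<bar>r\<bar> \<le> 1 \<Longrightarrow> (\<lambda>k. a k * r ^ k) sums S r" and b: "\<And>r. \<bar>r\<bar> \<le> 1 \<Longrightarrow> (\<lambda>k. b k * r ^ k) sums S r"
  shows "a = b"
proof (rule ccontr)
  assume "a \<noteq> b"
  then have ex: "\<exists>m. a m - b m \<noteq> 0" by (simp add: fun_eq_iff)
  define m where "m = (LEAST m. a m - b m \<noteq> 0)"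
  have less: "a k - b k = 0" if "k < m" for k
    using not_less_Least[of k "\<lambda>m. a m - b m \<noteq> 0"] that by (auto simp: m_def)
  have m: "a m - b m \<noteq> 0" using LeastI_ex[OF ex] by (simp add: m_def)
  have "(\<lambda>k. (a (k + m) - b (k + m)) * r ^ k) sums 0" if "r \<noteq> 0" "norm r < 1" for r :: real
  proof -
    have "(\<lambda>k. a k * r ^ k - b k * r ^ k) sums (S r - S r)"
      using that by (intro sums_diff a b) auto
    then have "(\<lambda>k. (a k - b k) * r ^ k) sums 0" by (simp add: left_diff_distrib)
    then have "(\<lambda>k. (a (k + m) - b (k + m)) * r ^ (k + m)) sums 0"
      using less by (subst sums_iff_shift) auto
    then have "(\<lambda>k. (a (k + m) - b (k + m)) * r ^ (k + m) / r ^ m) sums (0 / r ^ m)"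
      by (rule sums_divide)
    then show ?thesis using that by (simp add: power_add)
  qed
  then have "((\<lambda>r. 0) \<longlongrightarrow> a (0 + m) - b (0 + m)) (at (0::real))"
    by (intro powser_limit_0_strong[where s=1 and a="\<lambda>k. a (k + m) - b (k + m)"]) auto
  then have "a m - b m = 0" using LIM_unique[OF _ tendsto_const] by fastforce
  with m show False by simp
qed

section \<open>Entire power series, majorants and the generating function\<close>

definition entire :: "real fps \<Rightarrow> bool" where
  "entire F \<longleftrightarrow> fps_conv_radius F = \<infinity>"

lemma entire_mult: "entire F \<Longrightarrow> entire G \<Longrightarrow> entire (F * G)"
  using fps_conv_radius_mult[of F G] by (simp add: entire_def)

lemma entire_add: "entire F \<Longrightarrow> entire G \<Longrightarrow> entire (F + G)"
  using fps_conv_radius_add[of F G] by (simp add: entire_def)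

lemma entire_power: "entire F \<Longrightarrow> entire (F ^ n)"
  using fps_conv_radius_power[of F n] by (simp add: entire_def)

lemma entire_basic: "entire (fps_exp c)" "entire (fps_const c)" "entire fps_X" "entire 1"
  by (simp_all add: entire_def)

lemma entire_prod: "(\<And>j. j \<in> J \<Longrightarrow> entire (F j)) \<Longrightarrow> entire (\<Prod>j\<in>J. F j)"
  by (induction J rule: infinite_finite_induct) (auto intro: entire_mult entire_basic)

lemma entire_linear_power: "entire ((1 + fps_const c * fps_X) ^ n)"
  by (intro entire_power entire_add entire_mult entire_basic)

lemma eval_entire_mult: "entire F \<Longrightarrow> entire G \<Longrightarrow> eval_fps (F * G) r = eval_fps F r * eval_fps G r"
  by (rule eval_fps_mult) (auto simp: entire_def)

lemma eval_entire_prod: "(\<And>j. j \<in> J \<Longrightarrow> entire (F j)) \<Longrightarrow> eval_fps (\<Prod>j\<in>J. F j) r = (\<Prod>j\<in>J. eval_fps (F j) r)"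
  by (induction J rule: infinite_finite_induct) (auto simp: eval_entire_mult entire_prod)

lemma eval_linear_power:
  fixes c r :: real
  shows "eval_fps ((1 + fps_const c * fps_X) ^ n) r = (1 + c * r) ^ n"
proof -
  have l: "entire (fps_const c * fps_X)" "entire (1 + fps_const c * fps_X)"
    by (intro entire_add entire_mult entire_basic)+
  then have "eval_fps (1 + fps_const c * fps_X) r = 1 + c * r"
    by (subst eval_fps_add) (simp_all add: eval_entire_mult entire_basic, simp_all add: entire_def)
  then show ?thesis using l(2) by (subst eval_fps_power) (simp_all add: entire_def)
qed

text \<open>Coefficientwise domination survives products and powers, so the sum of the absolute
  coefficients of a product is bounded by the value of an explicit majorant at
  \<open>1\<close>.\<close>

definition majorized :: "real fps \<Rightarrow> real fps \<Rightarrow> bool" where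
  "majorized F G \<longleftrightarrow> (\<forall>k. \<bar>fps_nth F k\<bar> \<le> fps_nth G k)"

lemma majorized_mult:
  assumes "majorized F F'" "majorized G G'"
  shows "majorized (F * G) (F' * G')"
  unfolding majorized_def
proof
  fix k
  have "\<bar>fps_nth (F * G) k\<bar> \<le> (\<Sum>i=0..k. \<bar>fps_nth F i * fps_nth G (k - i)\<bar>)"
    by (simp add: fps_mult_nth)
  also have "\<dots> \<le> (\<Sum>i=0..k. fps_nth F' i * fps_nth G' (k - i))"
  proof (rule sum_mono)
    fix i
    have "\<bar>fps_nth F i\<bar> \<le> fps_nth F' i" "\<bar>fps_nth G (k - i)\<bar> \<le> fps_nth G' (k - i)"
      using assms by (auto simp: majorized_def)
    then show "\<bar>fps_nth F i * fps_nth G (k - i)\<bar> \<le> fps_nth F' i * fps_nth G' (k - i)"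
      unfolding abs_mult by (intro mult_mono) (auto intro: order_trans[OF abs_ge_zero])
  qed
  finally show "\<bar>fps_nth (F * G) k\<bar> \<le> fps_nth (F' * G') k" by (simp add: fps_mult_nth)
qed

lemma majorized_one: "majorized 1 1"
  by (simp add: majorized_def)

lemma majorized_power: "majorized F G \<Longrightarrow> majorized (F ^ n) (G ^ n)"
  by (induction n) (auto intro: majorized_mult majorized_one)

lemma majorized_prod: "(\<And>j. j \<in> J \<Longrightarrow> majorized (F j) (G j)) \<Longrightarrow> majorized (\<Prod>j\<in>J. F j) (\<Prod>j\<in>J. G j)"
  by (induction J rule: infinite_finite_induct) (auto intro: majorized_mult majorized_one)

lemma majorized_exp: "majorized (fps_exp c) (fps_exp \<bar>c\<bar>)"
  by (simp add: majorized_def power_abs)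

lemma majorized_linear: "majorized (1 + fps_const v * fps_X) (1 + fps_const \<bar>v\<bar> * fps_X)"
  by (auto simp: majorized_def)

text \<open>Generating function of the multivariate Charlier polynomials: the coefficient of order \<open>k\<close> is
  the \<open>k\<close>-th chaos component of the exponential \<open>\<Prod>j. exp (- u j * l j) * (1 + u j) ^ n j\<close>.\<close>

definition chaos :: "nat \<Rightarrow> (nat \<Rightarrow> real) \<Rightarrow> (nat \<Rightarrow> nat) \<Rightarrow> (nat \<Rightarrow> real) \<Rightarrow> real fps" where
  "chaos m u n l = (\<Prod>j<m. fps_exp (- (u j * l j)) * (1 + fps_const (u j) * fps_X) ^ n j)"

definition chaos_exp :: "nat \<Rightarrow> (nat \<Rightarrow> real) \<Rightarrow> (nat \<Rightarrow> nat) \<Rightarrow> (nat \<Rightarrow> real) \<Rightarrow> real \<Rightarrow> real" where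
  "chaos_exp m u n l r = (\<Prod>j<m. exp (- (u j * l j * r)) * (1 + u j * r) ^ n j)"

text \<open>The value at \<open>1\<close> of the coefficientwise majorant of \<open>chaos\<close>.
  As a function of the counts it is again a constant times a product of powers, hence integrable for
  Poisson counts, and it serves as the dominating function for all termwise integrations.\<close>

definition chaos_bound :: "nat \<Rightarrow> (nat \<Rightarrow> real) \<Rightarrow> (nat \<Rightarrow> nat) \<Rightarrow> (nat \<Rightarrow> real) \<Rightarrow> real" where
  "chaos_bound m u n l = (\<Prod>j<m. exp \<bar>u j * l j\<bar> * (1 + \<bar>u j\<bar>) ^ n j)"

lemma entire_chaos: "entire (chaos m u n l)"
  unfolding chaos_def by (intro entire_prod entire_mult entire_power entire_add entire_basic)

lemma chaos_sums: "(\<lambda>k. fps_nth (chaos m u n l) k * r ^ k) sums chaos_exp m u n l r"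
proof -
  have "eval_fps (chaos m u n l) r = chaos_exp m u n l r"
    unfolding chaos_def chaos_exp_def
    by (subst eval_entire_prod)
       (auto simp: eval_entire_mult entire_basic entire_linear_power eval_linear_power entire_mult intro!: prod.cong)
  then show ?thesis using sums_eval_fps[of r "chaos m u n l"] entire_chaos[of m u n l] by (simp add: entire_def)
qed

lemma chaos_abs_sums:
  shows "summable (\<lambda>k. \<bar>fps_nth (chaos m u n l) k\<bar>)"
    and "(\<Sum>k. \<bar>fps_nth (chaos m u n l) k\<bar>) \<le> chaos_bound m u n l"
proof -
  define G where "G = (\<Prod>j<m. fps_exp \<bar>u j * l j\<bar> * (1 + fps_const \<bar>u j\<bar> * fps_X) ^ n j)"
  have maj: "majorized (chaos m u n l) G"
    unfolding chaos_def G_def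
    using majorized_exp[of "- (u _ * l _)"]
    by (intro majorized_prod majorized_mult majorized_power majorized_linear) simp
  have G: "entire G"
    unfolding G_def by (intro entire_prod entire_mult entire_power entire_add entire_basic)
  have "eval_fps G 1 = chaos_bound m u n l"
    unfolding G_def chaos_bound_def
    by (subst eval_entire_prod)
       (auto simp: eval_entire_mult entire_basic entire_linear_power eval_linear_power entire_mult intro!: prod.cong)
  then have s: "(\<lambda>k. fps_nth G k) sums chaos_bound m u n l"
    using sums_eval_fps[of 1 G] G by (simp add: entire_def)
  show sm: "summable (\<lambda>k. \<bar>fps_nth (chaos m u n l) k\<bar>)"
    using maj by (intro summable_comparison_test'[OF sums_summable[OF s]]) (simp add: majorized_def)
  show "(\<Sum>k. \<bar>fps_nth (chaos m u n l) k\<bar>) \<le> chaos_bound m u n l"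
    using maj sums_unique[OF s] suminf_le[OF _ sm sums_summable[OF s]] by (simp add: majorized_def)
qed

lemma chaos_abs_le: "\<bar>fps_nth (chaos m u n l) k\<bar> \<le> chaos_bound m u n l"
proof -
  have "(\<Sum>i\<in>{k}. \<bar>fps_nth (chaos m u n l) i\<bar>) \<le> (\<Sum>i. \<bar>fps_nth (chaos m u n l) i\<bar>)"
    by (rule sum_le_suminf[OF chaos_abs_sums(1)]) auto
  then show ?thesis using chaos_abs_sums(2)[of m u n l] by simp
qed

lemma chaos_bound_nonneg: "0 \<le> chaos_bound m u n l"
  unfolding chaos_bound_def by (intro prod_nonneg) auto

lemma chaos_0 [simp]: "fps_nth (chaos m u n l) 0 = 1"
  unfolding chaos_def by (induction m) (auto simp: fps_mult_nth_0 fps_power_zeroth)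

text \<open>Adding counts and means multiplies generating functions. Applied to revealed and hidden
  counts this exhibits each chaos level as a convolution.\<close>

lemma chaos_add:
  "chaos m u (\<lambda>j. n j + n' j) (\<lambda>j. l j + l' j) = chaos m u n l * chaos m u n' l'"
  unfolding chaos_def prod.distrib[symmetric]
proof (rule prod.cong[OF refl])
  fix j
  have "fps_exp (- (u j * (l j + l' j))) = fps_exp (- (u j * l j)) * fps_exp (- (u j * l' j))"
    by (simp add: fps_exp_add_mult[symmetric] distrib_left)
  then show "fps_exp (- (u j * (l j + l' j))) * (1 + fps_const (u j) * fps_X) ^ (n j + n' j) =
      fps_exp (- (u j * l j)) * (1 + fps_const (u j) * fps_X) ^ n j *
      (fps_exp (- (u j * l' j)) * (1 + fps_const (u j) * fps_X) ^ n' j)"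
    by (simp add: power_add mult_ac)
qed

lemma chaos_cong: "(\<And>j. j < m \<Longrightarrow> n j = n' j \<and> l j = l' j \<and> u j = u' j) \<Longrightarrow> chaos m u n l = chaos m u' n' l'"
  unfolding chaos_def by (intro prod.cong) auto

lemma measurable_chaos:
  assumes "\<And>j. j < m \<Longrightarrow> (\<lambda>\<omega>. n \<omega> j) \<in> M \<rightarrow>\<^sub>M count_space UNIV" "\<And>j. j < m \<Longrightarrow> (\<lambda>\<omega>. l \<omega> j) \<in> borel_measurable M"
  shows "(\<lambda>\<omega>. fps_nth (chaos m u (n \<omega>) (l \<omega>)) k) \<in> borel_measurable M"
  using assms
proof (induction m arbitrary: k)
  case 0
  then show ?case by (simp add: chaos_def)
next
  case (Suc m)
  have [measurable]: "(\<lambda>\<omega>. fps_nth (chaos m u (n \<omega>) (l \<omega>)) k) \<in> borel_measurable M" for k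
    using Suc by auto
  have [measurable]: "(\<lambda>\<omega>. fps_nth ((1 + fps_const (u m) * fps_X) ^ n \<omega> m) k) \<in> borel_measurable M" for k
    using Suc(2)[of m] by (rule measurable_compose) simp_all
  have [measurable]: "(\<lambda>\<omega>. l \<omega> m) \<in> borel_measurable M" using Suc(3)[of m] by simp
  have eq: "chaos (Suc m) u (n \<omega>) (l \<omega>) = chaos m u (n \<omega>) (l \<omega>) * (fps_exp (- (u m * l \<omega> m)) * (1 + fps_const (u m) * fps_X) ^ n \<omega> m)" for \<omega>
    by (simp add: chaos_def)
  show ?case unfolding eq fps_mult_nth fps_exp_nth by measurable
qed

text \<open>Termwise integration of a random power series on the closed unit interval: the
  integrable \<open>D\<close> dominates the sum of the absolute coefficients and therefore every
  partial sum.\<close>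

lemma powser_integral:
  fixes F :: "'b \<Rightarrow> nat \<Rightarrow> real"
  assumes [measurable]: "\<And>k. (\<lambda>\<omega>. F \<omega> k) \<in> borel_measurable M"
    and s: "\<And>\<omega>. summable (\<lambda>k. \<bar>F \<omega> k\<bar>)" and le: "\<And>\<omega>. (\<Sum>k. \<bar>F \<omega> k\<bar>) \<le> D \<omega>" and D: "integrable M D"
    and r: "\<bar>r\<bar> \<le> 1"
  shows "integrable M (\<lambda>\<omega>. F \<omega> k)" and "(\<lambda>k. (\<integral>\<omega>. F \<omega> k \<partial>M) * r ^ k) sums (\<integral>\<omega>. (\<Sum>k. F \<omega> k * r ^ k) \<partial>M)"
proof -
  have part: "(\<Sum>k\<in>K. \<bar>F \<omega> k\<bar>) \<le> D \<omega>" if "finite K" for K \<omega>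
    using sum_le_suminf[OF s that] le[of \<omega>] by (meson abs_ge_zero order_trans)
  show int: "integrable M (\<lambda>\<omega>. F \<omega> k)" for k
    using part[of "{k}"] by (intro Bochner_Integration.integrable_bound[OF D]) (auto intro!: AE_I2 order_trans[OF _ abs_ge_self])
  have i: "integrable M (\<lambda>\<omega>. F \<omega> k * r ^ k)" for k using int by simp
  have b: "\<bar>F \<omega> k * r ^ k\<bar> \<le> \<bar>F \<omega> k\<bar>" for \<omega> k
    using r power_le_one[of "\<bar>r\<bar>" k] by (simp add: abs_mult power_abs mult_left_le)
  have "(\<lambda>k. \<integral>\<omega>. F \<omega> k * r ^ k \<partial>M) sums (\<integral>\<omega>. (\<Sum>k. F \<omega> k * r ^ k) \<partial>M)"
  proof (rule sums_integral[OF i])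
    show "AE \<omega> in M. summable (\<lambda>k. norm (F \<omega> k * r ^ k))"
      using b by (intro AE_I2 summable_comparison_test'[OF s]) auto
    show "summable (\<lambda>k. \<integral>\<omega>. norm (F \<omega> k * r ^ k) \<partial>M)"
    proof (rule summableI_nonneg_bounded)
      fix K
      have "(\<Sum>k<K. \<integral>\<omega>. norm (F \<omega> k * r ^ k) \<partial>M) = (\<integral>\<omega>. (\<Sum>k<K. norm (F \<omega> k * r ^ k)) \<partial>M)"
        using i by (intro Bochner_Integration.integral_sum[symmetric]) auto
      also have "\<dots> \<le> (\<integral>\<omega>. D \<omega> \<partial>M)"
      proof (rule integral_mono)
        fix \<omega>
        have "(\<Sum>k<K. norm (F \<omega> k * r ^ k)) \<le> (\<Sum>k<K. \<bar>F \<omega> k\<bar>)" using b by (intro sum_mono) auto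
        then show "(\<Sum>k<K. norm (F \<omega> k * r ^ k)) \<le> D \<omega>" using part[of "{..<K}" \<omega>] by simp
      qed (use i D in \<open>auto intro!: Bochner_Integration.integrable_sum\<close>)
      finally show "(\<Sum>k<K. \<integral>\<omega>. norm (F \<omega> k * r ^ k) \<partial>M) \<le> (\<integral>\<omega>. D \<omega> \<partial>M)" .
    qed (auto intro!: Bochner_Integration.integral_nonneg)
  qed
  then show "(\<lambda>k. (\<integral>\<omega>. F \<omega> k \<partial>M) * r ^ k) sums (\<integral>\<omega>. (\<Sum>k. F \<omega> k * r ^ k) \<partial>M)" by simp
qed

text \<open>Independent Poisson counts with means \<open>l j\<close>, encoded by their joint
  generating function. Its values at all positive arguments, also above \<open>1\<close>, give the
  exponential moments behind the dominating functions.\<close>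

locale poisson_vector = prob_space M for M :: "'b measure" +
  fixes m :: nat and n :: "'b \<Rightarrow> nat \<Rightarrow> nat" and l :: "nat \<Rightarrow> real"
  assumes measurable_n: "\<And>j. j < m \<Longrightarrow> (\<lambda>\<omega>. n \<omega> j) \<in> M \<rightarrow>\<^sub>M count_space UNIV"
    and pgf: "\<And>z. (\<And>j. j < m \<Longrightarrow> 0 < z j) \<Longrightarrow>
      (\<integral>\<^sup>+\<omega>. ennreal (\<Prod>j<m. z j ^ n \<omega> j) \<partial>M) = ennreal (exp (\<Sum>j<m. l j * (z j - 1)))"
begin

lemma measurable_monomial:
  "(\<lambda>\<omega>. \<Prod>j<m. z j ^ n \<omega> j :: real) \<in> borel_measurable M"
  by (intro borel_measurable_prod measurable_compose[OF measurable_n]) auto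

lemma pgf_integral:
  assumes z: "\<And>j. j < m \<Longrightarrow> 0 < z j"
  shows "integrable M (\<lambda>\<omega>. \<Prod>j<m. z j ^ n \<omega> j)"
    and "(\<integral>\<omega>. (\<Prod>j<m. z j ^ n \<omega> j) \<partial>M) = exp (\<Sum>j<m. l j * (z j - 1))"
proof -
  have nn: "0 \<le> (\<Prod>j<m. z j ^ n \<omega> j)" for \<omega> using z by (intro prod_nonneg zero_le_power) (auto intro: less_imp_le)
  show "integrable M (\<lambda>\<omega>. \<Prod>j<m. z j ^ n \<omega> j)"
    using measurable_monomial nn pgf[OF z] by (intro integrableI_nonneg) auto
  show "(\<integral>\<omega>. (\<Prod>j<m. z j ^ n \<omega> j) \<partial>M) = exp (\<Sum>j<m. l j * (z j - 1))"
    using measurable_monomial nn pgf[OF z] by (subst integral_eq_nn_integral) auto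
qed

lemma measurable_coeff [measurable]: "(\<lambda>\<omega>. fps_nth (chaos m u (n \<omega>) l) k) \<in> borel_measurable M"
  by (rule measurable_chaos[OF measurable_n]) simp_all

text \<open>The terms of \<open>(1 + u * r) * (1 + v * s) - 1\<close> that are linear in
  \<open>u\<close> or \<open>v\<close> cancel against the normalizing exponentials; only
  \<open>u * v * r * s\<close> is left. The bounds on \<open>u\<close> and \<open>v\<close> keep the
  arguments of the generating function positive.\<close>

lemma chaos_exp_mult_integral:
  assumes uv: "\<And>j. j < m \<Longrightarrow> \<bar>u j\<bar> < 1" "\<And>j. j < m \<Longrightarrow> \<bar>v j\<bar> < 1" and rs: "\<bar>r\<bar> \<le> 1" "\<bar>s\<bar> \<le> 1"
  shows "(\<integral>\<omega>. chaos_exp m u (n \<omega>) l r * chaos_exp m v (n \<omega>) l s \<partial>M) = exp (r * s * (\<Sum>j<m. l j * u j * v j))"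
proof -
  define z where "z j = (1 + u j * r) * (1 + v j * s)" for j
  have pos: "0 < 1 + a * b" if "\<bar>a\<bar> < 1" "\<bar>b\<bar> \<le> 1" for a b :: real
  proof -
    have "\<bar>a * b\<bar> \<le> \<bar>a\<bar> * 1" unfolding abs_mult using that by (intro mult_left_mono) auto
    then show ?thesis using that by linarith
  qed
  have z: "0 < z j" if "j < m" for j unfolding z_def using pos uv rs that by simp
  have "chaos_exp m u (n \<omega>) l r * chaos_exp m v (n \<omega>) l s =
      exp (\<Sum>j<m. - (u j * l j * r) - v j * l j * s) * (\<Prod>j<m. z j ^ n \<omega> j)" for \<omega>
    unfolding chaos_exp_def z_def exp_sum[OF finite_lessThan] prod.distrib[symmetric]
    by (intro prod.cong refl) (simp only: power_mult_distrib diff_conv_add_uminus exp_add mult_ac)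
  then have "(\<integral>\<omega>. chaos_exp m u (n \<omega>) l r * chaos_exp m v (n \<omega>) l s \<partial>M) =
      exp (\<Sum>j<m. - (u j * l j * r) - v j * l j * s) * exp (\<Sum>j<m. l j * (z j - 1))"
    by (simp add: pgf_integral(2)[OF z])
  also have "\<dots> = exp (\<Sum>j<m. (- (u j * l j * r) - v j * l j * s) + l j * (z j - 1))"
    by (simp only: exp_add[symmetric] sum.distrib)
  also have "(\<Sum>j<m. (- (u j * l j * r) - v j * l j * s) + l j * (z j - 1)) = r * s * (\<Sum>j<m. l j * u j * v j)"
    unfolding sum_distrib_left by (rule sum.cong) (auto simp: z_def algebra_simps)
  finally show ?thesis .
qed

lemma integrable_chaos_bound: "integrable M (\<lambda>\<omega>. chaos_bound m u (n \<omega>) l * chaos_bound m v (n \<omega>) l)"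
proof -
  have z: "0 < (1 + \<bar>u j\<bar>) * (1 + \<bar>v j\<bar>)" for j by (intro mult_pos_pos) auto
  have "chaos_bound m u (n \<omega>) l * chaos_bound m v (n \<omega>) l =
      (\<Prod>j<m. exp \<bar>u j * l j\<bar> * exp \<bar>v j * l j\<bar>) * (\<Prod>j<m. ((1 + \<bar>u j\<bar>) * (1 + \<bar>v j\<bar>)) ^ n \<omega> j)" for \<omega>
    unfolding chaos_bound_def prod.distrib[symmetric] by (simp add: power_mult_distrib mult_ac)
  then show ?thesis using pgf_integral(1)[OF z] by simp
qed

text \<open>\<open>exp (r * s * \<alpha>)\<close> contains only equal powers of \<open>r\<close> and
  \<open>s\<close>. The coefficients are compared first in \<open>r\<close> with \<open>s\<close>
  fixed and then in \<open>s\<close>, each time by uniqueness of a power series in one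
  variable.\<close>

lemma chaos_orthogonal:
  assumes uv: "\<And>j. j < m \<Longrightarrow> \<bar>u j\<bar> < 1" "\<And>j. j < m \<Longrightarrow> \<bar>v j\<bar> < 1"
  shows "integrable M (\<lambda>\<omega>. fps_nth (chaos m u (n \<omega>) l) k * fps_nth (chaos m v (n \<omega>) l) k')"
    and "(\<integral>\<omega>. fps_nth (chaos m u (n \<omega>) l) k * fps_nth (chaos m v (n \<omega>) l) k' \<partial>M) =
      (if k = k' then (\<Sum>j<m. l j * u j * v j) ^ k / fact k else 0)"
proof -
  define \<alpha> where "\<alpha> = (\<Sum>j<m. l j * u j * v j)"
  let ?c = "\<lambda>\<omega>. fps_nth (chaos m u (n \<omega>) l)" and ?d = "\<lambda>\<omega>. fps_nth (chaos m v (n \<omega>) l)"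
  let ?C = "\<lambda>\<omega>. chaos_bound m u (n \<omega>) l" and ?D = "\<lambda>\<omega>. chaos_bound m v (n \<omega>) l"
  have exp_meas [measurable]: "(\<lambda>\<omega>. chaos_exp m v (n \<omega>) l s) \<in> borel_measurable M" for s
    unfolding chaos_exp_def prod.distrib using measurable_monomial[of "\<lambda>j. 1 + v j * s"] by simp
  have exp_le: "\<bar>chaos_exp m v (n \<omega>) l s\<bar> \<le> ?D \<omega>" if "\<bar>s\<bar> \<le> 1" for s \<omega>
    unfolding chaos_exp_def chaos_bound_def abs_prod
  proof (rule prod_mono, safe)
    fix j
    have "\<bar>u * s\<bar> \<le> \<bar>u\<bar>" for u :: real
      unfolding abs_mult using that by (simp add: mult_left_le)
    then have a: "\<bar>v j * s\<bar> \<le> \<bar>v j\<bar>" "\<bar>v j * l j * s\<bar> \<le> \<bar>v j * l j\<bar>" by blast+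
    have "\<bar>1 + v j * s\<bar> \<le> 1 + \<bar>v j\<bar>" using a(1) by linarith
    then have "\<bar>1 + v j * s\<bar> ^ n \<omega> j \<le> (1 + \<bar>v j\<bar>) ^ n \<omega> j" by (intro power_mono) auto
    moreover have "exp (- (v j * l j * s)) \<le> exp \<bar>v j * l j\<bar>" using a(2) by simp
    ultimately show "\<bar>exp (- (v j * l j * s)) * (1 + v j * s) ^ n \<omega> j\<bar> \<le> exp \<bar>v j * l j\<bar> * (1 + \<bar>v j\<bar>) ^ n \<omega> j"
      unfolding abs_mult power_abs by (intro mult_mono) auto
  qed simp
  have step1: "(\<lambda>k. (\<integral>\<omega>. ?c \<omega> k * chaos_exp m v (n \<omega>) l s \<partial>M) * r ^ k) sums exp (r * s * \<alpha>)"
    if rs: "\<bar>r\<bar> \<le> 1" "\<bar>s\<bar> \<le> 1" for r s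
  proof -
    let ?e = "\<lambda>\<omega>. chaos_exp m v (n \<omega>) l s"
    have sm: "summable (\<lambda>k. \<bar>?c \<omega> k * ?e \<omega>\<bar>)" for \<omega>
      unfolding abs_mult by (intro summable_mult2 chaos_abs_sums)
    have "(\<Sum>k. \<bar>?c \<omega> k * ?e \<omega>\<bar>) \<le> ?C \<omega> * ?D \<omega>" for \<omega>
    proof -
      have "(\<Sum>k. \<bar>?c \<omega> k * ?e \<omega>\<bar>) = (\<Sum>k. \<bar>?c \<omega> k\<bar>) * \<bar>?e \<omega>\<bar>"
        unfolding abs_mult by (rule suminf_mult2[symmetric, OF chaos_abs_sums(1)])
      also have "\<dots> \<le> ?C \<omega> * ?D \<omega>"
        by (intro mult_mono chaos_abs_sums exp_le rs) (simp_all add: chaos_bound_nonneg)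
      finally show ?thesis .
    qed
    from powser_integral(2)[OF _ sm this integrable_chaos_bound rs(1)]
    have "(\<lambda>k. (\<integral>\<omega>. ?c \<omega> k * ?e \<omega> \<partial>M) * r ^ k) sums (\<integral>\<omega>. (\<Sum>k. ?c \<omega> k * ?e \<omega> * r ^ k) \<partial>M)" by simp
    also have "(\<integral>\<omega>. (\<Sum>k. ?c \<omega> k * ?e \<omega> * r ^ k) \<partial>M) = (\<integral>\<omega>. chaos_exp m u (n \<omega>) l r * ?e \<omega> \<partial>M)"
    proof (rule Bochner_Integration.integral_cong[OF refl])
      fix \<omega>
      have "(\<lambda>k. ?c \<omega> k * r ^ k * ?e \<omega>) sums (chaos_exp m u (n \<omega>) l r * ?e \<omega>)"
        by (rule sums_mult2[OF chaos_sums])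
      then show "(\<Sum>k. ?c \<omega> k * ?e \<omega> * r ^ k) = chaos_exp m u (n \<omega>) l r * ?e \<omega>"
        by (simp add: sums_unique[symmetric] mult_ac)
    qed
    finally show ?thesis using chaos_exp_mult_integral[OF uv rs] by (simp add: \<alpha>_def)
  qed
  have exp_series: "(\<lambda>k. (s * \<alpha>) ^ k / fact k * r ^ k) sums exp (r * s * \<alpha>)" for r s
  proof -
    have "(\<lambda>k. (r * s * \<alpha>) ^ k /\<^sub>R fact k) sums exp (r * s * \<alpha>)" by (rule exp_converges)
    moreover have "(\<lambda>k. (r * s * \<alpha>) ^ k /\<^sub>R fact k) = (\<lambda>k. (s * \<alpha>) ^ k / fact k * r ^ k)"
      by (auto simp: power_mult_distrib field_simps)
    ultimately show ?thesis by simp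
  qed
  \<comment> \<open>One generating function is now resolved into its coefficients, while the other
    is still evaluated as a whole at \<open>s\<close>.\<close>
  have mom1: "(\<integral>\<omega>. ?c \<omega> k * chaos_exp m v (n \<omega>) l s \<partial>M) = (s * \<alpha>) ^ k / fact k" if s: "\<bar>s\<bar> \<le> 1" for s k
    using powser_unique[OF step1[OF _ s] exp_series] by metis
  have sm2: "summable (\<lambda>k'. \<bar>?c \<omega> k * ?d \<omega> k'\<bar>)" for \<omega> k
    unfolding abs_mult by (intro summable_mult chaos_abs_sums)
  have le2: "(\<Sum>k'. \<bar>?c \<omega> k * ?d \<omega> k'\<bar>) \<le> ?C \<omega> * ?D \<omega>" for \<omega> k
  proof -
    have "(\<Sum>k'. \<bar>?c \<omega> k * ?d \<omega> k'\<bar>) = \<bar>?c \<omega> k\<bar> * (\<Sum>k'. \<bar>?d \<omega> k'\<bar>)"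
      unfolding abs_mult by (rule suminf_mult[OF chaos_abs_sums(1)])
    also have "\<dots> \<le> ?C \<omega> * ?D \<omega>"
      by (intro mult_mono chaos_abs_sums chaos_abs_le suminf_nonneg) (simp_all add: chaos_bound_nonneg)
    finally show ?thesis .
  qed
  note P = powser_integral[OF _ sm2 le2 integrable_chaos_bound]
  show "integrable M (\<lambda>\<omega>. ?c \<omega> k * ?d \<omega> k')" by (rule P(1)[where r=0]) auto
  have step2: "(\<lambda>k'. (\<integral>\<omega>. ?c \<omega> k * ?d \<omega> k' \<partial>M) * s ^ k') sums ((s * \<alpha>) ^ k / fact k)" if s: "\<bar>s\<bar> \<le> 1" for s
  proof -
    have "(\<lambda>k'. (\<integral>\<omega>. ?c \<omega> k * ?d \<omega> k' \<partial>M) * s ^ k') sums (\<integral>\<omega>. (\<Sum>k'. ?c \<omega> k * ?d \<omega> k' * s ^ k') \<partial>M)"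
      by (rule P(2)) (use s in auto)
    also have "(\<integral>\<omega>. (\<Sum>k'. ?c \<omega> k * ?d \<omega> k' * s ^ k') \<partial>M) = (\<integral>\<omega>. ?c \<omega> k * chaos_exp m v (n \<omega>) l s \<partial>M)"
    proof (rule Bochner_Integration.integral_cong[OF refl])
      fix \<omega>
      have "(\<lambda>k'. ?c \<omega> k * (?d \<omega> k' * s ^ k')) sums (?c \<omega> k * chaos_exp m v (n \<omega>) l s)"
        by (rule sums_mult[OF chaos_sums])
      then show "(\<Sum>k'. ?c \<omega> k * ?d \<omega> k' * s ^ k') = ?c \<omega> k * chaos_exp m v (n \<omega>) l s"
        by (simp add: sums_unique[symmetric] mult_ac)
    qed
    finally show ?thesis by (simp add: mom1[OF s])
  qed
  have single: "(\<lambda>k'. (if k = k' then \<alpha> ^ k / fact k else 0) * s ^ k') sums ((s * \<alpha>) ^ k / fact k)" for s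
  proof -
    have "(\<lambda>k'. (if k = k' then \<alpha> ^ k / fact k else 0) * s ^ k') sums (\<Sum>k'\<in>{k}. (if k = k' then \<alpha> ^ k / fact k else 0) * s ^ k')"
      by (rule sums_finite) auto
    then show ?thesis by (simp add: power_mult_distrib mult_ac)
  qed
  show "(\<integral>\<omega>. ?c \<omega> k * ?d \<omega> k' \<partial>M) = (if k = k' then (\<Sum>j<m. l j * u j * v j) ^ k / fact k else 0)"
    using powser_unique[OF step2 single] unfolding \<alpha>_def by meson
qed

end

section \<open>The Schramm-Steif inequality\<close>

text \<open>The order in which variances of linear combinations of chaoses are compared. The
  coefficients of an approximant have arbitrary signs, so entrywise inequalities between the kernels
  would not suffice.\<close>

definition psd :: "nat \<Rightarrow> (nat \<Rightarrow> nat \<Rightarrow> real) \<Rightarrow> bool" where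
  "psd r K \<longleftrightarrow> (\<forall>a. 0 \<le> (\<Sum>i<r. \<Sum>i'<r. a i * a i' * K i i'))"

text \<open>With cell masses as \<open>q\<close>, this is the \<open>L2\<close> inner product of the
  step functions that take the values \<open>u i j\<close> and \<open>u i' j\<close> on the
  cells.\<close>

definition gram :: "nat \<Rightarrow> (nat \<Rightarrow> real) \<Rightarrow> (nat \<Rightarrow> nat \<Rightarrow> real) \<Rightarrow> nat \<Rightarrow> nat \<Rightarrow> real" where
  "gram m q u i i' = (\<Sum>j<m. q j * u i j * u i' j)"

lemma psd_one: "psd r (\<lambda>i i'. 1)"
proof -
  have "(\<Sum>i<r. \<Sum>i'<r. a i * a i') = (\<Sum>i<r. a i)\<^sup>2" for a :: "nat \<Rightarrow> real"
    by (simp add: power2_eq_square sum_product)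
  then show ?thesis by (simp add: psd_def)
qed

lemma psd_add: "psd r K \<Longrightarrow> psd r K' \<Longrightarrow> psd r (\<lambda>i i'. K i i' + K' i i')"
  by (simp add: psd_def distrib_left sum.distrib add_nonneg_nonneg)

text \<open>The case of the Schur product theorem in which one factor is an explicit Gram matrix:
  expanding it gives a nonnegative combination of forms of \<open>K\<close>, evaluated at the
  rescaled vectors \<open>a i * u i j\<close>.\<close>

lemma psd_gram_mult:
  assumes K: "psd r K" and q: "\<And>j. j < m \<Longrightarrow> 0 \<le> q j"
  shows "psd r (\<lambda>i i'. gram m q u i i' * K i i')"
  unfolding psd_def
proof
  fix a :: "nat \<Rightarrow> real"
  have "(\<Sum>i<r. \<Sum>i'<r. a i * a i' * (gram m q u i i' * K i i')) =
      (\<Sum>i<r. \<Sum>i'<r. \<Sum>j<m. q j * ((a i * u i j) * (a i' * u i' j) * K i i'))"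
    by (simp add: gram_def sum_distrib_left sum_distrib_right mult_ac)
  also have "\<dots> = (\<Sum>i<r. \<Sum>j<m. \<Sum>i'<r. q j * ((a i * u i j) * (a i' * u i' j) * K i i'))"
    by (rule sum.cong[OF refl], rule sum.swap)
  also have "\<dots> = (\<Sum>j<m. \<Sum>i<r. \<Sum>i'<r. q j * ((a i * u i j) * (a i' * u i' j) * K i i'))"
    by (rule sum.swap)
  also have "\<dots> = (\<Sum>j<m. q j * (\<Sum>i<r. \<Sum>i'<r. (a i * u i j) * (a i' * u i' j) * K i i'))"
    by (simp add: sum_distrib_left)
  also have "\<dots> \<ge> 0"
    using q by (intro sum_nonneg[of "{..<m}"] mult_nonneg_nonneg K[unfolded psd_def, rule_format]) auto
  finally show "0 \<le> (\<Sum>i<r. \<Sum>i'<r. a i * a i' * (gram m q u i i' * K i i'))" .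
qed

lemma psd_gram_power_mult:
  assumes "psd r K" "\<And>j. j < m \<Longrightarrow> 0 \<le> q j"
  shows "psd r (\<lambda>i i'. gram m q u i i' ^ k * K i i')"
proof (induction k)
  case (Suc k)
  from psd_gram_mult[OF Suc assms(2)] show ?case by (simp add: mult.assoc)
qed (use assms in simp)

lemma psd_gram_power:
  assumes "\<And>j. j < m \<Longrightarrow> 0 \<le> q j"
  shows "psd r (\<lambda>i i'. gram m q u i i' ^ k)"
  using psd_gram_power_mult[OF psd_one, of m q r u k] assms by simp

lemma gram_diff: "gram m p u i i' - gram m q u i i' = gram m (\<lambda>j. p j - q j) u i i'"
  by (simp add: gram_def sum_subtractf[symmetric] left_diff_distrib)

text \<open>Monotonicity of entrywise powers, by splitting \<open>p ^ (k + 1) - q ^ (k + 1)\<close>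
  into \<open>p * (p ^ k - q ^ k)\<close> and \<open>(p - q) * q ^ k\<close>.\<close>

lemma psd_gram_power_diff:
  assumes q: "\<And>j. j < m \<Longrightarrow> 0 \<le> q j" "\<And>j. j < m \<Longrightarrow> q j \<le> p j"
  shows "psd r (\<lambda>i i'. gram m p u i i' ^ k - gram m q u i i' ^ k)"
proof (induction k)
  case 0
  then show ?case by (simp add: psd_def)
next
  case (Suc k)
  have p: "0 \<le> p j" if "j < m" for j using q[OF that] by simp
  have "psd r (\<lambda>i i'. gram m (\<lambda>j. p j - q j) u i i' * gram m q u i i' ^ k)"
    using q by (intro psd_gram_mult psd_gram_power) auto
  then have "psd r (\<lambda>i i'. gram m p u i i' * (gram m p u i i' ^ k - gram m q u i i' ^ k)
      + gram m (\<lambda>j. p j - q j) u i i' * gram m q u i i' ^ k)"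
    by (intro psd_add psd_gram_mult[OF Suc] p)
  then show ?case by (simp add: gram_diff[symmetric] algebra_simps)
qed

text \<open>Convexity of \<open>x ^ (k + 1)\<close>, with tangent point \<open>p\<close>, for
  entrywise powers in the positive semidefinite order. The inductive step multiplies the previous
  inequality by \<open>p\<close> and adds \<open>(p - q)\<close> times the monotonicity gap. The
  factor \<open>k + 1\<close> is the source of the level factor in the Schramm-Steif bound.\<close>

lemma psd_gram_power_tangent:
  assumes q: "\<And>j. j < m \<Longrightarrow> 0 \<le> q j" "\<And>j. j < m \<Longrightarrow> q j \<le> p j"
  shows "psd r (\<lambda>i i'. real (Suc k) * gram m p u i i' ^ k * gram m (\<lambda>j. p j - q j) u i i'
    - (gram m p u i i' ^ Suc k - gram m q u i i' ^ Suc k))"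
proof (induction k)
  case 0
  then show ?case by (simp add: psd_def gram_diff[symmetric])
next
  case (Suc k)
  have p: "0 \<le> p j" if "j < m" for j using q[OF that] by simp
  let ?d = "gram m (\<lambda>j. p j - q j) u"
  have "psd r (\<lambda>i i'. ?d i i' * (gram m p u i i' ^ Suc k - gram m q u i i' ^ Suc k))"
    using q by (intro psd_gram_mult psd_gram_power_diff) auto
  then have "psd r (\<lambda>i i'. gram m p u i i' * (real (Suc k) * gram m p u i i' ^ k * ?d i i'
      - (gram m p u i i' ^ Suc k - gram m q u i i' ^ Suc k))
      + ?d i i' * (gram m p u i i' ^ Suc k - gram m q u i i' ^ Suc k))"
    by (intro psd_add psd_gram_mult[OF Suc] p)
  then show ?case by (simp add: gram_diff[symmetric] algebra_simps)
qed

definition quad :: "nat \<Rightarrow> (nat \<Rightarrow> real) \<Rightarrow> (nat \<Rightarrow> nat \<Rightarrow> real) \<Rightarrow> real" where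
  "quad r a K = (\<Sum>i<r. \<Sum>i'<r. a i * a i' * K i i')"

lemma quad_nonneg: "psd r K \<Longrightarrow> 0 \<le> quad r a K"
  by (simp add: psd_def quad_def)

lemma quad_diff: "quad r a (\<lambda>i i'. K i i' - K' i i') = quad r a K - quad r a K'"
  by (simp add: quad_def right_diff_distrib sum_subtractf)

lemma quad_divide: "quad r a (\<lambda>i i'. K i i' / c) = quad r a K / c"
  by (simp add: quad_def sum_divide_distrib)

lemma quad_cmult: "quad r a (\<lambda>i i'. c * K i i') = c * quad r a K"
  by (simp add: quad_def sum_distrib_left mult_ac)

text \<open>Orthogonality to the coefficient of order \<open>0\<close>, which is the constant
  \<open>1\<close>.\<close>

lemma (in poisson_vector) chaos_mean:
  assumes "\<And>j. j < m \<Longrightarrow> \<bar>u j\<bar> < 1"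
  shows "integrable M (\<lambda>\<omega>. fps_nth (chaos m u (n \<omega>) l) k)"
    and "(\<integral>\<omega>. fps_nth (chaos m u (n \<omega>) l) k \<partial>M) = of_bool (k = 0)"
  using chaos_orthogonal[of u "\<lambda>_. 0" k 0] assms by (auto simp: power_0_left)

text \<open>The coefficients \<open>a i q\<close> will be the revealed parts of a chaos level,
  frozen while the hidden counts are averaged. Terms with different hidden orders
  \<open>k - q\<close> are orthogonal, so the second moment is a sum over \<open>q\<close>.\<close>

lemma (in poisson_vector) chaos_quad:
  assumes u: "\<And>i j. i < r \<Longrightarrow> j < m \<Longrightarrow> \<bar>u i j\<bar> < 1"
  shows "integrable M (\<lambda>\<omega>. (\<Sum>i<r. \<Sum>q\<le>k. a i q * fps_nth (chaos m (u i) (n \<omega>) l) (k - q))\<^sup>2)"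
    and "(\<integral>\<omega>. (\<Sum>i<r. \<Sum>q\<le>k. a i q * fps_nth (chaos m (u i) (n \<omega>) l) (k - q))\<^sup>2 \<partial>M) =
      (\<Sum>q\<le>k. quad r (\<lambda>i. a i q) (\<lambda>i i'. gram m l u i i' ^ (k - q) / fact (k - q)))"
proof -
  let ?d = "\<lambda>i \<omega> q. fps_nth (chaos m (u i) (n \<omega>) l) (k - q)"
  have eq: "(\<Sum>i<r. \<Sum>q\<le>k. a i q * ?d i \<omega> q)\<^sup>2 =
      (\<Sum>i<r. \<Sum>i'<r. \<Sum>q\<le>k. \<Sum>q'\<le>k. a i q * a i' q' * (?d i \<omega> q * ?d i' \<omega> q'))" for \<omega>
    by (simp add: power2_eq_square sum_product mult_ac)
  have int: "integrable M (\<lambda>\<omega>. ?d i \<omega> q * ?d i' \<omega> q')"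
    and val: "(\<integral>\<omega>. ?d i \<omega> q * ?d i' \<omega> q' \<partial>M) = (if k - q = k - q' then gram m l u i i' ^ (k - q) / fact (k - q) else 0)"
    if "i < r" "i' < r" for i i' q q'
    using chaos_orthogonal[of "u i" "u i'" "k - q" "k - q'"] u that by (auto simp: gram_def)
  have hb: "has_bochner_integral M (\<lambda>\<omega>. (\<Sum>i<r. \<Sum>q\<le>k. a i q * ?d i \<omega> q)\<^sup>2)
      (\<Sum>i<r. \<Sum>i'<r. \<Sum>q\<le>k. \<Sum>q'\<le>k. a i q * a i' q' * (\<integral>\<omega>. ?d i \<omega> q * ?d i' \<omega> q' \<partial>M))"
    unfolding eq using int
    by (intro has_bochner_integral_sum has_bochner_integral_mult_right) (simp add: has_bochner_integral_iff)
  then show "integrable M (\<lambda>\<omega>. (\<Sum>i<r. \<Sum>q\<le>k. a i q * ?d i \<omega> q)\<^sup>2)"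
    by (simp add: has_bochner_integral_iff)
  have "(\<integral>\<omega>. (\<Sum>i<r. \<Sum>q\<le>k. a i q * ?d i \<omega> q)\<^sup>2 \<partial>M) =
      (\<Sum>i<r. \<Sum>i'<r. \<Sum>q\<le>k. \<Sum>q'\<le>k. a i q * a i' q' * (\<integral>\<omega>. ?d i \<omega> q * ?d i' \<omega> q' \<partial>M))"
    using hb by (simp add: has_bochner_integral_iff)
  also have "\<dots> = (\<Sum>i<r. \<Sum>i'<r. \<Sum>q\<le>k. a i q * a i' q * (gram m l u i i' ^ (k - q) / fact (k - q)))"
  proof (intro sum.cong refl)
    fix i i' q assume i: "i \<in> {..<r}" "i' \<in> {..<r}" and q: "q \<in> {..k}"
    \<comment> \<open>Truncated subtraction does no harm: both indices are at most \<open>k\<close>,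
      so \<open>k - q = k - q'\<close> means \<open>q = q'\<close>.\<close>
    have "(\<Sum>q'\<le>k. a i q * a i' q' * (\<integral>\<omega>. ?d i \<omega> q * ?d i' \<omega> q' \<partial>M)) =
        (\<Sum>q'\<le>k. if q' = q then a i q * a i' q * (gram m l u i i' ^ (k - q) / fact (k - q)) else 0)"
      using i q by (intro sum.cong refl) (auto simp: val)
    then show "(\<Sum>q'\<le>k. a i q * a i' q' * (\<integral>\<omega>. ?d i \<omega> q * ?d i' \<omega> q' \<partial>M)) = a i q * a i' q * (gram m l u i i' ^ (k - q) / fact (k - q))"
      using q by (simp add: sum.delta')
  qed
  also have "\<dots> = (\<Sum>i<r. \<Sum>q\<le>k. \<Sum>i'<r. a i q * a i' q * (gram m l u i i' ^ (k - q) / fact (k - q)))"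
    by (rule sum.cong[OF refl], rule sum.swap)
  also have "\<dots> = (\<Sum>q\<le>k. quad r (\<lambda>i. a i q) (\<lambda>i i'. gram m l u i i' ^ (k - q) / fact (k - q)))"
    unfolding quad_def by (rule sum.swap)
  finally show "(\<integral>\<omega>. (\<Sum>i<r. \<Sum>q\<le>k. a i q * ?d i \<omega> q)\<^sup>2 \<partial>M) =
      (\<Sum>q\<le>k. quad r (\<lambda>i. a i q) (\<lambda>i i'. gram m l u i i' ^ (k - q) / fact (k - q)))" .
qed

section \<open>Counts in disjoint bounded cells\<close>

context localized_space begin

definition count :: "'a measure \<Rightarrow> 'a set \<Rightarrow> nat" where
  "count \<mu> A = nat \<lfloor>measure \<mu> A\<rfloor>"

lemma emeasure_count:
  assumes "\<mu> \<in> space N" "A \<in> sets X" "A \<subseteq> B n"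
  shows "emeasure \<mu> A = of_nat (count \<mu> A)" "measure \<mu> A = real (count \<mu> A)"
proof -
  obtain k :: nat where "emeasure \<mu> A = of_nat k" using N_natE[OF assms] .
  then show "emeasure \<mu> A = of_nat (count \<mu> A)" "measure \<mu> A = real (count \<mu> A)"
    by (simp_all add: count_def measure_def flip: ennreal_of_nat_eq_real_of_nat)
qed

lemma measurable_count:
  assumes [measurable]: "F \<in> \<Omega> \<rightarrow>\<^sub>M N" "A \<in> sets X"
  shows "(\<lambda>\<omega>. count (F \<omega>) A) \<in> \<Omega> \<rightarrow>\<^sub>M count_space UNIV"
  unfolding count_def by measurable

definition cells :: "nat \<Rightarrow> (nat \<Rightarrow> 'a set) \<Rightarrow> bool" where
  "cells m A \<longleftrightarrow> (\<forall>j<m. A j \<in> sets X \<and> (\<exists>n. A j \<subseteq> B n)) \<and> disjoint_family_on A {..<m}"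

lemma cells_sets: "cells m A \<Longrightarrow> j < m \<Longrightarrow> A j \<in> sets X"
  by (simp add: cells_def)

lemma cells_bounded: "cells m A \<Longrightarrow> j < m \<Longrightarrow> \<exists>n. A j \<subseteq> B n"
  by (simp add: cells_def)

lemma cells_diff: "cells m A \<Longrightarrow> Z \<in> sets X \<Longrightarrow> cells m (\<lambda>j. A j - Z)"
  unfolding cells_def disjoint_family_on_def by (intro conjI allI impI ballI) (blast intro: sets.Diff)+

lemma test_cells: "cells m A \<Longrightarrow> test (\<lambda>x. \<Sum>j<m. c j * indicator (A j) x)"
  by (intro test_sum) (auto simp: cells_def intro: test_indicator)

text \<open>At most one of the disjoint cells contains \<open>x\<close>, so \<open>g\<close> meets a
  single coefficient, or the value \<open>0\<close> off the cells.\<close>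

lemma cells_sum_compose:
  fixes g :: "real \<Rightarrow> real"
  assumes "cells m A" "g 0 = 0"
  shows "g (\<Sum>j<m. c j * indicator (A j) x) = (\<Sum>j<m. g (c j) * indicator (A j) x)"
proof (cases "\<exists>j<m. x \<in> A j")
  case True
  then obtain j where j: "j < m" "x \<in> A j" by auto
  have "x \<notin> A i" if "i < m" "i \<noteq> j" for i
    using assms(1) that j disjoint_family_onD[of A "{..<m}" i j] by (auto simp: cells_def)
  then have "(\<Sum>i<m. d i * indicator (A i) x) = (\<Sum>i<m. if i = j then d j else 0)" for d :: "nat \<Rightarrow> real"
    using j by (intro sum.cong) (auto split: split_indicator)
  then show ?thesis using j by simp
next
  case False
  then have "(\<Sum>i<m. d i * indicator (A i) x) = 0" for d :: "nat \<Rightarrow> real"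
    by (intro sum.neutral) auto
  then show ?thesis using assms(2) by simp
qed

lemma expf_cells:
  assumes c: "cells m A" and \<mu>: "\<mu> \<in> space N"
  shows "expf (\<lambda>x. \<Sum>j<m. c j * indicator (A j) x) \<mu> = (\<Prod>j<m. exp (c j) ^ count \<mu> (A j))"
proof -
  have m: "measure \<mu> (A j) = real (count \<mu> (A j))" "emeasure \<mu> (A j) < \<infinity>" "A j \<in> sets \<mu>" if j: "j < m" for j
  proof -
    obtain n where "A j \<subseteq> B n" using cells_bounded[OF c j] by auto
    then show "measure \<mu> (A j) = real (count \<mu> (A j))" "emeasure \<mu> (A j) < \<infinity>" "A j \<in> sets \<mu>"
      using emeasure_count[OF \<mu> cells_sets[OF c j]] N_sets[OF \<mu>] cells_sets[OF c j] by (simp_all add: of_nat_less_top)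
  qed
  have "(\<integral>x. (\<Sum>j<m. c j * indicator (A j) x) \<partial>\<mu>) = (\<Sum>j<m. \<integral>x. c j * indicator (A j) x \<partial>\<mu>)"
    using m by (intro Bochner_Integration.integral_sum) simp
  also have "\<dots> = (\<Sum>j<m. real (count \<mu> (A j)) * c j)"
    using m sets.sets_into_space[OF m(3)] by (intro sum.cong) (auto simp: Int_absorb2)
  finally show ?thesis by (simp add: expf_def exp_sum exp_of_nat_mult)
qed

end

section \<open>Chaos levels of counts and the revealment inequality for a fixed stopping set\<close>

context intensity_space begin

text \<open>The monomial \<open>z ^ n\<close> is the exponential functional of the step function
  with values \<open>ln z\<close>; the sets being disjoint, its Laplace exponent is a sum over
  cells.\<close>

lemma poisson_vector_count:
  assumes P: "plaw \<kappa> P" and c: "cells m A"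
  shows "poisson_vector P m (\<lambda>\<mu> j. count \<mu> (A j)) (\<lambda>j. \<kappa> * measure L (A j))"
proof -
  interpret prob_space P using plaw_prob[OF P] .
  have sP[measurable_cong, simp]: "sets P = sets N" using plaw_sets[OF P] .
  have spP[simp]: "space P = space N" using sP sets_eq_imp_space_eq by blast
  show ?thesis
  proof
    show "(\<lambda>\<mu>. count \<mu> (A j)) \<in> P \<rightarrow>\<^sub>M count_space UNIV" if "j < m" for j
      using measurable_count[OF measurable_ident cells_sets[OF c that]] by (simp cong: measurable_cong_sets)
  next
    fix z :: "nat \<Rightarrow> real" assume z: "\<And>j. j < m \<Longrightarrow> 0 < z j"
    let ?\<phi> = "\<lambda>x. \<Sum>j<m. ln (z j) * indicator (A j) x"
    have "(\<integral>\<^sup>+\<mu>. ennreal (\<Prod>j<m. z j ^ count \<mu> (A j)) \<partial>P) = (\<integral>\<^sup>+\<mu>. expf ?\<phi> \<mu> \<partial>P)"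
    proof (rule nn_integral_cong)
      fix \<mu> assume "\<mu> \<in> space P"
      then show "ennreal (\<Prod>j<m. z j ^ count \<mu> (A j)) = ennreal (expf ?\<phi> \<mu>)"
        using z by (subst expf_cells[OF c]) auto
    qed
    also have "\<dots> = ennreal (exp (\<kappa> * (\<integral>x. exp (?\<phi> x) - 1 \<partial>L)))"
      by (rule plaw_expf[OF P test_cells[OF c]])
    also have "(\<integral>x. exp (?\<phi> x) - 1 \<partial>L) = (\<integral>x. (\<Sum>j<m. (exp (ln (z j)) - 1) * indicator (A j) x) \<partial>L)"
      using cells_sum_compose[OF c, of "\<lambda>v. exp v - 1"] by simp
    also have "\<dots> = (\<Sum>j<m. \<integral>x. (exp (ln (z j)) - 1) * indicator (A j) x \<partial>L)"
    proof (intro Bochner_Integration.integral_sum integrable_mult_right integrable_real_indicator)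
      fix j assume "j \<in> {..<m}"
      then show "A j \<in> sets L" "emeasure L (A j) < \<infinity>"
        using cells_sets[OF c, of j] cells_bounded[OF c, of j] emeasure_bounded_finite[OF locally_finite_L, of "A j"] by auto
    qed
    also have "\<dots> = (\<Sum>j<m. measure L (A j) * (z j - 1))"
      using z sets.sets_into_space[OF cells_sets[OF c]] by (intro sum.cong) (auto simp: Int_absorb2)
    finally show "(\<integral>\<^sup>+\<mu>. ennreal (\<Prod>j<m. z j ^ count \<mu> (A j)) \<partial>P) = ennreal (exp (\<Sum>j<m. \<kappa> * measure L (A j) * (z j - 1)))"
      by (simp add: sum_distrib_left mult_ac)
  qed
qed

lemma measurable_emeasure_L:
  assumes S: "\<And>\<omega>. \<omega> \<in> space \<Omega> \<Longrightarrow> S \<omega> \<in> sets X"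
    and [measurable]: "Measurable.pred (\<Omega> \<Otimes>\<^sub>M X) (\<lambda>(\<omega>, x). x \<in> S \<omega>)"
  shows "(\<lambda>\<omega>. emeasure L (S \<omega>)) \<in> borel_measurable \<Omega>"
proof -
  have "(\<lambda>\<omega>. \<integral>\<^sup>+x. indicator {(\<omega>, x). x \<in> S \<omega>} (\<omega>, x) \<partial>L) \<in> borel_measurable \<Omega>"
    by (rule L.borel_measurable_nn_integral) (simp cong: measurable_cong_sets)
  moreover have "(\<integral>\<^sup>+x. indicator {(\<omega>, x). x \<in> S \<omega>} (\<omega>, x) \<partial>L) = emeasure L (S \<omega>)" if "\<omega> \<in> space \<Omega>" for \<omega>
  proof -
    have "(\<integral>\<^sup>+x. indicator {(\<omega>, x). x \<in> S \<omega>} (\<omega>, x) \<partial>L) = (\<integral>\<^sup>+x. indicator (S \<omega>) x \<partial>L)"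
      by (intro nn_integral_cong) (simp split: split_indicator)
    then show ?thesis using S[OF that] by simp
  qed
  ultimately show ?thesis by (simp cong: measurable_cong)
qed

text \<open>The component of order \<open>k\<close> of a linear combination of exponentials
  normalized to mean \<open>1\<close>, written through the counts of the cells.\<close>

definition level :: "nat \<Rightarrow> (nat \<Rightarrow> 'a set) \<Rightarrow> nat \<Rightarrow> (nat \<Rightarrow> nat \<Rightarrow> real) \<Rightarrow> (nat \<Rightarrow> real) \<Rightarrow> nat \<Rightarrow> 'a measure \<Rightarrow> real" where
  "level m A r u a k \<mu> = (\<Sum>i<r. a i * fps_nth (chaos m (u i) (\<lambda>j. count \<mu> (A j)) (\<lambda>j. measure L (A j))) k)"

lemma measurable_level:
  assumes "cells m A"
  shows "level m A r u a k \<in> borel_measurable N"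
proof -
  have [measurable]: "(\<lambda>\<mu>. fps_nth (chaos m (u i) (\<lambda>j. count \<mu> (A j)) (\<lambda>j. measure L (A j))) k) \<in> borel_measurable N" for i
    using measurable_count[OF measurable_ident] cells_sets[OF assms] by (intro measurable_chaos) auto
  show ?thesis unfolding level_def[abs_def] by measurable
qed

lemma level_square:
  assumes P: "plaw 1 P" and c: "cells m A" and u: "\<And>i j. i < r \<Longrightarrow> j < m \<Longrightarrow> \<bar>u i j\<bar> < 1"
  shows "integrable P (\<lambda>\<mu>. (level m A r u a k \<mu>)\<^sup>2)"
    and "(\<integral>\<mu>. (level m A r u a k \<mu>)\<^sup>2 \<partial>P) = quad r a (\<lambda>i i'. gram m (\<lambda>j. measure L (A j)) u i i' ^ k) / fact k"
proof -
  interpret V: poisson_vector P m "\<lambda>\<mu> j. count \<mu> (A j)" "\<lambda>j. measure L (A j)"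
    using poisson_vector_count[OF P c] by simp
  \<comment> \<open>Nothing is revealed here: with coefficients at \<open>q = 0\<close> only, the
    convolution in \<open>chaos_quad\<close> reduces to the single term of order
    \<open>k\<close>.\<close>
  define b where "b i q = (if q = 0 then a i else 0)" for i and q :: nat
  have eq: "level m A r u a k \<mu> = (\<Sum>i<r. \<Sum>q\<le>k. b i q * fps_nth (chaos m (u i) (\<lambda>j. count \<mu> (A j)) (\<lambda>j. measure L (A j))) (k - q))" for \<mu>
    unfolding level_def
  proof (rule sum.cong[OF refl])
    fix i
    let ?c = "fps_nth (chaos m (u i) (\<lambda>j. count \<mu> (A j)) (\<lambda>j. measure L (A j)))"
    have "(\<Sum>q\<le>k. b i q * ?c (k - q)) = (\<Sum>q\<le>k. if q = 0 then a i * ?c k else 0)"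
      by (rule sum.cong) (auto simp: b_def)
    then show "a i * ?c k = (\<Sum>q\<le>k. b i q * ?c (k - q))" by simp
  qed
  show "integrable P (\<lambda>\<mu>. (level m A r u a k \<mu>)\<^sup>2)" unfolding eq by (rule V.chaos_quad(1)[OF u])
  have "(\<integral>\<mu>. (level m A r u a k \<mu>)\<^sup>2 \<partial>P) = (\<Sum>q\<le>k. quad r (\<lambda>i. b i q) (\<lambda>i i'. gram m (\<lambda>j. measure L (A j)) u i i' ^ (k - q) / fact (k - q)))"
    unfolding eq by (rule V.chaos_quad(2)[OF u])
  also have "\<dots> = (\<Sum>q\<le>k. if q = 0 then quad r a (\<lambda>i i'. gram m (\<lambda>j. measure L (A j)) u i i' ^ k / fact k) else 0)"
    by (rule sum.cong) (auto simp: b_def quad_def)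
  finally show "(\<integral>\<mu>. (level m A r u a k \<mu>)\<^sup>2 \<partial>P) = quad r a (\<lambda>i i'. gram m (\<lambda>j. measure L (A j)) u i i' ^ k) / fact k"
    by (simp add: quad_divide)
qed

text \<open>A \<open>k\<close>-th chaos is nearly uncorrelated with a functional read off a stopping set that is
  unlikely to hit any given point: conditionally on what the set reveals, the purely hidden part of the
  chaos keeps most of the variance.\<close>

lemma schramm_steif:
  assumes Z: "stopping_set X B Z" and P: "plaw 1 P" and Fm: "F \<in> borel_measurable N"
    and F1: "\<And>\<mu>. \<mu> \<in> space N \<Longrightarrow> \<bar>F \<mu>\<bar> \<le> (1::real)" and det: "determined_by X B F Z"
    and c: "cells m A" and u: "\<And>i j. i < r \<Longrightarrow> j < m \<Longrightarrow> \<bar>u i j\<bar> < 1"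
  shows "(\<integral>\<mu>. F \<mu> * level m A r u a (Suc k) \<mu> \<partial>P)\<^sup>2 \<le>
    quad r a (\<lambda>i i'. real (Suc k) * gram m (\<lambda>j. measure L (A j)) u i i' ^ k *
      gram m (\<lambda>j. \<integral>\<mu>. measure L (A j \<inter> Z \<mu>) \<partial>P) u i i') / fact (Suc k)"
proof -
  interpret P: prob_space P using plaw_prob[OF P] .
  have sP[measurable_cong, simp]: "sets P = sets N" using plaw_sets[OF P] .
  have spP[simp]: "space P = space N" using sP sets_eq_imp_space_eq by blast
  interpret PP: pair_prob_space P P ..
  define K where "K = Suc k"
  define lam where "lam j = measure L (A j)" for j
  define lamZ where "lamZ \<mu> j = measure L (A j \<inter> Z \<mu>)" for \<mu> j
  define lamC where "lamC \<mu> j = measure L (A j - Z \<mu>)" for \<mu> j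
  define h where "h = level m A r u a K"
  define G where "G p = glue (space X) Z (fst p) (snd p)" for p
  note [measurable] = Fm
  have [measurable]: "h \<in> borel_measurable N" unfolding h_def by (rule measurable_level[OF c])
  have G[measurable]: "G \<in> P \<Otimes>\<^sub>M P \<rightarrow>\<^sub>M N"
    using measurable_glue[OF Z sets.top] by (simp add: G_def[abs_def] case_prod_beta' cong: measurable_cong_sets)
  have law: "distr (P \<Otimes>\<^sub>M P) N G = P"
    using strong_markov[OF Z P] by (simp add: G_def[abs_def] case_prod_beta')
  have Zs: "Z \<mu> \<in> sets X" if "\<mu> \<in> space N" for \<mu> using stopping_set_sets[OF Z that] .
  have finL: "emeasure L (A j) < \<infinity>" if "j < m" for j
    using cells_sets[OF c that] cells_bounded[OF c that] emeasure_bounded_finite[OF locally_finite_L, of "A j"] by auto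
  have lam_split: "lam j = lamZ \<mu> j + lamC \<mu> j" if "j < m" "\<mu> \<in> space N" for j \<mu>
  proof -
    have "A j = (A j \<inter> Z \<mu>) \<union> (A j - Z \<mu>)" by auto
    then have "lam j = measure L ((A j \<inter> Z \<mu>) \<union> (A j - Z \<mu>))" by (simp add: lam_def)
    also have "\<dots> = lamZ \<mu> j + lamC \<mu> j" unfolding lamZ_def lamC_def
    proof (rule measure_Union)
      show "emeasure L (A j \<inter> Z \<mu>) \<noteq> \<infinity>" "emeasure L (A j - Z \<mu>) \<noteq> \<infinity>"
        using finL[OF that(1)] cells_sets[OF c that(1)] emeasure_mono[of "A j \<inter> Z \<mu>" "A j" L] emeasure_mono[of "A j - Z \<mu>" "A j" L]
        by (auto simp: top_unique)
    qed (use cells_sets[OF c that(1)] Zs[OF that(2)] in auto)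
    finally show ?thesis .
  qed
  have lam0: "0 \<le> lamZ \<mu> j" "0 \<le> lamC \<mu> j" "0 \<le> lam j" for \<mu> j by (simp_all add: lamZ_def lamC_def lam_def)
  have meas_lam [measurable]: "(\<lambda>\<mu>. lamZ \<mu> j) \<in> borel_measurable N" "(\<lambda>\<mu>. lamC \<mu> j) \<in> borel_measurable N" if "j < m" for j
  proof -
    note [measurable] = stopping_set_pred[OF Z] cells_sets[OF c that]
    have "(\<lambda>\<mu>. emeasure L (A j \<inter> Z \<mu>)) \<in> borel_measurable N" "(\<lambda>\<mu>. emeasure L (A j - Z \<mu>)) \<in> borel_measurable N"
      using cells_sets[OF c that] Zs by (intro measurable_emeasure_L; auto)+
    then show "(\<lambda>\<mu>. lamZ \<mu> j) \<in> borel_measurable N" "(\<lambda>\<mu>. lamC \<mu> j) \<in> borel_measurable N"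
      unfolding lamZ_def lamC_def measure_def by measurable
  qed
  have lam_le: "\<bar>lamZ \<mu> j\<bar> \<le> lam j" "\<bar>lamC \<mu> j\<bar> \<le> lam j" if "j < m" "\<mu> \<in> space N" for \<mu> j
    using lam_split[OF that] lam0(1)[of \<mu> j] lam0(2)[of \<mu> j] by simp_all

  \<comment> \<open>\<open>cc\<close> is computed from the revealed points of \<open>\<mu>\<close>,
    \<open>dd\<close> from the points of the independent copy in the hidden region of
    \<open>\<mu>\<close>.\<close>
  define cc where "cc i \<mu> q = fps_nth (chaos m (u i) (\<lambda>j. count \<mu> (A j \<inter> Z \<mu>)) (lamZ \<mu>)) q" for i \<mu> q
  define dd where "dd i \<mu> \<psi> q = fps_nth (chaos m (u i) (\<lambda>j. count \<psi> (A j - Z \<mu>)) (lamC \<mu>)) q" for i \<mu> \<psi> q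
  have hG: "h (G (\<mu>, \<psi>)) = (\<Sum>i<r. \<Sum>q\<le>K. (a i * cc i \<mu> q) * dd i \<mu> \<psi> (K - q))"
    if m: "\<mu> \<in> space N" "\<psi> \<in> space N" for \<mu> \<psi>
  proof -
    have cnt: "count (G (\<mu>, \<psi>)) (A j) = count \<mu> (A j \<inter> Z \<mu>) + count \<psi> (A j - Z \<mu>)" if j: "j < m" for j
    proof -
      obtain n where n: "A j \<subseteq> B n" using cells_bounded[OF c j] by auto
      note Aj = cells_sets[OF c j]
      have GN: "G (\<mu>, \<psi>) \<in> space N" unfolding G_def using glue_in_N[OF Z sets.top m] by simp
      have e: "A j \<inter> (Z \<mu> \<union> (space X - space X)) = A j \<inter> Z \<mu>" "A j \<inter> (space X - Z \<mu>) = A j - Z \<mu>"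
        using sets.sets_into_space[OF Aj] by auto
      have "of_nat (count (G (\<mu>, \<psi>)) (A j)) = emeasure (G (\<mu>, \<psi>)) (A j)"
        using emeasure_count(1)[OF GN Aj n] by simp
      also have "\<dots> = emeasure \<mu> (A j \<inter> Z \<mu>) + emeasure \<psi> (A j - Z \<mu>)"
        unfolding G_def using emeasure_glue[OF Z sets.top m Aj] by (simp only: e fst_conv snd_conv)
      also have "emeasure \<mu> (A j \<inter> Z \<mu>) = of_nat (count \<mu> (A j \<inter> Z \<mu>))"
        using Aj Zs[OF m(1)] n by (intro emeasure_count(1)[OF m(1), of _ n]) auto
      also have "emeasure \<psi> (A j - Z \<mu>) = of_nat (count \<psi> (A j - Z \<mu>))"
        using Aj Zs[OF m(1)] n by (intro emeasure_count(1)[OF m(2), of _ n]) auto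
      finally have "(of_nat (count (G (\<mu>, \<psi>)) (A j)) :: ennreal) = of_nat (count \<mu> (A j \<inter> Z \<mu>) + count \<psi> (A j - Z \<mu>))" by simp
      then show ?thesis by (simp only: of_nat_eq_iff)
    qed
    have "chaos m (u i) (\<lambda>j. count (G (\<mu>, \<psi>)) (A j)) lam =
        chaos m (u i) (\<lambda>j. count \<mu> (A j \<inter> Z \<mu>) + count \<psi> (A j - Z \<mu>)) (\<lambda>j. lamZ \<mu> j + lamC \<mu> j)" for i
      using cnt lam_split m(1) by (intro chaos_cong) simp
    then have "fps_nth (chaos m (u i) (\<lambda>j. count (G (\<mu>, \<psi>)) (A j)) lam) K = (\<Sum>q\<le>K. cc i \<mu> q * dd i \<mu> \<psi> (K - q))" for i
      by (simp add: chaos_add fps_mult_nth cc_def dd_def atLeast0AtMost)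
    then show ?thesis unfolding h_def level_def lam_def[symmetric]
      by (simp add: sum_distrib_left mult.assoc)
  qed
  have V: "poisson_vector P m (\<lambda>\<psi> j. count \<psi> (A j - Z \<mu>)) (lamC \<mu>)" if "\<mu> \<in> space N" for \<mu>
    using poisson_vector_count[OF P cells_diff[OF c Zs[OF that]]] by (simp add: lamC_def[abs_def])
  \<comment> \<open>The conditional mean of the level given what is revealed: hidden coefficients of
    positive order average to \<open>0\<close>, so only \<open>q = K\<close> remains.\<close>
  define R where "R \<mu> = (\<Sum>i<r. a i * cc i \<mu> K)" for \<mu>
  \<comment> \<open>The conditional second moment of the purely hidden term \<open>q = 0\<close>,
    whose revealed coefficient is \<open>1\<close>.\<close>
  define S where "S \<mu> = quad r a (\<lambda>i i'. gram m (lamC \<mu>) u i i' ^ K) / fact K" for \<mu>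
  have mean: "(\<integral>\<psi>. h (G (\<mu>, \<psi>)) \<partial>P) = R \<mu>" if m: "\<mu> \<in> space N" for \<mu>
  proof -
    interpret V: poisson_vector P m "\<lambda>\<psi> j. count \<psi> (A j - Z \<mu>)" "lamC \<mu>" by (rule V[OF m])
    have "has_bochner_integral P (\<lambda>\<psi>. \<Sum>i<r. \<Sum>q\<le>K. (a i * cc i \<mu> q) * dd i \<mu> \<psi> (K - q))
        (\<Sum>i<r. \<Sum>q\<le>K. (a i * cc i \<mu> q) * of_bool (K - q = 0))"
      unfolding dd_def using V.chaos_mean u
      by (intro has_bochner_integral_sum has_bochner_integral_mult_right) (simp add: has_bochner_integral_iff)
    moreover have "(\<Sum>q\<le>K. (a i * cc i \<mu> q) * of_bool (K - q = 0)) = a i * cc i \<mu> K" for i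
    proof -
      have "(\<Sum>q\<le>K. (a i * cc i \<mu> q) * of_bool (K - q = 0)) = (\<Sum>q\<le>K. if q = K then a i * cc i \<mu> K else 0)"
        by (rule sum.cong) auto
      then show ?thesis by simp
    qed
    ultimately have "(\<integral>\<psi>. (\<Sum>i<r. \<Sum>q\<le>K. (a i * cc i \<mu> q) * dd i \<mu> \<psi> (K - q)) \<partial>P) = R \<mu>"
      by (simp add: has_bochner_integral_iff R_def)
    moreover have "(\<integral>\<psi>. h (G (\<mu>, \<psi>)) \<partial>P) = (\<integral>\<psi>. (\<Sum>i<r. \<Sum>q\<le>K. (a i * cc i \<mu> q) * dd i \<mu> \<psi> (K - q)) \<partial>P)"
      using hG[OF m] by (intro Bochner_Integration.integral_cong) auto
    ultimately show ?thesis by simp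
  qed
  have square: "ennreal ((R \<mu>)\<^sup>2 + S \<mu>) \<le> (\<integral>\<^sup>+\<psi>. ennreal ((h (G (\<mu>, \<psi>)))\<^sup>2) \<partial>P)" if m: "\<mu> \<in> space N" for \<mu>
  proof -
    interpret V: poisson_vector P m "\<lambda>\<psi> j. count \<psi> (A j - Z \<mu>)" "lamC \<mu>" by (rule V[OF m])
    define T where "T q = quad r (\<lambda>i. a i * cc i \<mu> q) (\<lambda>i i'. gram m (lamC \<mu>) u i i' ^ (K - q) / fact (K - q))" for q
    have T0: "0 \<le> T q" for q
      unfolding T_def quad_divide
      by (intro divide_nonneg_nonneg quad_nonneg psd_gram_power lam0) simp
    have TK: "T K = (R \<mu>)\<^sup>2"
      by (simp add: T_def quad_def R_def power2_eq_square sum_product)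
    have T00: "T 0 = S \<mu>" by (simp add: T_def S_def quad_divide cc_def)
    \<comment> \<open>Of the orthogonal contributions only the purely revealed and the purely hidden
      one are kept; \<open>K\<close> is positive, so they are two different terms.\<close>
    have "(R \<mu>)\<^sup>2 + S \<mu> = (\<Sum>q\<in>{0, K}. T q)" using TK T00 by (simp add: K_def)
    also have "\<dots> \<le> (\<Sum>q\<le>K. T q)" using T0 by (intro sum_mono2) auto
    also have "\<dots> = (\<integral>\<psi>. (\<Sum>i<r. \<Sum>q\<le>K. (a i * cc i \<mu> q) * dd i \<mu> \<psi> (K - q))\<^sup>2 \<partial>P)"
      unfolding T_def dd_def by (rule V.chaos_quad(2)[OF u, symmetric])
    finally have "ennreal ((R \<mu>)\<^sup>2 + S \<mu>) \<le> ennreal (\<integral>\<psi>. (\<Sum>i<r. \<Sum>q\<le>K. (a i * cc i \<mu> q) * dd i \<mu> \<psi> (K - q))\<^sup>2 \<partial>P)"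
      by (rule ennreal_leI)
    also have "\<dots> = (\<integral>\<^sup>+\<psi>. ennreal ((\<Sum>i<r. \<Sum>q\<le>K. (a i * cc i \<mu> q) * dd i \<mu> \<psi> (K - q))\<^sup>2) \<partial>P)"
      unfolding dd_def by (rule nn_integral_eq_integral[symmetric, OF V.chaos_quad(1)[OF u]]) auto
    also have "\<dots> = (\<integral>\<^sup>+\<psi>. ennreal ((h (G (\<mu>, \<psi>)))\<^sup>2) \<partial>P)"
      using hG[OF m] by (intro nn_integral_cong) auto
    finally show ?thesis .
  qed
  define T where "T = quad r a (\<lambda>i i'. gram m lam u i i' ^ K) / fact K"
  have h2: "integrable P (\<lambda>\<mu>. (h \<mu>)\<^sup>2)" "(\<integral>\<mu>. (h \<mu>)\<^sup>2 \<partial>P) = T"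
    unfolding h_def T_def lam_def[abs_def] using level_square[OF P c u] by auto
  have hi: "integrable P h" by (rule P.square_integrable_imp_integrable[OF _ h2(1)]) simp
  have Rm[measurable]: "R \<in> borel_measurable P"
  proof -
    have "(\<lambda>\<mu>. \<integral>\<psi>. h (G (\<mu>, \<psi>)) \<partial>P) \<in> borel_measurable P"
      by (rule P.borel_measurable_lebesgue_integral) (simp add: case_prod_beta')
    then show ?thesis by (rule measurable_cong[THEN iffD1, rotated]) (simp add: mean)
  qed
  have S0: "0 \<le> S \<mu>" for \<mu> unfolding S_def by (intro divide_nonneg_nonneg quad_nonneg psd_gram_power lam0) simp
  have Sm[measurable]: "S \<in> borel_measurable P"
  proof -
    have "(\<lambda>\<mu>. gram m (lamC \<mu>) u i i') \<in> borel_measurable P" for i i'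
      unfolding gram_def by (intro borel_measurable_sum borel_measurable_times) (auto cong: measurable_cong_sets)
    then show ?thesis unfolding S_def[abs_def] quad_def by measurable
  qed
  \<comment> \<open>Averaging over \<open>\<mu>\<close> as well, the glued configuration again has
    law \<open>P\<close>, so the total is the unconditional second moment \<open>T\<close>.\<close>
  have le: "(\<integral>\<^sup>+\<mu>. ennreal ((R \<mu>)\<^sup>2 + S \<mu>) \<partial>P) \<le> ennreal T"
  proof -
    have "(\<integral>\<^sup>+\<mu>. ennreal ((R \<mu>)\<^sup>2 + S \<mu>) \<partial>P) \<le> (\<integral>\<^sup>+\<mu>. \<integral>\<^sup>+\<psi>. ennreal ((h (G (\<mu>, \<psi>)))\<^sup>2) \<partial>P \<partial>P)"
      using square by (intro nn_integral_mono) auto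
    also have "\<dots> = (\<integral>\<^sup>+p. ennreal ((h (G p))\<^sup>2) \<partial>(P \<Otimes>\<^sub>M P))"
      by (subst P.nn_integral_fst) auto
    also have "\<dots> = (\<integral>\<^sup>+\<mu>. ennreal ((h \<mu>)\<^sup>2) \<partial>distr (P \<Otimes>\<^sub>M P) N G)"
      by (subst nn_integral_distr) auto
    also have "\<dots> = ennreal T" unfolding law using h2 by (simp add: nn_integral_eq_integral)
    finally show ?thesis .
  qed
  have iRS: "integrable P (\<lambda>\<mu>. (R \<mu>)\<^sup>2 + S \<mu>)"
    using le S0 by (intro integrableI_nonneg) (auto simp: top_unique less_top[symmetric] intro!: le_less_trans[OF le])
  have iS: "integrable P S"
    by (rule Bochner_Integration.integrable_bound[OF iRS]) (use S0 in auto)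
  have iR: "integrable P (\<lambda>\<mu>. (R \<mu>)\<^sup>2)"
    by (rule Bochner_Integration.integrable_bound[OF iRS]) (use S0 in auto)
  have T0: "0 \<le> T" using h2 Bochner_Integration.integral_nonneg[of P "\<lambda>\<mu>. (h \<mu>)\<^sup>2"] by simp
  have RS: "(\<integral>\<mu>. (R \<mu>)\<^sup>2 \<partial>P) + (\<integral>\<mu>. S \<mu> \<partial>P) \<le> T"
  proof -
    have "ennreal (\<integral>\<mu>. (R \<mu>)\<^sup>2 + S \<mu> \<partial>P) \<le> ennreal T"
      using le nn_integral_eq_integral[OF iRS] S0 by simp
    then show ?thesis using T0 iR iS by (simp add: ennreal_le_iff)
  qed
  define q where "q j = (\<integral>\<mu>. lamZ \<mu> j \<partial>P)" for j
  define U where "U \<mu> = quad r a (\<lambda>i i'. real K * gram m lam u i i' ^ k * gram m (lamZ \<mu>) u i i') / fact K" for \<mu>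
  \<comment> \<open>The tangent inequality at \<open>lam\<close> against \<open>lamC \<mu>\<close>;
    their difference is the revealed intensity \<open>lamZ \<mu>\<close>.\<close>
  have TS: "T - S \<mu> \<le> U \<mu>" if m: "\<mu> \<in> space N" for \<mu>
  proof -
    have "psd r (\<lambda>i i'. real (Suc k) * gram m lam u i i' ^ k * gram m (\<lambda>j. lam j - lamC \<mu> j) u i i'
        - (gram m lam u i i' ^ Suc k - gram m (lamC \<mu>) u i i' ^ Suc k))"
      using lam0 lam_le[OF _ m] by (intro psd_gram_power_tangent) auto
    from quad_nonneg[OF this, of a]
    have "quad r a (\<lambda>i i'. gram m lam u i i' ^ K) - quad r a (\<lambda>i i'. gram m (lamC \<mu>) u i i' ^ K) \<le>
        quad r a (\<lambda>i i'. real K * gram m lam u i i' ^ k * gram m (\<lambda>j. lam j - lamC \<mu> j) u i i')"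
      by (simp only: quad_diff K_def)
    moreover have "gram m (\<lambda>j. lam j - lamC \<mu> j) u i i' = gram m (lamZ \<mu>) u i i'" for i i'
      using lam_split[OF _ m] by (simp add: gram_def)
    ultimately show ?thesis unfolding T_def S_def U_def by (simp add: divide_right_mono flip: diff_divide_distrib)
  qed
  have hbU: "has_bochner_integral P U (quad r a (\<lambda>i i'. real K * gram m lam u i i' ^ k * gram m q u i i') / fact K)"
  proof -
    have "has_bochner_integral P (\<lambda>\<mu>. lamZ \<mu> j) (q j)" if j: "j < m" for j
      unfolding q_def has_bochner_integral_iff using meas_lam(1)[OF j] lam_le(1)[OF j]
      by (auto intro!: P.integrable_const_bound[where B="lam j"] cong: measurable_cong_sets)
    then show ?thesis
      unfolding U_def quad_def gram_def
      by (intro has_bochner_integral_divide_zero has_bochner_integral_sum has_bochner_integral_mult_right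
          has_bochner_integral_mult_left) auto
  qed
  have R2: "(\<integral>\<mu>. (R \<mu>)\<^sup>2 \<partial>P) \<le> quad r a (\<lambda>i i'. real K * gram m lam u i i' ^ k * gram m q u i i') / fact K"
  proof -
    have "(\<integral>\<mu>. (R \<mu>)\<^sup>2 \<partial>P) \<le> (\<integral>\<mu>. T - S \<mu> \<partial>P)" using RS iS P.prob_space by simp
    also have "\<dots> \<le> (\<integral>\<mu>. U \<mu> \<partial>P)"
      using TS iS hbU by (intro integral_mono) (auto simp: has_bochner_integral_iff)
    finally show ?thesis using hbU by (simp add: has_bochner_integral_iff)
  qed
  \<comment> \<open>\<open>F\<close> reads only the revealed region, which gluing leaves as it is.
    Hence \<open>F \<mu>\<close> leaves the inner average and meets only the conditional mean
    \<open>R \<mu>\<close>.\<close>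
  have FG: "F (G (\<mu>, \<psi>)) = F \<mu>" if m: "\<mu> \<in> space N" "\<psi> \<in> space N" for \<mu> \<psi>
  proof -
    have GN: "G (\<mu>, \<psi>) \<in> space N" unfolding G_def using glue_in_N[OF Z sets.top m] by simp
    have ZG: "Z (G (\<mu>, \<psi>)) = Z \<mu>" unfolding G_def using stopping_set_glue[OF Z sets.top m] by simp
    have "restr (G (\<mu>, \<psi>)) (Z \<mu>) = restr \<mu> (Z \<mu>)"
    proof (rule measure_eqI)
      fix C assume "C \<in> sets (restr (G (\<mu>, \<psi>)) (Z \<mu>))"
      then have C: "C \<in> sets X" using N_sets[OF GN] by simp
      have e: "C \<inter> Z \<mu> \<inter> (Z \<mu> \<union> (space X - space X)) = C \<inter> Z \<mu>" "C \<inter> Z \<mu> \<inter> (space X - Z \<mu>) = {}" by auto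
      have "emeasure (glue (space X) Z \<mu> \<psi>) (C \<inter> Z \<mu>) = emeasure \<mu> (C \<inter> Z \<mu>) + emeasure \<psi> {}"
        using emeasure_glue[OF Z sets.top m, of "C \<inter> Z \<mu>"] C Zs[OF m(1)] by (simp only: e sets.Int)
      then show "emeasure (restr (G (\<mu>, \<psi>)) (Z \<mu>)) C = emeasure (restr \<mu> (Z \<mu>)) C"
        using C Zs[OF m(1)] N_sets[OF GN] N_sets[OF m(1)] by (simp add: emeasure_restr G_def)
    qed (simp add: N_sets[OF GN] N_sets[OF m(1)])
    then show ?thesis using det GN m(1) ZG unfolding determined_by_def by metis
  qed
  have Fh: "(\<integral>\<mu>. F \<mu> * h \<mu> \<partial>P) = (\<integral>\<mu>. F \<mu> * R \<mu> \<partial>P)"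
  proof -
    have iFh: "integrable P (\<lambda>\<mu>. F \<mu> * h \<mu>)"
      using F1 by (intro Bochner_Integration.integrable_bound[OF hi]) (auto simp: abs_mult intro!: mult_left_le_one_le AE_I2)
    have "(\<integral>\<mu>. F \<mu> * h \<mu> \<partial>P) = (\<integral>\<mu>. F \<mu> * h \<mu> \<partial>distr (P \<Otimes>\<^sub>M P) N G)" by (simp only: law)
    also have "\<dots> = (\<integral>p. F (G p) * h (G p) \<partial>(P \<Otimes>\<^sub>M P))"
      by (rule integral_distr) auto
    also have "\<dots> = (\<integral>\<mu>. \<integral>\<psi>. F (G (\<mu>, \<psi>)) * h (G (\<mu>, \<psi>)) \<partial>P \<partial>P)"
    proof (rule PP.integral_fst'[symmetric])
      have "integrable (distr (P \<Otimes>\<^sub>M P) N G) (\<lambda>\<mu>. F \<mu> * h \<mu>)" unfolding law by (rule iFh)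
      then show "integrable (P \<Otimes>\<^sub>M P) (\<lambda>p. F (G p) * h (G p))"
        by (subst (asm) integrable_distr_eq) auto
    qed
    also have "\<dots> = (\<integral>\<mu>. F \<mu> * R \<mu> \<partial>P)"
    proof (rule Bochner_Integration.integral_cong[OF refl])
      fix \<mu> assume "\<mu> \<in> space P"
      then have m: "\<mu> \<in> space N" by simp
      have "(\<integral>\<psi>. F (G (\<mu>, \<psi>)) * h (G (\<mu>, \<psi>)) \<partial>P) = (\<integral>\<psi>. F \<mu> * h (G (\<mu>, \<psi>)) \<partial>P)"
        using FG[OF m] by (intro Bochner_Integration.integral_cong) auto
      then show "(\<integral>\<psi>. F (G (\<mu>, \<psi>)) * h (G (\<mu>, \<psi>)) \<partial>P) = F \<mu> * R \<mu>" using mean[OF m] by simp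
    qed
    finally show ?thesis .
  qed
  have sq: "(F \<mu> * R \<mu>)\<^sup>2 \<le> (R \<mu>)\<^sup>2" if "\<mu> \<in> space N" for \<mu>
    using F1[OF that] by (simp add: power_mult_distrib mult_left_le_one_le abs_square_le_1)
  have iFR2: "integrable P (\<lambda>\<mu>. (F \<mu> * R \<mu>)\<^sup>2)"
    using sq by (intro Bochner_Integration.integrable_bound[OF iR]) auto
  have iFR: "integrable P (\<lambda>\<mu>. F \<mu> * R \<mu>)" by (rule P.square_integrable_imp_integrable[OF _ iFR2]) simp
  have "(\<integral>\<mu>. F \<mu> * R \<mu> \<partial>P)\<^sup>2 \<le> (\<integral>\<mu>. (F \<mu> * R \<mu>)\<^sup>2 \<partial>P)"
  proof -
    have "0 \<le> P.variance (\<lambda>\<mu>. F \<mu> * R \<mu>)" by (rule P.variance_positive)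
    then show ?thesis unfolding P.variance_eq[OF iFR iFR2] by simp
  qed
  also have "\<dots> \<le> (\<integral>\<mu>. (R \<mu>)\<^sup>2 \<partial>P)" using iFR2 iR sq by (intro integral_mono) auto
  also note R2
  finally show ?thesis using Fh
    by (simp only: h_def K_def lam_def[abs_def] q_def[abs_def] lamZ_def)
qed

end

lemma gram_cmult: "gram m (\<lambda>j. c * q j) u i i' = c * gram m q u i i'"
  by (simp add: gram_def sum_distrib_left mult_ac)

context localized_space begin

text \<open>The cells are the joint level sets of the vector of all \<open>\<phi> i\<close>. The
  zero vector is excluded so that every cell lies in the support of some \<open>\<phi> i\<close> and
  is bounded. The last clause lets the coefficients inherit the sign of
  \<open>\<phi> i\<close>.\<close>

lemma common_cells:
  assumes \<phi>: "\<And>i. i < (r::nat) \<Longrightarrow> test (\<phi> i)"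
  shows "\<exists>(m::nat) A w. cells m A \<and> (\<forall>i<r. \<forall>x\<in>space X. \<phi> i x = (\<Sum>j<m. w i j * indicator (A j) x)) \<and>
    (\<forall>i<r. \<forall>j<m. \<exists>x\<in>space X. w i j = \<phi> i x)"
proof -
  \<comment> \<open>Padding with \<open>0\<close> beyond \<open>r\<close> makes the vectors
    functions with finitely many free coordinates, so only finitely many of them occur.\<close>
  define v where "v x i = (if i < r then \<phi> i x else 0)" for x and i :: nat
  define V where "V = v ` space X - {\<lambda>_. 0}"
  have "v ` space X \<subseteq> {f. \<forall>i. (i \<in> {..<r} \<longrightarrow> f i \<in> (\<Union>i<r. \<phi> i ` space X)) \<and> (i \<notin> {..<r} \<longrightarrow> f i = 0)}"
    by (auto simp: v_def intro!: bexI imageI)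
  moreover have "finite (\<Union>i<r. \<phi> i ` space X)" using \<phi> by (auto simp: test_def dest: simple_functionD)
  then have "finite {f. \<forall>i. (i \<in> {..<r} \<longrightarrow> f i \<in> (\<Union>i<r. \<phi> i ` space X)) \<and> (i \<notin> {..<r} \<longrightarrow> f i = 0)}"
    by (intro finite_set_of_finite_funs) auto
  ultimately have "finite (v ` space X)" by (rule finite_subset)
  then have "finite V" by (simp add: V_def)
  then obtain h where h: "bij_betw h {..<card V} V"
    by (metis lessThan_atLeast0 ex_bij_betw_nat_finite)
  define A where "A j = {x \<in> space X. v x = h j}" for j
  have hV: "h j \<in> V" if "j < card V" for j using h that by (auto simp: bij_betw_def)
  have "A j \<in> sets X \<and> (\<exists>n. A j \<subseteq> B n)" if j: "j < card V" for j
  proof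
    obtain x0 where x0: "x0 \<in> space X" "h j = v x0" "h j \<noteq> (\<lambda>_. 0)" using hV[OF j] by (auto simp: V_def)
    then obtain i where i: "i < r" "\<phi> i x0 \<noteq> 0" by (auto simp: v_def fun_eq_iff split: if_splits)
    have "A j = {x \<in> space X. \<forall>i\<in>{..<r}. \<phi> i x = \<phi> i x0}"
      using x0 by (auto simp: A_def v_def fun_eq_iff)
    also have "\<dots> \<in> sets X"
    proof (rule sets.sets_Collect_finite_All)
      fix i assume "i \<in> {..<r}"
      then have [measurable]: "\<phi> i \<in> borel_measurable X" using \<phi> test_measurable by auto
      show "{x \<in> space X. \<phi> i x = \<phi> i x0} \<in> sets X" by measurable
    qed simp
    finally show "A j \<in> sets X" .
    obtain n where "{x \<in> space X. \<phi> i x = \<phi> i x0} \<subseteq> B n" using test_vimage(2)[OF \<phi>[OF i(1)] i(2)] by auto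
    moreover have "A j \<subseteq> {x \<in> space X. \<phi> i x = \<phi> i x0}"
    proof
      fix x assume "x \<in> A j"
      then have "x \<in> space X" "v x i = v x0 i" using x0 by (auto simp: A_def)
      then show "x \<in> {x \<in> space X. \<phi> i x = \<phi> i x0}" using i by (simp add: v_def)
    qed
    ultimately show "\<exists>n. A j \<subseteq> B n" by blast
  qed
  moreover have "disjoint_family_on A {..<card V}"
    using h by (auto simp: disjoint_family_on_def A_def bij_betw_def inj_on_def)
  ultimately have "cells (card V) A" by (simp add: cells_def)
  moreover have "\<phi> i x = (\<Sum>j<card V. h j i * indicator (A j) x)" if i: "i < r" and x: "x \<in> space X" for i x
  proof (cases "v x = (\<lambda>_. 0)")
    case True
    have "indicator (A j) x = (0::real)" if "j < card V" for j
      using hV[OF that] True by (auto simp: A_def V_def)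
    then have "(\<Sum>j<card V. h j i * indicator (A j) x) = 0" by (intro sum.neutral) auto
    moreover have "\<phi> i x = 0" using fun_cong[OF True, of i] i by (simp add: v_def)
    ultimately show ?thesis by simp
  next
    case False
    then have "v x \<in> V" using x by (auto simp: V_def)
    then obtain j0 where j0: "j0 < card V" "h j0 = v x" using h by (auto simp: bij_betw_def image_iff) (metis image_iff lessThan_iff)
    have "(\<Sum>j<card V. h j i * indicator (A j) x) = (\<Sum>j<card V. if j = j0 then v x i else 0)"
    proof (rule sum.cong[OF refl])
      fix j assume j: "j \<in> {..<card V}"
      have "x \<in> A j \<longleftrightarrow> j = j0"
        using j j0 h x by (auto simp: A_def bij_betw_def inj_on_def)
      then show "h j i * indicator (A j) x = (if j = j0 then v x i else 0)" using j0 by (auto simp: indicator_def)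
    qed
    then show ?thesis using j0 i by (simp add: v_def)
  qed
  moreover have "\<exists>x\<in>space X. h j i = \<phi> i x" if "i < r" "j < card V" for i j
    using hV[OF that(2)] that(1) by (auto simp: V_def v_def)
  ultimately show ?thesis by (intro exI[of _ "card V"] exI[of _ A] exI[of _ "\<lambda>i j. h j i"]) blast
qed

end

section \<open>Averaging over the randomization\<close>

context intensity_space begin

text \<open>The bound for a fixed stopping set is linear in the expected revealed masses
  \<open>Q y j\<close>, so it may be averaged over \<open>y\<close>; the averaged masses are at most
  \<open>\<delta> * lam j\<close>, which replaces one Gram factor by \<open>\<delta>\<close> times
  the full one.\<close>

lemma randomized_schramm_steif:
  assumes P: "plaw 1 P" and D: "prob_space D" "sets D = sets \<Y>"
    and Z: "AE y in D. stopping_set X B (Z y) \<and> determined_by X B F (Z y)"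
    and Zm: "Measurable.pred (N \<Otimes>\<^sub>M X \<Otimes>\<^sub>M \<Y>) (\<lambda>(\<mu>, x, y). x \<in> Z y \<mu>)"
    and \<delta>: "\<And>x. x \<in> space X \<Longrightarrow> (\<integral>\<^sup>+p. indicator {(y, \<mu>). x \<in> Z y \<mu>} p \<partial>(D \<Otimes>\<^sub>M P)) \<le> ennreal \<delta>" "0 \<le> \<delta>"
    and Fm: "F \<in> borel_measurable N" and F1: "\<And>\<mu>. \<mu> \<in> space N \<Longrightarrow> \<bar>F \<mu>\<bar> \<le> (1::real)"
    and c: "cells m A" and u: "\<And>i j. i < r \<Longrightarrow> j < m \<Longrightarrow> \<bar>u i j\<bar> < 1"
  shows "(\<integral>\<mu>. F \<mu> * level m A r u a (Suc k) \<mu> \<partial>P)\<^sup>2 \<le>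
    \<delta> * (real (Suc k) * (quad r a (\<lambda>i i'. gram m (\<lambda>j. measure L (A j)) u i i' ^ Suc k) / fact (Suc k)))"
proof -
  interpret P: prob_space P using plaw_prob[OF P] .
  interpret D: prob_space D by (rule D(1))
  have sP[measurable_cong, simp]: "sets P = sets N" using plaw_sets[OF P] .
  have spP[simp]: "space P = space N" using sP sets_eq_imp_space_eq by blast
  note sD[measurable_cong, simp] = D(2)
  interpret DP: pair_prob_space D P ..
  interpret LDP: pair_sigma_finite L "D \<Otimes>\<^sub>M P" ..
  define lam where "lam j = measure L (A j)" for j
  have Aj: "A j \<in> sets X" "emeasure L (A j) = ennreal (lam j)" if "j < m" for j
    using cells_sets[OF c that] cells_bounded[OF c that] emeasure_L_eq[of "A j"] by (auto simp: lam_def)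
  define f where "f j = (\<lambda>p. \<integral>\<^sup>+x. indicator (A j) x * indicator {(y, \<mu>). x \<in> Z y \<mu>} p \<partial>L)" for j
  have pr: "Measurable.pred ((D \<Otimes>\<^sub>M P) \<Otimes>\<^sub>M X) (\<lambda>(p, x). x \<in> Z (fst p) (snd p))"
  proof -
    have "(\<lambda>w. (snd (fst w), snd w, fst (fst w))) \<in> (D \<Otimes>\<^sub>M P) \<Otimes>\<^sub>M X \<rightarrow>\<^sub>M N \<Otimes>\<^sub>M X \<Otimes>\<^sub>M \<Y>"
      by (simp cong: measurable_cong_sets)
    from measurable_compose[OF this Zm] show ?thesis by (simp add: case_prod_beta')
  qed
  \<comment> \<open>For exceptional \<open>y\<close> the set \<open>Z y \<mu>\<close> itself need
    not be measurable, but its trace on \<open>space X\<close> is, by joint measurability. This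
    keeps \<open>f\<close> meaningful for all \<open>y\<close>.\<close>
  have sec: "{x \<in> space X. x \<in> Z y \<mu>} \<in> sets X" if "y \<in> space D" "\<mu> \<in> space N" for y \<mu>
  proof -
    have "(y, \<mu>) \<in> space (D \<Otimes>\<^sub>M P)" using that by (simp add: space_pair_measure)
    from measurable_compose[OF measurable_Pair1'[OF this, of X] pr] show ?thesis by (simp add: pred_def)
  qed
  have fm[measurable]: "f j \<in> borel_measurable (D \<Otimes>\<^sub>M P)" if "j < m" for j
  proof -
    note [measurable] = Aj(1)[OF that] pr
    have "(\<lambda>(p, x). indicator (A j) x * indicator {w. snd w \<in> Z (fst (fst w)) (snd (fst w))} (p, x) :: ennreal) \<in> borel_measurable ((D \<Otimes>\<^sub>M P) \<Otimes>\<^sub>M X)"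
      using pr by (simp add: case_prod_beta')
    then have "(\<lambda>p. \<integral>\<^sup>+x. indicator (A j) x * indicator {w. snd w \<in> Z (fst (fst w)) (snd (fst w))} (p, x) \<partial>L) \<in> borel_measurable (D \<Otimes>\<^sub>M P)"
      by (intro L.borel_measurable_nn_integral) (simp cong: measurable_cong_sets)
    moreover have "f j = (\<lambda>p. \<integral>\<^sup>+x. indicator (A j) x * indicator {w. snd w \<in> Z (fst (fst w)) (snd (fst w))} (p, x) \<partial>L)"
      unfolding f_def by (intro ext nn_integral_cong) (auto split: split_indicator)
    ultimately show ?thesis by simp
  qed
  have f_eq: "f j (y, \<mu>) = emeasure L (A j \<inter> Z y \<mu>)" and f_le: "f j (y, \<mu>) \<le> ennreal (lam j)"
    if "j < m" "y \<in> space D" "\<mu> \<in> space N" for j y \<mu>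
  proof -
    have s: "A j \<inter> Z y \<mu> = A j \<inter> {x \<in> space X. x \<in> Z y \<mu>}" using sets.sets_into_space[OF Aj(1)[OF that(1)]] by auto
    then have "A j \<inter> Z y \<mu> \<in> sets L" using Aj(1)[OF that(1)] sec[OF that(2,3)] by auto
    then have "emeasure L (A j \<inter> Z y \<mu>) = (\<integral>\<^sup>+x. indicator (A j \<inter> Z y \<mu>) x \<partial>L)" by simp
    also have "\<dots> = f j (y, \<mu>)" unfolding f_def by (intro nn_integral_cong) (auto split: split_indicator)
    finally show eq: "f j (y, \<mu>) = emeasure L (A j \<inter> Z y \<mu>)" by simp
    show "f j (y, \<mu>) \<le> ennreal (lam j)"
      unfolding eq Aj(2)[OF that(1), symmetric] using Aj(1)[OF that(1)] by (intro emeasure_mono) auto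
  qed
  \<comment> \<open>Exchanging integrals turns the expected revealed mass of a cell into the
    integral over that cell of the one-point revealment probability.\<close>
  have tot: "(\<integral>\<^sup>+p. f j p \<partial>(D \<Otimes>\<^sub>M P)) \<le> ennreal (\<delta> * lam j)" if j: "j < m" for j
  proof -
    have m2: "(\<lambda>(x, p). indicator (A j) x * indicator {(y, \<mu>). x \<in> Z y \<mu>} p :: ennreal) \<in> borel_measurable (L \<Otimes>\<^sub>M (D \<Otimes>\<^sub>M P))"
    proof -
      note [measurable] = Aj(1)[OF j]
      have "Measurable.pred (X \<Otimes>\<^sub>M (D \<Otimes>\<^sub>M P)) (\<lambda>w. fst w \<in> Z (fst (snd w)) (snd (snd w)))"
        using measurable_compose[OF measurable_pair_swap' pr] by (simp add: case_prod_beta')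
      then have "(\<lambda>w. indicator (A j) (fst w) * indicator {w. fst w \<in> Z (fst (snd w)) (snd (snd w))} w :: ennreal) \<in> borel_measurable (X \<Otimes>\<^sub>M (D \<Otimes>\<^sub>M P))"
        by measurable
      moreover have "(\<lambda>w. indicator (A j) (fst w) * indicator {w. fst w \<in> Z (fst (snd w)) (snd (snd w))} w :: ennreal) =
          (\<lambda>(x, p). indicator (A j) x * indicator {(y, \<mu>). x \<in> Z y \<mu>} p)"
        by (auto simp: fun_eq_iff split: split_indicator)
      ultimately show ?thesis by (simp cong: measurable_cong_sets)
    qed
    have "(\<integral>\<^sup>+p. f j p \<partial>(D \<Otimes>\<^sub>M P)) = (\<integral>\<^sup>+x. \<integral>\<^sup>+p. indicator (A j) x * indicator {(y, \<mu>). x \<in> Z y \<mu>} p \<partial>(D \<Otimes>\<^sub>M P) \<partial>L)"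
      unfolding f_def by (rule LDP.Fubini'[OF m2])
    also have "\<dots> \<le> (\<integral>\<^sup>+x. ennreal \<delta> * indicator (A j) x \<partial>L)"
    proof (rule nn_integral_mono)
      fix x assume "x \<in> space L"
      then show "(\<integral>\<^sup>+p. indicator (A j) x * indicator {(y, \<mu>). x \<in> Z y \<mu>} p \<partial>(D \<Otimes>\<^sub>M P)) \<le> ennreal \<delta> * indicator (A j) x"
        using \<delta>(1)[of x] by (cases "x \<in> A j") auto
    qed
    also have "\<dots> = ennreal (\<delta> * lam j)"
      using Aj[OF j] \<delta>(2) by (simp add: nn_integral_cmult_indicator ennreal_mult lam_def)
    finally show ?thesis .
  qed
  define Q where "Q y j = (\<integral>\<mu>. measure L (A j \<inter> Z y \<mu>) \<partial>P)" for y j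
  have Qf: "Q y j = enn2real (\<integral>\<^sup>+\<mu>. f j (y, \<mu>) \<partial>P)" "0 \<le> Q y j" "ennreal (Q y j) = (\<integral>\<^sup>+\<mu>. f j (y, \<mu>) \<partial>P)" "Q y j \<le> lam j"
    if j: "j < m" and y: "y \<in> space D" for y j
  proof -
    have m: "(\<lambda>\<mu>. f j (y, \<mu>)) \<in> borel_measurable P" using measurable_compose[OF measurable_Pair1'[OF y] fm[OF j]] .
    have ms: "(\<lambda>\<mu>. measure L (A j \<inter> Z y \<mu>)) \<in> borel_measurable P"
      using f_eq[OF j y] m by (subst measurable_cong[where g="\<lambda>\<mu>. enn2real (f j (y, \<mu>))"]) (auto simp: measure_def)
    have "Q y j = enn2real (\<integral>\<^sup>+\<mu>. ennreal (measure L (A j \<inter> Z y \<mu>)) \<partial>P)"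
      unfolding Q_def using ms by (intro integral_eq_nn_integral) auto
    also have "(\<integral>\<^sup>+\<mu>. ennreal (measure L (A j \<inter> Z y \<mu>)) \<partial>P) = (\<integral>\<^sup>+\<mu>. f j (y, \<mu>) \<partial>P)"
    proof (rule nn_integral_cong)
      fix \<mu> assume "\<mu> \<in> space P"
      then have "\<mu> \<in> space N" by simp
      from f_eq[OF j y this] f_le[OF j y this] show "ennreal (measure L (A j \<inter> Z y \<mu>)) = f j (y, \<mu>)"
        by (metis emeasure_eq_ennreal_measure ennreal_less_top order_le_less_trans less_irrefl top.not_eq_extremum)
    qed
    finally show e: "Q y j = enn2real (\<integral>\<^sup>+\<mu>. f j (y, \<mu>) \<partial>P)" .
    show "0 \<le> Q y j" unfolding e by simp
    have "(\<integral>\<^sup>+\<mu>. f j (y, \<mu>) \<partial>P) \<le> (\<integral>\<^sup>+\<mu>. ennreal (lam j) \<partial>P)"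
      using f_le[OF j y] by (intro nn_integral_mono) auto
    also have "\<dots> = ennreal (lam j)" using P.emeasure_space_1 by simp
    finally have le: "(\<integral>\<^sup>+\<mu>. f j (y, \<mu>) \<partial>P) \<le> ennreal (lam j)" .
    then show "ennreal (Q y j) = (\<integral>\<^sup>+\<mu>. f j (y, \<mu>) \<partial>P)"
      unfolding e by (intro ennreal_enn2real) (auto simp: le_less_trans)
    show "Q y j \<le> lam j" unfolding e using enn2real_mono[OF le] by (simp add: lam_def)
  qed
  have Qm: "(\<lambda>y. Q y j) \<in> borel_measurable D" if j: "j < m" for j
  proof -
    have "(\<lambda>y. enn2real (\<integral>\<^sup>+\<mu>. f j (y, \<mu>) \<partial>P)) \<in> borel_measurable D"
      using P.borel_measurable_nn_integral_fst[OF fm[OF j]] by measurable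
    then show ?thesis using Qf(1)[OF j] by (simp cong: measurable_cong)
  qed
  have Qi: "integrable D (\<lambda>y. Q y j)" if j: "j < m" for j
    using Qm[OF j] Qf[OF j] by (intro D.integrable_const_bound[where B="lam j"]) (auto intro!: AE_I2)
  define q where "q j = (\<integral>y. Q y j \<partial>D)" for j
  have q: "0 \<le> q j" "q j \<le> \<delta> * lam j" if j: "j < m" for j
  proof -
    show "0 \<le> q j" unfolding q_def using Qf(2)[OF j] by (intro Bochner_Integration.integral_nonneg_AE) auto
    have "ennreal (q j) = (\<integral>\<^sup>+y. ennreal (Q y j) \<partial>D)"
      unfolding q_def using Qi[OF j] Qf(2)[OF j] by (intro nn_integral_eq_integral[symmetric]) auto
    also have "\<dots> = (\<integral>\<^sup>+y. \<integral>\<^sup>+\<mu>. f j (y, \<mu>) \<partial>P \<partial>D)"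
      using Qf(3)[OF j] by (intro nn_integral_cong) auto
    also have "\<dots> = (\<integral>\<^sup>+p. f j p \<partial>(D \<Otimes>\<^sub>M P))" by (rule P.nn_integral_fst[OF fm[OF j]])
    also note tot[OF j]
    finally show "q j \<le> \<delta> * lam j" using \<delta>(2) by (simp add: ennreal_le_iff lam_def)
  qed
  let ?l = "(\<integral>\<mu>. F \<mu> * level m A r u a (Suc k) \<mu> \<partial>P)\<^sup>2"
  define U where "U y = quad r a (\<lambda>i i'. real (Suc k) * gram m lam u i i' ^ k * gram m (Q y) u i i') / fact (Suc k)" for y
  have AEU: "AE y in D. ?l \<le> U y"
    using Z
  proof eventually_elim
    case (elim y)
    then show ?case
      using schramm_steif[OF _ P Fm F1 _ c u, where Z="Z y" and a=a and k=k] unfolding U_def Q_def[abs_def] lam_def[abs_def] by simp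
  qed
  have hbU: "has_bochner_integral D U (quad r a (\<lambda>i i'. real (Suc k) * gram m lam u i i' ^ k * gram m q u i i') / fact (Suc k))"
  proof -
    have "has_bochner_integral D (\<lambda>y. Q y j) (q j)" if j: "j < m" for j
      using Qi[OF j] by (simp add: q_def has_bochner_integral_iff)
    then show ?thesis
      unfolding U_def quad_def gram_def
      by (intro has_bochner_integral_divide_zero has_bochner_integral_sum has_bochner_integral_mult_right
          has_bochner_integral_mult_left) auto
  qed
  have "?l = (\<integral>y. ?l \<partial>D)" using D.prob_space by simp
  also have "\<dots> \<le> (\<integral>y. U y \<partial>D)"
    using AEU hbU by (intro integral_mono_AE) (auto simp: has_bochner_integral_iff)
  also have "\<dots> = quad r a (\<lambda>i i'. real (Suc k) * gram m lam u i i' ^ k * gram m q u i i') / fact (Suc k)"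
    using hbU by (simp add: has_bochner_integral_iff)
  \<comment> \<open>The inequality \<open>q j \<le> \<delta> * lam j\<close> is passed through the
    quadratic form by the Schur product of two Gram kernels with nonnegative weights.\<close>
  also have "\<dots> \<le> quad r a (\<lambda>i i'. real (Suc k) * gram m lam u i i' ^ k * gram m (\<lambda>j. \<delta> * lam j) u i i') / fact (Suc k)"
  proof (rule divide_right_mono)
    have "psd r (\<lambda>i i'. gram m (\<lambda>j. \<delta> * lam j - q j) u i i' * gram m lam u i i' ^ k)"
      using q by (intro psd_gram_mult psd_gram_power) (auto simp: lam_def)
    from quad_nonneg[OF this, of a]
    have "0 \<le> real (Suc k) * quad r a (\<lambda>i i'. gram m (\<lambda>j. \<delta> * lam j - q j) u i i' * gram m lam u i i' ^ k)"
      by (intro mult_nonneg_nonneg) auto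
    also have "\<dots> = quad r a (\<lambda>i i'. real (Suc k) * gram m lam u i i' ^ k * gram m (\<lambda>j. \<delta> * lam j) u i i')
        - quad r a (\<lambda>i i'. real (Suc k) * gram m lam u i i' ^ k * gram m q u i i')"
      unfolding quad_cmult[symmetric] quad_diff[symmetric] gram_diff[symmetric] by (simp add: algebra_simps)
    finally show "quad r a (\<lambda>i i'. real (Suc k) * gram m lam u i i' ^ k * gram m q u i i')
        \<le> quad r a (\<lambda>i i'. real (Suc k) * gram m lam u i i' ^ k * gram m (\<lambda>j. \<delta> * lam j) u i i')" by simp
  qed simp
  also have "quad r a (\<lambda>i i'. real (Suc k) * gram m lam u i i' ^ k * gram m (\<lambda>j. \<delta> * lam j) u i i') =
      \<delta> * (real (Suc k) * quad r a (\<lambda>i i'. gram m lam u i i' ^ Suc k))"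
    unfolding quad_cmult[symmetric] gram_cmult by (simp add: mult_ac)
  finally show ?thesis unfolding lam_def[abs_def] by (simp add: mult_ac)
qed

end

section \<open>Couplings and the sharp threshold\<close>

text \<open>Resums the level variances: weighting level \<open>k\<close> by \<open>t ^ k\<close> is
  the same as multiplying all intensities by \<open>t\<close>.\<close>

lemma quad_exp_sums: "(\<lambda>k. t ^ k * (quad r a (\<lambda>i i'. G i i' ^ k) / fact k)) sums quad r a (\<lambda>i i'. exp (t * G i i'))"
proof -
  have "(\<lambda>k. \<Sum>i<r. \<Sum>i'<r. a i * a i' * ((t * G i i') ^ k /\<^sub>R fact k)) sums (\<Sum>i<r. \<Sum>i'<r. a i * a i' * exp (t * G i i'))"
    by (intro sums_sum sums_mult exp_converges)
  moreover have "(\<Sum>i<r. \<Sum>i'<r. a i * a i' * ((t * G i i') ^ k /\<^sub>R fact k)) = t ^ k * (quad r a (\<lambda>i i'. G i i' ^ k) / fact k)" for k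
    by (simp add: quad_def sum_distrib_left sum_divide_distrib power_mult_distrib field_simps)
  ultimately show ?thesis by (simp add: quad_def)
qed

lemma quad_exp_mono:
  assumes q: "\<And>j. j < m \<Longrightarrow> 0 \<le> q j" and st: "0 \<le> s" "s \<le> t"
  shows "quad r a (\<lambda>i i'. exp (s * gram m q u i i')) \<le> quad r a (\<lambda>i i'. exp (t * gram m q u i i'))"
proof (rule sums_le[OF _ quad_exp_sums quad_exp_sums])
  fix k
  have "0 \<le> quad r a (\<lambda>i i'. gram m q u i i' ^ k)" by (intro quad_nonneg psd_gram_power q)
  then show "s ^ k * (quad r a (\<lambda>i i'. gram m q u i i' ^ k) / fact k) \<le> t ^ k * (quad r a (\<lambda>i i'. gram m q u i i' ^ k) / fact k)"
    using st by (intro mult_right_mono power_mono) auto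
qed

lemma gram_scale: "gram m q (\<lambda>i j. \<tau> * u i j) i i' = \<tau>\<^sup>2 * gram m q u i i'"
  by (simp add: gram_def sum_distrib_left power2_eq_square mult_ac)

text \<open>The inequality is proved for partial sums and passed to the limit, as the series of
  \<open>e\<close> is only assumed to converge.\<close>

lemma sums_Cauchy_Schwarz:
  fixes e p v :: "nat \<Rightarrow> real"
  assumes e: "e sums s" and p: "p sums P" and v: "v sums V" and nn: "\<And>k. 0 \<le> p k" "\<And>k. 0 \<le> v k"
    and le: "\<And>k. (e k)\<^sup>2 \<le> p k * v k"
  shows "\<bar>s\<bar> \<le> sqrt (P * V)"
proof -
  have part: "\<bar>\<Sum>k<n. e k\<bar> \<le> sqrt (P * V)" for n
  proof -
    have "\<bar>\<Sum>k<n. e k\<bar> \<le> (\<Sum>k<n. \<bar>e k\<bar>)" by (rule sum_abs)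
    also have "\<dots> \<le> (\<Sum>k<n. sqrt (p k) * sqrt (v k))"
      using le by (intro sum_mono) (metis real_sqrt_abs real_sqrt_le_iff real_sqrt_mult)
    also have "\<dots> \<le> sqrt ((\<Sum>k<n. (sqrt (p k))\<^sup>2) * (\<Sum>k<n. (sqrt (v k))\<^sup>2))"
      by (rule real_le_rsqrt) (rule Cauchy_Schwarz_ineq_sum)
    also have "(\<Sum>k<n. (sqrt (p k))\<^sup>2) = (\<Sum>k<n. p k)" using nn by simp
    also have "(\<Sum>k<n. (sqrt (v k))\<^sup>2) = (\<Sum>k<n. v k)" using nn by simp
    also have "sqrt ((\<Sum>k<n. p k) * (\<Sum>k<n. v k)) \<le> sqrt (P * V)"
    proof (intro real_sqrt_le_mono mult_mono)
      show "(\<Sum>k<n. p k) \<le> P" using sum_le_suminf[OF sums_summable[OF p], of "{..<n}"] nn sums_unique[OF p] by simp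
      show "(\<Sum>k<n. v k) \<le> V" using sum_le_suminf[OF sums_summable[OF v], of "{..<n}"] nn sums_unique[OF v] by simp
      show "0 \<le> P" using suminf_nonneg[OF sums_summable[OF p]] nn sums_unique[OF p] by simp
    qed (auto intro: sum_nonneg nn)
    finally show ?thesis .
  qed
  have "(\<lambda>n. \<bar>\<Sum>k<n. e k\<bar>) \<longlonglongrightarrow> \<bar>s\<bar>" using e unfolding sums_def by (rule tendsto_rabs)
  then show ?thesis by (rule LIMSEQ_le_const2) (use part in auto)
qed

lemma (in prob_space) abs_integral_le_sqrt:
  fixes h :: "'a \<Rightarrow> real"
  assumes [measurable]: "h \<in> borel_measurable M" and i: "integrable M (\<lambda>x. (h x)\<^sup>2)"
  shows "(\<integral>x. \<bar>h x\<bar> \<partial>M) \<le> sqrt (\<integral>x. (h x)\<^sup>2 \<partial>M)"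
proof -
  have i1: "integrable M (\<lambda>x. \<bar>h x\<bar>)" "integrable M (\<lambda>x. \<bar>h x\<bar>\<^sup>2)"
    using square_integrable_imp_integrable[OF _ i] i by auto
  have "0 \<le> variance (\<lambda>x. \<bar>h x\<bar>)" by (rule variance_positive)
  then have "(\<integral>x. \<bar>h x\<bar> \<partial>M)\<^sup>2 \<le> (\<integral>x. (h x)\<^sup>2 \<partial>M)" unfolding variance_eq[OF i1] by simp
  then show ?thesis by (rule real_le_rsqrt)
qed

section \<open>Covariances of coupled processes\<close>

context intensity_space begin

text \<open>All that the remaining argument retains of the stopping set: a bound for the correlation
  of \<open>F\<close> with every level of positive order, relative to the variance of that
  level.\<close>

definition chaos_bounded :: "'a measure measure \<Rightarrow> ('a measure \<Rightarrow> real) \<Rightarrow> real \<Rightarrow> bool" where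
  "chaos_bounded P F \<delta> \<longleftrightarrow> (\<forall>m A r u a k. cells m A \<longrightarrow> (\<forall>i<r. \<forall>j<m. \<bar>u i j\<bar> < 1) \<longrightarrow>
    (\<integral>\<mu>. F \<mu> * level m A r u a (Suc k) \<mu> \<partial>P)\<^sup>2 \<le>
    \<delta> * (real (Suc k) * (quad r a (\<lambda>i i'. gram m (\<lambda>j. measure L (A j)) u i i' ^ Suc k) / fact (Suc k))))"

text \<open>The pairing of \<open>F\<close> with the exponentials is summed over the levels, level
  \<open>0\<close> giving the product of means. Cauchy-Schwarz with the split
  \<open>k * v k = (k / t ^ k) * (t ^ k * v k)\<close> leaves a convergent numerical series and a
  second moment at intensity \<open>t\<close>.\<close>

lemma covariance_bound:
  assumes P: "plaw 1 P" and Fm: "F \<in> borel_measurable N" and F1: "\<And>\<mu>. \<mu> \<in> space N \<Longrightarrow> \<bar>F \<mu>\<bar> \<le> (1::real)"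
    and bnd: "chaos_bounded P F \<delta>" and \<delta>: "0 \<le> \<delta>" and t: "1 < t"
    and c: "cells m A" and u: "\<And>i j. i < r \<Longrightarrow> j < m \<Longrightarrow> \<bar>u i j\<bar> < 1"
  shows "\<bar>(\<integral>\<mu>. F \<mu> * (\<Sum>i<r. a i * chaos_exp m (u i) (\<lambda>j. count \<mu> (A j)) (\<lambda>j. measure L (A j)) 1) \<partial>P)
      - (\<integral>\<mu>. F \<mu> \<partial>P) * (\<Sum>i<r. a i)\<bar>
    \<le> sqrt (t / (t - 1)\<^sup>2 * (\<delta> * quad r a (\<lambda>i i'. exp (t * gram m (\<lambda>j. measure L (A j)) u i i'))))"
proof -
  interpret P: prob_space P using plaw_prob[OF P] .
  have sP[measurable_cong, simp]: "sets P = sets N" using plaw_sets[OF P] .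
  have spP[simp]: "space P = space N" using sP sets_eq_imp_space_eq by blast
  define lam where "lam j = measure L (A j)" for j
  define n where "n \<mu> j = count \<mu> (A j)" for \<mu> j
  interpret V: poisson_vector P m n lam
    using poisson_vector_count[OF P c] by (simp add: n_def[abs_def] lam_def[abs_def])
  have [measurable]: "F \<in> borel_measurable P" using Fm by (simp cong: measurable_cong_sets)
  let ?l = "\<lambda>k \<mu>. level m A r u a k \<mu>"
  have l: "?l k \<mu> = (\<Sum>i<r. a i * fps_nth (chaos m (u i) (n \<mu>) lam) k)" for k \<mu>
    by (simp add: level_def n_def[abs_def] lam_def[abs_def])
  have lm[measurable]: "?l k \<in> borel_measurable P" for k using measurable_level[OF c] by (simp cong: measurable_cong_sets)
  define S where "S \<mu> = (\<Sum>i<r. \<bar>a i\<bar> * chaos_bound m (u i) (n \<mu>) lam)" for \<mu>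
  have Si: "integrable P S"
  proof -
    have "chaos_bound m (\<lambda>_. 0) (n \<mu>) lam = 1" for \<mu> by (simp add: chaos_bound_def)
    then have "integrable P (\<lambda>\<mu>. chaos_bound m (u i) (n \<mu>) lam)" for i
      using V.integrable_chaos_bound[of "u i" "\<lambda>_. 0"] by simp
    then show ?thesis unfolding S_def[abs_def] by (intro Bochner_Integration.integrable_sum integrable_mult_right)
  qed
  have S0: "0 \<le> S \<mu>" for \<mu> unfolding S_def by (intro sum_nonneg mult_nonneg_nonneg) (auto simp: chaos_bound_nonneg)
  have sm0: "summable (\<lambda>k. \<Sum>i<r. \<bar>a i\<bar> * \<bar>fps_nth (chaos m (u i) (n \<mu>) lam) k\<bar>)" for \<mu>
    by (intro summable_sum summable_mult chaos_abs_sums)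
  have lle: "\<bar>?l k \<mu>\<bar> \<le> (\<Sum>i<r. \<bar>a i\<bar> * \<bar>fps_nth (chaos m (u i) (n \<mu>) lam) k\<bar>)" for k \<mu>
    unfolding l abs_mult[symmetric] by (rule sum_abs)
  have sm1: "summable (\<lambda>k. \<bar>?l k \<mu>\<bar>)" for \<mu>
    using lle by (intro summable_comparison_test'[OF sm0]) auto
  have le1: "(\<Sum>k. \<bar>?l k \<mu>\<bar>) \<le> S \<mu>" for \<mu>
  proof -
    have "(\<Sum>k. \<bar>?l k \<mu>\<bar>) \<le> (\<Sum>k. \<Sum>i<r. \<bar>a i\<bar> * \<bar>fps_nth (chaos m (u i) (n \<mu>) lam) k\<bar>)"
      by (intro suminf_le lle sm0 sm1)
    also have "\<dots> = (\<Sum>i<r. \<Sum>k. \<bar>a i\<bar> * \<bar>fps_nth (chaos m (u i) (n \<mu>) lam) k\<bar>)"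
      by (intro suminf_sum summable_mult chaos_abs_sums)
    also have "\<dots> = (\<Sum>i<r. \<bar>a i\<bar> * (\<Sum>k. \<bar>fps_nth (chaos m (u i) (n \<mu>) lam) k\<bar>))"
      by (intro sum.cong refl suminf_mult chaos_abs_sums)
    also have "\<dots> \<le> S \<mu>"
      unfolding S_def by (intro sum_mono mult_left_mono chaos_abs_sums) auto
    finally show ?thesis .
  qed
  have FSi: "integrable P (\<lambda>\<mu>. \<bar>F \<mu>\<bar> * S \<mu>)"
    using F1 S0 Si by (intro Bochner_Integration.integrable_bound[OF Si]) (auto intro!: AE_I2 mult_left_le_one_le simp: abs_mult)
  have sm2: "summable (\<lambda>k. \<bar>F \<mu> * ?l k \<mu>\<bar>)" for \<mu> unfolding abs_mult by (intro summable_mult sm1)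
  have le2: "(\<Sum>k. \<bar>F \<mu> * ?l k \<mu>\<bar>) \<le> \<bar>F \<mu>\<bar> * S \<mu>" for \<mu>
    unfolding abs_mult suminf_mult[OF sm1] by (intro mult_left_mono le1) auto
  let ?g = "\<lambda>\<mu>. \<Sum>i<r. a i * chaos_exp m (u i) (n \<mu>) lam 1"
  have "(\<lambda>k. (\<integral>\<mu>. F \<mu> * ?l k \<mu> \<partial>P) * 1 ^ k) sums (\<integral>\<mu>. (\<Sum>k. F \<mu> * ?l k \<mu> * 1 ^ k) \<partial>P)"
    by (rule powser_integral(2)[OF _ sm2 le2 FSi]) auto
  also have "(\<integral>\<mu>. (\<Sum>k. F \<mu> * ?l k \<mu> * 1 ^ k) \<partial>P) = (\<integral>\<mu>. F \<mu> * ?g \<mu> \<partial>P)"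
  proof (rule Bochner_Integration.integral_cong[OF refl])
    fix \<mu>
    have "(\<lambda>k. F \<mu> * ?l k \<mu>) sums (F \<mu> * ?g \<mu>)"
      unfolding l using chaos_sums[of m "u _" "n \<mu>" lam 1] by (intro sums_mult sums_sum) simp
    then show "(\<Sum>k. F \<mu> * ?l k \<mu> * 1 ^ k) = F \<mu> * ?g \<mu>" by (simp add: sums_unique[symmetric])
  qed
  finally have "(\<lambda>k. \<integral>\<mu>. F \<mu> * ?l k \<mu> \<partial>P) sums (\<integral>\<mu>. F \<mu> * ?g \<mu> \<partial>P)" by simp
  then have e: "(\<lambda>k. \<integral>\<mu>. F \<mu> * ?l (Suc k) \<mu> \<partial>P) sums ((\<integral>\<mu>. F \<mu> * ?g \<mu> \<partial>P) - (\<integral>\<mu>. F \<mu> \<partial>P) * (\<Sum>i<r. a i))"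
    by (subst sums_Suc_iff) (simp add: l)
  define v where "v k = quad r a (\<lambda>i i'. gram m lam u i i' ^ k) / fact k" for k
  have v0: "0 \<le> v k" for k
    unfolding v_def by (intro divide_nonneg_nonneg quad_nonneg psd_gram_power) (auto simp: lam_def)
  define W where "W = quad r a (\<lambda>i i'. exp (t * gram m lam u i i'))"
  have "(\<lambda>k. \<delta> * (t ^ k * v k)) sums (\<delta> * W)"
    unfolding v_def W_def by (intro sums_mult quad_exp_sums)
  then have v1: "(\<lambda>k. \<delta> * (t ^ Suc k * v (Suc k))) sums (\<delta> * W - \<delta> * v 0)"
    by (subst sums_Suc_iff) simp
  \<comment> \<open>The series of \<open>k * x ^ k\<close> is the derivative of the geometric
    series; at \<open>x = 1 / t\<close> its sum is \<open>t / (t - 1)\<^sup>2\<close>.\<close>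
  define x where "x = 1 / t"
  have x: "0 < x" "x < 1" using t by (auto simp: x_def)
  have "(\<lambda>k. real (Suc k) * x ^ k) sums (1 / (1 - x)\<^sup>2)" using geometric_deriv_sums[of x] x by simp
  then have p: "(\<lambda>k. x * (real (Suc k) * x ^ k)) sums (x * (1 / (1 - x)\<^sup>2))" by (rule sums_mult)
  have "(1 - x) = (t - 1) / t" using t by (simp add: x_def field_simps)
  then have px: "x * (1 / (1 - x)\<^sup>2) = t / (t - 1)\<^sup>2" using t by (simp add: x_def power_divide power2_eq_square)
  have "\<bar>(\<integral>\<mu>. F \<mu> * ?g \<mu> \<partial>P) - (\<integral>\<mu>. F \<mu> \<partial>P) * (\<Sum>i<r. a i)\<bar> \<le> sqrt (x * (1 / (1 - x)\<^sup>2) * (\<delta> * W - \<delta> * v 0))"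
  proof (rule sums_Cauchy_Schwarz[OF e p v1])
    fix k
    show "0 \<le> x * (real (Suc k) * x ^ k)" using x by simp
    show "0 \<le> \<delta> * (t ^ Suc k * v (Suc k))" using \<delta> t v0 by simp
    have "(\<integral>\<mu>. F \<mu> * ?l (Suc k) \<mu> \<partial>P)\<^sup>2 \<le> \<delta> * (real (Suc k) * v (Suc k))"
      using bnd c u unfolding chaos_bounded_def v_def lam_def[abs_def] by blast
    also have "\<dots> = x ^ Suc k * t ^ Suc k * (\<delta> * (real (Suc k) * v (Suc k)))"
      using t by (simp add: x_def power_one_over)
    also have "\<dots> = x * (real (Suc k) * x ^ k) * (\<delta> * (t ^ Suc k * v (Suc k)))" by simp
    finally show "(\<integral>\<mu>. F \<mu> * ?l (Suc k) \<mu> \<partial>P)\<^sup>2 \<le> x * (real (Suc k) * x ^ k) * (\<delta> * (t ^ Suc k * v (Suc k)))" .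
  qed
  also have "\<dots> \<le> sqrt (t / (t - 1)\<^sup>2 * (\<delta> * W))"
    unfolding px using t \<delta> v0 by (intro real_sqrt_le_mono mult_left_mono) auto
  finally show ?thesis unfolding W_def lam_def[abs_def] n_def[abs_def] .
qed

text \<open>The hypothesis \<open>tilt\<close> says that averaging over \<open>\<xi>\<close> given \<open>\<eta>\<close> turns the normalized exponential
  \<open>exp (- \<kappa> * (\<integral> u dL)) * (\<Prod>x\<in>\<xi>. 1 + u x)\<close> into the one of \<open>\<eta>\<close> with \<open>\<tau> * u\<close> in place of \<open>u\<close>: here
  \<open>\<tau> = 1\<close> for a superposition and \<open>\<tau> = \<kappa>\<close> for a thinning.\<close>

lemma coupling_bound:
  assumes P: "plaw 1 P" and P': "plaw \<kappa> P'"
    and Q: "prob_space Q" "sets Q = sets (N \<Otimes>\<^sub>M N)" and fst: "distr Q N fst = P" and snd: "distr Q N snd = P'"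
    and fm: "f \<in> borel_measurable N" and f01: "f \<in> space N \<rightarrow> {0, 1 :: real}"
    and tilt: "\<And>\<phi>. test \<phi> \<Longrightarrow> (\<And>x. \<phi> x \<le> 0) \<Longrightarrow>
      (\<integral>\<^sup>+p. ennreal (f (fst p)) * ennreal (expf \<phi> (snd p)) \<partial>Q) =
      ennreal (exp ((\<kappa> - \<tau>) * (\<integral>x. exp (\<phi> x) - 1 \<partial>L))) *
      (\<integral>\<^sup>+\<mu>. ennreal (f \<mu>) * ennreal (expf (\<lambda>x. ln (1 + \<tau> * (exp (\<phi> x) - 1))) \<mu>) \<partial>P)"
    and bnd: "chaos_bounded P f \<delta>" and \<delta>: "0 \<le> \<delta>" and t: "1 < t" and \<tau>: "0 < \<tau>" "\<tau> \<le> 1" and t\<tau>: "t * \<tau>\<^sup>2 \<le> \<kappa>"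
  shows "\<bar>(\<integral>p. f (fst p) * f (snd p) \<partial>Q) - (\<integral>\<mu>. f \<mu> \<partial>P) * (\<integral>\<mu>. f \<mu> \<partial>P')\<bar> \<le> sqrt (t / (t - 1)\<^sup>2 * (\<delta> * 4))"
proof -
  interpret P: prob_space P using plaw_prob[OF P] .
  interpret P': prob_space P' using plaw_prob[OF P'] .
  interpret Q: prob_space Q by (rule Q(1))
  have sP[measurable_cong, simp]: "sets P = sets N" using plaw_sets[OF P] .
  have spP[simp]: "space P = space N" using sP sets_eq_imp_space_eq by blast
  have sP'[measurable_cong, simp]: "sets P' = sets N" using plaw_sets[OF P'] .
  have spP'[simp]: "space P' = space N" using sP' sets_eq_imp_space_eq by blast
  note sQ[measurable_cong] = Q(2)
  have spQ: "space Q = space N \<times> space N" using sQ sets_eq_imp_space_eq space_pair_measure by metis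
  interpret FP: finite_point_law X B P'
    using P'.finite_measure_axioms by (simp add: finite_point_law_def finite_point_law_axioms_def localized_space_axioms)
  note [measurable] = fm
  have f1: "0 \<le> f \<mu>" "f \<mu> \<le> 1" "\<bar>f \<mu>\<bar> \<le> 1" if "\<mu> \<in> space N" for \<mu> using funcset_mem[OF f01 that] by auto
  have fst_m[measurable]: "fst \<in> Q \<rightarrow>\<^sub>M N" and snd_m[measurable]: "snd \<in> Q \<rightarrow>\<^sub>M N"
    by (simp_all cong: measurable_cong_sets)
  let ?cov = "(\<integral>p. f (fst p) * f (snd p) \<partial>Q) - (\<integral>\<mu>. f \<mu> \<partial>P) * (\<integral>\<mu>. f \<mu> \<partial>P')"
  \<comment> \<open>In the second coordinate \<open>f\<close> is replaced by an exponential
    polynomial that is close in \<open>L2\<close> of \<open>P'\<close>. The joint expectation and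
    the product of means each change by at most \<open>sqrt \<epsilon>\<close>.\<close>
  have main: "\<bar>?cov\<bar> \<le> sqrt (t / (t - 1)\<^sup>2 * (\<delta> * 4)) + 2 * sqrt \<epsilon>" if \<epsilon>: "0 < \<epsilon>" "\<epsilon> \<le> 1" for \<epsilon>
  proof -
    define E where "E = {\<mu> \<in> space N. f \<mu> = 1}"
    have E: "E \<in> sets N" unfolding E_def by measurable
    have fE: "indicator E \<mu> = f \<mu>" if "\<mu> \<in> space N" for \<mu>
      using funcset_mem[OF f01 that] that by (auto simp: E_def)
    obtain G0 where G0: "expoly G0" "(\<integral>\<mu>. (indicator E \<mu> - G0 \<mu>)\<^sup>2 \<partial>P') < \<epsilon>"
      using FP.approx_indicator[OF E] \<epsilon>(1) unfolding FP.approx_def by blast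
    obtain r :: nat and b \<phi> where \<phi>: "\<And>i. i < r \<Longrightarrow> test (\<phi> i)" "\<And>i x. i < r \<Longrightarrow> \<phi> i x \<le> 0"
      and Grep: "\<And>\<mu>. \<mu> \<in> space N \<Longrightarrow> G0 \<mu> = (\<Sum>i<r. b i * expf (\<phi> i) \<mu>)"
      using expoly_repr[OF G0(1)] by blast
    define G where "G \<mu> = (\<Sum>i<r. b i * expf (\<phi> i) \<mu>)" for \<mu>
    have em[measurable]: "expf (\<phi> i) \<in> borel_measurable N" if "i < r" for i
      using measurable_expf[OF measurable_ident \<phi>(1)[OF that]] by (simp add: id_def)
    have Gm[measurable]: "G \<in> borel_measurable N" unfolding G_def[abs_def] by measurable
    have e1: "0 \<le> expf (\<phi> i) \<mu>" "\<bar>expf (\<phi> i) \<mu>\<bar> \<le> 1" if "i < r" for i \<mu>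
      using expf_le_1[OF \<phi>(2)[OF that]] expf_nonneg by auto
    obtain C where C: "\<bar>G \<mu>\<bar> \<le> C" for \<mu>
    proof
      fix \<mu>
      have "\<bar>G \<mu>\<bar> \<le> (\<Sum>i<r. \<bar>b i * expf (\<phi> i) \<mu>\<bar>)" unfolding G_def by (rule sum_abs)
      also have "\<dots> \<le> (\<Sum>i<r. \<bar>b i\<bar>)" using e1 by (intro sum_mono) (auto simp: abs_mult intro!: mult_left_le)
      finally show "\<bar>G \<mu>\<bar> \<le> (\<Sum>i<r. \<bar>b i\<bar>)" .
    qed
    have fG: "(\<integral>\<mu>. (f \<mu> - G \<mu>)\<^sup>2 \<partial>P') < \<epsilon>"
    proof -
      have "(\<integral>\<mu>. (f \<mu> - G \<mu>)\<^sup>2 \<partial>P') = (\<integral>\<mu>. (indicator E \<mu> - G0 \<mu>)\<^sup>2 \<partial>P')"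
        using fE Grep by (intro Bochner_Integration.integral_cong) (auto simp: G_def)
      then show ?thesis using G0(2) by simp
    qed
    have ifG: "integrable P' (\<lambda>\<mu>. (f \<mu> - G \<mu>)\<^sup>2)"
      using f1 C by (intro FP.integrable_diff_square[where C=1 and D=C]) auto
    have iG: "integrable P' G" using C by (intro FP.integrable_bounded[where C=C]) auto
    have if': "integrable P' f" using f1 by (intro FP.integrable_bounded[where C=1]) auto
    have iG2: "integrable P' (\<lambda>\<mu>. (G \<mu>)\<^sup>2)"
      using FP.integrable_diff_square[of "\<lambda>_. 0" G 0 C] C by auto
    have L1: "(\<integral>\<mu>. \<bar>f \<mu> - G \<mu>\<bar> \<partial>P') \<le> sqrt \<epsilon>"
      using P'.abs_integral_le_sqrt[of "\<lambda>\<mu>. f \<mu> - G \<mu>", OF _ ifG] fG by (auto intro: order_trans real_sqrt_le_mono)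
    \<comment> \<open>Origin of the constant \<open>4\<close>: the square of \<open>G\<close> is at
      most \<open>2 * (f \<mu>)\<^sup>2 + 2 * (f \<mu> - G \<mu>)\<^sup>2\<close>, with
      \<open>f\<close> bounded by \<open>1\<close> and \<open>\<epsilon> \<le> 1\<close>.\<close>
    have G2: "(\<integral>\<mu>. (G \<mu>)\<^sup>2 \<partial>P') \<le> 4"
    proof -
      have "(\<integral>\<mu>. (G \<mu>)\<^sup>2 \<partial>P') \<le> (\<integral>\<mu>. 2 * 1 + 2 * (f \<mu> - G \<mu>)\<^sup>2 \<partial>P')"
      proof (rule integral_mono)
        fix \<mu> assume "\<mu> \<in> space P'"
        then have "f \<mu> = 0 \<or> f \<mu> = 1" using funcset_mem[OF f01, of \<mu>] by auto
        moreover have "(G \<mu>)\<^sup>2 \<le> 2 * (f \<mu>)\<^sup>2 + 2 * (f \<mu> - G \<mu>)\<^sup>2"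
          using zero_le_power2[of "G \<mu> - 2 * f \<mu>"] by (simp add: power2_eq_square algebra_simps)
        ultimately show "(G \<mu>)\<^sup>2 \<le> 2 * 1 + 2 * (f \<mu> - G \<mu>)\<^sup>2" by auto
      qed (use iG2 ifG in auto)
      also have "\<dots> = 2 + 2 * (\<integral>\<mu>. (f \<mu> - G \<mu>)\<^sup>2 \<partial>P')" using ifG P'.prob_space by simp
      finally show ?thesis using fG \<epsilon> by linarith
    qed
    obtain m :: nat and A w where c: "cells m A" and w: "\<And>i x. i < r \<Longrightarrow> x \<in> space X \<Longrightarrow> \<phi> i x = (\<Sum>j<m. w i j * indicator (A j) x)"
      and w': "\<And>i j. i < r \<Longrightarrow> j < m \<Longrightarrow> \<exists>x\<in>space X. w i j = \<phi> i x"
      using common_cells[of r \<phi>] \<phi>(1) by blast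
    define lam where "lam j = measure L (A j)" for j
    \<comment> \<open>\<open>expf (\<phi> i)\<close> is now the product over the cells of
      \<open>1 + u i j\<close> raised to the count. Nonpositive \<open>\<phi> i\<close> place
      \<open>u i j\<close> in the interval from \<open>- 1\<close> (excluded) to \<open>0\<close>,
      inside the range that orthogonality requires.\<close>
    define u where "u i j = exp (w i j) - 1" for i j
    have u0: "- 1 < u i j" "u i j \<le> 0" if "i < r" "j < m" for i j
      using w'[OF that] \<phi>(2)[OF that(1)] by (auto simp: u_def)
    have \<tau>u: "\<bar>\<tau> * u i j\<bar> < 1" if "i < r" "j < m" for i j
    proof -
      have "\<bar>\<tau> * u i j\<bar> \<le> 1 * \<bar>u i j\<bar>" unfolding abs_mult using \<tau> by (intro mult_right_mono) auto
      then show ?thesis using u0[OF that] by linarith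
    qed
    have Aj: "A j \<in> sets X" "emeasure L (A j) < \<infinity>" if "j < m" for j
      using cells_sets[OF c that] cells_bounded[OF c that] emeasure_bounded_finite[OF locally_finite_L, of "A j"] by auto
    have int_cells: "(\<integral>x. (\<Sum>j<m. d j * indicator (A j) x) \<partial>L) = (\<Sum>j<m. lam j * d j)" for d :: "nat \<Rightarrow> real"
    proof -
      have "has_bochner_integral L (\<lambda>x. \<Sum>j<m. d j * indicator (A j) x) (\<Sum>j<m. d j * lam j)"
        unfolding lam_def using Aj by (intro has_bochner_integral_sum has_bochner_integral_mult_right has_bochner_integral_real_indicator) auto
      then show ?thesis by (simp add: has_bochner_integral_iff mult.commute)
    qed
    define s where "s i = (\<Sum>j<m. lam j * u i j)" for i
    have s: "(\<integral>x. exp (\<phi> i x) - 1 \<partial>L) = s i" if i: "i < r" for i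
    proof -
      have "(\<integral>x. exp (\<phi> i x) - 1 \<partial>L) = (\<integral>x. (\<Sum>j<m. u i j * indicator (A j) x) \<partial>L)"
        using w[OF i] cells_sum_compose[OF c, of "\<lambda>v. exp v - 1" "w i"] unfolding u_def
        by (intro Bochner_Integration.integral_cong) auto
      then show ?thesis by (simp only: int_cells s_def)
    qed
    have s2: "(\<integral>x. exp (\<phi> i x + \<phi> i' x) - 1 \<partial>L) = s i + s i' + gram m lam u i i'" if i: "i < r" "i' < r" for i i'
    proof -
      have "(\<integral>x. exp (\<phi> i x + \<phi> i' x) - 1 \<partial>L) = (\<integral>x. (\<Sum>j<m. (exp (w i j + w i' j) - 1) * indicator (A j) x) \<partial>L)"
      proof (rule Bochner_Integration.integral_cong[OF refl])
        fix x assume "x \<in> space L"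
        then have "\<phi> i x + \<phi> i' x = (\<Sum>j<m. (w i j + w i' j) * indicator (A j) x)"
          using w[OF i(1), of x] w[OF i(2), of x] by (simp only: sum.distrib distrib_right space_L)
        then show "exp (\<phi> i x + \<phi> i' x) - 1 = (\<Sum>j<m. (exp (w i j + w i' j) - 1) * indicator (A j) x)"
          using cells_sum_compose[OF c, of "\<lambda>v. exp v - 1" "\<lambda>j. w i j + w i' j" x] by simp
      qed
      also have "\<dots> = (\<Sum>j<m. lam j * u i j + lam j * u i' j + lam j * u i j * u i' j)"
        unfolding int_cells by (rule sum.cong) (auto simp: u_def exp_add algebra_simps)
      finally show ?thesis by (simp add: sum.distrib s_def gram_def)
    qed
    \<comment> \<open>The coefficients of \<open>G\<close> with respect to the exponentials
      normalized to mean \<open>1\<close> under \<open>P'\<close>.\<close>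
    define a where "a i = b i * exp (\<kappa> * s i)" for i
    have Gmean: "(\<integral>\<mu>. G \<mu> \<partial>P') = (\<Sum>i<r. a i)"
    proof -
      have "has_bochner_integral P' (expf (\<phi> i)) (exp (\<kappa> * s i))" if i: "i < r" for i
        unfolding has_bochner_integral_iff using plaw_expf[OF P' \<phi>(1)[OF i]] s[OF i] em[OF i] e1[OF i]
        by (auto intro!: FP.integrable_bounded[where C=1] simp: integral_eq_nn_integral)
      then have "has_bochner_integral P' G (\<Sum>i<r. b i * exp (\<kappa> * s i))"
        unfolding G_def[abs_def] by (intro has_bochner_integral_sum has_bochner_integral_mult_right) auto
      then show ?thesis by (simp add: has_bochner_integral_iff a_def)
    qed
    \<comment> \<open>Under \<open>P'\<close> the cell means are \<open>\<kappa> * lam j\<close>, so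
      level \<open>k\<close> of \<open>G\<close> carries a factor \<open>\<kappa> ^ k\<close>: this
      is the room that the weight \<open>t ^ k\<close> uses below.\<close>
    have Gsq: "(\<integral>\<mu>. (G \<mu>)\<^sup>2 \<partial>P') = quad r a (\<lambda>i i'. exp (\<kappa> * gram m lam u i i'))"
    proof -
      have hb: "has_bochner_integral P' (\<lambda>\<mu>. expf (\<phi> i) \<mu> * expf (\<phi> i') \<mu>) (exp (\<kappa> * (s i + s i' + gram m lam u i i')))"
        if i: "i < r" "i' < r" for i i'
      proof -
        have ta: "test (\<lambda>x. \<phi> i x + \<phi> i' x)" using \<phi>(1) i by (intro test_add) auto
        have "(\<integral>\<^sup>+\<mu>. ennreal (expf (\<phi> i) \<mu> * expf (\<phi> i') \<mu>) \<partial>P') = (\<integral>\<^sup>+\<mu>. expf (\<lambda>x. \<phi> i x + \<phi> i' x) \<mu> \<partial>P')"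
          using \<phi>(1) i by (intro nn_integral_cong) (simp add: expf_add)
        then have nn: "(\<integral>\<^sup>+\<mu>. ennreal (expf (\<phi> i) \<mu> * expf (\<phi> i') \<mu>) \<partial>P') = ennreal (exp (\<kappa> * (s i + s i' + gram m lam u i i')))"
          using plaw_expf[OF P' ta] s2[OF i] by simp
        have [measurable]: "expf (\<phi> i) \<in> borel_measurable N" "expf (\<phi> i') \<in> borel_measurable N" using em i by auto
        have "\<bar>expf (\<phi> i) \<mu> * expf (\<phi> i') \<mu>\<bar> \<le> 1" for \<mu>
          using e1(2)[OF i(1), of \<mu>] e1(2)[OF i(2), of \<mu>] unfolding abs_mult by (intro mult_le_one) auto
        then show ?thesis unfolding has_bochner_integral_iff using nn e1 i
          by (auto intro!: FP.integrable_bounded[where C=1] simp: integral_eq_nn_integral)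
      qed
      have sq: "(G \<mu>)\<^sup>2 = (\<Sum>i<r. \<Sum>i'<r. b i * b i' * (expf (\<phi> i) \<mu> * expf (\<phi> i') \<mu>))" for \<mu>
        by (simp add: G_def power2_eq_square sum_product mult_ac)
      have "has_bochner_integral P' (\<lambda>\<mu>. (G \<mu>)\<^sup>2) (\<Sum>i<r. \<Sum>i'<r. b i * b i' * exp (\<kappa> * (s i + s i' + gram m lam u i i')))"
        unfolding sq by (intro has_bochner_integral_sum has_bochner_integral_mult_right hb) auto
      then show ?thesis
        by (simp add: has_bochner_integral_iff quad_def a_def distrib_left exp_add mult_ac)
    qed
    \<comment> \<open>Plays the part of the conditional expectation of \<open>G (snd p)\<close>
      given \<open>fst p\<close> when tested against \<open>f\<close>. Scaling \<open>u\<close> by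
      \<open>\<tau>\<close> damps level \<open>k\<close> by \<open>\<tau> ^ k\<close>.\<close>
    define g where "g \<mu> = (\<Sum>i<r. a i * chaos_exp m (\<lambda>j. \<tau> * u i j) (\<lambda>j. count \<mu> (A j)) lam 1)" for \<mu>
    have tilted: "(\<integral>p. f (fst p) * G (snd p) \<partial>Q) = (\<integral>\<mu>. f \<mu> * g \<mu> \<partial>P)"
    proof -
      have one: "has_bochner_integral Q (\<lambda>p. f (fst p) * expf (\<phi> i) (snd p)) (\<integral>p. f (fst p) * expf (\<phi> i) (snd p) \<partial>Q)"
        "integrable P (\<lambda>\<mu>. f \<mu> * chaos_exp m (\<lambda>j. \<tau> * u i j) (\<lambda>j. count \<mu> (A j)) lam 1)"
        "(\<integral>p. f (fst p) * expf (\<phi> i) (snd p) \<partial>Q) = exp (\<kappa> * s i) * (\<integral>\<mu>. f \<mu> * chaos_exp m (\<lambda>j. \<tau> * u i j) (\<lambda>j. count \<mu> (A j)) lam 1 \<partial>P)"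
        if i: "i < r" for i
      proof -
        note [measurable] = em[OF i]
        have b: "\<bar>f (fst p) * expf (\<phi> i) (snd p)\<bar> \<le> 1" if "p \<in> space Q" for p
          using that e1(2)[OF i, of "snd p"] f1[of "fst p"] unfolding abs_mult spQ by (intro mult_le_one) auto
        have iQ: "integrable Q (\<lambda>p. f (fst p) * expf (\<phi> i) (snd p))"
          using b by (intro Q.integrable_const_bound[where B=1]) (auto intro!: AE_I2)
        then show "has_bochner_integral Q (\<lambda>p. f (fst p) * expf (\<phi> i) (snd p)) (\<integral>p. f (fst p) * expf (\<phi> i) (snd p) \<partial>Q)"
          by (simp add: has_bochner_integral_iff)
        let ?\<theta> = "\<lambda>x. ln (1 + \<tau> * (exp (\<phi> i x) - 1))"
        have t\<theta>: "test ?\<theta>" using test_compose[OF \<phi>(1)[OF i], of "\<lambda>v. ln (1 + \<tau> * (exp v - 1))"] by simp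
        have [measurable]: "expf ?\<theta> \<in> borel_measurable N"
          using measurable_expf[OF measurable_ident t\<theta>] by (simp add: id_def)
        have ce: "chaos_exp m (\<lambda>j. \<tau> * u i j) (\<lambda>j. count \<mu> (A j)) lam 1 = exp (- (\<tau> * s i)) * expf ?\<theta> \<mu>" if \<mu>: "\<mu> \<in> space N" for \<mu>
        proof -
          have "expf ?\<theta> \<mu> = expf (\<lambda>x. \<Sum>j<m. ln (1 + \<tau> * u i j) * indicator (A j) x) \<mu>"
            using w[OF i] cells_sum_compose[OF c, of "\<lambda>v. ln (1 + \<tau> * (exp v - 1))" "w i"]
            by (intro expf_cong[OF \<mu>]) (simp add: u_def)
          also have "\<dots> = (\<Prod>j<m. exp (ln (1 + \<tau> * u i j)) ^ count \<mu> (A j))" by (rule expf_cells[OF c \<mu>])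
          also have "\<dots> = (\<Prod>j<m. (1 + \<tau> * u i j) ^ count \<mu> (A j))"
          proof (rule prod.cong[OF refl])
            fix j assume "j \<in> {..<m}"
            then have "0 < 1 + \<tau> * u i j" using \<tau>u[OF i, of j] by auto
            then show "exp (ln (1 + \<tau> * u i j)) ^ count \<mu> (A j) = (1 + \<tau> * u i j) ^ count \<mu> (A j)" by simp
          qed
          finally show ?thesis
            by (simp add: chaos_exp_def prod.distrib exp_sum[symmetric] s_def sum_distrib_left sum_negf[symmetric] mult_ac)
        qed
        have nn\<theta>: "(\<integral>\<^sup>+\<mu>. ennreal (f \<mu> * expf ?\<theta> \<mu>) \<partial>P) \<le> (\<integral>\<^sup>+\<mu>. expf ?\<theta> \<mu> \<partial>P)"
          using f1 expf_nonneg[of ?\<theta>] by (intro nn_integral_mono ennreal_leI) (auto intro!: mult_left_le_one_le)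
        have i\<theta>: "integrable P (\<lambda>\<mu>. f \<mu> * expf ?\<theta> \<mu>)"
        proof (rule integrableI_nonneg)
          show "AE \<mu> in P. 0 \<le> f \<mu> * expf ?\<theta> \<mu>" using f1 by (auto simp: expf_nonneg intro!: AE_I2)
          show "(\<integral>\<^sup>+\<mu>. ennreal (f \<mu> * expf ?\<theta> \<mu>) \<partial>P) < \<infinity>"
            using nn\<theta> plaw_expf[OF P t\<theta>] by (auto intro: le_less_trans)
        qed measurable
        have cong: "(\<integral>\<mu>. f \<mu> * chaos_exp m (\<lambda>j. \<tau> * u i j) (\<lambda>j. count \<mu> (A j)) lam 1 \<partial>P) = (\<integral>\<mu>. exp (- (\<tau> * s i)) * (f \<mu> * expf ?\<theta> \<mu>) \<partial>P)"
          using ce by (intro Bochner_Integration.integral_cong) auto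
        have "integrable P (\<lambda>\<mu>. exp (- (\<tau> * s i)) * (f \<mu> * expf ?\<theta> \<mu>))" using i\<theta> by (rule integrable_mult_right)
        then show "integrable P (\<lambda>\<mu>. f \<mu> * chaos_exp m (\<lambda>j. \<tau> * u i j) (\<lambda>j. count \<mu> (A j)) lam 1)"
          by (rule Bochner_Integration.integrable_cong[THEN iffD1, rotated -1]) (auto simp: ce)
        have "ennreal (\<integral>p. f (fst p) * expf (\<phi> i) (snd p) \<partial>Q) = (\<integral>\<^sup>+p. ennreal (f (fst p) * expf (\<phi> i) (snd p)) \<partial>Q)"
          using iQ f1 e1[OF i] by (intro nn_integral_eq_integral[symmetric]) (auto intro!: AE_I2 simp: spQ)
        also have "\<dots> = (\<integral>\<^sup>+p. ennreal (f (fst p)) * ennreal (expf (\<phi> i) (snd p)) \<partial>Q)"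
          using f1 e1[OF i] by (intro nn_integral_cong ennreal_mult) (auto simp: spQ)
        also have "\<dots> = ennreal (exp ((\<kappa> - \<tau>) * s i)) * (\<integral>\<^sup>+\<mu>. ennreal (f \<mu>) * ennreal (expf ?\<theta> \<mu>) \<partial>P)"
          using tilt[OF \<phi>(1)[OF i] \<phi>(2)[OF i]] s[OF i] by simp
        also have "(\<integral>\<^sup>+\<mu>. ennreal (f \<mu>) * ennreal (expf ?\<theta> \<mu>) \<partial>P) = (\<integral>\<^sup>+\<mu>. ennreal (f \<mu> * expf ?\<theta> \<mu>) \<partial>P)"
          using f1 by (intro nn_integral_cong ennreal_mult[symmetric]) (auto simp: expf_nonneg)
        also have "\<dots> = ennreal (\<integral>\<mu>. f \<mu> * expf ?\<theta> \<mu> \<partial>P)"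
          using i\<theta> f1 by (intro nn_integral_eq_integral) (auto intro!: AE_I2 simp: expf_nonneg)
        finally have "ennreal (\<integral>p. f (fst p) * expf (\<phi> i) (snd p) \<partial>Q) = ennreal (exp ((\<kappa> - \<tau>) * s i) * (\<integral>\<mu>. f \<mu> * expf ?\<theta> \<mu> \<partial>P))"
          by (simp add: ennreal_mult')
        moreover have "0 \<le> (\<integral>p. f (fst p) * expf (\<phi> i) (snd p) \<partial>Q)"
          using f1 e1[OF i] by (intro Bochner_Integration.integral_nonneg_AE) (auto intro!: AE_I2 simp: spQ)
        moreover have "0 \<le> (\<integral>\<mu>. f \<mu> * expf ?\<theta> \<mu> \<partial>P)"
          using f1 by (intro Bochner_Integration.integral_nonneg_AE) (auto intro!: AE_I2 simp: expf_nonneg)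
        ultimately have "(\<integral>p. f (fst p) * expf (\<phi> i) (snd p) \<partial>Q) = exp ((\<kappa> - \<tau>) * s i) * (\<integral>\<mu>. f \<mu> * expf ?\<theta> \<mu> \<partial>P)"
          by simp
        also have "\<dots> = exp (\<kappa> * s i) * (exp (- (\<tau> * s i)) * (\<integral>\<mu>. f \<mu> * expf ?\<theta> \<mu> \<partial>P))"
          by (simp add: mult.assoc[symmetric] exp_add[symmetric] algebra_simps)
        finally show "(\<integral>p. f (fst p) * expf (\<phi> i) (snd p) \<partial>Q) = exp (\<kappa> * s i) * (\<integral>\<mu>. f \<mu> * chaos_exp m (\<lambda>j. \<tau> * u i j) (\<lambda>j. count \<mu> (A j)) lam 1 \<partial>P)"
          unfolding cong by simp
      qed
      have "has_bochner_integral Q (\<lambda>p. \<Sum>i<r. b i * (f (fst p) * expf (\<phi> i) (snd p))) (\<Sum>i<r. b i * (\<integral>p. f (fst p) * expf (\<phi> i) (snd p) \<partial>Q))"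
        using one(1) by (intro has_bochner_integral_sum has_bochner_integral_mult_right) auto
      then have "(\<integral>p. (\<Sum>i<r. b i * (f (fst p) * expf (\<phi> i) (snd p))) \<partial>Q) = (\<Sum>i<r. b i * (\<integral>p. f (fst p) * expf (\<phi> i) (snd p) \<partial>Q))"
        by (simp add: has_bochner_integral_iff)
      also have "\<dots> = (\<Sum>i<r. a i * (\<integral>\<mu>. f \<mu> * chaos_exp m (\<lambda>j. \<tau> * u i j) (\<lambda>j. count \<mu> (A j)) lam 1 \<partial>P))"
        using one(3) by (intro sum.cong) (auto simp: a_def)
      also have "\<dots> = (\<integral>\<mu>. (\<Sum>i<r. a i * (f \<mu> * chaos_exp m (\<lambda>j. \<tau> * u i j) (\<lambda>j. count \<mu> (A j)) lam 1)) \<partial>P)"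
      proof -
        have "has_bochner_integral P (\<lambda>\<mu>. \<Sum>i<r. a i * (f \<mu> * chaos_exp m (\<lambda>j. \<tau> * u i j) (\<lambda>j. count \<mu> (A j)) lam 1))
           (\<Sum>i<r. a i * (\<integral>\<mu>. f \<mu> * chaos_exp m (\<lambda>j. \<tau> * u i j) (\<lambda>j. count \<mu> (A j)) lam 1 \<partial>P))"
          using one(2) by (intro has_bochner_integral_sum has_bochner_integral_mult_right) (simp add: has_bochner_integral_iff)
        then show ?thesis by (simp add: has_bochner_integral_iff)
      qed
      finally show ?thesis by (simp add: G_def g_def sum_distrib_left mult_ac)
    qed
    have cov: "\<bar>(\<integral>p. f (fst p) * G (snd p) \<partial>Q) - (\<integral>\<mu>. f \<mu> \<partial>P) * (\<integral>\<mu>. G \<mu> \<partial>P')\<bar> \<le> sqrt (t / (t - 1)\<^sup>2 * (\<delta> * 4))"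
    proof -
      have "\<bar>(\<integral>p. f (fst p) * G (snd p) \<partial>Q) - (\<integral>\<mu>. f \<mu> \<partial>P) * (\<integral>\<mu>. G \<mu> \<partial>P')\<bar> \<le>
         sqrt (t / (t - 1)\<^sup>2 * (\<delta> * quad r a (\<lambda>i i'. exp (t * gram m lam (\<lambda>i j. \<tau> * u i j) i i'))))"
        unfolding tilted Gmean g_def lam_def[abs_def]
        by (rule covariance_bound[OF P fm f1(3) bnd \<delta> t c \<tau>u])
      also have "\<dots> \<le> sqrt (t / (t - 1)\<^sup>2 * (\<delta> * 4))"
      proof (intro real_sqrt_le_mono mult_left_mono \<delta>)
        have "quad r a (\<lambda>i i'. exp (t * gram m lam (\<lambda>i j. \<tau> * u i j) i i')) = quad r a (\<lambda>i i'. exp (t * \<tau>\<^sup>2 * gram m lam u i i'))"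
          by (simp add: gram_scale mult.assoc)
        \<comment> \<open>Damping contributes \<open>\<tau>\<^sup>2\<close> to the exponent, so the
          weighted second moment of \<open>g\<close> is at most the second moment of
          \<open>G\<close> precisely because
          \<open>t * \<tau>\<^sup>2 \<le> \<kappa>\<close>.\<close>
        also have "\<dots> \<le> quad r a (\<lambda>i i'. exp (\<kappa> * gram m lam u i i'))"
          using t t\<tau> by (intro quad_exp_mono) (auto simp: lam_def)
        also have "\<dots> \<le> 4" using G2 unfolding Gsq .
        finally show "quad r a (\<lambda>i i'. exp (t * gram m lam (\<lambda>i j. \<tau> * u i j) i i')) \<le> 4" .
      qed (use t in auto)
      finally show ?thesis .
    qed
    have iQ: "integrable Q (\<lambda>p. f (fst p) * f (snd p))" "integrable Q (\<lambda>p. f (fst p) * G (snd p))" "integrable Q (\<lambda>p. \<bar>f (snd p) - G (snd p)\<bar>)"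
    proof -
      have bb: "\<bar>f (fst p) * f (snd p)\<bar> \<le> 1" "\<bar>f (fst p) * G (snd p)\<bar> \<le> C" "\<bar>f (snd p) - G (snd p)\<bar> \<le> 1 + C" if "p \<in> space Q" for p
      proof -
        have p: "fst p \<in> space N" "snd p \<in> space N" using that by (auto simp: spQ)
        show "\<bar>f (fst p) * f (snd p)\<bar> \<le> 1" unfolding abs_mult using f1[OF p(1)] f1[OF p(2)] by (intro mult_le_one) auto
        have "\<bar>f (fst p) * G (snd p)\<bar> \<le> 1 * C" unfolding abs_mult using f1[OF p(1)] C by (intro mult_mono) auto
        then show "\<bar>f (fst p) * G (snd p)\<bar> \<le> C" by simp
        show "\<bar>f (snd p) - G (snd p)\<bar> \<le> 1 + C" using f1(3)[OF p(2)] C[of "snd p"] by linarith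
      qed
      show "integrable Q (\<lambda>p. f (fst p) * f (snd p))"
        by (rule Q.integrable_const_bound[where B=1]) (use bb(1) in \<open>auto intro!: AE_I2\<close>)
      show "integrable Q (\<lambda>p. f (fst p) * G (snd p))"
        by (rule Q.integrable_const_bound[where B=C]) (use bb(2) in \<open>auto intro!: AE_I2\<close>)
      show "integrable Q (\<lambda>p. \<bar>f (snd p) - G (snd p)\<bar>)"
        by (rule Q.integrable_const_bound[where B="1 + C"]) (use bb(3) in \<open>auto intro!: AE_I2\<close>)
    qed
    have d1: "\<bar>(\<integral>p. f (fst p) * f (snd p) \<partial>Q) - (\<integral>p. f (fst p) * G (snd p) \<partial>Q)\<bar> \<le> sqrt \<epsilon>"
    proof -
      have "\<bar>(\<integral>p. f (fst p) * f (snd p) \<partial>Q) - (\<integral>p. f (fst p) * G (snd p) \<partial>Q)\<bar> = \<bar>\<integral>p. f (fst p) * f (snd p) - f (fst p) * G (snd p) \<partial>Q\<bar>"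
        using iQ by simp
      also have "\<dots> \<le> (\<integral>p. \<bar>f (fst p) * f (snd p) - f (fst p) * G (snd p)\<bar> \<partial>Q)" by (rule integral_abs_bound)
      also have "\<dots> \<le> (\<integral>p. \<bar>f (snd p) - G (snd p)\<bar> \<partial>Q)"
      proof (rule integral_mono)
        fix p assume "p \<in> space Q"
        then have "\<bar>f (fst p)\<bar> \<le> 1" using f1(3) by (auto simp: spQ)
        then show "\<bar>f (fst p) * f (snd p) - f (fst p) * G (snd p)\<bar> \<le> \<bar>f (snd p) - G (snd p)\<bar>"
          unfolding right_diff_distrib[symmetric] abs_mult by (intro mult_left_le_one_le) auto
      qed (use iQ in auto)
      also have "\<dots> = (\<integral>\<mu>. \<bar>f \<mu> - G \<mu>\<bar> \<partial>distr Q N snd)" by (rule integral_distr[symmetric]) auto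
      finally show ?thesis using L1 unfolding snd by simp
    qed
    have d2: "\<bar>(\<integral>\<mu>. f \<mu> \<partial>P) * (\<integral>\<mu>. f \<mu> \<partial>P') - (\<integral>\<mu>. f \<mu> \<partial>P) * (\<integral>\<mu>. G \<mu> \<partial>P')\<bar> \<le> sqrt \<epsilon>"
    proof -
      have ifP: "integrable P f" using f1 by (intro P.integrable_const_bound[where B=1]) (auto intro!: AE_I2)
      have "(\<integral>\<mu>. f \<mu> \<partial>P) \<le> (\<integral>\<mu>. 1 \<partial>P)" using ifP f1 by (intro integral_mono) auto
      then have p1: "(\<integral>\<mu>. f \<mu> \<partial>P) \<le> 1" using P.prob_space by simp
      have p0: "0 \<le> (\<integral>\<mu>. f \<mu> \<partial>P)" using f1 by (intro Bochner_Integration.integral_nonneg_AE) (auto intro!: AE_I2)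
      have "\<bar>(\<integral>\<mu>. f \<mu> \<partial>P') - (\<integral>\<mu>. G \<mu> \<partial>P')\<bar> = \<bar>\<integral>\<mu>. f \<mu> - G \<mu> \<partial>P'\<bar>" using iG if' by simp
      also have "\<dots> \<le> (\<integral>\<mu>. \<bar>f \<mu> - G \<mu>\<bar> \<partial>P')" by (rule integral_abs_bound)
      also note L1
      finally have "\<bar>(\<integral>\<mu>. f \<mu> \<partial>P') - (\<integral>\<mu>. G \<mu> \<partial>P')\<bar> \<le> sqrt \<epsilon>" .
      moreover have "\<bar>(\<integral>\<mu>. f \<mu> \<partial>P) * ((\<integral>\<mu>. f \<mu> \<partial>P') - (\<integral>\<mu>. G \<mu> \<partial>P'))\<bar> \<le> \<bar>(\<integral>\<mu>. f \<mu> \<partial>P') - (\<integral>\<mu>. G \<mu> \<partial>P')\<bar>"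
        unfolding abs_mult using p0 p1 by (intro mult_left_le_one_le) auto
      ultimately show ?thesis by (simp add: right_diff_distrib)
    qed
    show ?thesis using cov d1 d2 by linarith
  qed
  show ?thesis
  proof (rule field_le_epsilon)
    fix e :: real assume e: "0 < e"
    \<comment> \<open>Chosen so that \<open>2 * sqrt \<epsilon> \<le> e\<close>, and capped because
      the second moment bound needs \<open>\<epsilon> \<le> 1\<close>.\<close>
    define \<epsilon> where "\<epsilon> = (min 1 (e / 2))\<^sup>2"
    have \<epsilon>: "0 < \<epsilon>" "\<epsilon> \<le> 1" using e by (auto simp: \<epsilon>_def power_le_one)
    have "sqrt \<epsilon> = min 1 (e / 2)" using e by (simp add: \<epsilon>_def)
    then have "2 * sqrt \<epsilon> \<le> e" by simp
    then show "\<bar>?cov\<bar> \<le> sqrt (t / (t - 1)\<^sup>2 * (\<delta> * 4)) + e" using main[OF \<epsilon>] by linarith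
  qed
qed

end

lemma indep_elements_distr_pair:
  assumes M: "prob_space M" and ind: "indep_elements M S U T V"
  shows "distr M (S \<Otimes>\<^sub>M T) (\<lambda>\<omega>. (U \<omega>, V \<omega>)) = distr M S U \<Otimes>\<^sub>M distr M T V"
proof -
  interpret prob_space M by fact
  have m[measurable]: "U \<in> M \<rightarrow>\<^sub>M S" "V \<in> M \<rightarrow>\<^sub>M T"
    and i: "indep_set (sets (vimage_algebra (space M) U S)) (sets (vimage_algebra (space M) V T))"
    using ind by (auto simp: indep_elements_def)
  interpret DU: prob_space "distr M S U" by (rule prob_space_distr) fact
  interpret DV: prob_space "distr M T V" by (rule prob_space_distr) fact
  show ?thesis
  proof (rule pair_measure_eqI[symmetric])
    show "sets (distr M S U \<Otimes>\<^sub>M distr M T V) = sets (distr M (S \<Otimes>\<^sub>M T) (\<lambda>\<omega>. (U \<omega>, V \<omega>)))"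
      by (simp cong: sets_pair_measure_cong)
    fix A C assume "A \<in> sets (distr M S U)" "C \<in> sets (distr M T V)"
    then have AC[measurable]: "A \<in> sets S" "C \<in> sets T" by auto
    have "U -` A \<inter> space M \<in> sets (vimage_algebra (space M) U S)" "V -` C \<inter> space M \<in> sets (vimage_algebra (space M) V T)"
      using AC by (auto intro: in_vimage_algebra)
    from indep_setD[OF i this] have "prob ((U -` A \<inter> space M) \<inter> (V -` C \<inter> space M)) = prob (U -` A \<inter> space M) * prob (V -` C \<inter> space M)" .
    moreover have "(U -` A \<inter> space M) \<inter> (V -` C \<inter> space M) = (\<lambda>\<omega>. (U \<omega>, V \<omega>)) -` (A \<times> C) \<inter> space M" by auto
    ultimately show "emeasure (distr M S U) A * emeasure (distr M T V) C = emeasure (distr M (S \<Otimes>\<^sub>M T) (\<lambda>\<omega>. (U \<omega>, V \<omega>))) (A \<times> C)"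
      by (simp add: emeasure_distr emeasure_eq_measure ennreal_mult[symmetric])
  qed (rule DU.sigma_finite_measure_axioms DV.sigma_finite_measure_axioms)+
qed

section \<open>Superposition, thinning and the two one-sided estimates\<close>

context intensity_space begin

lemma nn_integral_expf_pair:
  assumes P: "plaw \<kappa> P" and R: "plaw c R" and k: "k \<in> borel_measurable N" and \<phi>: "test \<phi>"
  shows "(\<integral>\<^sup>+p. k (fst p) * ennreal (expf \<phi> (snd p)) \<partial>(P \<Otimes>\<^sub>M R)) = (\<integral>\<^sup>+\<mu>. k \<mu> \<partial>P) * ennreal (exp (c * (\<integral>x. exp (\<phi> x) - 1 \<partial>L)))"
proof -
  interpret P: prob_space P using plaw_prob[OF P] .
  interpret R: prob_space R using plaw_prob[OF R] .
  note sP[measurable_cong] = plaw_sets[OF P] and sR[measurable_cong] = plaw_sets[OF R] and [measurable] = k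
  have e[measurable]: "expf \<phi> \<in> borel_measurable N" using measurable_expf[OF measurable_ident \<phi>] by (simp add: id_def)
  have "(\<integral>\<^sup>+p. k (fst p) * ennreal (expf \<phi> (snd p)) \<partial>(P \<Otimes>\<^sub>M R)) = (\<integral>\<^sup>+\<mu>. \<integral>\<^sup>+\<nu>. k \<mu> * ennreal (expf \<phi> \<nu>) \<partial>R \<partial>P)"
    by (subst R.nn_integral_fst[symmetric]) auto
  also have "\<dots> = (\<integral>\<^sup>+\<mu>. k \<mu> * (\<integral>\<^sup>+\<nu>. expf \<phi> \<nu> \<partial>R) \<partial>P)"
    by (intro nn_integral_cong nn_integral_cmult) simp
  also have "\<dots> = (\<integral>\<^sup>+\<mu>. k \<mu> \<partial>P) * (\<integral>\<^sup>+\<nu>. expf \<phi> \<nu> \<partial>R)" by (rule nn_integral_multc) simp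
  finally show ?thesis by (simp add: plaw_expf[OF R \<phi>])
qed

lemma plaw_superpose:
  assumes P: "plaw \<kappa> P" and R: "plaw c R"
  shows "plaw (\<kappa> + c) (distr (P \<Otimes>\<^sub>M R) N (\<lambda>p. superpose (fst p) (snd p)))"
proof -
  interpret P: prob_space P using plaw_prob[OF P] .
  interpret R: prob_space R using plaw_prob[OF R] .
  note sP[measurable_cong] = plaw_sets[OF P] and sR[measurable_cong] = plaw_sets[OF R]
  have sp: "space P = space N" "space R = space N" using sP sR sets_eq_imp_space_eq by blast+
  interpret PR: pair_prob_space P R ..
  have [measurable]: "(\<lambda>p. superpose (fst p) (snd p)) \<in> P \<Otimes>\<^sub>M R \<rightarrow>\<^sub>M N"
    by (rule measurable_superpose_N) (simp_all cong: measurable_cong_sets)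
  have "(\<integral>\<^sup>+\<mu>. expf \<phi> \<mu> \<partial>distr (P \<Otimes>\<^sub>M R) N (\<lambda>p. superpose (fst p) (snd p))) = ennreal (exp ((\<kappa> + c) * (\<integral>x. exp (\<phi> x) - 1 \<partial>L)))"
    if \<phi>: "test \<phi>" for \<phi>
  proof -
    have [measurable]: "expf \<phi> \<in> borel_measurable N" using measurable_expf[OF measurable_ident \<phi>] by (simp add: id_def)
    have "(\<integral>\<^sup>+\<mu>. expf \<phi> \<mu> \<partial>distr (P \<Otimes>\<^sub>M R) N (\<lambda>p. superpose (fst p) (snd p))) = (\<integral>\<^sup>+p. expf \<phi> (superpose (fst p) (snd p)) \<partial>(P \<Otimes>\<^sub>M R))"
      by (subst nn_integral_distr) auto
    also have "\<dots> = (\<integral>\<^sup>+p. ennreal (expf \<phi> (fst p)) * ennreal (expf \<phi> (snd p)) \<partial>(P \<Otimes>\<^sub>M R))"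
      by (intro nn_integral_cong) (auto simp: space_pair_measure sp expf_superpose[OF _ _ \<phi>] ennreal_mult expf_nonneg)
    also have "\<dots> = ennreal (exp (\<kappa> * (\<integral>x. exp (\<phi> x) - 1 \<partial>L))) * ennreal (exp (c * (\<integral>x. exp (\<phi> x) - 1 \<partial>L)))"
      by (subst nn_integral_expf_pair[OF P R _ \<phi>]) (simp_all add: plaw_expf[OF P \<phi>])
    finally show ?thesis by (simp add: ennreal_mult[symmetric] exp_add[symmetric] distrib_right)
  qed
  then show ?thesis by (simp add: plaw_def PR.prob_space_distr)
qed

lemma increasing_superpose:
  assumes "increasing_functional X B f" "\<mu> \<in> space N" "\<psi> \<in> space N"
  shows "f \<mu> \<le> f (superpose \<mu> \<psi>)"
  using assms le_superpose superpose_in_N by (auto simp: increasing_functional_def mono_on_def)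

text \<open>With \<open>\<tau> = 1\<close> and \<open>\<kappa> = 1 + c\<close> the largest
  admissible weight is \<open>t = 1 + c\<close>. Then \<open>t / (t - 1)\<^sup>2 * 4\<close> equals
  \<open>4 * (1 + c) / c\<^sup>2\<close>, and \<open>c < 1\<close> gives the constant
  \<open>8\<close>.\<close>

lemma threshold_upper:
  assumes P: "plaw 1 P" and R: "plaw c R" and P': "plaw (1 + c) P'" and c: "0 < c" "c < 1"
    and fm: "f \<in> borel_measurable N" and f01: "f \<in> space N \<rightarrow> {0, 1 :: real}" and inc: "increasing_functional X B f"
    and bnd: "chaos_bounded P f \<delta>" and \<delta>: "0 \<le> \<delta>"
  shows "(\<integral>\<mu>. f \<mu> \<partial>P) * (1 - (\<integral>\<mu>. f \<mu> \<partial>P')) \<le> sqrt (8 * (\<delta> / c\<^sup>2))"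
proof -
  interpret P: prob_space P using plaw_prob[OF P] .
  interpret R: prob_space R using plaw_prob[OF R] .
  note sP[measurable_cong] = plaw_sets[OF P] and sR[measurable_cong] = plaw_sets[OF R]
  have sp: "space P = space N" "space R = space N" using sP sR sets_eq_imp_space_eq by blast+
  interpret PR: pair_prob_space P R ..
  note [measurable] = fm
  have sup[measurable]: "(\<lambda>p. superpose (fst p) (snd p)) \<in> P \<Otimes>\<^sub>M R \<rightarrow>\<^sub>M N"
    by (rule measurable_superpose_N) (simp_all cong: measurable_cong_sets)
  have fst_m[measurable]: "fst \<in> P \<Otimes>\<^sub>M R \<rightarrow>\<^sub>M N" by (simp cong: measurable_cong_sets)
  define h where "h p = (fst p, superpose (fst p) (snd p))" for p :: "'a measure \<times> 'a measure"
  have h[measurable]: "h \<in> P \<Otimes>\<^sub>M R \<rightarrow>\<^sub>M N \<Otimes>\<^sub>M N" unfolding h_def[abs_def] by measurable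
  define Q where "Q = distr (P \<Otimes>\<^sub>M R) (N \<Otimes>\<^sub>M N) h"
  have cov: "\<bar>(\<integral>p. f (fst p) * f (snd p) \<partial>Q) - (\<integral>\<mu>. f \<mu> \<partial>P) * (\<integral>\<mu>. f \<mu> \<partial>P')\<bar> \<le> sqrt ((1 + c) / ((1 + c) - 1)\<^sup>2 * (\<delta> * 4))"
  proof (rule coupling_bound[OF P P' _ _ _ _ fm f01 _ bnd \<delta>, where \<tau>=1])
    show "prob_space Q" unfolding Q_def by (rule PR.prob_space_distr) simp
    show "sets Q = sets (N \<Otimes>\<^sub>M N)" by (simp add: Q_def)
    have "distr Q N fst = distr (P \<Otimes>\<^sub>M R) N fst" unfolding Q_def by (subst distr_distr) (auto simp: comp_def h_def)
    also have "\<dots> = distr (P \<Otimes>\<^sub>M R) P fst" by (rule distr_cong) (simp_all add: sP)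
    also have "\<dots> = P" by (rule R.distr_pair_fst)
    finally show "distr Q N fst = P" .
    have "distr Q N snd = distr (P \<Otimes>\<^sub>M R) N (\<lambda>p. superpose (fst p) (snd p))"
      unfolding Q_def by (subst distr_distr) (auto simp: comp_def h_def)
    then show "distr Q N snd = P'" using plaw_unique[OF plaw_superpose[OF P R] P'] by simp
    fix \<phi> assume \<phi>: "test \<phi>"
    have [measurable]: "expf \<phi> \<in> borel_measurable N" using measurable_expf[OF measurable_ident \<phi>] by (simp add: id_def)
    have "(\<integral>\<^sup>+p. ennreal (f (fst p)) * ennreal (expf \<phi> (snd p)) \<partial>Q) =
        (\<integral>\<^sup>+p. ennreal (f (fst p)) * ennreal (expf \<phi> (superpose (fst p) (snd p))) \<partial>(P \<Otimes>\<^sub>M R))"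
      unfolding Q_def by (subst nn_integral_distr) (auto simp: h_def)
    also have "\<dots> = (\<integral>\<^sup>+p. (ennreal (f (fst p)) * ennreal (expf \<phi> (fst p))) * ennreal (expf \<phi> (snd p)) \<partial>(P \<Otimes>\<^sub>M R))"
      by (intro nn_integral_cong)
         (auto simp: space_pair_measure sp expf_superpose[OF _ _ \<phi>] ennreal_mult expf_nonneg mult.assoc)
    also have "\<dots> = (\<integral>\<^sup>+\<mu>. ennreal (f \<mu>) * ennreal (expf \<phi> \<mu>) \<partial>P) * ennreal (exp (c * (\<integral>x. exp (\<phi> x) - 1 \<partial>L)))"
      by (subst nn_integral_expf_pair[OF P R _ \<phi>]) simp_all
    finally show "(\<integral>\<^sup>+p. ennreal (f (fst p)) * ennreal (expf \<phi> (snd p)) \<partial>Q) =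
        ennreal (exp ((1 + c - 1) * (\<integral>x. exp (\<phi> x) - 1 \<partial>L))) *
        (\<integral>\<^sup>+\<mu>. ennreal (f \<mu>) * ennreal (expf (\<lambda>x. ln (1 + 1 * (exp (\<phi> x) - 1))) \<mu>) \<partial>P)"
      by (simp add: mult.commute)
  qed (use c in auto)
  have "(\<integral>p. f (fst p) * f (snd p) \<partial>Q) = (\<integral>p. f (fst p) * f (superpose (fst p) (snd p)) \<partial>(P \<Otimes>\<^sub>M R))"
    unfolding Q_def by (subst integral_distr) (auto simp: h_def)
  also have "\<dots> = (\<integral>p. f (fst p) \<partial>(P \<Otimes>\<^sub>M R))"
  proof (rule Bochner_Integration.integral_cong[OF refl])
    fix p assume "p \<in> space (P \<Otimes>\<^sub>M R)"
    then have p: "fst p \<in> space N" "snd p \<in> space N" by (auto simp: space_pair_measure sp)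
    show "f (fst p) * f (superpose (fst p) (snd p)) = f (fst p)"
      using increasing_superpose[OF inc p] funcset_mem[OF f01 p(1)] funcset_mem[OF f01 superpose_in_N[OF p]] by auto
  qed
  also have "\<dots> = (\<integral>\<mu>. f \<mu> \<partial>distr (P \<Otimes>\<^sub>M R) P fst)"
    by (rule integral_distr[symmetric]) (simp_all cong: measurable_cong_sets)
  also have "\<dots> = (\<integral>\<mu>. f \<mu> \<partial>P)" by (simp only: R.distr_pair_fst)
  finally have "(\<integral>\<mu>. f \<mu> \<partial>P) * (1 - (\<integral>\<mu>. f \<mu> \<partial>P')) \<le> sqrt ((1 + c) / ((1 + c) - 1)\<^sup>2 * (\<delta> * 4))"
    using cov by (simp add: right_diff_distrib)
  also have "\<dots> \<le> sqrt (8 * (\<delta> / c\<^sup>2))"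
  proof (rule real_sqrt_le_mono)
    have "(1 + c) * (\<delta> * 4) \<le> 2 * (\<delta> * 4)" using c \<delta> by (intro mult_right_mono) auto
    then have "(1 + c) * (\<delta> * 4) / c\<^sup>2 \<le> 2 * (\<delta> * 4) / c\<^sup>2" by (rule divide_right_mono) simp
    then show "(1 + c) / ((1 + c) - 1)\<^sup>2 * (\<delta> * 4) \<le> 8 * (\<delta> / c\<^sup>2)" by simp
  qed
  finally show ?thesis .
qed

text \<open>Averaging \<open>exp (\<phi> x)\<close> over the retention of a point gives
  \<open>1 + \<kappa> * (exp (\<phi> x) - 1)\<close>. Instead of building a thinning kernel, the
  weighted law of the superposition and the weighted law of \<open>\<eta>\<close> are identified
  through their Laplace functionals, where retained and deleted intensities add up.\<close>

lemma thinning_tilt: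
  assumes P: "plaw 1 P" and P': "plaw \<kappa> P'" and R: "plaw (1 - \<kappa>) R" and \<kappa>: "0 < \<kappa>" "\<kappa> \<le> 1"
    and f: "f \<in> borel_measurable N" and \<phi>: "test \<phi>" "\<And>x. \<phi> x \<le> 0"
  shows "(\<integral>\<^sup>+p. f (superpose (fst p) (snd p)) * ennreal (expf \<phi> (fst p)) \<partial>(P' \<Otimes>\<^sub>M R)) =
    (\<integral>\<^sup>+\<mu>. f \<mu> * ennreal (expf (\<lambda>x. ln (1 + \<kappa> * (exp (\<phi> x) - 1))) \<mu>) \<partial>P)"
proof -
  interpret P: prob_space P using plaw_prob[OF P] .
  interpret P': prob_space P' using plaw_prob[OF P'] .
  interpret R: prob_space R using plaw_prob[OF R] .
  note sP[measurable_cong] = plaw_sets[OF P] and sP'[measurable_cong] = plaw_sets[OF P'] and sR[measurable_cong] = plaw_sets[OF R]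
  have sp: "space P' = space N" "space R = space N" "space P = space N" using sP sP' sR sets_eq_imp_space_eq by blast+
  interpret PR: pair_prob_space P' R ..
  note [measurable] = f
  have sup[measurable]: "(\<lambda>p. superpose (fst p) (snd p)) \<in> P' \<Otimes>\<^sub>M R \<rightarrow>\<^sub>M N"
    by (rule measurable_superpose_N) (simp_all cong: measurable_cong_sets)
  have fst_m[measurable]: "fst \<in> P' \<Otimes>\<^sub>M R \<rightarrow>\<^sub>M N" by (simp cong: measurable_cong_sets)
  have e[measurable]: "expf \<psi> \<in> borel_measurable N" if "test \<psi>" for \<psi>
    using measurable_expf[OF measurable_ident that] by (simp add: id_def)
  note [measurable] = e[OF \<phi>(1)]
  define \<theta> where "\<theta> x = ln (1 + \<kappa> * (exp (\<phi> x) - 1))" for x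
  have \<theta>: "test \<theta>" unfolding \<theta>_def[abs_def] using test_compose[OF \<phi>(1), of "\<lambda>v. ln (1 + \<kappa> * (exp v - 1))"] by simp
  have pos: "0 < 1 + \<kappa> * (exp (\<phi> x) - 1)" for x
  proof -
    have "1 + \<kappa> * (exp (\<phi> x) - 1) = (1 - \<kappa>) + \<kappa> * exp (\<phi> x)" by (simp add: algebra_simps)
    moreover have "0 < \<kappa> * exp (\<phi> x)" using \<kappa> by simp
    ultimately show ?thesis using \<kappa> by linarith
  qed
  have \<theta>0: "\<theta> x \<le> 0" for x
  proof -
    have "\<kappa> * (exp (\<phi> x) - 1) \<le> 0" using \<kappa> \<phi>(2)[of x] by (intro mult_nonneg_nonpos) auto
    then show ?thesis unfolding \<theta>_def using pos[of x] by simp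
  qed
  note [measurable] = e[OF \<theta>]
  define \<nu>1 where "\<nu>1 = distr (density (P' \<Otimes>\<^sub>M R) (\<lambda>p. ennreal (expf \<phi> (fst p)))) N (\<lambda>p. superpose (fst p) (snd p))"
  define \<nu>2 where "\<nu>2 = density P (\<lambda>\<mu>. ennreal (expf \<theta> \<mu>))"
  have i1: "(\<integral>\<^sup>+\<mu>. k \<mu> \<partial>\<nu>1) = (\<integral>\<^sup>+p. ennreal (expf \<phi> (fst p)) * k (superpose (fst p) (snd p)) \<partial>(P' \<Otimes>\<^sub>M R))"
    if [measurable]: "k \<in> borel_measurable N" for k
    unfolding \<nu>1_def by (subst nn_integral_distr) (auto simp: nn_integral_density)
  have i2: "(\<integral>\<^sup>+\<mu>. k \<mu> \<partial>\<nu>2) = (\<integral>\<^sup>+\<mu>. ennreal (expf \<theta> \<mu>) * k \<mu> \<partial>P)" if [measurable]: "k \<in> borel_measurable N" for k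
    unfolding \<nu>2_def by (subst nn_integral_density) auto
  have le1: "ennreal (expf \<phi> \<mu>) \<le> 1" "ennreal (expf \<theta> \<mu>) \<le> 1" for \<mu>
    using expf_le_1[OF \<phi>(2)] expf_le_1[OF \<theta>0] by (simp_all add: ennreal_le_1)
  have "\<nu>1 = \<nu>2"
  proof (rule point_law_unique)
    show s: "sets \<nu>1 = sets N" "sets \<nu>2 = sets N" by (simp_all add: \<nu>1_def \<nu>2_def sP)
    have "(\<integral>\<^sup>+\<mu>. 1 \<partial>\<nu>1) \<le> (\<integral>\<^sup>+p. 1 \<partial>(P' \<Otimes>\<^sub>M R))" unfolding i1[OF borel_measurable_const] mult_1_right by (intro nn_integral_mono le1)
    then show "finite_measure \<nu>1" using PR.emeasure_space_1 by (intro finite_measureI) (auto simp: top_unique)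
    have "(\<integral>\<^sup>+\<mu>. 1 \<partial>\<nu>2) \<le> (\<integral>\<^sup>+p. 1 \<partial>P)" unfolding i2[OF borel_measurable_const] mult_1_right by (intro nn_integral_mono le1)
    then show "finite_measure \<nu>2" using P.emeasure_space_1 by (intro finite_measureI) (auto simp: top_unique)
    fix \<psi> assume \<psi>: "test \<psi>"
    note [measurable] = e[OF \<psi>]
    have t: "test (\<lambda>x. \<phi> x + \<psi> x)" "test (\<lambda>x. \<theta> x + \<psi> x)" using \<phi>(1) \<theta> \<psi> by (auto intro: test_add)
    have "(\<integral>\<^sup>+\<mu>. expf \<psi> \<mu> \<partial>\<nu>1) = (\<integral>\<^sup>+p. ennreal (expf \<phi> (fst p)) * ennreal (expf \<psi> (superpose (fst p) (snd p))) \<partial>(P' \<Otimes>\<^sub>M R))"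
      by (rule i1) simp
    also have "\<dots> = (\<integral>\<^sup>+p. ennreal (expf (\<lambda>x. \<phi> x + \<psi> x) (fst p)) * ennreal (expf \<psi> (snd p)) \<partial>(P' \<Otimes>\<^sub>M R))"
      by (intro nn_integral_cong)
         (auto simp: space_pair_measure sp expf_superpose[OF _ _ \<psi>] expf_add[OF _ \<phi>(1) \<psi>] ennreal_mult expf_nonneg mult.assoc)
    also have "\<dots> = ennreal (exp (\<kappa> * (\<integral>x. exp (\<phi> x + \<psi> x) - 1 \<partial>L))) * ennreal (exp ((1 - \<kappa>) * (\<integral>x. exp (\<psi> x) - 1 \<partial>L)))"
    proof (subst nn_integral_expf_pair[OF P' R _ \<psi>])
      show "(\<lambda>\<mu>. ennreal (expf (\<lambda>x. \<phi> x + \<psi> x) \<mu>)) \<in> borel_measurable N"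
        by (rule measurable_compose[OF e[OF t(1)] measurable_ennreal])
    qed (simp add: plaw_expf[OF P' t(1)])
    also have "\<dots> = ennreal (exp (\<kappa> * (\<integral>x. exp (\<phi> x + \<psi> x) - 1 \<partial>L) + (1 - \<kappa>) * (\<integral>x. exp (\<psi> x) - 1 \<partial>L)))"
      by (simp add: ennreal_mult[symmetric] exp_add)
    also have "\<kappa> * (\<integral>x. exp (\<phi> x + \<psi> x) - 1 \<partial>L) + (1 - \<kappa>) * (\<integral>x. exp (\<psi> x) - 1 \<partial>L) =
        (\<integral>x. \<kappa> * (exp (\<phi> x + \<psi> x) - 1) + (1 - \<kappa>) * (exp (\<psi> x) - 1) \<partial>L)"
      using integrable_exp_test[OF t(1)] integrable_exp_test[OF \<psi>] by (simp del: integral_diff)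
    also have "\<dots> = 1 * (\<integral>x. exp (\<theta> x + \<psi> x) - 1 \<partial>L)"
    proof -
      have "\<kappa> * (exp (\<phi> x + \<psi> x) - 1) + (1 - \<kappa>) * (exp (\<psi> x) - 1) = exp (\<theta> x + \<psi> x) - 1" for x
        using pos[of x] by (simp add: \<theta>_def exp_add algebra_simps)
      then show ?thesis by simp
    qed
    also have "ennreal (exp (1 * (\<integral>x. exp (\<theta> x + \<psi> x) - 1 \<partial>L))) = (\<integral>\<^sup>+\<mu>. expf (\<lambda>x. \<theta> x + \<psi> x) \<mu> \<partial>P)"
      by (rule plaw_expf[OF P t(2), symmetric])
    also have "\<dots> = (\<integral>\<^sup>+\<mu>. ennreal (expf \<theta> \<mu>) * ennreal (expf \<psi> \<mu>) \<partial>P)"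
      by (intro nn_integral_cong) (auto simp: sp expf_add[OF _ \<theta> \<psi>] ennreal_mult expf_nonneg)
    also have "\<dots> = (\<integral>\<^sup>+\<mu>. expf \<psi> \<mu> \<partial>\<nu>2)" by (rule i2[symmetric]) simp
    finally show "(\<integral>\<^sup>+\<mu>. expf \<psi> \<mu> \<partial>\<nu>1) = (\<integral>\<^sup>+\<mu>. expf \<psi> \<mu> \<partial>\<nu>2)" .
  qed
  then have "(\<integral>\<^sup>+\<mu>. f \<mu> \<partial>\<nu>1) = (\<integral>\<^sup>+\<mu>. f \<mu> \<partial>\<nu>2)" by simp
  then show ?thesis unfolding i1[OF f] i2[OF f] by (simp add: \<theta>_def[abs_def] mult.commute)
qed

text \<open>The thinning is drawn first and \<open>\<eta>\<close> is its superposition with an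
  independent process of intensity \<open>c\<close> times \<open>L\<close>, so the order between the
  two holds pointwise. Here \<open>\<kappa> = \<tau> = 1 - c\<close>, and
  \<open>t = 1 / (1 - c)\<close> exhausts \<open>t * \<tau>\<^sup>2 \<le> \<kappa>\<close>; then
  \<open>t / (t - 1)\<^sup>2 = (1 - c) / c\<^sup>2\<close>.\<close>

lemma threshold_lower:
  assumes P: "plaw 1 P" and R: "plaw c R" and P': "plaw (1 - c) P'" and c: "0 < c" "c < 1"
    and fm: "f \<in> borel_measurable N" and f01: "f \<in> space N \<rightarrow> {0, 1 :: real}" and inc: "increasing_functional X B f"
    and bnd: "chaos_bounded P f \<delta>" and \<delta>: "0 \<le> \<delta>"
  shows "(\<integral>\<mu>. f \<mu> \<partial>P') * (1 - (\<integral>\<mu>. f \<mu> \<partial>P)) \<le> sqrt (8 * (\<delta> / c\<^sup>2))"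
proof -
  interpret P': prob_space P' using plaw_prob[OF P'] .
  interpret R: prob_space R using plaw_prob[OF R] .
  note sP'[measurable_cong] = plaw_sets[OF P'] and sR[measurable_cong] = plaw_sets[OF R]
  have sp: "space P' = space N" "space R = space N" using sP' sR sets_eq_imp_space_eq by blast+
  interpret PR: pair_prob_space P' R ..
  note [measurable] = fm
  have sup[measurable]: "(\<lambda>p. superpose (fst p) (snd p)) \<in> P' \<Otimes>\<^sub>M R \<rightarrow>\<^sub>M N"
    by (rule measurable_superpose_N) (simp_all cong: measurable_cong_sets)
  have fst_m[measurable]: "fst \<in> P' \<Otimes>\<^sub>M R \<rightarrow>\<^sub>M N" by (simp cong: measurable_cong_sets)
  define h where "h p = (superpose (fst p) (snd p), fst p)" for p :: "'a measure \<times> 'a measure"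
  have h[measurable]: "h \<in> P' \<Otimes>\<^sub>M R \<rightarrow>\<^sub>M N \<Otimes>\<^sub>M N" unfolding h_def[abs_def] by measurable
  define Q where "Q = distr (P' \<Otimes>\<^sub>M R) (N \<Otimes>\<^sub>M N) h"
  have cov: "\<bar>(\<integral>p. f (fst p) * f (snd p) \<partial>Q) - (\<integral>\<mu>. f \<mu> \<partial>P) * (\<integral>\<mu>. f \<mu> \<partial>P')\<bar>
      \<le> sqrt (1 / (1 - c) / (1 / (1 - c) - 1)\<^sup>2 * (\<delta> * 4))"
  proof (rule coupling_bound[OF P P' _ _ _ _ fm f01 _ bnd \<delta>, where \<tau>="1 - c"])
    show "prob_space Q" unfolding Q_def by (rule PR.prob_space_distr) simp
    show "sets Q = sets (N \<Otimes>\<^sub>M N)" by (simp add: Q_def)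
    have "distr Q N fst = distr (P' \<Otimes>\<^sub>M R) N (\<lambda>p. superpose (fst p) (snd p))"
      unfolding Q_def by (subst distr_distr) (auto simp: comp_def h_def)
    then show "distr Q N fst = P" using plaw_unique[OF _ P] plaw_superpose[OF P' R] by simp
    have "distr Q N snd = distr (P' \<Otimes>\<^sub>M R) N fst" unfolding Q_def by (subst distr_distr) (auto simp: comp_def h_def)
    also have "\<dots> = distr (P' \<Otimes>\<^sub>M R) P' fst" by (rule distr_cong) (simp_all add: sP')
    also have "\<dots> = P'" by (rule R.distr_pair_fst)
    finally show "distr Q N snd = P'" .
    fix \<phi> assume \<phi>: "test \<phi>" "\<And>x. \<phi> x \<le> 0"
    have [measurable]: "expf \<phi> \<in> borel_measurable N" using measurable_expf[OF measurable_ident \<phi>(1)] by (simp add: id_def)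
    have R': "plaw (1 - (1 - c)) R" using R by simp
    have "(\<integral>\<^sup>+p. ennreal (f (fst p)) * ennreal (expf \<phi> (snd p)) \<partial>Q) =
        (\<integral>\<^sup>+p. ennreal (f (superpose (fst p) (snd p))) * ennreal (expf \<phi> (fst p)) \<partial>(P' \<Otimes>\<^sub>M R))"
      unfolding Q_def by (subst nn_integral_distr) (auto simp: h_def)
    also have "\<dots> = (\<integral>\<^sup>+\<mu>. ennreal (f \<mu>) * ennreal (expf (\<lambda>x. ln (1 + (1 - c) * (exp (\<phi> x) - 1))) \<mu>) \<partial>P)"
      using c by (intro thinning_tilt[OF P P' R' _ _ _ \<phi>]) auto
    finally show "(\<integral>\<^sup>+p. ennreal (f (fst p)) * ennreal (expf \<phi> (snd p)) \<partial>Q) =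
        ennreal (exp ((1 - c - (1 - c)) * (\<integral>x. exp (\<phi> x) - 1 \<partial>L))) *
        (\<integral>\<^sup>+\<mu>. ennreal (f \<mu>) * ennreal (expf (\<lambda>x. ln (1 + (1 - c) * (exp (\<phi> x) - 1))) \<mu>) \<partial>P)"
      by simp
  qed (use c in \<open>auto simp: power2_eq_square\<close>)
  have "(\<integral>p. f (fst p) * f (snd p) \<partial>Q) = (\<integral>p. f (superpose (fst p) (snd p)) * f (fst p) \<partial>(P' \<Otimes>\<^sub>M R))"
    unfolding Q_def by (subst integral_distr) (auto simp: h_def)
  also have "\<dots> = (\<integral>p. f (fst p) \<partial>(P' \<Otimes>\<^sub>M R))"
  proof (rule Bochner_Integration.integral_cong[OF refl])
    fix p assume "p \<in> space (P' \<Otimes>\<^sub>M R)"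
    then have p: "fst p \<in> space N" "snd p \<in> space N" by (auto simp: space_pair_measure sp)
    show "f (superpose (fst p) (snd p)) * f (fst p) = f (fst p)"
      using increasing_superpose[OF inc p] funcset_mem[OF f01 p(1)] funcset_mem[OF f01 superpose_in_N[OF p]] by auto
  qed
  also have "\<dots> = (\<integral>\<mu>. f \<mu> \<partial>distr (P' \<Otimes>\<^sub>M R) P' fst)"
    by (rule integral_distr[symmetric]) (simp_all cong: measurable_cong_sets)
  also have "\<dots> = (\<integral>\<mu>. f \<mu> \<partial>P')" by (simp only: R.distr_pair_fst)
  finally have "(\<integral>\<mu>. f \<mu> \<partial>P') * (1 - (\<integral>\<mu>. f \<mu> \<partial>P)) \<le> sqrt (1 / (1 - c) / (1 / (1 - c) - 1)\<^sup>2 * (\<delta> * 4))"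
    using cov by (simp add: right_diff_distrib mult.commute)
  also have "1 / (1 - c) / (1 / (1 - c) - 1)\<^sup>2 * (\<delta> * 4) = (1 - c) * (\<delta> * 4) / c\<^sup>2"
  proof -
    have "1 / (1 - c) - 1 = c / (1 - c)" using c by (simp add: field_simps)
    then show ?thesis using c by (simp add: power_divide power2_eq_square)
  qed
  also have "sqrt ((1 - c) * (\<delta> * 4) / c\<^sup>2) \<le> sqrt (8 * (\<delta> / c\<^sup>2))"
  proof (rule real_sqrt_le_mono)
    have "(1 - c) * (\<delta> * 4) \<le> 2 * (\<delta> * 4)" using c \<delta> by (intro mult_right_mono) auto
    then have "(1 - c) * (\<delta> * 4) / c\<^sup>2 \<le> 2 * (\<delta> * 4) / c\<^sup>2" by (rule divide_right_mono) simp
    then show "(1 - c) * (\<delta> * 4) / c\<^sup>2 \<le> 8 * (\<delta> / c\<^sup>2)" by simp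
  qed
  finally show ?thesis .
qed

text \<open>Independence makes the joint law of \<open>(Y, \<eta>)\<close> a product measure, so the
  one-point probabilities on \<open>M\<close> are the averages that
  \<open>randomized_schramm_steif\<close> asks for.\<close>

lemma chaos_bounded_randomized:
  assumes M: "prob_space M" and \<eta>: "\<eta> \<in> M \<rightarrow>\<^sub>M N" and P: "plaw 1 (distr M N \<eta>)"
    and rs: "randomized_stopping_set M X B \<eta> \<Y> Y Z" and det: "determined_by_randomized M X B \<Y> Y F Z"
    and Fm: "F \<in> borel_measurable N" and F1: "\<And>\<mu>. \<mu> \<in> space N \<Longrightarrow> \<bar>F \<mu>\<bar> \<le> (1::real)"
    and \<delta>: "\<And>x. x \<in> space X \<Longrightarrow> measure M {\<omega> \<in> space M. x \<in> Z (Y \<omega>) (\<eta> \<omega>)} \<le> \<delta>" "0 \<le> \<delta>"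
  shows "chaos_bounded (distr M N \<eta>) F \<delta>"
proof -
  interpret prob_space M by fact
  note [measurable] = \<eta>
  have ind: "indep_elements M \<Y> Y N \<eta>" and st: "AE y in distr M \<Y> Y. stopping_set X B (Z y)"
    and pr[measurable]: "Measurable.pred (N \<Otimes>\<^sub>M X \<Otimes>\<^sub>M \<Y>) (\<lambda>(\<mu>, x, y). x \<in> Z y \<mu>)"
    using rs by (auto simp: randomized_stopping_set_def)
  have Y[measurable]: "Y \<in> M \<rightarrow>\<^sub>M \<Y>" using ind by (simp add: indep_elements_def)
  have AE: "AE y in distr M \<Y> Y. stopping_set X B (Z y) \<and> determined_by X B F (Z y)"
    using st det unfolding determined_by_randomized_def by eventually_elim auto
  have d: "(\<integral>\<^sup>+p. indicator {(y, \<mu>). x \<in> Z y \<mu>} p \<partial>(distr M \<Y> Y \<Otimes>\<^sub>M distr M N \<eta>)) \<le> ennreal \<delta>" if x: "x \<in> space X" for x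
  proof -
    have m: "Measurable.pred (\<Y> \<Otimes>\<^sub>M N) (\<lambda>(y, \<mu>). x \<in> Z y \<mu>)"
    proof -
      have "(\<lambda>p. (snd p, x, fst p)) \<in> \<Y> \<Otimes>\<^sub>M N \<rightarrow>\<^sub>M N \<Otimes>\<^sub>M X \<Otimes>\<^sub>M \<Y>" using x by measurable
      from measurable_compose[OF this pr] show ?thesis by (simp add: case_prod_beta')
    qed
    then have im: "(indicator {(y, \<mu>). x \<in> Z y \<mu>} :: _ \<Rightarrow> ennreal) \<in> borel_measurable (\<Y> \<Otimes>\<^sub>M N)"
      by (auto simp: borel_measurable_indicator_iff pred_def case_prod_beta' Int_def vimage_def conj_commute)
    have ym: "(\<lambda>\<omega>. (Y \<omega>, \<eta> \<omega>)) \<in> M \<rightarrow>\<^sub>M \<Y> \<Otimes>\<^sub>M N" by measurable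
    have em: "{\<omega> \<in> space M. x \<in> Z (Y \<omega>) (\<eta> \<omega>)} \<in> sets M"
      using measurable_compose[OF ym m] by (simp add: pred_def)
    have "(\<integral>\<^sup>+p. indicator {(y, \<mu>). x \<in> Z y \<mu>} p \<partial>(distr M \<Y> Y \<Otimes>\<^sub>M distr M N \<eta>)) = (\<integral>\<^sup>+\<omega>. indicator {(y, \<mu>). x \<in> Z y \<mu>} (Y \<omega>, \<eta> \<omega>) \<partial>M)"
      unfolding indep_elements_distr_pair[OF M ind, symmetric] using ym im by (subst nn_integral_distr) auto
    also have "\<dots> = (\<integral>\<^sup>+\<omega>. indicator {\<omega> \<in> space M. x \<in> Z (Y \<omega>) (\<eta> \<omega>)} \<omega> \<partial>M)"
      by (intro nn_integral_cong) (auto split: split_indicator)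
    also have "\<dots> = ennreal (measure M {\<omega> \<in> space M. x \<in> Z (Y \<omega>) (\<eta> \<omega>)})"
      using em by (simp add: emeasure_eq_measure)
    also have "\<dots> \<le> ennreal \<delta>" using \<delta>(1)[OF x] by (rule ennreal_leI)
    finally show ?thesis .
  qed
  show ?thesis
    unfolding chaos_bounded_def
    by (intro allI impI, rule randomized_schramm_steif[OF P prob_space_distr[OF Y] sets_distr AE pr d \<delta>(2) Fm F1]) auto
qed

end

section \<open>The sharp threshold from non-degeneracy and the two estimates\<close>

theorem theorem7p3:
  fixes X :: "'a measure" and B :: "nat \<Rightarrow> 'a set" and L :: "'a measure"
    and M :: "'o measure" and \<eta> :: "'o \<Rightarrow> 'a measure" and \<eta>t :: "real \<Rightarrow> 'o \<Rightarrow> 'a measure"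
    and P :: "'a measure \<Rightarrow> 'p measure" and pois :: "'a measure \<Rightarrow> 'p \<Rightarrow> 'a measure"
    and f :: "nat \<Rightarrow> 'a measure \<Rightarrow> real"
    and \<Y> :: "nat \<Rightarrow> 'y measure" and Y :: "nat \<Rightarrow> 'o \<Rightarrow> 'y"
    and Z :: "nat \<Rightarrow> 'y \<Rightarrow> 'a measure \<Rightarrow> 'a set"
    and Zs :: "nat \<Rightarrow> nat \<Rightarrow> 'y \<Rightarrow> 'a measure \<Rightarrow> 'a set"
    and \<delta> :: "nat \<Rightarrow> real" and c :: "nat \<Rightarrow> real"
  assumes "borel_space X" and "localizing_sequence X B" and "locally_finite X B L"
    and "poisson_process M X B L \<eta>"
    and "birth_death_process M X B L \<eta> \<eta>t"
    and "\<And>r \<nu>. 0 < r \<Longrightarrow> \<nu> = scale_measure (ennreal r) L \<Longrightarrow> poisson_process (P \<nu>) X B \<nu> (pois \<nu>)"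
    and "\<And>n. f n \<in> space (point_measures X B) \<rightarrow> {0, 1}"
    and "\<And>n. f n \<in> borel_measurable (point_measures X B)"
    and "\<And>n. increasing_functional X B (f n)"
    and "\<And>n. jump_regular M \<eta>t (f n)"
    and "non_degenerate M \<eta> f"
    and "\<And>n. randomized_stopping_set M X B \<eta> (\<Y> n) (Y n) (Z n)"
    and "\<And>n. determined_by_randomized M X B (\<Y> n) (Y n) (f n) (Z n)"
    and "\<And>n j. randomized_stopping_set M X B \<eta> (\<Y> n) (Y n) (Zs n j)"
    and "\<And>n j. AE \<omega> in M. emeasure (\<eta> \<omega>) (Zs n j (Y n \<omega>) (\<eta> \<omega>)) < \<infinity>"
    and "\<And>n. AE y in distr M (\<Y> n) (Y n). \<forall>\<mu> \<in> space (point_measures X B).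
           incseq (\<lambda>j. Zs n j y \<mu>) \<and> Z n y \<mu> = (\<Union>j. Zs n j y \<mu>)"
    and "\<And>n. \<delta> n = (SUP x\<in>space X. measure M {\<omega> \<in> space M. x \<in> Z n (Y n \<omega>) (\<eta> \<omega>)})"
    and "\<delta> \<longlonglongrightarrow> 0"
    and "\<And>n. 0 < c n \<and> c n < 1"
    and "\<delta> \<in> o(\<lambda>n. (c n)\<^sup>2)"
  shows "(\<lambda>n. \<integral>\<omega>. f n (pois (scale_measure (ennreal (1 + c n)) L) \<omega>)
                 \<partial>P (scale_measure (ennreal (1 + c n)) L)) \<longlonglongrightarrow> 1 \<and>
         (\<lambda>n. \<integral>\<omega>. f n (pois (scale_measure (ennreal (1 - c n)) L) \<omega>)
                 \<partial>P (scale_measure (ennreal (1 - c n)) L)) \<longlonglongrightarrow> 0"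
proof -
  interpret intensity_space X B L
    by (simp add: intensity_space_def localized_space_def intensity_space_axioms_def assms(2,3))
  have M: "prob_space M" and \<eta>: "\<eta> \<in> M \<rightarrow>\<^sub>M N" using assms(4) by (auto simp: poisson_process_def)
  interpret M: prob_space M by (rule M)
  define P1 where "P1 = distr M N \<eta>"
  have P1: "plaw 1 P1" unfolding P1_def by (rule poisson_process_plaw[OF assms(4)]) simp_all
  define law where "law r = distr (P (scale_measure (ennreal r) L)) N (pois (scale_measure (ennreal r) L))" for r
  have pp: "poisson_process (P (scale_measure (ennreal r) L)) X B (scale_measure (ennreal r) L) (pois (scale_measure (ennreal r) L))"
    if "0 < r" for r using assms(6)[OF that refl] .
  have law: "plaw r (law r)" if "0 < r" for r
    unfolding law_def by (rule poisson_process_plaw[OF pp[OF that] refl]) (use that in simp)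
  note f01 = assms(7) and fm = assms(8) and inc = assms(9)
  have int_law: "(\<integral>\<mu>. f n \<mu> \<partial>law r) = (\<integral>\<omega>. f n (pois (scale_measure (ennreal r) L) \<omega>) \<partial>P (scale_measure (ennreal r) L))"
    if "0 < r" for n r
    unfolding law_def using pp[OF that] fm[of n] by (intro integral_distr) (auto simp: poisson_process_def)
  have int_P1: "(\<integral>\<mu>. f n \<mu> \<partial>P1) = (\<integral>\<omega>. f n (\<eta> \<omega>) \<partial>M)" for n
    unfolding P1_def using \<eta> fm[of n] by (rule integral_distr)
  obtain \<gamma> where \<gamma>: "0 < \<gamma>" "\<And>n. \<gamma> \<le> (\<integral>\<mu>. f n \<mu> \<partial>P1)" "\<And>n. (\<integral>\<mu>. f n \<mu> \<partial>P1) \<le> 1 - \<gamma>"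
    using assms(11) unfolding non_degenerate_def int_P1 by blast
  \<comment> \<open>The absolute value supplies the sign condition even for an empty
    \<open>space X\<close>, where the supremum is taken over the empty set.\<close>
  have cb: "chaos_bounded P1 (f n) \<bar>\<delta> n\<bar>" for n
    unfolding P1_def
  proof (rule chaos_bounded_randomized[OF M \<eta> P1[unfolded P1_def] assms(12,13) fm])
    show "\<bar>f n \<mu>\<bar> \<le> 1" if "\<mu> \<in> space N" for \<mu> using funcset_mem[OF f01[of n] that] by auto
    fix x assume "x \<in> space X"
    then have "measure M {\<omega> \<in> space M. x \<in> Z n (Y n \<omega>) (\<eta> \<omega>)} \<le> \<delta> n"
      unfolding assms(17)[of n] by (intro cSUP_upper bdd_aboveI[where M=1]) auto
    then show "measure M {\<omega> \<in> space M. x \<in> Z n (Y n \<omega>) (\<eta> \<omega>)} \<le> \<bar>\<delta> n\<bar>" by linarith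
  qed simp
  note c = assms(19)
  \<comment> \<open>Non-degeneracy enters by the division by \<open>\<gamma>\<close>: it bounds
    \<open>E f(\<eta>)\<close> from below for the upper estimate and \<open>1 - E f(\<eta>)\<close>
    for the lower one. The quotient under the root tends to \<open>0\<close> exactly by
    \<open>\<delta> = o(c\<^sup>2)\<close>.\<close>
  define e where "e n = sqrt (8 * (\<bar>\<delta> n\<bar> / (c n)\<^sup>2)) / \<gamma>" for n
  have e0: "e \<longlonglongrightarrow> 0"
  proof -
    have "(\<lambda>n. \<delta> n / (c n)\<^sup>2) \<longlonglongrightarrow> 0" using assms(20) by (rule smalloD_tendsto)
    then have "(\<lambda>n. \<bar>\<delta> n / (c n)\<^sup>2\<bar>) \<longlonglongrightarrow> 0" by (rule tendsto_rabs_zero)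
    then have "(\<lambda>n. \<bar>\<delta> n\<bar> / (c n)\<^sup>2) \<longlonglongrightarrow> 0" by (simp add: abs_divide)
    then have "(\<lambda>n. sqrt (8 * (\<bar>\<delta> n\<bar> / (c n)\<^sup>2)) / \<gamma>) \<longlonglongrightarrow> sqrt (8 * 0) / \<gamma>"
      using \<gamma>(1) by (intro tendsto_divide tendsto_real_sqrt tendsto_mult tendsto_const) auto
    then show ?thesis by (simp add: e_def[abs_def])
  qed
  have range: "0 \<le> (\<integral>\<mu>. f n \<mu> \<partial>law r)" "(\<integral>\<mu>. f n \<mu> \<partial>law r) \<le> 1" if r: "0 < r" for n r
  proof -
    interpret law: prob_space "law r" using plaw_prob[OF law[OF r]] .
    have s: "sets (law r) = sets N" using plaw_sets[OF law[OF r]] .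
    then have sp: "space (law r) = space N" using sets_eq_imp_space_eq by blast
    have v: "f n \<mu> = 0 \<or> f n \<mu> = 1" if "\<mu> \<in> space N" for \<mu> using funcset_mem[OF f01[of n] that] by auto
    show "0 \<le> (\<integral>\<mu>. f n \<mu> \<partial>law r)"
      using v by (intro Bochner_Integration.integral_nonneg_AE AE_I2) (force simp: sp)
    have "integrable (law r) (f n)"
      using v fm[of n] s by (intro law.integrable_const_bound[where B=1] AE_I2) (force simp: sp cong: measurable_cong_sets)+
    then have "(\<integral>\<mu>. f n \<mu> \<partial>law r) \<le> (\<integral>\<mu>. 1 \<partial>law r)"
      using v by (intro integral_mono) (force simp: sp)+
    then show "(\<integral>\<mu>. f n \<mu> \<partial>law r) \<le> 1" using law.prob_space by simp
  qed
  have up: "1 - e n \<le> (\<integral>\<mu>. f n \<mu> \<partial>law (1 + c n))" for n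
  proof -
    have "\<gamma> * (1 - (\<integral>\<mu>. f n \<mu> \<partial>law (1 + c n))) \<le> (\<integral>\<mu>. f n \<mu> \<partial>P1) * (1 - (\<integral>\<mu>. f n \<mu> \<partial>law (1 + c n)))"
      using \<gamma>(2)[of n] range(2)[of "1 + c n" n] c[of n] by (intro mult_right_mono) auto
    also have "\<dots> \<le> sqrt (8 * (\<bar>\<delta> n\<bar> / (c n)\<^sup>2))"
      using c[of n] by (intro threshold_upper[OF P1 law law _ _ fm f01 inc cb]) auto
    finally show ?thesis using \<gamma>(1) by (simp add: e_def field_simps)
  qed
  have low: "(\<integral>\<mu>. f n \<mu> \<partial>law (1 - c n)) \<le> e n" for n
  proof -
    have "(\<integral>\<mu>. f n \<mu> \<partial>law (1 - c n)) * \<gamma> \<le> (\<integral>\<mu>. f n \<mu> \<partial>law (1 - c n)) * (1 - (\<integral>\<mu>. f n \<mu> \<partial>P1))"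
      using \<gamma>(3)[of n] range(1)[of "1 - c n" n] c[of n] by (intro mult_left_mono) auto
    also have "\<dots> \<le> sqrt (8 * (\<bar>\<delta> n\<bar> / (c n)\<^sup>2))"
      using c[of n] by (intro threshold_lower[OF P1 law law _ _ fm f01 inc cb]) auto
    finally show ?thesis using \<gamma>(1) by (simp add: e_def field_simps)
  qed
  have "(\<lambda>n. \<integral>\<mu>. f n \<mu> \<partial>law (1 + c n)) \<longlonglongrightarrow> 1"
  proof (rule tendsto_sandwich)
    show "(\<lambda>n. 1 - e n) \<longlonglongrightarrow> 1" using tendsto_diff[OF tendsto_const e0, of 1] by simp
    show "\<forall>\<^sub>F n in sequentially. (\<integral>\<mu>. f n \<mu> \<partial>law (1 + c n)) \<le> 1"
      using range(2) c by (intro always_eventually allI) (simp add: add_pos_pos)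
  qed (use up in auto)
  moreover have "(\<lambda>n. \<integral>\<mu>. f n \<mu> \<partial>law (1 - c n)) \<longlonglongrightarrow> 0"
  proof (rule tendsto_sandwich[OF _ _ tendsto_const e0])
    show "\<forall>\<^sub>F n in sequentially. 0 \<le> (\<integral>\<mu>. f n \<mu> \<partial>law (1 - c n))"
      using range(1) c by (intro always_eventually allI) simp
  qed (use low in auto)
  moreover have "0 < 1 + c n" "0 < 1 - c n" for n using c[of n] by auto
  ultimately show ?thesis by (simp add: int_law)
qed

end
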